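(* Let $\mathcal{X}:|\mathcal{X}|\to\mathbb{X}$ be a totally connected fibered frame on an exact category $\mathbb{X}$. 1. In terms of the representation of subobjects by strict predicates, the universal closure operation $j$ on $\mathbb{X}[\mathcal{X}]$ induced by the cartesian reflector $\Delta\Pi$ is given by $\varphi\mapsto[c\mid\delta\pi\varphi(c)\wedge\rho(c,c)]$, where $\varphi\in\mathcal{X}_C$ represents a subobject of $(C,\rho)$. 2. $\mathbf{Sep}_j(\mathbb{X}[\mathcal{X}])\simeq|\mathcal{X}_d|$ via the embedding $(\varphi\in(\mathcal{X}_d)_C)\mapsto(C,=_\varphi)$. 3. $\mathbf{Sep}_j(\mathbb{X}[\mathcal{X}])$ coincides up to equivalence with the category $\mathbf{Asm}(\mathcal{X})$ of $\mathcal{X}$-assemblies (the terminal fiber of the positive completion of $\mathcal{X}$).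
   Context: **Fibered frames.** A fibered frame on a regular category $\mathbb{X}$ is a fibration $\mathcal{X}$ of preorders (fibers $\mathcal{X}_I$, reindexing $u^*$) with finite meets preserved by reindexing, left adjoints $\exists_u\dashv u^*$ satisfying Beck–Chevalley and Frobenius ($\varphi\wedge\exists_u\psi\cong\exists_u(u^*\varphi\wedge\psi)$), which is a pre-stack: $e^*\varphi\le e^*\psi$ implies $\varphi\le\psi$ for regular epis $e$. It interprets $\top,\wedge,\exists,=$ (equality is $\exists_{\mathrm{diag}}\top$). Let $\mathrm{sub}(\mathbb{X})$ be the subobject fibration. The fibered monotone map $\delta:\mathrm{sub}(\mathbb{X})\to\mathcal{X}$ sends $m:U\rightarrowtail I$ to $\exists_m\top\in\mathcal{X}_I$. $\mathcal{X}$ is totally connected if $\delta$ has a finite meet preserving (fibered) left adjoint $\pi:\mathcal{X}\to\mathrm{sub}(\mathbb{X})$. **$\mathbb{X}[\mathcal{X}]$.** Objects: pairs $(C,\rho)$ with $C\in\mathbb{X}$ and $\rho\in\mathcal{X}_{C\times C}$ symmetric and transitive in the internal logic. Morphisms $(C,\rho)\to(D,\sigma)$: classes up to logical equivalence of $\phi\in\mathcal{X}_{C\times D}$ with $\phi(c,d)\vdash\rho(c,c)\wedge\sigma(d,d)$; $\phi(c,d),\rho(c,c'),\sigma(d,d')\vdash\phi(c',d')$; $\phi(c,d),\phi(c,d')\vdash\sigma(d,d')$; $\rho(c,c)\vdash\exists d.\phi(c,d)$; composition is relational. This is an exact category. $\varphi\in\mathcal{X}_C$ is strict with respect to $\rho$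 if $\varphi(x)\vdash\rho(x,x)$ and $\varphi(x),\rho(x,y)\vdash\varphi(y)$; subobjects of $(C,\rho)$ correspond to strict predicates $\varphi$, via $(C,\rho|_\varphi)\rightarrowtail(C,\rho)$ with $\rho|_\varphi(c,c')=\rho(c,c')\wedge\varphi(c)$. The constant objects functor $\Delta:\mathbb{X}\to\mathbb{X}[\mathcal{X}]$ is $I\mapsto(I,=)$. Since $\mathbb{X}$ is exact and $\mathcal{X}$ totally connected, $\Delta$ has a finite limit preserving left adjoint $\Pi$ (obtained by applying $\pi$ to partial equivalence relations and functional relations and using $\mathbb{X}[\mathrm{sub}(\mathbb{X})]\simeq\mathbb{X}$), with invertible counit. **Universal closure operation and separated objects.** For the idempotent finite limit preserving monad $L=\Delta\Pi$ on $\mathbb{X}[\mathcal{X}]$ with unit $\eta$, and a mono $m:U\rightarrowtail A$, $j(m)$ is the pullback of $Lm:LU\rightarrowtail LA$ along $\eta_A:A\to LA$. A mono $m$ is dense if $j(m)\cong\top$. An object $S$ is $j$-separated if for each dense mono $m:U\rightarrowtail A$ and each $f:U\to S$ there is at most one $h:A\to S$ with $hm=f$; $\mathbf{Sep}_j$ is the full subcategory of $j$-separated objects. **Dense part and assemblies.** $\mathcal{X}_d$ is the full subfibration of $\mathcal{X}$ on the predicates $\varphi\in\mathcal{X}_C$ with $\pi\varphi\cong\top$ in $\mathrm{sub}(\mathbb{X})_C$; $|\mathcal{X}_d|$ is its total category. For $\varphi\in\mathcal{X}_C$, $(x=_\varphi y)$ is the predicate $\varphi(x)\wedge x=y$. $\mathbf{Asm}(\mathcal{X})$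 is the full subcategory of $\mathbb{X}[\mathcal{X}]$ on the objects $(C,=_\varphi)$, $C\in\mathbb{X}$, $\varphi\in\mathcal{X}_C$. *)

theory Defs
  imports Main
begin

section \<open>Categories\<close>

record ('o, 'm) cat =
  Ob :: "'o set"
  Arr :: "'m set"
  Dom :: "'m \<Rightarrow> 'o"
  Cod :: "'m \<Rightarrow> 'o"
  Ident :: "'o \<Rightarrow> 'm"
  Comp :: "'m \<Rightarrow> 'm \<Rightarrow> 'm"

text \<open>Composition is in applicative order: \<open>g \<cdot>\<^bsub>C\<^esub> f\<close> is \<open>f\<close> followed by \<open>g\<close>.\<close>

abbreviation comp_syntax :: "'m \<Rightarrow> ('o, 'm) cat \<Rightarrow> 'm \<Rightarrow> 'm"
    ("(_ \<cdot>\<^bsub>_\<^esub> _)" [71, 0, 70] 70) where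
  "g \<cdot>\<^bsub>C\<^esub> f \<equiv> Comp C g f"

definition Hom :: "('o, 'm) cat \<Rightarrow> 'o \<Rightarrow> 'o \<Rightarrow> 'm set" where
  "Hom C a b = {f \<in> Arr C. Dom C f = a \<and> Cod C f = b}"

definition category :: "('o, 'm) cat \<Rightarrow> bool" where
  "category C \<longleftrightarrow>
     (\<forall>f\<in>Arr C. Dom C f \<in> Ob C \<and> Cod C f \<in> Ob C) \<and>
     (\<forall>a\<in>Ob C. Ident C a \<in> Hom C a a) \<and>
     (\<forall>f\<in>Arr C. \<forall>g\<in>Arr C. Cod C f = Dom C g \<longrightarrow> g \<cdot>\<^bsub>C\<^esub> f \<in> Hom C (Dom C f) (Cod C g)) \<and>
     (\<forall>f\<in>Arr C. f \<cdot>\<^bsub>C\<^esub> Ident C (Dom C f) = f \<and> Ident C (Cod C f) \<cdot>\<^bsub>C\<^esub> f = f) \<and>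
     (\<forall>f\<in>Arr C. \<forall>g\<in>Arr C. \<forall>h\<in>Arr C. Cod C f = Dom C g \<longrightarrow> Cod C g = Dom C h \<longrightarrow>
        h \<cdot>\<^bsub>C\<^esub> (g \<cdot>\<^bsub>C\<^esub> f) = (h \<cdot>\<^bsub>C\<^esub> g) \<cdot>\<^bsub>C\<^esub> f)"

definition mono_arr :: "('o, 'm) cat \<Rightarrow> 'm \<Rightarrow> bool" where
  "mono_arr C m \<longleftrightarrow> m \<in> Arr C \<and>
     (\<forall>a\<in>Ob C. \<forall>f\<in>Hom C a (Dom C m). \<forall>g\<in>Hom C a (Dom C m). m \<cdot>\<^bsub>C\<^esub> f = m \<cdot>\<^bsub>C\<^esub> g \<longrightarrow> f = g)"

definition iso_arr :: "('o, 'm) cat \<Rightarrow> 'm \<Rightarrow> bool" where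
  "iso_arr C f \<longleftrightarrow> f \<in> Arr C \<and>
     (\<exists>g\<in>Hom C (Cod C f) (Dom C f).
        g \<cdot>\<^bsub>C\<^esub> f = Ident C (Dom C f) \<and> f \<cdot>\<^bsub>C\<^esub> g = Ident C (Cod C f))"

definition full_subcat :: "('o, 'm) cat \<Rightarrow> 'o set \<Rightarrow> ('o, 'm) cat" where
  "full_subcat C S =
     C\<lparr>Ob := Ob C \<inter> S, Arr := {f \<in> Arr C. Dom C f \<in> S \<and> Cod C f \<in> S}\<rparr>"

subsection \<open>Functors, equivalences, adjunctions\<close>

record ('o, 'm, 'o2, 'm2) ftor =
  Fob :: "'o \<Rightarrow> 'o2"
  Far :: "'m \<Rightarrow> 'm2"

definition is_functor :: "('o, 'm) cat \<Rightarrow> ('o2, 'm2) cat \<Rightarrow> ('o, 'm, 'o2, 'm2) ftor \<Rightarrow> bool" where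
  "is_functor C D T \<longleftrightarrow> category C \<and> category D \<and>
     (\<forall>a\<in>Ob C. Fob T a \<in> Ob D) \<and>
     (\<forall>f\<in>Arr C. Far T f \<in> Hom D (Fob T (Dom C f)) (Fob T (Cod C f))) \<and>
     (\<forall>a\<in>Ob C. Far T (Ident C a) = Ident D (Fob T a)) \<and>
     (\<forall>f\<in>Arr C. \<forall>g\<in>Arr C. Cod C f = Dom C g \<longrightarrow>
        Far T (g \<cdot>\<^bsub>C\<^esub> f) = Far T g \<cdot>\<^bsub>D\<^esub> Far T f)"

definition id_ftor :: "('o, 'm, 'o, 'm) ftor" where
  "id_ftor = \<lparr>Fob = (\<lambda>a. a), Far = (\<lambda>f. f)\<rparr>"

definition comp_ftor ::
  "('o2, 'm2, 'o3, 'm3) ftor \<Rightarrow> ('o1, 'm1, 'o2, 'm2) ftor \<Rightarrow> ('o1, 'm1, 'o3, 'm3) ftor" where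
  "comp_ftor S T = \<lparr>Fob = (\<lambda>a. Fob S (Fob T a)), Far = (\<lambda>f. Far S (Far T f))\<rparr>"

definition nat_trans ::
  "('o, 'm) cat \<Rightarrow> ('o2, 'm2) cat \<Rightarrow> ('o, 'm, 'o2, 'm2) ftor \<Rightarrow> ('o, 'm, 'o2, 'm2) ftor
    \<Rightarrow> ('o \<Rightarrow> 'm2) \<Rightarrow> bool" where
  "nat_trans C D S T \<tau> \<longleftrightarrow> is_functor C D S \<and> is_functor C D T \<and>
     (\<forall>a\<in>Ob C. \<tau> a \<in> Hom D (Fob S a) (Fob T a)) \<and>
     (\<forall>f\<in>Arr C. \<tau> (Cod C f) \<cdot>\<^bsub>D\<^esub> Far S f = Far T f \<cdot>\<^bsub>D\<^esub> \<tau> (Dom C f))"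

definition nat_iso ::
  "('o, 'm) cat \<Rightarrow> ('o2, 'm2) cat \<Rightarrow> ('o, 'm, 'o2, 'm2) ftor \<Rightarrow> ('o, 'm, 'o2, 'm2) ftor
    \<Rightarrow> ('o \<Rightarrow> 'm2) \<Rightarrow> bool" where
  "nat_iso C D S T \<tau> \<longleftrightarrow> nat_trans C D S T \<tau> \<and> (\<forall>a\<in>Ob C. iso_arr D (\<tau> a))"

definition equivalence_functor ::
  "('o, 'm) cat \<Rightarrow> ('o2, 'm2) cat \<Rightarrow> ('o, 'm, 'o2, 'm2) ftor \<Rightarrow> bool" where
  "equivalence_functor C D T \<longleftrightarrow> is_functor C D T \<and>
     (\<exists>S. is_functor D C S \<and>
        (\<exists>\<tau>. nat_iso C C id_ftor (comp_ftor S T) \<tau>) \<and>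
        (\<exists>\<tau>. nat_iso D D (comp_ftor T S) id_ftor \<tau>))"

text \<open>\<open>L\<close> is left adjoint to \<open>R\<close> with unit \<open>\<eta>\<close>.\<close>

definition left_adjoint ::
  "('o, 'm) cat \<Rightarrow> ('o2, 'm2) cat \<Rightarrow> ('o, 'm, 'o2, 'm2) ftor \<Rightarrow> ('o2, 'm2, 'o, 'm) ftor
    \<Rightarrow> ('o \<Rightarrow> 'm) \<Rightarrow> bool" where
  "left_adjoint C D L R \<eta> \<longleftrightarrow> is_functor C D L \<and> is_functor D C R \<and>
     nat_trans C C id_ftor (comp_ftor R L) \<eta> \<and>
     (\<forall>a\<in>Ob C. \<forall>d\<in>Ob D. \<forall>f\<in>Hom C a (Fob R d).
        \<exists>!g. g \<in> Hom D (Fob L a) d \<and> Far R g \<cdot>\<^bsub>C\<^esub> \<eta> a = f)"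

subsection \<open>Limits, regular and exact categories\<close>

definition is_terminal :: "('o, 'm) cat \<Rightarrow> 'o \<Rightarrow> bool" where
  "is_terminal C t \<longleftrightarrow> t \<in> Ob C \<and> (\<forall>a\<in>Ob C. \<exists>!f. f \<in> Hom C a t)"

text \<open>The square \<open>f \<cdot> p = g \<cdot> q\<close> is a pullback.\<close>

definition is_pullback :: "('o, 'm) cat \<Rightarrow> 'm \<Rightarrow> 'm \<Rightarrow> 'm \<Rightarrow> 'm \<Rightarrow> bool" where
  "is_pullback C f g p q \<longleftrightarrow>
     f \<in> Arr C \<and> g \<in> Arr C \<and> p \<in> Arr C \<and> q \<in> Arr C \<and> Cod C f = Cod C g \<and>
     Cod C p = Dom C f \<and> Cod C q = Dom C g \<and> Dom C p = Dom C q \<and>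
     f \<cdot>\<^bsub>C\<^esub> p = g \<cdot>\<^bsub>C\<^esub> q \<and>
     (\<forall>a\<in>Ob C. \<forall>x\<in>Hom C a (Dom C f). \<forall>y\<in>Hom C a (Dom C g).
        f \<cdot>\<^bsub>C\<^esub> x = g \<cdot>\<^bsub>C\<^esub> y \<longrightarrow>
        (\<exists>!h. h \<in> Hom C a (Dom C p) \<and> p \<cdot>\<^bsub>C\<^esub> h = x \<and> q \<cdot>\<^bsub>C\<^esub> h = y))"

definition is_product :: "('o, 'm) cat \<Rightarrow> 'o \<Rightarrow> 'o \<Rightarrow> 'o \<Rightarrow> 'm \<Rightarrow> 'm \<Rightarrow> bool" where
  "is_product C a b c p q \<longleftrightarrow>
     a \<in> Ob C \<and> b \<in> Ob C \<and> c \<in> Ob C \<and> p \<in> Hom C c a \<and> q \<in> Hom C c b \<and>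
     (\<forall>z\<in>Ob C. \<forall>x\<in>Hom C z a. \<forall>y\<in>Hom C z b.
        \<exists>!h. h \<in> Hom C z c \<and> p \<cdot>\<^bsub>C\<^esub> h = x \<and> q \<cdot>\<^bsub>C\<^esub> h = y)"

definition has_finite_limits :: "('o, 'm) cat \<Rightarrow> bool" where
  "has_finite_limits C \<longleftrightarrow> (\<exists>t. is_terminal C t) \<and>
     (\<forall>f\<in>Arr C. \<forall>g\<in>Arr C. Cod C f = Cod C g \<longrightarrow> (\<exists>p q. is_pullback C f g p q))"

definition is_coequalizer :: "('o, 'm) cat \<Rightarrow> 'm \<Rightarrow> 'm \<Rightarrow> 'm \<Rightarrow> bool" where
  "is_coequalizer C f g e \<longleftrightarrow>
     f \<in> Arr C \<and> g \<in> Arr C \<and> e \<in> Arr C \<and> Dom C f = Dom C g \<and> Cod C f = Cod C g \<and>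
     Dom C e = Cod C f \<and> e \<cdot>\<^bsub>C\<^esub> f = e \<cdot>\<^bsub>C\<^esub> g \<and>
     (\<forall>z\<in>Ob C. \<forall>h\<in>Hom C (Dom C e) z. h \<cdot>\<^bsub>C\<^esub> f = h \<cdot>\<^bsub>C\<^esub> g \<longrightarrow>
        (\<exists>!k. k \<in> Hom C (Cod C e) z \<and> k \<cdot>\<^bsub>C\<^esub> e = h))"

definition regular_epi :: "('o, 'm) cat \<Rightarrow> 'm \<Rightarrow> bool" where
  "regular_epi C e \<longleftrightarrow> (\<exists>f g. is_coequalizer C f g e)"

definition regular_category :: "('o, 'm) cat \<Rightarrow> bool" where
  "regular_category C \<longleftrightarrow> category C \<and> has_finite_limits C \<and>
     (\<forall>f p q. is_pullback C f f p q \<longrightarrow> (\<exists>e. is_coequalizer C p q e)) \<and>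
     (\<forall>e g p q. regular_epi C e \<longrightarrow> is_pullback C e g p q \<longrightarrow> regular_epi C q)"

definition equivalence_relation :: "('o, 'm) cat \<Rightarrow> 'm \<Rightarrow> 'm \<Rightarrow> bool" where
  "equivalence_relation C r s \<longleftrightarrow>
     r \<in> Arr C \<and> s \<in> Arr C \<and> Dom C r = Dom C s \<and> Cod C r = Cod C s \<and>
     (\<forall>z\<in>Ob C. \<forall>f\<in>Hom C z (Dom C r). \<forall>g\<in>Hom C z (Dom C r).
        r \<cdot>\<^bsub>C\<^esub> f = r \<cdot>\<^bsub>C\<^esub> g \<longrightarrow> s \<cdot>\<^bsub>C\<^esub> f = s \<cdot>\<^bsub>C\<^esub> g \<longrightarrow> f = g) \<and>
     (\<exists>d\<in>Hom C (Cod C r) (Dom C r).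
        r \<cdot>\<^bsub>C\<^esub> d = Ident C (Cod C r) \<and> s \<cdot>\<^bsub>C\<^esub> d = Ident C (Cod C r)) \<and>
     (\<exists>w\<in>Hom C (Dom C r) (Dom C r). r \<cdot>\<^bsub>C\<^esub> w = s \<and> s \<cdot>\<^bsub>C\<^esub> w = r) \<and>
     (\<forall>p q. is_pullback C s r p q \<longrightarrow>
        (\<exists>t\<in>Hom C (Dom C p) (Dom C r). r \<cdot>\<^bsub>C\<^esub> t = r \<cdot>\<^bsub>C\<^esub> p \<and> s \<cdot>\<^bsub>C\<^esub> t = s \<cdot>\<^bsub>C\<^esub> q))"

definition exact_category :: "('o, 'm) cat \<Rightarrow> bool" where
  "exact_category C \<longleftrightarrow> regular_category C \<and>
     (\<forall>r s. equivalence_relation C r s \<longrightarrow> (\<exists>f. is_pullback C f f r s))"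

subsection \<open>Chosen binary products\<close>

definition chosen_product :: "('o, 'm) cat \<Rightarrow> 'o \<Rightarrow> 'o \<Rightarrow> 'o \<times> 'm \<times> 'm" where
  "chosen_product C a b = (SOME (c, p, q). is_product C a b c p q)"

definition prd :: "('o, 'm) cat \<Rightarrow> 'o \<Rightarrow> 'o \<Rightarrow> 'o" where
  "prd C a b = fst (chosen_product C a b)"

definition pr1 :: "('o, 'm) cat \<Rightarrow> 'o \<Rightarrow> 'o \<Rightarrow> 'm" where
  "pr1 C a b = fst (snd (chosen_product C a b))"

definition pr2 :: "('o, 'm) cat \<Rightarrow> 'o \<Rightarrow> 'o \<Rightarrow> 'm" where
  "pr2 C a b = snd (snd (chosen_product C a b))"

definition pair :: "('o, 'm) cat \<Rightarrow> 'm \<Rightarrow> 'm \<Rightarrow> 'm" where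
  "pair C x y = (THE h. h \<in> Hom C (Dom C x) (prd C (Cod C x) (Cod C y)) \<and>
     pr1 C (Cod C x) (Cod C y) \<cdot>\<^bsub>C\<^esub> h = x \<and> pr2 C (Cod C x) (Cod C y) \<cdot>\<^bsub>C\<^esub> h = y)"


section \<open>Fibrations of preorders\<close>

record ('p, 'e, 'o, 'm) fibn =
  Tot :: "('p, 'e) cat"
  Base :: "('o, 'm) cat"
  Proj :: "('p, 'e, 'o, 'm) ftor"

definition fibre :: "('p, 'e, 'o, 'm) fibn \<Rightarrow> 'o \<Rightarrow> 'p set" where
  "fibre F I = {\<phi> \<in> Ob (Tot F). Fob (Proj F) \<phi> = I}"

text \<open>The preorder of a fibre, given by the vertical arrows.\<close>

definition entails :: "('p, 'e, 'o, 'm) fibn \<Rightarrow> 'p \<Rightarrow> 'p \<Rightarrow> bool" where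
  "entails F \<phi> \<psi> \<longleftrightarrow> \<phi> \<in> Ob (Tot F) \<and> \<psi> \<in> Ob (Tot F) \<and>
     (\<exists>f\<in>Hom (Tot F) \<phi> \<psi>. Far (Proj F) f = Ident (Base F) (Fob (Proj F) \<phi>))"

abbreviation entails_syntax :: "'p \<Rightarrow> ('p, 'e, 'o, 'm) fibn \<Rightarrow> 'p \<Rightarrow> bool"
    ("(_ \<turnstile>\<^bsub>_\<^esub> _)" [51, 0, 51] 50) where
  "\<phi> \<turnstile>\<^bsub>F\<^esub> \<psi> \<equiv> entails F \<phi> \<psi>"

definition eqv :: "('p, 'e, 'o, 'm) fibn \<Rightarrow> 'p \<Rightarrow> 'p \<Rightarrow> bool" where
  "eqv F \<phi> \<psi> \<longleftrightarrow> (\<phi> \<turnstile>\<^bsub>F\<^esub> \<psi>) \<and> (\<psi> \<turnstile>\<^bsub>F\<^esub> \<phi>)"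

abbreviation eqv_syntax :: "'p \<Rightarrow> ('p, 'e, 'o, 'm) fibn \<Rightarrow> 'p \<Rightarrow> bool"
    ("(_ \<cong>\<^bsub>_\<^esub> _)" [51, 0, 51] 50) where
  "\<phi> \<cong>\<^bsub>F\<^esub> \<psi> \<equiv> eqv F \<phi> \<psi>"

definition cartesian_arr :: "('p, 'e, 'o, 'm) fibn \<Rightarrow> 'e \<Rightarrow> bool" where
  "cartesian_arr F f \<longleftrightarrow> f \<in> Arr (Tot F) \<and>
     (\<forall>g\<in>Arr (Tot F). Cod (Tot F) g = Cod (Tot F) f \<longrightarrow>
        (\<forall>w\<in>Hom (Base F) (Fob (Proj F) (Dom (Tot F) g)) (Fob (Proj F) (Dom (Tot F) f)).
           Far (Proj F) f \<cdot>\<^bsub>Base F\<^esub> w = Far (Proj F) g \<longrightarrow>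
           (\<exists>!h. h \<in> Hom (Tot F) (Dom (Tot F) g) (Dom (Tot F) f) \<and>
                 Far (Proj F) h = w \<and> f \<cdot>\<^bsub>Tot F\<^esub> h = g)))"

definition cartesian_lift :: "('p, 'e, 'o, 'm) fibn \<Rightarrow> 'm \<Rightarrow> 'p \<Rightarrow> 'e \<Rightarrow> bool" where
  "cartesian_lift F u \<psi> f \<longleftrightarrow>
     cartesian_arr F f \<and> Cod (Tot F) f = \<psi> \<and> Far (Proj F) f = u"

definition preorder_fibration :: "('p, 'e, 'o, 'm) fibn \<Rightarrow> bool" where
  "preorder_fibration F \<longleftrightarrow> is_functor (Tot F) (Base F) (Proj F) \<and>
     (\<forall>u\<in>Arr (Base F). \<forall>\<psi>\<in>fibre F (Cod (Base F) u). \<exists>f. cartesian_lift F u \<psi> f) \<and>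
     (\<forall>\<phi>\<in>Ob (Tot F). \<forall>\<psi>\<in>Ob (Tot F). \<forall>f\<in>Hom (Tot F) \<phi> \<psi>. \<forall>g\<in>Hom (Tot F) \<phi> \<psi>.
        Far (Proj F) f = Ident (Base F) (Fob (Proj F) \<phi>) \<longrightarrow>
        Far (Proj F) g = Ident (Base F) (Fob (Proj F) \<phi>) \<longrightarrow> f = g)"

definition reindex :: "('p, 'e, 'o, 'm) fibn \<Rightarrow> 'm \<Rightarrow> 'p \<Rightarrow> 'p" where
  "reindex F u \<psi> = Dom (Tot F) (SOME f. cartesian_lift F u \<psi> f)"

definition is_top :: "('p, 'e, 'o, 'm) fibn \<Rightarrow> 'o \<Rightarrow> 'p \<Rightarrow> bool" where
  "is_top F I t \<longleftrightarrow> t \<in> fibre F I \<and> (\<forall>\<phi>\<in>fibre F I. \<phi> \<turnstile>\<^bsub>F\<^esub> t)"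

definition is_meet :: "('p, 'e, 'o, 'm) fibn \<Rightarrow> 'p \<Rightarrow> 'p \<Rightarrow> 'p \<Rightarrow> bool" where
  "is_meet F \<phi> \<psi> \<chi> \<longleftrightarrow> (\<chi> \<turnstile>\<^bsub>F\<^esub> \<phi>) \<and> (\<chi> \<turnstile>\<^bsub>F\<^esub> \<psi>) \<and>
     (\<forall>\<theta>. (\<theta> \<turnstile>\<^bsub>F\<^esub> \<phi>) \<longrightarrow> (\<theta> \<turnstile>\<^bsub>F\<^esub> \<psi>) \<longrightarrow> (\<theta> \<turnstile>\<^bsub>F\<^esub> \<chi>))"

definition Top :: "('p, 'e, 'o, 'm) fibn \<Rightarrow> 'o \<Rightarrow> 'p" where
  "Top F I = (SOME t. is_top F I t)"

definition Meet :: "('p, 'e, 'o, 'm) fibn \<Rightarrow> 'p \<Rightarrow> 'p \<Rightarrow> 'p" where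
  "Meet F \<phi> \<psi> = (SOME \<chi>. is_meet F \<phi> \<psi> \<chi>)"

abbreviation meet_syntax :: "'p \<Rightarrow> ('p, 'e, 'o, 'm) fibn \<Rightarrow> 'p \<Rightarrow> 'p"
    ("(_ \<sqinter>\<^bsub>_\<^esub> _)" [65, 0, 66] 65) where
  "\<phi> \<sqinter>\<^bsub>F\<^esub> \<psi> \<equiv> Meet F \<phi> \<psi>"

text \<open>\<open>\<psi>\<close> has the universal property of \<open>\<exists>\<^sub>u \<phi>\<close>.\<close>

definition is_exists :: "('p, 'e, 'o, 'm) fibn \<Rightarrow> 'm \<Rightarrow> 'p \<Rightarrow> 'p \<Rightarrow> bool" where
  "is_exists F u \<phi> \<psi> \<longleftrightarrow> \<psi> \<in> fibre F (Cod (Base F) u) \<and>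
     (\<forall>\<chi>\<in>fibre F (Cod (Base F) u). (\<psi> \<turnstile>\<^bsub>F\<^esub> \<chi>) \<longleftrightarrow> (\<phi> \<turnstile>\<^bsub>F\<^esub> reindex F u \<chi>))"

definition Exists :: "('p, 'e, 'o, 'm) fibn \<Rightarrow> 'm \<Rightarrow> 'p \<Rightarrow> 'p" where
  "Exists F u \<phi> = (SOME \<psi>. is_exists F u \<phi> \<psi>)"

definition fibered_frame :: "('p, 'e, 'o, 'm) fibn \<Rightarrow> bool" where
  "fibered_frame F \<longleftrightarrow> regular_category (Base F) \<and> preorder_fibration F \<and>
     \<comment> \<open>finite meets, preserved by reindexing\<close>
     (\<forall>I\<in>Ob (Base F). \<exists>t. is_top F I t) \<and>
     (\<forall>I\<in>Ob (Base F). \<forall>\<phi>\<in>fibre F I. \<forall>\<psi>\<in>fibre F I. \<exists>\<chi>. is_meet F \<phi> \<psi> \<chi>) \<and>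
     (\<forall>u\<in>Arr (Base F). \<forall>t. is_top F (Cod (Base F) u) t \<longrightarrow>
        is_top F (Dom (Base F) u) (reindex F u t)) \<and>
     (\<forall>u\<in>Arr (Base F). \<forall>\<phi>\<in>fibre F (Cod (Base F) u). \<forall>\<psi>\<in>fibre F (Cod (Base F) u). \<forall>\<chi>.
        is_meet F \<phi> \<psi> \<chi> \<longrightarrow> is_meet F (reindex F u \<phi>) (reindex F u \<psi>) (reindex F u \<chi>)) \<and>
     \<comment> \<open>left adjoints to reindexing\<close>
     (\<forall>u\<in>Arr (Base F). \<forall>\<phi>\<in>fibre F (Dom (Base F) u). \<exists>\<psi>. is_exists F u \<phi> \<psi>) \<and>
     \<comment> \<open>Beck--Chevalley\<close>
     (\<forall>u v p q. is_pullback (Base F) u v p q \<longrightarrow>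
        (\<forall>\<phi>\<in>fibre F (Dom (Base F) u).
           reindex F v (Exists F u \<phi>) \<cong>\<^bsub>F\<^esub> Exists F q (reindex F p \<phi>))) \<and>
     \<comment> \<open>Frobenius\<close>
     (\<forall>u\<in>Arr (Base F). \<forall>\<phi>\<in>fibre F (Cod (Base F) u). \<forall>\<psi>\<in>fibre F (Dom (Base F) u).
        (\<phi> \<sqinter>\<^bsub>F\<^esub> Exists F u \<psi>) \<cong>\<^bsub>F\<^esub> Exists F u (reindex F u \<phi> \<sqinter>\<^bsub>F\<^esub> \<psi>)) \<and>
     \<comment> \<open>pre-stack\<close>
     (\<forall>e. regular_epi (Base F) e \<longrightarrow>
        (\<forall>\<phi>\<in>fibre F (Cod (Base F) e). \<forall>\<psi>\<in>fibre F (Cod (Base F) e).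
           (reindex F e \<phi> \<turnstile>\<^bsub>F\<^esub> reindex F e \<psi>) \<longrightarrow> (\<phi> \<turnstile>\<^bsub>F\<^esub> \<psi>)))"

subsection \<open>The subobject fibration\<close>

text \<open>Objects of the total category are the monos, without passing to isomorphism classes.
  A commutative square from \<open>m\<close> to \<open>n\<close> is determined by its lower edge \<open>u\<close>, as \<open>n\<close> is monic,
  and is encoded as \<open>(m, u, n)\<close>.\<close>

definition sub_fib :: "('o, 'm) cat \<Rightarrow> ('m, 'm \<times> 'm \<times> 'm, 'o, 'm) fibn" where
  "sub_fib C =
     \<lparr>Tot = \<lparr>Ob = {m. mono_arr C m},
             Arr = {(m, u, n). mono_arr C m \<and> mono_arr C n \<and> u \<in> Hom C (Cod C m) (Cod C n) \<and>
                      (\<exists>h\<in>Hom C (Dom C m) (Dom C n). n \<cdot>\<^bsub>C\<^esub> h = u \<cdot>\<^bsub>C\<^esub> m)},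
             Dom = (\<lambda>(m, u, n). m),
             Cod = (\<lambda>(m, u, n). n),
             Ident = (\<lambda>m. (m, Ident C (Cod C m), m)),
             Comp = (\<lambda>(n, v, k) (m, u, n'). (m, v \<cdot>\<^bsub>C\<^esub> u, k))\<rparr>,
      Base = C,
      Proj = \<lparr>Fob = (\<lambda>m. Cod C m), Far = (\<lambda>(m, u, n). u)\<rparr>\<rparr>"

subsection \<open>Totally connected fibered frames\<close>

definition delta :: "('p, 'e, 'o, 'm) fibn \<Rightarrow> 'm \<Rightarrow> 'p" where
  "delta F m = Exists F m (Top F (Dom (Base F) m))"

definition fibered_monotone ::
  "('p, 'e, 'o, 'm) fibn \<Rightarrow> ('q, 'e2, 'o, 'm) fibn \<Rightarrow> ('p \<Rightarrow> 'q) \<Rightarrow> bool" where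
  "fibered_monotone F G h \<longleftrightarrow>
     (\<forall>I\<in>Ob (Base F). \<forall>\<phi>\<in>fibre F I. h \<phi> \<in> fibre G I) \<and>
     (\<forall>\<phi> \<psi>. (\<phi> \<turnstile>\<^bsub>F\<^esub> \<psi>) \<longrightarrow> (h \<phi> \<turnstile>\<^bsub>G\<^esub> h \<psi>)) \<and>
     (\<forall>u\<in>Arr (Base F). \<forall>\<phi>\<in>fibre F (Cod (Base F) u).
        h (reindex F u \<phi>) \<cong>\<^bsub>G\<^esub> reindex G u (h \<phi>))"

definition preserves_finite_meets ::
  "('p, 'e, 'o, 'm) fibn \<Rightarrow> ('q, 'e2, 'o, 'm) fibn \<Rightarrow> ('p \<Rightarrow> 'q) \<Rightarrow> bool" where
  "preserves_finite_meets F G h \<longleftrightarrow>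
     (\<forall>I\<in>Ob (Base F). \<forall>t. is_top F I t \<longrightarrow> is_top G I (h t)) \<and>
     (\<forall>I\<in>Ob (Base F). \<forall>\<phi>\<in>fibre F I. \<forall>\<psi>\<in>fibre F I. \<forall>\<chi>.
        is_meet F \<phi> \<psi> \<chi> \<longrightarrow> is_meet G (h \<phi>) (h \<psi>) (h \<chi>))"

definition connected_components :: "('p, 'e, 'o, 'm) fibn \<Rightarrow> ('p \<Rightarrow> 'm) \<Rightarrow> bool" where
  "connected_components F \<pi> \<longleftrightarrow>
     fibered_monotone F (sub_fib (Base F)) \<pi> \<and>
     (\<forall>I\<in>Ob (Base F). \<forall>\<phi>\<in>fibre F I. \<forall>m\<in>fibre (sub_fib (Base F)) I.
        (\<pi> \<phi> \<turnstile>\<^bsub>sub_fib (Base F)\<^esub> m) \<longleftrightarrow> (\<phi> \<turnstile>\<^bsub>F\<^esub> delta F m)) \<and>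
     preserves_finite_meets F (sub_fib (Base F)) \<pi>"

definition totally_connected :: "('p, 'e, 'o, 'm) fibn \<Rightarrow> bool" where
  "totally_connected F \<longleftrightarrow> (\<exists>\<pi>. connected_components F \<pi>)"


section \<open>Partial equivalence relations in a fibered frame\<close>

subsection \<open>Internal logic\<close>

text \<open>Contexts are products, left-nested; variables are projections out of the context,
  and \<open>\<phi>(x, y)\<close> is the reindexing of \<open>\<phi>\<close> along \<open>\<langle>x, y\<rangle>\<close>.\<close>

definition inst2 :: "('p, 'e, 'o, 'm) fibn \<Rightarrow> 'p \<Rightarrow> 'm \<Rightarrow> 'm \<Rightarrow> 'p" where
  "inst2 F \<phi> x y = reindex F (pair (Base F) x y) \<phi>"

definition equality :: "('p, 'e, 'o, 'm) fibn \<Rightarrow> 'o \<Rightarrow> 'p" where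
  "equality F C =
     Exists F (pair (Base F) (Ident (Base F) C) (Ident (Base F) C)) (Top F C)"

definition var31 :: "('o, 'm) cat \<Rightarrow> 'o \<Rightarrow> 'o \<Rightarrow> 'o \<Rightarrow> 'm" where
  "var31 X a b c = pr1 X a b \<cdot>\<^bsub>X\<^esub> pr1 X (prd X a b) c"

definition var32 :: "('o, 'm) cat \<Rightarrow> 'o \<Rightarrow> 'o \<Rightarrow> 'o \<Rightarrow> 'm" where
  "var32 X a b c = pr2 X a b \<cdot>\<^bsub>X\<^esub> pr1 X (prd X a b) c"

definition var33 :: "('o, 'm) cat \<Rightarrow> 'o \<Rightarrow> 'o \<Rightarrow> 'o \<Rightarrow> 'm" where
  "var33 X a b c = pr2 X (prd X a b) c"

definition var41 :: "('o, 'm) cat \<Rightarrow> 'o \<Rightarrow> 'o \<Rightarrow> 'o \<Rightarrow> 'o \<Rightarrow> 'm" where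
  "var41 X a b c d = var31 X a b c \<cdot>\<^bsub>X\<^esub> pr1 X (prd X (prd X a b) c) d"

definition var42 :: "('o, 'm) cat \<Rightarrow> 'o \<Rightarrow> 'o \<Rightarrow> 'o \<Rightarrow> 'o \<Rightarrow> 'm" where
  "var42 X a b c d = var32 X a b c \<cdot>\<^bsub>X\<^esub> pr1 X (prd X (prd X a b) c) d"

definition var43 :: "('o, 'm) cat \<Rightarrow> 'o \<Rightarrow> 'o \<Rightarrow> 'o \<Rightarrow> 'o \<Rightarrow> 'm" where
  "var43 X a b c d = var33 X a b c \<cdot>\<^bsub>X\<^esub> pr1 X (prd X (prd X a b) c) d"

definition var44 :: "('o, 'm) cat \<Rightarrow> 'o \<Rightarrow> 'o \<Rightarrow> 'o \<Rightarrow> 'o \<Rightarrow> 'm" where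
  "var44 X a b c d = pr2 X (prd X (prd X a b) c) d"

subsection \<open>Partial equivalence relations and functional relations\<close>

definition per :: "('p, 'e, 'o, 'm) fibn \<Rightarrow> 'o \<times> 'p \<Rightarrow> bool" where
  "per F A \<longleftrightarrow> (case A of (C, \<rho>) \<Rightarrow>
     C \<in> Ob (Base F) \<and> \<rho> \<in> fibre F (prd (Base F) C C) \<and>
     (\<rho> \<turnstile>\<^bsub>F\<^esub> inst2 F \<rho> (pr2 (Base F) C C) (pr1 (Base F) C C)) \<and>
     (let x = var31 (Base F) C C C; y = var32 (Base F) C C C; z = var33 (Base F) C C C in
        inst2 F \<rho> x y \<sqinter>\<^bsub>F\<^esub> inst2 F \<rho> y z \<turnstile>\<^bsub>F\<^esub> inst2 F \<rho> x z))"

definition functional_relation ::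
  "('p, 'e, 'o, 'm) fibn \<Rightarrow> 'o \<times> 'p \<Rightarrow> 'o \<times> 'p \<Rightarrow> 'p \<Rightarrow> bool" where
  "functional_relation F A B \<phi> \<longleftrightarrow> (case (A, B) of ((C, \<rho>), (D, \<sigma>)) \<Rightarrow>
     \<phi> \<in> fibre F (prd (Base F) C D) \<and>
     \<comment> \<open>strictness\<close>
     (let c = pr1 (Base F) C D; d = pr2 (Base F) C D in
        \<phi> \<turnstile>\<^bsub>F\<^esub> inst2 F \<rho> c c \<sqinter>\<^bsub>F\<^esub> inst2 F \<sigma> d d) \<and>
     \<comment> \<open>congruence\<close>
     (let c = var41 (Base F) C D C D; d = var42 (Base F) C D C D;
          c' = var43 (Base F) C D C D; d' = var44 (Base F) C D C D in
        inst2 F \<phi> c d \<sqinter>\<^bsub>F\<^esub> inst2 F \<rho> c c' \<sqinter>\<^bsub>F\<^esub> inst2 F \<sigma> d d' \<turnstile>\<^bsub>F\<^esub> inst2 F \<phi> c' d') \<and>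
     \<comment> \<open>single-valuedness\<close>
     (let c = var31 (Base F) C D D; d = var32 (Base F) C D D; d' = var33 (Base F) C D D in
        inst2 F \<phi> c d \<sqinter>\<^bsub>F\<^esub> inst2 F \<phi> c d' \<turnstile>\<^bsub>F\<^esub> inst2 F \<sigma> d d') \<and>
     \<comment> \<open>totality\<close>
     (let c = Ident (Base F) C in
        inst2 F \<rho> c c \<turnstile>\<^bsub>F\<^esub> Exists F (pr1 (Base F) C D) \<phi>))"

definition relcomp :: "('p, 'e, 'o, 'm) fibn \<Rightarrow> 'o \<Rightarrow> 'o \<Rightarrow> 'o \<Rightarrow> 'p \<Rightarrow> 'p \<Rightarrow> 'p" where
  "relcomp F C D E \<phi> \<psi> =
     (let c = var31 (Base F) C D E; d = var32 (Base F) C D E; e = var33 (Base F) C D E in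
        Exists F (pair (Base F) c e) (inst2 F \<phi> c d \<sqinter>\<^bsub>F\<^esub> inst2 F \<psi> d e))"

definition eqv_class :: "('p, 'e, 'o, 'm) fibn \<Rightarrow> 'p \<Rightarrow> 'p set" where
  "eqv_class F \<phi> = {\<psi>. \<psi> \<cong>\<^bsub>F\<^esub> \<phi>}"

type_synonym ('o, 'p) per_arr = "('o \<times> 'p) \<times> 'p set \<times> ('o \<times> 'p)"

definition per_cat :: "('p, 'e, 'o, 'm) fibn \<Rightarrow> ('o \<times> 'p, ('o, 'p) per_arr) cat" where
  "per_cat F =
     \<lparr>Ob = {A. per F A},
      Arr = {(A, \<Phi>, B). per F A \<and> per F B \<and>
               (\<exists>\<phi>. functional_relation F A B \<phi> \<and> \<Phi> = eqv_class F \<phi>)},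
      Dom = (\<lambda>(A, \<Phi>, B). A),
      Cod = (\<lambda>(A, \<Phi>, B). B),
      Ident = (\<lambda>(C, \<rho>). ((C, \<rho>), eqv_class F \<rho>, (C, \<rho>))),
      Comp = (\<lambda>(B, \<Psi>, E) (A, \<Phi>, B').
        (A, {\<chi>. \<exists>\<phi>\<in>\<Phi>. \<exists>\<psi>\<in>\<Psi>. \<chi> \<cong>\<^bsub>F\<^esub> relcomp F (fst A) (fst B) (fst E) \<phi> \<psi>}, E))\<rparr>"

subsection \<open>Strict predicates\<close>

definition strict :: "('p, 'e, 'o, 'm) fibn \<Rightarrow> 'o \<times> 'p \<Rightarrow> 'p \<Rightarrow> bool" where
  "strict F A \<phi> \<longleftrightarrow> (case A of (C, \<rho>) \<Rightarrow>
     \<phi> \<in> fibre F C \<and>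
     (\<phi> \<turnstile>\<^bsub>F\<^esub> inst2 F \<rho> (Ident (Base F) C) (Ident (Base F) C)) \<and>
     (let x = pr1 (Base F) C C; y = pr2 (Base F) C C in
        reindex F x \<phi> \<sqinter>\<^bsub>F\<^esub> \<rho> \<turnstile>\<^bsub>F\<^esub> reindex F y \<phi>))"

definition restrict_per :: "('p, 'e, 'o, 'm) fibn \<Rightarrow> 'o \<times> 'p \<Rightarrow> 'p \<Rightarrow> 'o \<times> 'p" where
  "restrict_per F A \<phi> =
     (fst A, snd A \<sqinter>\<^bsub>F\<^esub> reindex F (pr1 (Base F) (fst A) (fst A)) \<phi>)"

definition strict_mono_arr :: "('p, 'e, 'o, 'm) fibn \<Rightarrow> 'o \<times> 'p \<Rightarrow> 'p \<Rightarrow> ('o, 'p) per_arr" where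
  "strict_mono_arr F A \<phi> =
     (restrict_per F A \<phi>, eqv_class F (snd (restrict_per F A \<phi>)), A)"

subsection \<open>Constant objects and their reflector\<close>

definition Delta :: "('p, 'e, 'o, 'm) fibn \<Rightarrow> ('o, 'm, 'o \<times> 'p, ('o, 'p) per_arr) ftor" where
  "Delta F =
     \<lparr>Fob = (\<lambda>I. (I, equality F I)),
      Far = (\<lambda>u. let I = Dom (Base F) u; J = Cod (Base F) u in
        ((I, equality F I),
         eqv_class F (inst2 F (equality F J) (u \<cdot>\<^bsub>Base F\<^esub> pr1 (Base F) I J) (pr2 (Base F) I J)),
         (J, equality F J)))\<rparr>"

text \<open>A chosen left adjoint of \<open>Delta\<close> with its unit. Any two choices are canonically
  isomorphic, so the closure of a subobject and the notions derived from it do not depend on it.\<close>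

definition reflector ::
  "('p, 'e, 'o, 'm) fibn \<Rightarrow>
    ('o \<times> 'p, ('o, 'p) per_arr, 'o, 'm) ftor \<times> ('o \<times> 'p \<Rightarrow> ('o, 'p) per_arr)" where
  "reflector F = (SOME (\<Pi>, \<eta>). left_adjoint (per_cat F) (Base F) \<Pi> (Delta F) \<eta>)"

definition Pi_ftor :: "('p, 'e, 'o, 'm) fibn \<Rightarrow> ('o \<times> 'p, ('o, 'p) per_arr, 'o, 'm) ftor" where
  "Pi_ftor F = fst (reflector F)"

definition eta :: "('p, 'e, 'o, 'm) fibn \<Rightarrow> 'o \<times> 'p \<Rightarrow> ('o, 'p) per_arr" where
  "eta F = snd (reflector F)"

definition L_monad ::
  "('p, 'e, 'o, 'm) fibn \<Rightarrow> ('o \<times> 'p, ('o, 'p) per_arr, 'o \<times> 'p, ('o, 'p) per_arr) ftor" where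
  "L_monad F = comp_ftor (Delta F) (Pi_ftor F)"

subsection \<open>Closure, density and separated objects\<close>

definition closure_op :: "('p, 'e, 'o, 'm) fibn \<Rightarrow> ('o, 'p) per_arr \<Rightarrow> ('o, 'p) per_arr" where
  "closure_op F m =
     (SOME k. \<exists>q. is_pullback (per_cat F) (eta F (Cod (per_cat F) m)) (Far (L_monad F) m) k q)"

definition dense_mono :: "('p, 'e, 'o, 'm) fibn \<Rightarrow> ('o, 'p) per_arr \<Rightarrow> bool" where
  "dense_mono F m \<longleftrightarrow> mono_arr (per_cat F) m \<and>
     (closure_op F m \<cong>\<^bsub>sub_fib (per_cat F)\<^esub> Top (sub_fib (per_cat F)) (Cod (per_cat F) m))"

definition separated :: "('p, 'e, 'o, 'm) fibn \<Rightarrow> 'o \<times> 'p \<Rightarrow> bool" where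
  "separated F S \<longleftrightarrow> S \<in> Ob (per_cat F) \<and>
     (\<forall>U A m f h h'. m \<in> Hom (per_cat F) U A \<longrightarrow> dense_mono F m \<longrightarrow> f \<in> Hom (per_cat F) U S \<longrightarrow>
        h \<in> Hom (per_cat F) A S \<longrightarrow> h' \<in> Hom (per_cat F) A S \<longrightarrow>
        h \<cdot>\<^bsub>per_cat F\<^esub> m = f \<longrightarrow> h' \<cdot>\<^bsub>per_cat F\<^esub> m = f \<longrightarrow> h = h')"

definition Sep :: "('p, 'e, 'o, 'm) fibn \<Rightarrow> ('o \<times> 'p, ('o, 'p) per_arr) cat" where
  "Sep F = full_subcat (per_cat F) {S. separated F S}"

subsection \<open>Dense predicates and assemblies\<close>

definition dense_total :: "('p, 'e, 'o, 'm) fibn \<Rightarrow> ('p \<Rightarrow> 'm) \<Rightarrow> ('p, 'e) cat" where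
  "dense_total F \<pi> = full_subcat (Tot F)
     {\<phi>. \<pi> \<phi> \<cong>\<^bsub>sub_fib (Base F)\<^esub> Top (sub_fib (Base F)) (Fob (Proj F) \<phi>)}"

text \<open>\<open>(C, =\<^sub>\<phi>)\<close> for \<open>\<phi>\<close> in the fibre over \<open>C\<close>.\<close>

definition assembly :: "('p, 'e, 'o, 'm) fibn \<Rightarrow> 'p \<Rightarrow> 'o \<times> 'p" where
  "assembly F \<phi> = (let C = Fob (Proj F) \<phi> in
     (C, reindex F (pr1 (Base F) C C) \<phi> \<sqinter>\<^bsub>F\<^esub> equality F C))"

definition Asm :: "('p, 'e, 'o, 'm) fibn \<Rightarrow> ('o \<times> 'p, ('o, 'p) per_arr) cat" where
  "Asm F = full_subcat (per_cat F) {assembly F \<phi> | C \<phi>. C \<in> Ob (Base F) \<and> \<phi> \<in> fibre F C}"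

text \<open>An arrow \<open>\<phi> \<rightarrow> \<psi>\<close> over \<open>u : C \<rightarrow> D\<close> is sent to the functional relation
  \<open>\<phi>(c) \<and> u(c) = d\<close>.\<close>

definition assembly_ftor ::
  "('p, 'e, 'o, 'm) fibn \<Rightarrow> ('p, 'e, 'o \<times> 'p, ('o, 'p) per_arr) ftor" where
  "assembly_ftor F =
     \<lparr>Fob = assembly F,
      Far = (\<lambda>f. let \<phi> = Dom (Tot F) f; \<psi> = Cod (Tot F) f; u = Far (Proj F) f;
                     C = Fob (Proj F) \<phi>; D = Fob (Proj F) \<psi>;
                     c = pr1 (Base F) C D; d = pr2 (Base F) C D in
        (assembly F \<phi>,
         eqv_class F (reindex F c \<phi> \<sqinter>\<^bsub>F\<^esub> inst2 F (equality F D) (u \<cdot>\<^bsub>Base F\<^esub> c) d),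
         assembly F \<psi>))\<rparr>"

end

theory Submission
  imports Defs
begin

text \<open>
  Relations of the fibered frame are replaced by the sets of pairs of generalized elements they force
  (Kripke--Joyal semantics). The category of partial equivalence relations then lives in a calculus of
  relations with composition and converse, in which \<open>f : \<rho> \<rightarrow> \<sigma>\<close> is functional iff \<open>\<rho>f = f = f\<sigma>\<close>,
  \<open>f\<degree>f \<le> \<sigma>\<close> and \<open>\<rho> \<le> ff\<degree>\<close>. The operator \<open>\<box> = \<delta>\<pi>\<close> is inflationary and idempotent, commutes with
  composition and converse, and fixes graphs of arrows; relations fixed by \<open>\<box>\<close> are tabulated by
  subobjects, so closed functional relations between constant objects are graphs.

  Exactness gives a quotient \<open>e : (C, \<rho>) \<rightarrow> \<Delta>Q\<close> with \<open>ee\<degree> \<le> \<box>\<rho>\<close> and \<open>1 \<le> \<box>(e\<degree>e)\<close>, and these two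
  inequalities make \<open>e\<close> universal. They also show that the closure of a mono \<open>M : U \<rightarrow> (C, \<rho>)\<close> is
  \<open>\<rho> \<and> \<box>(M\<degree>M)\<close>, so \<open>M\<close> is dense iff \<open>\<rho> \<le> \<box>(M\<degree>M)\<close>. If \<open>H\<close> and \<open>H'\<close> map into a subobject of a constant
  object and agree on a dense \<open>M\<close>, then \<open>H\<degree>H' \<le> \<box>(H\<degree>M\<degree>MH') \<le> 1\<close>, hence \<open>H = H'\<close>: assemblies are
  separated. Conversely, separatedness tested on the dense inclusion of the assembly of \<open>\<rho>\<close> into that of
  \<open>\<rho>;\<box>\<rho>;\<rho>\<close> over \<open>C \<times> C\<close> forces \<open>ee\<degree> = \<rho>\<close>, so that \<open>(C, \<rho>)\<close> is isomorphic to the assembly of the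
  dense predicate \<open>e\<degree>e\<close> on \<open>Q\<close>.
\<close>

section \<open>Categories\<close>

text \<open>Every meet, quantifier, product and reindexing here is an arbitrary choice and homs are
  equivalence classes, so computing with predicates would drag coherence isomorphisms along. Sets of
  forced pairs are canonical: associativity and the laws of converse become equations for rewriting,
  and comparable functional relations are equal, so an equation of arrows needs one inclusion. The
  axioms enter at few points. The pre-stack condition makes regular epis covers. As \<pi> preserves
  the top predicate, \<delta> reflects truth, which turns forced factorizations into arrows. As
  \<pi> preserves binary meets, one half of \<box>(PQ) = \<box>P \<box>Q holds; image factorization
  gives the other. Exactness makes a closed equivalence relation effective. The obstacle to the
  quotient is that \<rho> is reflexive only on its domain: the quotient is formed on the subobject
  \<pi>(\<rho>(c, c)), which elements of the domain enter only locally. Assemblies over C \<times> C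
  act as test objects, since they turn an inclusion of relations into an equation between two
  projections.\<close>

lemma HomI: "f \<in> Arr C \<Longrightarrow> Dom C f = a \<Longrightarrow> Cod C f = b \<Longrightarrow> f \<in> Hom C a b"
  by (simp add: Hom_def)

lemma Arr_Hom: "x \<in> Arr C \<Longrightarrow> x \<in> Hom C (Dom C x) (Cod C x)" by (simp add: Hom_def)

lemma HomD:
  assumes "f \<in> Hom C a b"
  shows "f \<in> Arr C" "Dom C f = a" "Cod C f = b"
  using assms by (auto simp: Hom_def)

lemma Hom_Ob:
  assumes "category C" "f \<in> Hom C a b"
  shows "a \<in> Ob C" "b \<in> Ob C"
  using assms by (auto simp: Hom_def category_def)

lemma Ident_Hom: "category C \<Longrightarrow> a \<in> Ob C \<Longrightarrow> Ident C a \<in> Hom C a a"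
  by (auto simp: category_def)

lemma comp_Hom: "category C \<Longrightarrow> g \<in> Hom C b c \<Longrightarrow> f \<in> Hom C a b \<Longrightarrow> g \<cdot>\<^bsub>C\<^esub> f \<in> Hom C a c"
  unfolding category_def Hom_def by force

lemma comp_assoc_Hom:
  "category C \<Longrightarrow> f \<in> Hom C a b \<Longrightarrow> g \<in> Hom C b c \<Longrightarrow> h \<in> Hom C c d \<Longrightarrow>
    h \<cdot>\<^bsub>C\<^esub> (g \<cdot>\<^bsub>C\<^esub> f) = (h \<cdot>\<^bsub>C\<^esub> g) \<cdot>\<^bsub>C\<^esub> f"
  unfolding category_def Hom_def by force

lemma comp_Ident_right: "category C \<Longrightarrow> f \<in> Hom C a b \<Longrightarrow> f \<cdot>\<^bsub>C\<^esub> Ident C a = f"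
  and comp_Ident_left: "category C \<Longrightarrow> f \<in> Hom C a b \<Longrightarrow> Ident C b \<cdot>\<^bsub>C\<^esub> f = f"
  unfolding category_def Hom_def by force+

lemma mono_arrD:
  assumes "mono_arr C m" "m \<in> Hom C u a" "f \<in> Hom C z u" "g \<in> Hom C z u"
    "m \<cdot>\<^bsub>C\<^esub> f = m \<cdot>\<^bsub>C\<^esub> g" "category C"
  shows "f = g"
  using assms Hom_Ob[OF assms(6,3)] unfolding mono_arr_def Hom_def by auto

lemma mono_arrI:
  assumes "m \<in> Hom C u a"
    "\<And>z f g. f \<in> Hom C z u \<Longrightarrow> g \<in> Hom C z u \<Longrightarrow> m \<cdot>\<^bsub>C\<^esub> f = m \<cdot>\<^bsub>C\<^esub> g \<Longrightarrow> f = g"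
  shows "mono_arr C m"
  using assms unfolding mono_arr_def Hom_def by auto

lemma pullback_Hom:
  assumes "is_pullback C f g p q" "f \<in> Hom C a c"
  shows "g \<in> Hom C (Dom C g) c" "p \<in> Hom C (Dom C p) a" "q \<in> Hom C (Dom C p) (Dom C g)"
    "f \<cdot>\<^bsub>C\<^esub> p = g \<cdot>\<^bsub>C\<^esub> q"
  using assms unfolding is_pullback_def Hom_def by auto

lemma pullback_univ:
  assumes "is_pullback C f g p q" "category C" "x \<in> Hom C z (Dom C f)" "y \<in> Hom C z (Dom C g)"
    "f \<cdot>\<^bsub>C\<^esub> x = g \<cdot>\<^bsub>C\<^esub> y"
  shows "\<exists>!h. h \<in> Hom C z (Dom C p) \<and> p \<cdot>\<^bsub>C\<^esub> h = x \<and> q \<cdot>\<^bsub>C\<^esub> h = y"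
  using assms Hom_Ob[OF assms(2,3)] unfolding is_pullback_def by blast

lemma pullback_joint_mono:
  assumes "is_pullback C f g p q" "category C" "h \<in> Hom C z (Dom C p)" "k \<in> Hom C z (Dom C p)"
    "p \<cdot>\<^bsub>C\<^esub> h = p \<cdot>\<^bsub>C\<^esub> k" "q \<cdot>\<^bsub>C\<^esub> h = q \<cdot>\<^bsub>C\<^esub> k"
  shows "h = k"
proof -
  have f: "f \<in> Hom C (Dom C f) (Cod C f)" using assms(1) by (simp add: is_pullback_def Hom_def)
  note P = pullback_Hom[OF assms(1) f]
  have a: "p \<cdot>\<^bsub>C\<^esub> h \<in> Hom C z (Dom C f)" and b: "q \<cdot>\<^bsub>C\<^esub> h \<in> Hom C z (Dom C g)"
    by (rule comp_Hom[OF assms(2) _ assms(3)], fact P)+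
  have "f \<cdot>\<^bsub>C\<^esub> (p \<cdot>\<^bsub>C\<^esub> h) = g \<cdot>\<^bsub>C\<^esub> (q \<cdot>\<^bsub>C\<^esub> h)"
    by (simp add: comp_assoc_Hom[OF assms(2) assms(3) P(2) f]
        comp_assoc_Hom[OF assms(2) assms(3) P(3) P(1)] P(4))
  from pullback_univ[OF assms(1,2) a b this] show ?thesis using assms by metis
qed

lemma pullback_mono:
  assumes "is_pullback C f g p q" "category C" "mono_arr C f"
  shows "mono_arr C q"
proof -
  have f: "f \<in> Hom C (Dom C f) (Cod C f)" using assms(1) by (simp add: is_pullback_def Hom_def)
  note P = pullback_Hom[OF assms(1) f]
  show ?thesis
  proof (rule mono_arrI[OF P(3)])
    fix z h k
    assume h: "h \<in> Hom C z (Dom C p)" and k: "k \<in> Hom C z (Dom C p)"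
      and e: "q \<cdot>\<^bsub>C\<^esub> h = q \<cdot>\<^bsub>C\<^esub> k"
    have "f \<cdot>\<^bsub>C\<^esub> (p \<cdot>\<^bsub>C\<^esub> h) = f \<cdot>\<^bsub>C\<^esub> (p \<cdot>\<^bsub>C\<^esub> k)"
      by (simp add: comp_assoc_Hom[OF assms(2) h P(2) f] comp_assoc_Hom[OF assms(2) k P(2) f] P(4)
          comp_assoc_Hom[OF assms(2) h P(3) P(1), symmetric]
          comp_assoc_Hom[OF assms(2) k P(3) P(1), symmetric] e)
    then have "p \<cdot>\<^bsub>C\<^esub> h = p \<cdot>\<^bsub>C\<^esub> k"
      using mono_arrD[OF assms(3) f comp_Hom[OF assms(2) P(2) h] comp_Hom[OF assms(2) P(2) k]] assms(2)
      by blast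
    then show "h = k" using pullback_joint_mono[OF assms(1,2) h k _ e] by blast
  qed
qed

lemma mono_comp:
  assumes "category C" "mono_arr C m" "m \<in> Hom C b c" "mono_arr C n" "n \<in> Hom C a b"
  shows "mono_arr C (m \<cdot>\<^bsub>C\<^esub> n)"
proof (rule mono_arrI[OF comp_Hom[OF assms(1,3,5)]])
  fix z f g
  assume f: "f \<in> Hom C z a" and g: "g \<in> Hom C z a"
    and e: "(m \<cdot>\<^bsub>C\<^esub> n) \<cdot>\<^bsub>C\<^esub> f = (m \<cdot>\<^bsub>C\<^esub> n) \<cdot>\<^bsub>C\<^esub> g"
  have "n \<cdot>\<^bsub>C\<^esub> f = n \<cdot>\<^bsub>C\<^esub> g"
    using mono_arrD[OF assms(2,3) comp_Hom[OF assms(1,5) f] comp_Hom[OF assms(1,5) g]]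
      e assms(1) comp_assoc_Hom[OF assms(1) f assms(5,3)] comp_assoc_Hom[OF assms(1) g assms(5,3)]
    by simp
  then show "f = g" using mono_arrD[OF assms(4,5) f g _ assms(1)] by blast
qed

lemma mono_Ident: "category C \<Longrightarrow> a \<in> Ob C \<Longrightarrow> mono_arr C (Ident C a)"
  by (rule mono_arrI[OF Ident_Hom]) (auto simp: comp_Ident_left)

lemma full_subcat_simps [simp]:
  "Ob (full_subcat C S) = Ob C \<inter> S"
  "Arr (full_subcat C S) = {f \<in> Arr C. Dom C f \<in> S \<and> Cod C f \<in> S}"
  "Dom (full_subcat C S) = Dom C" "Cod (full_subcat C S) = Cod C"
  "Ident (full_subcat C S) = Ident C" "Comp (full_subcat C S) = Comp C"
  by (simp_all add: full_subcat_def)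

lemma Hom_full_subcat:
  "a \<in> S \<Longrightarrow> b \<in> S \<Longrightarrow> Hom (full_subcat C S) a b = Hom C a b"
  by (auto simp: Hom_def)

lemma category_full_subcat: "category C \<Longrightarrow> category (full_subcat C S)"
  unfolding category_def Hom_def by auto

section \<open>Regular categories\<close>

locale regcat =
  fixes X :: "('o, 'm) cat"
  assumes regX: "regular_category X"
begin

abbreviation cmp (infixl "\<cdot>" 70) where "g \<cdot> f \<equiv> Comp X g f"

lemma catX: "category X" using regX by (simp add: regular_category_def)

lemmas cmpH = comp_Hom[OF catX]
lemmas idH [intro] = Ident_Hom[OF catX]
lemmas cmp_assoc = comp_assoc_Hom[OF catX]
lemmas cmp_idr = comp_Ident_right[OF catX]
lemmas cmp_idl = comp_Ident_left[OF catX]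
lemmas HomOb = Hom_Ob[OF catX]

lemma pullback_ex:
  assumes "f \<in> Hom X a c" "g \<in> Hom X b c"
  obtains w p q where "p \<in> Hom X w a" "q \<in> Hom X w b" "f \<cdot> p = g \<cdot> q" "is_pullback X f g p q"
proof -
  have "has_finite_limits X" using regX by (simp add: regular_category_def)
  then obtain p q where pb: "is_pullback X f g p q"
    using HomD[OF assms(1)] HomD[OF assms(2)] unfolding has_finite_limits_def by metis
  from pullback_Hom[OF pb assms(1)] assms(2) show ?thesis
    by (intro that[OF _ _ _ pb]) (auto simp: Hom_def)
qed

lemma product_ex:
  assumes "a \<in> Ob X" "b \<in> Ob X"
  shows "\<exists>c p q. is_product X a b c p q"
proof -
  from regX obtain t where t: "is_terminal X t"
    unfolding regular_category_def has_finite_limits_def by auto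
  then obtain f g where f: "f \<in> Hom X a t" and g: "g \<in> Hom X b t"
    using assms unfolding is_terminal_def by blast
  obtain w p q where pq: "p \<in> Hom X w a" "q \<in> Hom X w b" and pb: "is_pullback X f g p q"
    using pullback_ex[OF f g] by metis
  have "is_product X a b w p q"
    unfolding is_product_def
  proof (intro conjI ballI assms pq HomOb(1)[OF pq(1)])
    fix z x y assume z: "z \<in> Ob X" and x: "x \<in> Hom X z a" and y: "y \<in> Hom X z b"
    have "f \<cdot> x = g \<cdot> y"
      using t z cmpH[OF f x] cmpH[OF g y] unfolding is_terminal_def by blast
    then show "\<exists>!h. h \<in> Hom X z w \<and> p \<cdot> h = x \<and> q \<cdot> h = y"
      using pullback_univ[OF pb catX, of x z y] x y f g pq by (simp add: Hom_def)
  qed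
  then show ?thesis by blast
qed

lemma chosen_is_product:
  assumes "a \<in> Ob X" "b \<in> Ob X"
  shows "is_product X a b (prd X a b) (pr1 X a b) (pr2 X a b)"
proof -
  let ?P = "\<lambda>(c, p, q). is_product X a b c p q"
  have "\<exists>x. ?P x" using product_ex[OF assms] by auto
  then have "?P (chosen_product X a b)" unfolding chosen_product_def by (rule someI_ex)
  then show ?thesis unfolding prd_def pr1_def pr2_def by (simp add: case_prod_beta)
qed

lemma prd_Ob [intro]: "a \<in> Ob X \<Longrightarrow> b \<in> Ob X \<Longrightarrow> prd X a b \<in> Ob X"
  and pr1H [intro]: "a \<in> Ob X \<Longrightarrow> b \<in> Ob X \<Longrightarrow> pr1 X a b \<in> Hom X (prd X a b) a"
  and pr2H [intro]: "a \<in> Ob X \<Longrightarrow> b \<in> Ob X \<Longrightarrow> pr2 X a b \<in> Hom X (prd X a b) b"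
  using chosen_is_product unfolding is_product_def by auto

lemma pair_props:
  assumes "x \<in> Hom X z a" "y \<in> Hom X z b"
  shows pairH: "pair X x y \<in> Hom X z (prd X a b)"
    and pr1_pair: "pr1 X a b \<cdot> pair X x y = x"
    and pr2_pair: "pr2 X a b \<cdot> pair X x y = y"
    and pair_unique: "\<And>h. h \<in> Hom X z (prd X a b) \<Longrightarrow> pr1 X a b \<cdot> h = x \<Longrightarrow> pr2 X a b \<cdot> h = y
      \<Longrightarrow> h = pair X x y"
proof -
  note ob = HomOb[OF assms(1)] HomOb[OF assms(2)]
  have ex: "\<exists>!h. h \<in> Hom X z (prd X a b) \<and> pr1 X a b \<cdot> h = x \<and> pr2 X a b \<cdot> h = y"
    using chosen_is_product[OF ob(2,4)] ob assms unfolding is_product_def by blast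
  have eq: "pair X x y = (THE h. h \<in> Hom X z (prd X a b) \<and> pr1 X a b \<cdot> h = x \<and> pr2 X a b \<cdot> h = y)"
    using assms unfolding pair_def by (simp add: Hom_def)
  from theI'[OF ex] show "pair X x y \<in> Hom X z (prd X a b)" "pr1 X a b \<cdot> pair X x y = x"
    "pr2 X a b \<cdot> pair X x y = y" unfolding eq by auto
  then show "\<And>h. h \<in> Hom X z (prd X a b) \<Longrightarrow> pr1 X a b \<cdot> h = x \<Longrightarrow> pr2 X a b \<cdot> h = y
      \<Longrightarrow> h = pair X x y" using ex by blast
qed

lemma pair_comp:
  assumes "x \<in> Hom X z a" "y \<in> Hom X z b" "w \<in> Hom X v z"
  shows "pair X x y \<cdot> w = pair X (x \<cdot> w) (y \<cdot> w)"
proof (rule pair_unique[OF cmpH[OF assms(1,3)] cmpH[OF assms(2,3)]])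
  note ob = HomOb[OF assms(1)] HomOb[OF assms(2)]
  note p = pairH[OF assms(1,2)]
  show "pair X x y \<cdot> w \<in> Hom X v (prd X a b)" using p assms(3) by (rule cmpH)
  show "pr1 X a b \<cdot> (pair X x y \<cdot> w) = x \<cdot> w" "pr2 X a b \<cdot> (pair X x y \<cdot> w) = y \<cdot> w"
    using cmp_assoc[OF assms(3) p pr1H[OF ob(2,4)]] cmp_assoc[OF assms(3) p pr2H[OF ob(2,4)]]
      pr1_pair[OF assms(1,2)] pr2_pair[OF assms(1,2)] by simp_all
qed

lemma pair_eta:
  assumes "h \<in> Hom X z (prd X a b)" "a \<in> Ob X" "b \<in> Ob X"
  shows "pair X (pr1 X a b \<cdot> h) (pr2 X a b \<cdot> h) = h"
  using pair_unique[OF cmpH[OF pr1H[OF assms(2,3)] assms(1)] cmpH[OF pr2H[OF assms(2,3)] assms(1)] assms(1)]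
  by simp

lemma pair_pr: "a \<in> Ob X \<Longrightarrow> b \<in> Ob X \<Longrightarrow> pair X (pr1 X a b) (pr2 X a b) = Ident X (prd X a b)"
  using pair_eta[of "Ident X (prd X a b)" "prd X a b" a b] cmp_idr[OF pr1H] cmp_idr[OF pr2H]
  by (simp add: idH prd_Ob)

lemma regular_epi_stable:
  "regular_epi X e \<Longrightarrow> is_pullback X e g p q \<Longrightarrow> regular_epi X q"
  using regX unfolding regular_category_def by blast

lemma regular_epi_epi:
  assumes "regular_epi X e" "e \<in> Hom X a b" "x \<in> Hom X b c" "y \<in> Hom X b c" "x \<cdot> e = y \<cdot> e"
  shows "x = y"
proof -
  from assms(1) obtain f g where c: "is_coequalizer X f g e" unfolding regular_epi_def by blast
  then have f: "f \<in> Hom X (Dom X f) a" and g: "g \<in> Hom X (Dom X f) a"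
    using assms(2) unfolding is_coequalizer_def Hom_def by auto
  have xe: "x \<cdot> e \<in> Hom X a c" using assms(3,2) by (rule cmpH)
  have "x \<cdot> e \<cdot> f = x \<cdot> e \<cdot> g"
    using c cmp_assoc[OF f assms(2,3)] cmp_assoc[OF g assms(2,3)] unfolding is_coequalizer_def by simp
  then have "\<exists>!k. k \<in> Hom X b c \<and> k \<cdot> e = x \<cdot> e"
    using c xe HomOb(2)[OF xe] assms(2) unfolding is_coequalizer_def Hom_def by auto
  then show ?thesis using assms by metis
qed

text \<open>The image is the coequalizer of the kernel pair of \<open>f\<close>. For monicity of
  \<open>m\<close>, two elements \<open>x\<close>, \<open>y\<close> of the image with
  \<open>m \<cdot> x = m \<cdot> y\<close> are lifted to \<open>a\<close> along pullbacks of
  \<open>e\<close>; the lifts form a pair in the kernel of \<open>f\<close>, so \<open>e\<close>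
  identifies them, and the pulled back regular epis cancel.\<close>

lemma image_factorization:
  assumes f: "f \<in> Hom X a b"
  obtains i e m where "e \<in> Hom X a i" "m \<in> Hom X i b" "m \<cdot> e = f" "regular_epi X e" "mono_arr X m"
proof -
  obtain k r s where r: "r \<in> Hom X k a" and s: "s \<in> Hom X k a" and pb: "is_pullback X f f r s"
    using pullback_ex[OF f f] by metis
  obtain e where co: "is_coequalizer X r s e"
    using pb regX unfolding regular_category_def by blast
  then have e: "e \<in> Hom X a (Cod X e)" using r unfolding is_coequalizer_def Hom_def by auto
  have re: "regular_epi X e" using co unfolding regular_epi_def by blast
  have er: "e \<cdot> r = e \<cdot> s" using co unfolding is_coequalizer_def by blast
  have fr: "f \<cdot> r = f \<cdot> s" using pb unfolding is_pullback_def by blast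
  have "\<forall>z\<in>Ob X. \<forall>h\<in>Hom X (Dom X e) z. h \<cdot> r = h \<cdot> s \<longrightarrow> (\<exists>!k. k \<in> Hom X (Cod X e) z \<and> k \<cdot> e = h)"
    using co unfolding is_coequalizer_def by blast
  then have "\<exists>!k. k \<in> Hom X (Cod X e) b \<and> k \<cdot> e = f"
    using f fr HomOb(2)[OF f] HomD(2)[OF e] by simp
  then obtain m where m: "m \<in> Hom X (Cod X e) b" and me: "m \<cdot> e = f" by blast
  have "mono_arr X m"
  proof (rule mono_arrI[OF m])
    fix z x y
    assume x: "x \<in> Hom X z (Cod X e)" and y: "y \<in> Hom X z (Cod X e)" and eq: "m \<cdot> x = m \<cdot> y"
    obtain w1 p1 q1 where p1: "p1 \<in> Hom X w1 a" and q1: "q1 \<in> Hom X w1 z"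
      and c1: "e \<cdot> p1 = x \<cdot> q1" and pb1: "is_pullback X e x p1 q1"
      using pullback_ex[OF e x] by metis
    have yq: "y \<cdot> q1 \<in> Hom X w1 (Cod X e)" using y q1 by (rule cmpH)
    obtain w2 p2 q2 where p2: "p2 \<in> Hom X w2 a" and q2: "q2 \<in> Hom X w2 w1"
      and c2: "e \<cdot> p2 = y \<cdot> q1 \<cdot> q2" and pb2: "is_pullback X e (y \<cdot> q1) p2 q2"
      using pullback_ex[OF e yq] by metis
    have r1: "regular_epi X q1" and r2: "regular_epi X q2"
      using regular_epi_stable[OF re] pb1 pb2 by blast+
    have p12: "p1 \<cdot> q2 \<in> Hom X w2 a" using p1 q2 by (rule cmpH)
    have q12: "q1 \<cdot> q2 \<in> Hom X w2 z" using q1 q2 by (rule cmpH)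
    have "f \<cdot> (p1 \<cdot> q2) = m \<cdot> (e \<cdot> p1 \<cdot> q2)"
      using cmp_assoc[OF p12 e m] cmp_assoc[OF q2 p1 e] by (simp add: me)
    also have "\<dots> = m \<cdot> x \<cdot> (q1 \<cdot> q2)"
      using cmp_assoc[OF q12 x m] cmp_assoc[OF q2 q1 x] by (simp add: c1)
    also have "\<dots> = m \<cdot> (e \<cdot> p2)"
      using cmp_assoc[OF q12 y m] cmp_assoc[OF q2 q1 y] by (simp add: c2 eq)
    also have "\<dots> = f \<cdot> p2" using cmp_assoc[OF p2 e m] by (simp add: me)
    finally have "f \<cdot> (p1 \<cdot> q2) = f \<cdot> p2" .
    then obtain h where h: "h \<in> Hom X w2 k" "r \<cdot> h = p1 \<cdot> q2" "s \<cdot> h = p2"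
      using pullback_univ[OF pb catX, of "p1 \<cdot> q2" w2 p2] p12 p2 f r by (auto simp: Hom_def)
    have "e \<cdot> (p1 \<cdot> q2) = e \<cdot> p2"
      using cmp_assoc[OF h(1) r e] cmp_assoc[OF h(1) s e] h er by simp
    then have "x \<cdot> q1 \<cdot> q2 = y \<cdot> q1 \<cdot> q2" using cmp_assoc[OF q2 p1 e] c1 c2 by simp
    then have "x \<cdot> q1 = y \<cdot> q1" using regular_epi_epi[OF r2 q2 cmpH[OF x q1] yq] by blast
    then show "x = y" using regular_epi_epi[OF r1 q1 x y] by blast
  qed
  then show ?thesis using that[OF e m me re] by blast
qed

end

section \<open>The internal logic of a fibered frame\<close>

locale fframe = regcat "Base F" for F :: "('p, 'e, 'o, 'm) fibn" +
  assumes fframe: "fibered_frame F"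
begin

abbreviation bcmp (infixl "\<cdot>" 70) where "g \<cdot> f \<equiv> Comp (Base F) g f"
abbreviation X where "X \<equiv> Base F"
abbreviation T where "T \<equiv> Tot F"
abbreviation base where "base \<equiv> Fob (Proj F)"
abbreviation fib where "fib \<equiv> fibre F"
abbreviation ent (infix "\<preceq>" 50) where "\<phi> \<preceq> \<psi> \<equiv> entails F \<phi> \<psi>"
abbreviation rx where "rx \<equiv> reindex F"
abbreviation meet (infixl "\<sqinter>" 65) where "\<phi> \<sqinter> \<psi> \<equiv> Meet F \<phi> \<psi>"

text \<open>\<open>reindex\<close> is an arbitrary choice of cartesian lift, functorial only up to
  isomorphism. Arrows above a given base arrow compose strictly, so the rules for entailment are
  proved for them and read back through \<open>over_iff\<close>.\<close>

definition over :: "'m \<Rightarrow> 'p \<Rightarrow> 'p \<Rightarrow> bool" where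
  "over u \<phi> \<psi> \<longleftrightarrow> (\<exists>f\<in>Hom T \<phi> \<psi>. Far (Proj F) f = u)"

lemma preord: "preorder_fibration F" using fframe by (simp add: fibered_frame_def)

lemma ProjF: "is_functor T X (Proj F)" using preord by (simp add: preorder_fibration_def)

lemma catT: "category T" using ProjF by (simp add: is_functor_def)

lemma fibD: "\<phi> \<in> fib I \<Longrightarrow> \<phi> \<in> Ob T" "\<phi> \<in> fib I \<Longrightarrow> base \<phi> = I"
  by (simp_all add: fibre_def)

lemma fib_Ob: "\<phi> \<in> fib I \<Longrightarrow> I \<in> Ob X"
  using ProjF unfolding fibre_def is_functor_def by auto

lemma Far_Hom: "f \<in> Hom T \<phi> \<psi> \<Longrightarrow> Far (Proj F) f \<in> Hom X (base \<phi>) (base \<psi>)"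
  using ProjF unfolding is_functor_def Hom_def by auto

lemma Far_comp: "f \<in> Hom T \<phi> \<psi> \<Longrightarrow> g \<in> Hom T \<psi> \<chi> \<Longrightarrow>
    Far (Proj F) (g \<cdot>\<^bsub>T\<^esub> f) = Far (Proj F) g \<cdot> Far (Proj F) f"
  using ProjF unfolding is_functor_def Hom_def by auto

lemma over_comp: "over u \<phi> \<psi> \<Longrightarrow> over v \<psi> \<chi> \<Longrightarrow> over (v \<cdot> u) \<phi> \<chi>"
  unfolding over_def using comp_Hom[OF catT] Far_comp by blast

lemma ent_over: "\<phi> \<preceq> \<psi> \<longleftrightarrow> over (Ident X (base \<phi>)) \<phi> \<psi>"
  unfolding entails_def over_def using Hom_Ob[OF catT] by blast

lemma ent_fib: "\<phi> \<preceq> \<psi> \<Longrightarrow> \<phi> \<in> fib I \<longleftrightarrow> \<psi> \<in> fib I"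
proof -
  assume "\<phi> \<preceq> \<psi>"
  then obtain f where f: "f \<in> Hom T \<phi> \<psi>" "Far (Proj F) f = Ident X (base \<phi>)"
    "\<phi> \<in> Ob T" "\<psi> \<in> Ob T" unfolding entails_def by blast
  have "base \<phi> \<in> Ob X" using f(3) ProjF unfolding is_functor_def by blast
  then have "base \<phi> = base \<psi>"
    using Far_Hom[OF f(1)] idH[of "base \<phi>"] f(2) by (simp add: Hom_def)
  then show ?thesis using f by (simp add: fibre_def)
qed

lemma ent_refl: "\<phi> \<in> fib I \<Longrightarrow> \<phi> \<preceq> \<phi>"
  unfolding entails_def fibre_def using Ident_Hom[OF catT, of \<phi>] ProjF unfolding is_functor_def by auto

lemma ent_trans [trans]: "\<phi> \<preceq> \<psi> \<Longrightarrow> \<psi> \<preceq> \<chi> \<Longrightarrow> \<phi> \<preceq> \<chi>"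
proof -
  assume a: "\<phi> \<preceq> \<psi>" "\<psi> \<preceq> \<chi>"
  have p: "\<phi> \<in> fib (base \<phi>)" using a(1) by (simp add: fibre_def entails_def)
  then have q: "base \<psi> = base \<phi>" using ent_fib[OF a(1), of "base \<phi>"] by (simp add: fibre_def)
  have "over (Ident X (base \<phi>) \<cdot> Ident X (base \<phi>)) \<phi> \<chi>"
    using over_comp a q unfolding ent_over by metis
  then show ?thesis unfolding ent_over using cmp_idl[OF idH[OF fib_Ob[OF p]]] by simp
qed

lemma lift_ex:
  assumes "u \<in> Hom X I J" "\<psi> \<in> fib J"
  obtains f where "cartesian_lift F u \<psi> f" "f \<in> Hom T (rx u \<psi>) \<psi>"
proof -
  have "\<exists>f. cartesian_lift F u \<psi> f" using preord assms unfolding preorder_fibration_def Hom_def by auto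
  then have "cartesian_lift F u \<psi> (SOME f. cartesian_lift F u \<psi> f)" by (rule someI_ex)
  then show ?thesis
    by (rule that) (use \<open>cartesian_lift F u \<psi> (SOME f. cartesian_lift F u \<psi> f)\<close> in
        \<open>auto simp: reindex_def cartesian_lift_def cartesian_arr_def Hom_def\<close>)
qed

lemma rx_fib: assumes "u \<in> Hom X I J" "\<psi> \<in> fib J" shows "rx u \<psi> \<in> fib I"
proof -
  obtain f where f: "cartesian_lift F u \<psi> f" "f \<in> Hom T (rx u \<psi>) \<psi>" using lift_ex[OF assms] .
  then have "u \<in> Hom X (base (rx u \<psi>)) (base \<psi>)" using Far_Hom[OF f(2)] unfolding cartesian_lift_def by simp
  then show ?thesis using assms Hom_Ob[OF catT f(2)] by (simp add: fibre_def Hom_def)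
qed

lemma over_rx:
  assumes "u \<in> Hom X I J" "\<psi> \<in> fib J" "w \<in> Hom X K I" "\<chi> \<in> fib K"
  shows "over w \<chi> (rx u \<psi>) \<longleftrightarrow> over (u \<cdot> w) \<chi> \<psi>"
proof -
  obtain f where f: "cartesian_lift F u \<psi> f" "f \<in> Hom T (rx u \<psi>) \<psi>" using lift_ex[OF assms(1,2)] .
  then have Ff: "Far (Proj F) f = u" and cf: "cartesian_arr F f" unfolding cartesian_lift_def by auto
  show ?thesis
  proof
    assume "over w \<chi> (rx u \<psi>)"
    then show "over (u \<cdot> w) \<chi> \<psi>" using over_comp f(2) Ff unfolding over_def by blast
  next
    assume "over (u \<cdot> w) \<chi> \<psi>"
    then obtain g where g: "g \<in> Hom T \<chi> \<psi>" "Far (Proj F) g = u \<cdot> w" unfolding over_def by blast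
    have "w \<in> Hom X (base \<chi>) (base (rx u \<psi>))"
      using assms(3) fibD(2)[OF assms(4)] fibD(2)[OF rx_fib[OF assms(1,2)]] by simp
    then have "\<exists>!h. h \<in> Hom T \<chi> (rx u \<psi>) \<and> Far (Proj F) h = w \<and> f \<cdot>\<^bsub>T\<^esub> h = g"
      using cf[unfolded cartesian_arr_def] g(2) HomD[OF g(1)] HomD[OF f(2)] Ff by metis
    then show "over w \<chi> (rx u \<psi>)" unfolding over_def by blast
  qed
qed

lemma over_iff:
  assumes "u \<in> Hom X I J" "\<phi> \<in> fib I" "\<psi> \<in> fib J"
  shows "over u \<phi> \<psi> \<longleftrightarrow> \<phi> \<preceq> rx u \<psi>"
  using over_rx[OF assms(1,3) idH[OF fib_Ob[OF assms(2)]] assms(2)] cmp_idr[OF assms(1)] fibD(2)[OF assms(2)]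
  unfolding ent_over by simp

lemma ent_rx_rx:
  assumes "u \<in> Hom X I J" "\<psi> \<in> fib J" "w \<in> Hom X K I" "\<chi> \<in> fib K"
  shows "\<chi> \<preceq> rx w (rx u \<psi>) \<longleftrightarrow> \<chi> \<preceq> rx (u \<cdot> w) \<psi>"
  using over_rx[OF assms] over_iff[OF assms(3,4) rx_fib[OF assms(1,2)]]
    over_iff[OF cmpH[OF assms(1,3)] assms(4,2)] by simp

text \<open>Cut with substitution: an arrow above \<open>w\<close> followed by one above
  \<open>x\<close>. It carries a forced statement to another stage.\<close>

lemma rx_cut:
  assumes "\<chi> \<preceq> rx w \<theta>" "\<theta> \<preceq> rx x \<phi>" "w \<in> Hom X W Z" "x \<in> Hom X Z I" "\<phi> \<in> fib I"
  shows "\<chi> \<preceq> rx (x \<cdot> w) \<phi>"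
proof -
  have th: "\<theta> \<in> fib Z" using ent_fib[OF assms(2)] rx_fib[OF assms(4,5)] by simp
  have ch: "\<chi> \<in> fib W" using ent_fib[OF assms(1)] rx_fib[OF assms(3) th] by simp
  have "over w \<chi> \<theta>" using over_iff[OF assms(3) ch th] assms(1) by simp
  moreover have "over x \<theta> \<phi>" using over_iff[OF assms(4) th assms(5)] assms(2) by simp
  ultimately show ?thesis using over_comp over_iff[OF cmpH[OF assms(4,3)] ch assms(5)] by blast
qed

lemma ent_rx_Ident: "\<phi> \<in> fib I \<Longrightarrow> \<theta> \<in> fib I \<Longrightarrow> \<theta> \<preceq> rx (Ident X I) \<phi> \<longleftrightarrow> \<theta> \<preceq> \<phi>"
  using over_iff[OF idH[OF fib_Ob], of \<theta> I \<theta> \<phi>] fibD(2) unfolding ent_over by metis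

lemma rx_mono: "\<phi> \<preceq> \<psi> \<Longrightarrow> \<psi> \<in> fib J \<Longrightarrow> u \<in> Hom X I J \<Longrightarrow> rx u \<phi> \<preceq> rx u \<psi>"
  using rx_cut[of "rx u \<phi>" u \<phi> "Ident X J" \<psi> I J J] ent_refl[OF rx_fib] ent_fib[of \<phi> \<psi> J]
    ent_rx_Ident[of \<psi> J \<phi>] cmp_idl idH HomOb(2) by metis

section \<open>Finite meets and existential quantification\<close>

lemma is_top_Top: "I \<in> Ob X \<Longrightarrow> is_top F I (Top F I)"
  unfolding Top_def by (rule someI_ex) (use fframe in \<open>auto simp: fibered_frame_def\<close>)

lemma Top_fib: "I \<in> Ob X \<Longrightarrow> Top F I \<in> fib I"
  and ent_Top: "\<theta> \<in> fib I \<Longrightarrow> \<theta> \<preceq> Top F I"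
  using is_top_Top fib_Ob unfolding is_top_def by auto

lemma ent_rx_Top: assumes "u \<in> Hom X I J" "\<theta> \<in> fib I" shows "\<theta> \<preceq> rx u (Top F J)"
proof -
  have "is_top F I (rx u (Top F J))"
    using fframe is_top_Top[OF HomOb(2)[OF assms(1)]] HomD[OF assms(1)] unfolding fibered_frame_def by auto
  then show ?thesis using assms unfolding is_top_def by simp
qed

lemma is_meet_Meet: assumes "\<phi> \<in> fib I" "\<psi> \<in> fib I" shows "is_meet F \<phi> \<psi> (\<phi> \<sqinter> \<psi>)"
  unfolding Meet_def
  by (rule someI_ex) (use fframe assms fib_Ob[OF assms(1)] in \<open>auto simp: fibered_frame_def\<close>)

lemma is_meet_iff: "is_meet F \<phi> \<psi> \<chi> \<Longrightarrow> \<theta> \<preceq> \<chi> \<longleftrightarrow> \<theta> \<preceq> \<phi> \<and> \<theta> \<preceq> \<psi>"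
  unfolding is_meet_def using ent_trans by blast

lemma ent_Meet: "\<phi> \<in> fib I \<Longrightarrow> \<psi> \<in> fib I \<Longrightarrow> \<theta> \<preceq> \<phi> \<sqinter> \<psi> \<longleftrightarrow> \<theta> \<preceq> \<phi> \<and> \<theta> \<preceq> \<psi>"
  using is_meet_iff[OF is_meet_Meet] .

lemma Meet_fib: "\<phi> \<in> fib I \<Longrightarrow> \<psi> \<in> fib I \<Longrightarrow> \<phi> \<sqinter> \<psi> \<in> fib I"
  using is_meet_Meet ent_fib unfolding is_meet_def by blast

lemma ent_rx_Meet:
  assumes "\<phi> \<in> fib J" "\<psi> \<in> fib J" "u \<in> Hom X I J"
  shows "\<theta> \<preceq> rx u (\<phi> \<sqinter> \<psi>) \<longleftrightarrow> \<theta> \<preceq> rx u \<phi> \<and> \<theta> \<preceq> rx u \<psi>"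
proof -
  have "is_meet F (rx u \<phi>) (rx u \<psi>) (rx u (\<phi> \<sqinter> \<psi>))"
    using fframe is_meet_Meet[OF assms(1,2)] HomD[OF assms(3)] assms unfolding fibered_frame_def by auto
  then show ?thesis by (rule is_meet_iff)
qed

lemma is_exists_Exists: assumes "u \<in> Hom X I J" "\<phi> \<in> fib I" shows "is_exists F u \<phi> (Exists F u \<phi>)"
  unfolding Exists_def
  by (rule someI_ex) (use fframe assms HomD[OF assms(1)] in \<open>auto simp: fibered_frame_def\<close>)

lemma Exists_fib: "u \<in> Hom X I J \<Longrightarrow> \<phi> \<in> fib I \<Longrightarrow> Exists F u \<phi> \<in> fib J"
  using is_exists_Exists unfolding is_exists_def Hom_def by fastforce

lemma Exists_ent: "u \<in> Hom X I J \<Longrightarrow> \<phi> \<in> fib I \<Longrightarrow> \<chi> \<in> fib J \<Longrightarrow> Exists F u \<phi> \<preceq> \<chi> \<longleftrightarrow> \<phi> \<preceq> rx u \<chi>"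
  using is_exists_Exists unfolding is_exists_def Hom_def by fastforce

lemma Exists_unit: "u \<in> Hom X I J \<Longrightarrow> \<phi> \<in> fib I \<Longrightarrow> \<phi> \<preceq> rx u (Exists F u \<phi>)"
  using Exists_ent Exists_fib ent_refl by blast

lemma Exists_mono: "u \<in> Hom X I J \<Longrightarrow> \<psi> \<in> fib I \<Longrightarrow> \<phi> \<preceq> \<psi> \<Longrightarrow> Exists F u \<phi> \<preceq> Exists F u \<psi>"
  using Exists_ent[of u I J \<phi> "Exists F u \<psi>"] Exists_fib Exists_unit ent_fib ent_trans by blast

lemma Exists_intro:
  assumes "\<theta> \<preceq> rx y \<phi>" "y \<in> Hom X Z I" "u \<in> Hom X I J" "\<phi> \<in> fib I"
  shows "\<theta> \<preceq> rx (u \<cdot> y) (Exists F u \<phi>)"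
  by (rule rx_cut[OF assms(1) Exists_unit[OF assms(3,4)] assms(2,3) Exists_fib[OF assms(3,4)]])

lemma Frobenius:
  assumes "u \<in> Hom X I J" "\<phi> \<in> fib J" "\<psi> \<in> fib I"
  shows "\<phi> \<sqinter> Exists F u \<psi> \<preceq> Exists F u (rx u \<phi> \<sqinter> \<psi>)"
  using fframe assms HomD[OF assms(1)] unfolding fibered_frame_def eqv_def by auto

lemma Beck_Chevalley:
  assumes "is_pullback X u v p q" "u \<in> Hom X I J" "\<phi> \<in> fib I"
  shows "rx v (Exists F u \<phi>) \<preceq> Exists F q (rx p \<phi>)"
proof -
  have "rx v (Exists F u \<phi>) \<cong>\<^bsub>F\<^esub> Exists F q (rx p \<phi>)"
    using fframe assms HomD[OF assms(2)] unfolding fibered_frame_def by blast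
  then show ?thesis by (simp add: eqv_def)
qed

lemma pre_stack:
  assumes "regular_epi X e" "e \<in> Hom X I J" "\<phi> \<in> fib J" "\<psi> \<in> fib J" "rx e \<phi> \<preceq> rx e \<psi>"
  shows "\<phi> \<preceq> \<psi>"
proof -
  have "\<forall>e. regular_epi X e \<longrightarrow>
        (\<forall>\<phi>\<in>fib (Cod X e). \<forall>\<psi>\<in>fib (Cod X e). rx e \<phi> \<preceq> rx e \<psi> \<longrightarrow> \<phi> \<preceq> \<psi>)"
    using fframe unfolding fibered_frame_def by blast
  then show ?thesis using assms HomD[OF assms(2)] by blast
qed

text \<open>The Kripke-Joyal clause for existence. The witness lives on the pullback of
  \<open>u\<close> along \<open>a\<close>: Beck-Chevalley moves the quantifier to the projection
  \<open>w\<close>, and Frobenius allows \<open>\<chi>\<close> to be cut down to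
  \<open>rx w \<theta> \<sqinter> rx y \<phi>\<close>, so that it also lies over
  \<open>\<theta>\<close>. A pair \<open>w\<close>, \<open>\<chi>\<close> with
  \<open>\<chi> \<preceq> rx w \<theta>\<close> and
  \<open>\<theta> \<preceq> Exists F w \<chi>\<close> plays the part of a cover of the stage
  \<open>\<theta>\<close>.\<close>

lemma Exists_elim:
  assumes "\<theta> \<preceq> rx a (Exists F u \<phi>)" "a \<in> Hom X Z J" "u \<in> Hom X I J" "\<phi> \<in> fib I"
  obtains W w y \<chi> where "w \<in> Hom X W Z" "y \<in> Hom X W I" "u \<cdot> y = a \<cdot> w" "\<chi> \<preceq> rx w \<theta>"
    "\<chi> \<preceq> rx y \<phi>" "\<theta> \<preceq> Exists F w \<chi>"
proof -
  obtain W y w where y: "y \<in> Hom X W I" and w: "w \<in> Hom X W Z" and e: "u \<cdot> y = a \<cdot> w"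
    and pb: "is_pullback X u a y w" using pullback_ex[OF assms(3,2)] by metis
  have th: "\<theta> \<in> fib Z" using ent_fib[OF assms(1)] rx_fib[OF assms(2) Exists_fib[OF assms(3,4)]] by simp
  note y\<phi> = rx_fib[OF y assms(4)]
  note w\<theta> = rx_fib[OF w th]
  have m: "rx w \<theta> \<sqinter> rx y \<phi> \<in> fib W" using Meet_fib[OF w\<theta> y\<phi>] .
  have "\<theta> \<preceq> Exists F w (rx y \<phi>)" using Beck_Chevalley[OF pb assms(3,4)] assms(1) ent_trans by blast
  then have "\<theta> \<preceq> \<theta> \<sqinter> Exists F w (rx y \<phi>)"
    using ent_Meet[OF th Exists_fib[OF w y\<phi>]] ent_refl[OF th] by blast
  then have "\<theta> \<preceq> Exists F w (rx w \<theta> \<sqinter> rx y \<phi>)" using Frobenius[OF w th y\<phi>] ent_trans by blast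
  moreover have "rx w \<theta> \<sqinter> rx y \<phi> \<preceq> rx w \<theta>" "rx w \<theta> \<sqinter> rx y \<phi> \<preceq> rx y \<phi>"
    using ent_Meet[OF w\<theta> y\<phi>] ent_refl[OF m] by auto
  ultimately show ?thesis using that[OF w y e] by blast
qed

section \<open>Covers of a stage: locality, stability, transitivity\<close>

lemma cover_local:
  assumes "\<theta> \<preceq> Exists F w \<chi>" "\<chi> \<preceq> rx w \<phi>" "w \<in> Hom X W Z" "\<phi> \<in> fib Z"
  shows "\<theta> \<preceq> \<phi>"
proof -
  have "\<chi> \<in> fib W" using ent_fib[OF assms(2)] rx_fib[OF assms(3,4)] by simp
  then show ?thesis using Exists_ent[OF assms(3) _ assms(4)] assms ent_trans by blast
qed

text \<open>The cover inequality is itself an existential statement forced by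
  \<open>\<theta>\<close>, hence by \<open>\<theta>'\<close> along \<open>v\<close>; eliminating
  that quantifier yields the pulled back cover.\<close>

lemma cover_pullback:
  assumes "\<theta> \<preceq> Exists F w \<chi>" "w \<in> Hom X W Z" "\<chi> \<in> fib W" "\<theta>' \<preceq> rx v \<theta>" "v \<in> Hom X V Z"
  obtains U w' v' \<chi>' where "w' \<in> Hom X U V" "v' \<in> Hom X U W" "w \<cdot> v' = v \<cdot> w'"
    "\<chi>' \<preceq> rx w' \<theta>'" "\<chi>' \<preceq> rx v' \<chi>" "\<theta>' \<preceq> Exists F w' \<chi>'"
proof -
  have "\<theta> \<preceq> rx (Ident X Z) (Exists F w \<chi>)"
    using assms(1) ent_rx_Ident Exists_fib[OF assms(2,3)] ent_fib by blast
  then have "\<theta>' \<preceq> rx (Ident X Z \<cdot> v) (Exists F w \<chi>)"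
    using rx_cut[OF assms(4) _ assms(5) idH[OF HomOb(2)[OF assms(5)]] Exists_fib[OF assms(2,3)]] by blast
  then have "\<theta>' \<preceq> rx v (Exists F w \<chi>)" using cmp_idl[OF assms(5)] by simp
  from Exists_elim[OF this assms(5,2,3)] that show ?thesis by metis
qed

lemma cover_trans:
  assumes "\<theta> \<preceq> Exists F w \<chi>" "w \<in> Hom X W Z" "\<chi> \<preceq> Exists F v \<xi>" "v \<in> Hom X V W" "\<xi> \<in> fib V"
  shows "\<theta> \<preceq> Exists F (w \<cdot> v) \<xi>"
proof -
  note wv = cmpH[OF assms(2,4)]
  note e = Exists_fib[OF wv assms(5)]
  have ch: "\<chi> \<in> fib W" using ent_fib[OF assms(3)] Exists_fib[OF assms(4,5)] by simp
  have "\<xi> \<preceq> rx v (rx w (Exists F (w \<cdot> v) \<xi>))"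
    using ent_rx_rx[OF assms(2) e assms(4,5)] Exists_unit[OF wv assms(5)] by simp
  then have "\<chi> \<preceq> rx w (Exists F (w \<cdot> v) \<xi>)"
    using cover_local[OF assms(3) _ assms(4) rx_fib[OF assms(2) e]] by blast
  then show ?thesis using cover_local[OF assms(1) _ assms(2) e] by blast
qed

lemma cover_refl: "\<theta> \<in> fib Z \<Longrightarrow> \<theta> \<preceq> Exists F (Ident X Z) \<theta>"
  using Exists_unit[OF idH[OF fib_Ob], of \<theta> Z \<theta>] ent_rx_Ident Exists_fib[OF idH[OF fib_Ob]] by metis

end

section \<open>Relations as sets of forced pairs of generalized elements\<close>

context fframe
begin

text \<open>A relation between \<open>C\<close> and \<open>D\<close> is represented by all \<open>(\<theta>, a, b)\<close> with \<open>\<theta>\<close> in the fibre over the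
  common domain of \<open>a\<close> and \<open>b\<close> such that \<open>\<theta>\<close> forces \<open>a\<close> and \<open>b\<close> to be related. Equivalent predicates
  then become equal, entailment becomes inclusion and composition becomes total and associative.\<close>

definition ext :: "'o \<Rightarrow> 'o \<Rightarrow> 'p \<Rightarrow> ('p \<times> 'm \<times> 'm) set" where
  "ext C D \<phi> = {(\<theta>, a, b). \<theta> \<in> Ob T \<and> a \<in> Hom X (base \<theta>) C \<and> b \<in> Hom X (base \<theta>) D \<and>
     \<theta> \<preceq> rx (pair X a b) \<phi>}"

text \<open>Codomains stay open, so relations of all types form one universe and composition needs
  no type arguments.\<close>

definition spn :: "'p \<Rightarrow> 'm \<Rightarrow> 'm \<Rightarrow> bool" where
  "spn \<theta> a b \<longleftrightarrow> \<theta> \<in> Ob T \<and> a \<in> Arr X \<and> b \<in> Arr X \<and> Dom X a = base \<theta> \<and> Dom X b = base \<theta>"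

text \<open>The last two clauses are stability under change of stage and locality for covers, the
  sheaf conditions that extensions of predicates satisfy. Associativity of composition, whose
  witnesses exist only on a cover, rests on them.\<close>

definition Cl :: "('p \<times> 'm \<times> 'm) set \<Rightarrow> bool" where
  "Cl P \<longleftrightarrow> (\<forall>\<theta> a b. (\<theta>, a, b) \<in> P \<longrightarrow> spn \<theta> a b) \<and>
    (\<forall>\<theta> a b \<chi> w W. (\<theta>, a, b) \<in> P \<longrightarrow> w \<in> Hom X W (base \<theta>) \<longrightarrow> \<chi> \<preceq> rx w \<theta> \<longrightarrow> (\<chi>, a \<cdot> w, b \<cdot> w) \<in> P) \<and>
    (\<forall>\<theta> a b \<chi> w W. spn \<theta> a b \<longrightarrow> w \<in> Hom X W (base \<theta>) \<longrightarrow> \<chi> \<preceq> rx w \<theta> \<longrightarrow> \<theta> \<preceq> Exists F w \<chi> \<longrightarrow>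
       (\<chi>, a \<cdot> w, b \<cdot> w) \<in> P \<longrightarrow> (\<theta>, a, b) \<in> P)"

text \<open>Diagrammatic order, against the applicative order of \<open>\<cdot>\<close>: first
  \<open>P\<close>, then \<open>Q\<close>. The middle element is asked for on a cover of the stage
  only, like any witness of an existential statement.\<close>

definition comp :: "('p \<times> 'm \<times> 'm) set \<Rightarrow> ('p \<times> 'm \<times> 'm) set \<Rightarrow> ('p \<times> 'm \<times> 'm) set"
    (infixr "\<odot>" 75) where
  "P \<odot> Q = {(\<theta>, a, c). spn \<theta> a c \<and> (\<exists>W w \<chi> b. w \<in> Hom X W (base \<theta>) \<and> \<chi> \<preceq> rx w \<theta> \<and> \<theta> \<preceq> Exists F w \<chi> \<and>
     (\<chi>, a \<cdot> w, b) \<in> P \<and> (\<chi>, b, c \<cdot> w) \<in> Q)}"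

definition cv :: "('p \<times> 'm \<times> 'm) set \<Rightarrow> ('p \<times> 'm \<times> 'm) set" where
  "cv P = {(\<theta>, a, b). (\<theta>, b, a) \<in> P}"

lemma Cl_spn: "Cl P \<Longrightarrow> (\<theta>, a, b) \<in> P \<Longrightarrow> spn \<theta> a b"
  and Cl_restrict: "Cl P \<Longrightarrow> (\<theta>, a, b) \<in> P \<Longrightarrow> w \<in> Hom X W (base \<theta>) \<Longrightarrow> \<chi> \<preceq> rx w \<theta> \<Longrightarrow>
    (\<chi>, a \<cdot> w, b \<cdot> w) \<in> P"
  and Cl_local: "Cl P \<Longrightarrow> spn \<theta> a b \<Longrightarrow> w \<in> Hom X W (base \<theta>) \<Longrightarrow> \<chi> \<preceq> rx w \<theta> \<Longrightarrow> \<theta> \<preceq> Exists F w \<chi> \<Longrightarrow>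
    (\<chi>, a \<cdot> w, b \<cdot> w) \<in> P \<Longrightarrow> (\<theta>, a, b) \<in> P"
  unfolding Cl_def by blast+

lemma fib_base: "\<theta> \<in> Ob T \<Longrightarrow> \<theta> \<in> fib (base \<theta>)" by (simp add: fibre_def)

lemma ent_Ob: "\<phi> \<preceq> \<psi> \<Longrightarrow> \<phi> \<in> Ob T" "\<phi> \<preceq> \<psi> \<Longrightarrow> \<psi> \<in> Ob T" by (simp_all add: entails_def)

lemma ent_rx_base: "\<chi> \<preceq> rx w \<theta> \<Longrightarrow> w \<in> Hom X W Z \<Longrightarrow> \<theta> \<in> fib Z \<Longrightarrow> base \<chi> = W"
  using ent_fib[of \<chi> "rx w \<theta>" W] rx_fib fibD by blast

lemma spnD: "spn \<theta> a b \<Longrightarrow> a \<in> Hom X (base \<theta>) (Cod X a)" "spn \<theta> a b \<Longrightarrow> b \<in> Hom X (base \<theta>) (Cod X b)"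
  "spn \<theta> a b \<Longrightarrow> \<theta> \<in> fib (base \<theta>)"
  by (auto simp: spn_def Hom_def fibre_def)

lemma spnI: "\<theta> \<in> fib Z \<Longrightarrow> a \<in> Hom X Z C \<Longrightarrow> b \<in> Hom X Z D \<Longrightarrow> spn \<theta> a b"
  by (auto simp: spn_def Hom_def fibre_def)

lemma extI: "\<theta> \<preceq> rx (pair X a b) \<phi> \<Longrightarrow> a \<in> Hom X Z C \<Longrightarrow> b \<in> Hom X Z D \<Longrightarrow> \<phi> \<in> fib (prd X C D) \<Longrightarrow>
    (\<theta>, a, b) \<in> ext C D \<phi>"
  using ent_rx_base[OF _ pairH, of \<theta> a b \<phi> Z C D] ent_Ob(1) unfolding ext_def by auto

lemma ext_iff:
  assumes "\<theta> \<in> fib Z" "a \<in> Hom X Z C" "b \<in> Hom X Z D"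
  shows "(\<theta>, a, b) \<in> ext C D \<phi> \<longleftrightarrow> \<theta> \<preceq> rx (pair X a b) \<phi>"
  using assms unfolding ext_def by (auto simp: fibre_def)

lemma extD:
  assumes "(\<theta>, a, b) \<in> ext C D \<phi>"
  shows "\<theta> \<in> fib (base \<theta>)" "a \<in> Hom X (base \<theta>) C" "b \<in> Hom X (base \<theta>) D"
    "\<theta> \<preceq> rx (pair X a b) \<phi>"
  using assms unfolding ext_def by (auto simp: fibre_def)

lemma ext_Cl: assumes "\<phi> \<in> fib (prd X C D)" shows "Cl (ext C D \<phi>)"
  unfolding Cl_def
proof (intro conjI allI impI)
  fix \<theta> a b assume "(\<theta>, a, b) \<in> ext C D \<phi>"
  then show "spn \<theta> a b" using extD spnI by metis
next
  fix \<theta> a b \<chi> w W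
  assume e: "(\<theta>, a, b) \<in> ext C D \<phi>" and w: "w \<in> Hom X W (base \<theta>)" and c: "\<chi> \<preceq> rx w \<theta>"
  note d = extD[OF e]
  have "\<chi> \<preceq> rx (pair X a b \<cdot> w) \<phi>" using rx_cut[OF c d(4) w pairH[OF d(2,3)] assms] .
  then show "(\<chi>, a \<cdot> w, b \<cdot> w) \<in> ext C D \<phi>"
    using extI[OF _ cmpH[OF d(2) w] cmpH[OF d(3) w] assms] pair_comp[OF d(2,3) w] by simp
next
  fix \<theta> a b \<chi> w W
  assume s: "spn \<theta> a b" and w: "w \<in> Hom X W (base \<theta>)" and c: "\<chi> \<preceq> rx w \<theta>" "\<theta> \<preceq> Exists F w \<chi>"
    and e: "(\<chi>, a \<cdot> w, b \<cdot> w) \<in> ext C D \<phi>"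
  have a: "a \<in> Hom X (base \<theta>) C" and b: "b \<in> Hom X (base \<theta>) D"
    using extD(2,3)[OF e] spnD(1,2)[OF s] cmpH[OF spnD(1)[OF s] w] cmpH[OF spnD(2)[OF s] w] by (auto simp: Hom_def)
  note p = pairH[OF a b]
  have ch: "\<chi> \<in> fib W" using ent_fib[OF c(1)] rx_fib[OF w spnD(3)[OF s]] by simp
  have "\<chi> \<preceq> rx w (rx (pair X a b) \<phi>)"
    using ent_rx_rx[OF p assms w ch] pair_comp[OF a b w] extD(4)[OF e] by simp
  then show "(\<theta>, a, b) \<in> ext C D \<phi>"
    using cover_local[OF c(2) _ w rx_fib[OF p assms]] extI[OF _ a b assms] by blast
qed

lemma comp_intro: assumes "(\<theta>, a, b) \<in> P" "(\<theta>, b, c) \<in> Q" "Cl P" "Cl Q" shows "(\<theta>, a, c) \<in> P \<odot> Q"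
proof -
  note s = Cl_spn[OF assms(3,1)] and s' = Cl_spn[OF assms(4,2)]
  have sp: "spn \<theta> a c" using s s' unfolding spn_def by blast
  let ?i = "Ident X (base \<theta>)"
  have i: "?i \<in> Hom X (base \<theta>) (base \<theta>)" using idH[OF fib_Ob[OF spnD(3)[OF s]]] .
  have th: "\<theta> \<preceq> rx ?i \<theta>" using ent_rx_Ident spnD(3)[OF s] ent_refl by blast
  have "\<theta> \<preceq> Exists F ?i \<theta>" using cover_refl spnD(3)[OF s] by blast
  moreover have "a \<cdot> ?i = a" "c \<cdot> ?i = c" using cmp_idr spnD sp by blast+
  ultimately show ?thesis unfolding comp_def using sp i th assms(1,2) by force
qed

lemma comp_elim:
  assumes "(\<theta>, a, c) \<in> P \<odot> Q"
  obtains W w \<chi> b where "spn \<theta> a c" "w \<in> Hom X W (base \<theta>)" "\<chi> \<in> fib W" "\<chi> \<preceq> rx w \<theta>" "\<theta> \<preceq> Exists F w \<chi>"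
    "(\<chi>, a \<cdot> w, b) \<in> P" "(\<chi>, b, c \<cdot> w) \<in> Q"
proof -
  from assms obtain W w \<chi> b where x: "spn \<theta> a c" "w \<in> Hom X W (base \<theta>)" "\<chi> \<preceq> rx w \<theta>" "\<theta> \<preceq> Exists F w \<chi>"
    "(\<chi>, a \<cdot> w, b) \<in> P" "(\<chi>, b, c \<cdot> w) \<in> Q" unfolding comp_def by blast
  have "\<chi> \<in> fib W" using ent_fib[OF x(3)] rx_fib[OF x(2) spnD(3)[OF x(1)]] by simp
  then show ?thesis using that x by blast
qed

text \<open>Locality of \<open>R\<close> lets the witness be assumed at the stage itself, so covers
  disappear from proofs of upper bounds.\<close>

lemma comp_least:
  assumes "Cl R" "\<And>\<theta> a b c. (\<theta>, a, b) \<in> P \<Longrightarrow> (\<theta>, b, c) \<in> Q \<Longrightarrow> (\<theta>, a, c) \<in> R"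
  shows "P \<odot> Q \<subseteq> R"
proof clarify
  fix \<theta> a c assume "(\<theta>, a, c) \<in> P \<odot> Q"
  then show "(\<theta>, a, c) \<in> R" by (rule comp_elim) (rule Cl_local[OF assms(1)], auto intro: assms(2))
qed

lemma comp_mono: "P \<subseteq> P' \<Longrightarrow> Q \<subseteq> Q' \<Longrightarrow> P \<odot> Q \<subseteq> P' \<odot> Q'"
  unfolding comp_def by blast

lemma spn_restrict: "spn \<theta> a b \<Longrightarrow> w \<in> Hom X W (base \<theta>) \<Longrightarrow> \<chi> \<in> fib W \<Longrightarrow> spn \<chi> (a \<cdot> w) (b \<cdot> w)"
  using spnI cmpH spnD by metis

text \<open>Stability pulls the cover carrying the witness back along the change of stage; locality
  composes two covers.\<close>

lemma comp_Cl: assumes "Cl P" "Cl Q" shows "Cl (P \<odot> Q)"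
  unfolding Cl_def
proof (intro conjI allI impI)
  fix \<theta> a c assume "(\<theta>, a, c) \<in> P \<odot> Q"
  then show "spn \<theta> a c" by (rule comp_elim)
next
  fix \<theta> a c \<theta>' v V
  assume e: "(\<theta>, a, c) \<in> P \<odot> Q" and v: "v \<in> Hom X V (base \<theta>)" and th': "\<theta>' \<preceq> rx v \<theta>"
  from e obtain W w \<chi> b where s: "spn \<theta> a c" and w: "w \<in> Hom X W (base \<theta>)" and ch: "\<chi> \<in> fib W"
    and c: "\<theta> \<preceq> Exists F w \<chi>" and P: "(\<chi>, a \<cdot> w, b) \<in> P" and Q: "(\<chi>, b, c \<cdot> w) \<in> Q" by (rule comp_elim)
  have t': "\<theta>' \<in> fib V" using ent_fib[OF th'] rx_fib[OF v spnD(3)[OF s]] by simp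
  obtain U w' v' \<chi>' where w': "w' \<in> Hom X U V" and v': "v' \<in> Hom X U W" and eq: "w \<cdot> v' = v \<cdot> w'"
    and x: "\<chi>' \<preceq> rx w' \<theta>'" "\<chi>' \<preceq> rx v' \<chi>" "\<theta>' \<preceq> Exists F w' \<chi>'" using cover_pullback[OF c w ch th' v] .
  have bc: "base \<chi> = W" using fibD ch by blast
  have "(\<chi>', a \<cdot> w \<cdot> v', b \<cdot> v') \<in> P" "(\<chi>', b \<cdot> v', c \<cdot> w \<cdot> v') \<in> Q"
    using Cl_restrict[OF assms(1) P _ x(2)] Cl_restrict[OF assms(2) Q _ x(2)] v' bc by auto
  moreover have "a \<cdot> w \<cdot> v' = a \<cdot> v \<cdot> w'" "c \<cdot> w \<cdot> v' = c \<cdot> v \<cdot> w'"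
    using cmp_assoc[OF v' w] cmp_assoc[OF w' v] eq spnD[OF s] by metis+
  ultimately have "(\<chi>', a \<cdot> v \<cdot> w', b \<cdot> v') \<in> P" "(\<chi>', b \<cdot> v', c \<cdot> v \<cdot> w') \<in> Q" by auto
  moreover have "base \<theta>' = V" using fibD t' by blast
  ultimately show "(\<theta>', a \<cdot> v, c \<cdot> v) \<in> P \<odot> Q"
    using spn_restrict[OF s v t'] w' x unfolding comp_def by blast
next
  fix \<theta> a c \<chi> w W
  assume s: "spn \<theta> a c" and w: "w \<in> Hom X W (base \<theta>)" and c: "\<chi> \<preceq> rx w \<theta>" "\<theta> \<preceq> Exists F w \<chi>"
    and e: "(\<chi>, a \<cdot> w, c \<cdot> w) \<in> P \<odot> Q"
  have ch: "\<chi> \<in> fib W" using ent_fib[OF c(1)] rx_fib[OF w spnD(3)[OF s]] by simp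
  then have bc: "base \<chi> = W" using fibD by blast
  from e obtain V v \<xi> b where v: "v \<in> Hom X V W" and xi: "\<xi> \<in> fib V"
    and d: "\<xi> \<preceq> rx v \<chi>" "\<chi> \<preceq> Exists F v \<xi>" and P: "(\<xi>, a \<cdot> w \<cdot> v, b) \<in> P" and Q: "(\<xi>, b, c \<cdot> w \<cdot> v) \<in> Q"
    by (rule comp_elim) (use bc in blast)
  have "\<theta> \<preceq> Exists F (w \<cdot> v) \<xi>" using cover_trans[OF c(2) w d(2) v xi] .
  moreover have "\<xi> \<preceq> rx (w \<cdot> v) \<theta>" using rx_cut[OF d(1) c(1) v w spnD(3)[OF s]] .
  moreover have "a \<cdot> w \<cdot> v = a \<cdot> (w \<cdot> v)" "c \<cdot> w \<cdot> v = c \<cdot> (w \<cdot> v)"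
    using cmp_assoc[OF v w] spnD[OF s] by metis+
  ultimately show "(\<theta>, a, c) \<in> P \<odot> Q"
    using s cmpH[OF w v] P Q unfolding comp_def by auto
qed

lemma cv_cv [simp]: "cv (cv P) = P" by (auto simp: cv_def)
lemma cv_iff [simp]: "(\<theta>, a, b) \<in> cv P \<longleftrightarrow> (\<theta>, b, a) \<in> P" by (auto simp: cv_def)
lemma cv_mono: "P \<subseteq> Q \<Longrightarrow> cv P \<subseteq> cv Q" by (auto simp: cv_def)
lemma cv_Int [simp]: "cv (P \<inter> Q) = cv P \<inter> cv Q" by (auto simp: cv_def)
lemma cv_comp: "cv (P \<odot> Q) = cv Q \<odot> cv P" by (auto simp: cv_def comp_def spn_def)
lemma spn_sym: "spn \<theta> a b \<Longrightarrow> spn \<theta> b a" by (auto simp: spn_def)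
lemma cv_Cl: assumes "Cl P" shows "Cl (cv P)"
  unfolding Cl_def cv_iff
proof (intro conjI allI impI)
  show "spn \<theta> a b" if "(\<theta>, b, a) \<in> P" for \<theta> a b using that Cl_spn[OF assms] spn_sym by blast
  show "(\<chi>, b \<cdot> w, a \<cdot> w) \<in> P"
    if "(\<theta>, b, a) \<in> P" "w \<in> Hom X W (base \<theta>)" "\<chi> \<preceq> rx w \<theta>" for \<theta> a b \<chi> w W
    using that Cl_restrict[OF assms] by blast
  show "(\<theta>, b, a) \<in> P"
    if "spn \<theta> a b" "w \<in> Hom X W (base \<theta>)" "\<chi> \<preceq> rx w \<theta>" "\<theta> \<preceq> Exists F w \<chi>" "(\<chi>, b \<cdot> w, a \<cdot> w) \<in> P"
    for \<theta> a b \<chi> w W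
    using that Cl_local[OF assms] spn_sym by blast
qed
lemma comp_assoc_le: assumes "Cl P" "Cl Q" "Cl R" shows "(P \<odot> Q) \<odot> R \<subseteq> P \<odot> (Q \<odot> R)"
proof clarify
  fix \<theta> a d assume "(\<theta>, a, d) \<in> (P \<odot> Q) \<odot> R"
  then obtain W w \<chi> c where s: "spn \<theta> a d" and w: "w \<in> Hom X W (base \<theta>)" and ch: "\<chi> \<in> fib W"
    and c: "\<chi> \<preceq> rx w \<theta>" "\<theta> \<preceq> Exists F w \<chi>" and PQ: "(\<chi>, a \<cdot> w, c) \<in> P \<odot> Q" and R: "(\<chi>, c, d \<cdot> w) \<in> R"
    by (rule comp_elim)
  note cl = comp_Cl[OF assms(1) comp_Cl[OF assms(2,3)]]
  from PQ obtain V v \<xi> b where s2: "spn \<chi> (a \<cdot> w) c" and v: "v \<in> Hom X V (base \<chi>)"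
    and e: "\<xi> \<preceq> rx v \<chi>" "\<chi> \<preceq> Exists F v \<xi>" and P: "(\<xi>, a \<cdot> w \<cdot> v, b) \<in> P" and Q: "(\<xi>, b, c \<cdot> v) \<in> Q"
    by (rule comp_elim)
  have "(\<xi>, c \<cdot> v, d \<cdot> w \<cdot> v) \<in> R" using Cl_restrict[OF assms(3) R v e(1)] .
  then have "(\<xi>, a \<cdot> w \<cdot> v, d \<cdot> w \<cdot> v) \<in> P \<odot> Q \<odot> R" using P Q assms by (meson comp_intro comp_Cl)
  then have "(\<chi>, a \<cdot> w, d \<cdot> w) \<in> P \<odot> Q \<odot> R"
    using Cl_local[OF cl spn_restrict[OF s w ch] v e] by blast
  then show "(\<theta>, a, d) \<in> P \<odot> Q \<odot> R" using Cl_local[OF cl s w c] by blast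
qed

lemma comp_assoc: assumes "Cl P" "Cl Q" "Cl R" shows "(P \<odot> Q) \<odot> R = P \<odot> (Q \<odot> R)"
proof
  show "(P \<odot> Q) \<odot> R \<subseteq> P \<odot> (Q \<odot> R)" using comp_assoc_le[OF assms] .
  \<comment> \<open>Converse reverses the order of composition, so the inclusion already proved,
    applied to the converses, is the missing one.\<close>
  have "(cv R \<odot> cv Q) \<odot> cv P \<subseteq> cv R \<odot> (cv Q \<odot> cv P)" using comp_assoc_le assms cv_Cl by blast
  then have "cv (P \<odot> (Q \<odot> R)) \<subseteq> cv ((P \<odot> Q) \<odot> R)" by (simp add: cv_comp)
  then show "P \<odot> (Q \<odot> R) \<subseteq> (P \<odot> Q) \<odot> R" using cv_mono cv_cv by metis
qed

text \<open>The only consequence of the modular law that the algebra below needs.\<close>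

lemma comp_cv_le: assumes "Cl P" shows "P \<subseteq> P \<odot> cv P \<odot> P"
proof clarify
  fix \<theta> a b assume "(\<theta>, a, b) \<in> P"
  moreover have "Cl (cv P)" using assms cv_Cl by blast
  ultimately show "(\<theta>, a, b) \<in> P \<odot> cv P \<odot> P" using assms
    by (meson comp_intro comp_Cl cv_iff)
qed

section \<open>From predicates to their sets of forced pairs\<close>

lemma ent_forcing:
  assumes "\<phi> \<in> fib K" "\<psi> \<in> fib K"
  shows "\<phi> \<preceq> \<psi> \<longleftrightarrow> (\<forall>Z y \<theta>. y \<in> Hom X Z K \<longrightarrow> \<theta> \<in> fib Z \<longrightarrow> \<theta> \<preceq> rx y \<phi> \<longrightarrow> \<theta> \<preceq> rx y \<psi>)"
proof (intro iffI allI impI)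
  fix Z y \<theta> assume "\<phi> \<preceq> \<psi>" "y \<in> Hom X Z K" "\<theta> \<preceq> rx y \<phi>"
  then show "\<theta> \<preceq> rx y \<psi>" using rx_mono assms ent_trans by blast
next
  assume "\<forall>Z y \<theta>. y \<in> Hom X Z K \<longrightarrow> \<theta> \<in> fib Z \<longrightarrow> \<theta> \<preceq> rx y \<phi> \<longrightarrow> \<theta> \<preceq> rx y \<psi>"
  \<comment> \<open>Yoneda: \<open>\<phi>\<close> is forced at the identity by the stage
    \<open>\<phi>\<close> itself.\<close>
  then show "\<phi> \<preceq> \<psi>" using idH[OF fib_Ob[OF assms(1)]] ent_rx_Ident assms ent_refl by metis
qed

lemma pair_surj:
  assumes "y \<in> Hom X Z (prd X C D)" "C \<in> Ob X" "D \<in> Ob X"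
  obtains a b where "a \<in> Hom X Z C" "b \<in> Hom X Z D" "y = pair X a b"
  using that[OF cmpH[OF pr1H[OF assms(2,3)] assms(1)] cmpH[OF pr2H[OF assms(2,3)] assms(1)]]
    pair_eta[OF assms] by simp

lemma ent_ext:
  assumes "\<phi> \<in> fib (prd X C D)" "\<psi> \<in> fib (prd X C D)" "C \<in> Ob X" "D \<in> Ob X"
  shows "\<phi> \<preceq> \<psi> \<longleftrightarrow> ext C D \<phi> \<subseteq> ext C D \<psi>"
proof
  assume l: "\<phi> \<preceq> \<psi>"
  show "ext C D \<phi> \<subseteq> ext C D \<psi>"
  proof clarify
    fix \<theta> a b assume "(\<theta>, a, b) \<in> ext C D \<phi>"
    from extD[OF this] show "(\<theta>, a, b) \<in> ext C D \<psi>"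
      using extI[OF ent_trans[OF _ rx_mono[OF l assms(2) pairH]]] assms by blast
  qed
next
  assume s: "ext C D \<phi> \<subseteq> ext C D \<psi>"
  have "\<theta> \<preceq> rx y \<psi>" if y: "y \<in> Hom X Z (prd X C D)" and t: "\<theta> \<in> fib Z" and p: "\<theta> \<preceq> rx y \<phi>" for Z y \<theta>
  proof -
    obtain a b where "a \<in> Hom X Z C" "b \<in> Hom X Z D" "y = pair X a b" using pair_surj[OF y assms(3,4)] .
    then show ?thesis using s p ext_iff[OF t] by blast
  qed
  then show "\<phi> \<preceq> \<psi>" using ent_forcing[OF assms(1,2)] by blast
qed

lemma eqv_ext:
  assumes "\<phi> \<in> fib (prd X C D)" "C \<in> Ob X" "D \<in> Ob X"
  shows "\<psi> \<cong>\<^bsub>F\<^esub> \<phi> \<longleftrightarrow> \<psi> \<in> fib (prd X C D) \<and> ext C D \<psi> = ext C D \<phi>"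
  unfolding eqv_def using ent_ext[of \<psi> C D \<phi>] ent_ext[of \<phi> C D \<psi>] assms ent_fib by blast

lemma inst2_fib: "u \<in> Hom X K C \<Longrightarrow> v \<in> Hom X K D \<Longrightarrow> \<phi> \<in> fib (prd X C D) \<Longrightarrow> inst2 F \<phi> u v \<in> fib K"
  unfolding inst2_def using rx_fib pairH by blast

lemma inst2_iff:
  assumes "u \<in> Hom X K C" "v \<in> Hom X K D" "\<phi> \<in> fib (prd X C D)" "y \<in> Hom X Z K" "\<theta> \<in> fib Z"
  shows "\<theta> \<preceq> rx y (inst2 F \<phi> u v) \<longleftrightarrow> (\<theta>, u \<cdot> y, v \<cdot> y) \<in> ext C D \<phi>"
  unfolding inst2_def
  using ent_rx_rx[OF pairH[OF assms(1,2)] assms(3-5)] pair_comp[OF assms(1,2,4)]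
    ext_iff[OF assms(5) cmpH[OF assms(1,4)] cmpH[OF assms(2,4)]] by simp

lemma ext_inst2:
  assumes "u \<in> Hom X (prd X A B) C" "v \<in> Hom X (prd X A B) D" "\<phi> \<in> fib (prd X C D)"
    "\<theta> \<in> fib Z" "a \<in> Hom X Z A" "b \<in> Hom X Z B"
  shows "(\<theta>, a, b) \<in> ext A B (inst2 F \<phi> u v) \<longleftrightarrow> (\<theta>, u \<cdot> pair X a b, v \<cdot> pair X a b) \<in> ext C D \<phi>"
  using inst2_iff[OF assms(1-3) pairH[OF assms(5,6)] assms(4)] ext_iff[OF assms(4-6)] by simp

lemma ext_cv:
  assumes "\<phi> \<in> fib (prd X C D)" "C \<in> Ob X" "D \<in> Ob X"
  shows "ext D C (inst2 F \<phi> (pr2 X D C) (pr1 X D C)) = cv (ext C D \<phi>)"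
proof -
  have "(\<theta>, b, a) \<in> ext D C (inst2 F \<phi> (pr2 X D C) (pr1 X D C)) \<longleftrightarrow> (\<theta>, a, b) \<in> ext C D \<phi>" for \<theta> a b
  proof (cases "\<theta> \<in> fib (base \<theta>) \<and> a \<in> Hom X (base \<theta>) C \<and> b \<in> Hom X (base \<theta>) D")
    case True
    then show ?thesis
      using ext_inst2[OF pr2H[OF assms(3,2)] pr1H[OF assms(3,2)] assms(1), of \<theta> "base \<theta>" b a]
        pr1_pair[of b "base \<theta>" D a C] pr2_pair[of b "base \<theta>" D a C] by simp
  next
    case False
    then show ?thesis using extD by metis
  qed
  then show ?thesis by (auto simp: cv_def)
qed

lemma ext_Meet:
  assumes "\<phi> \<in> fib (prd X C D)" "\<psi> \<in> fib (prd X C D)"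
  shows "ext C D (\<phi> \<sqinter> \<psi>) = ext C D \<phi> \<inter> ext C D \<psi>"
  using ent_rx_Meet[OF assms pairH] unfolding ext_def by auto

lemma var31H: "C \<in> Ob X \<Longrightarrow> D \<in> Ob X \<Longrightarrow> E \<in> Ob X \<Longrightarrow> var31 X C D E \<in> Hom X (prd X (prd X C D) E) C"
  and var32H: "C \<in> Ob X \<Longrightarrow> D \<in> Ob X \<Longrightarrow> E \<in> Ob X \<Longrightarrow> var32 X C D E \<in> Hom X (prd X (prd X C D) E) D"
  and var33H: "C \<in> Ob X \<Longrightarrow> D \<in> Ob X \<Longrightarrow> E \<in> Ob X \<Longrightarrow> var33 X C D E \<in> Hom X (prd X (prd X C D) E) E"
  unfolding var31_def var32_def var33_def by (meson cmpH pr1H pr2H prd_Ob)+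

lemma var3_pair:
  assumes "a \<in> Hom X Z C" "b \<in> Hom X Z D" "c \<in> Hom X Z E"
  shows "var31 X C D E \<cdot> pair X (pair X a b) c = a" "var32 X C D E \<cdot> pair X (pair X a b) c = b"
    "var33 X C D E \<cdot> pair X (pair X a b) c = c"
proof -
  note o = HomOb(2)[OF assms(1)] HomOb(2)[OF assms(2)] HomOb(2)[OF assms(3)]
  note p = pairH[OF assms(1,2)]
  note q = pr1H[OF prd_Ob[OF o(1,2)] o(3)]
  show "var31 X C D E \<cdot> pair X (pair X a b) c = a" "var32 X C D E \<cdot> pair X (pair X a b) c = b"
    "var33 X C D E \<cdot> pair X (pair X a b) c = c"
    unfolding var31_def var32_def var33_def
    using cmp_assoc[OF pairH[OF p assms(3)] q pr1H[OF o(1,2)]] cmp_assoc[OF pairH[OF p assms(3)] q pr2H[OF o(1,2)]]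
      pr1_pair[OF p assms(3)] pr2_pair[OF p assms(3)] pr1_pair[OF assms(1,2)] pr2_pair[OF assms(1,2)]
    by simp_all
qed

lemma var3_comp:
  assumes "y \<in> Hom X Z (prd X (prd X C D) E)" "C \<in> Ob X" "D \<in> Ob X" "E \<in> Ob X"
  obtains a b c where "a \<in> Hom X Z C" "b \<in> Hom X Z D" "c \<in> Hom X Z E" "y = pair X (pair X a b) c"
  using pair_surj[OF assms(1) prd_Ob[OF assms(2,3)] assms(4)] pair_surj[OF _ assms(2,3)] that by metis

lemma var41H: "C \<in> Ob X \<Longrightarrow> D \<in> Ob X \<Longrightarrow> E \<in> Ob X \<Longrightarrow> G \<in> Ob X \<Longrightarrow> var41 X C D E G \<in> Hom X (prd X (prd X (prd X C D) E) G) C"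
  and var42H: "C \<in> Ob X \<Longrightarrow> D \<in> Ob X \<Longrightarrow> E \<in> Ob X \<Longrightarrow> G \<in> Ob X \<Longrightarrow> var42 X C D E G \<in> Hom X (prd X (prd X (prd X C D) E) G) D"
  and var43H: "C \<in> Ob X \<Longrightarrow> D \<in> Ob X \<Longrightarrow> E \<in> Ob X \<Longrightarrow> G \<in> Ob X \<Longrightarrow> var43 X C D E G \<in> Hom X (prd X (prd X (prd X C D) E) G) E"
  and var44H: "C \<in> Ob X \<Longrightarrow> D \<in> Ob X \<Longrightarrow> E \<in> Ob X \<Longrightarrow> G \<in> Ob X \<Longrightarrow> var44 X C D E G \<in> Hom X (prd X (prd X (prd X C D) E) G) G"
  unfolding var41_def var42_def var43_def var44_def
  by (meson cmpH pr1H pr2H prd_Ob var31H var32H var33H)+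

lemma var4_pair:
  assumes "a \<in> Hom X Z C" "b \<in> Hom X Z D" "c \<in> Hom X Z E" "d \<in> Hom X Z G"
  shows "var41 X C D E G \<cdot> pair X (pair X (pair X a b) c) d = a" "var42 X C D E G \<cdot> pair X (pair X (pair X a b) c) d = b"
    "var43 X C D E G \<cdot> pair X (pair X (pair X a b) c) d = c" "var44 X C D E G \<cdot> pair X (pair X (pair X a b) c) d = d"
proof -
  note o = HomOb(2)[OF assms(1)] HomOb(2)[OF assms(2)] HomOb(2)[OF assms(3)] HomOb(2)[OF assms(4)]
  note p = pairH[OF pairH[OF assms(1,2)] assms(3)]
  note pp = pairH[OF p assms(4)]
  note q = pr1H[OF prd_Ob[OF prd_Ob[OF o(1,2)] o(3)] o(4)]
  note e = pr1_pair[OF p assms(4)] pr2_pair[OF p assms(4)] var3_pair[OF assms(1-3)]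
  show "var41 X C D E G \<cdot> pair X (pair X (pair X a b) c) d = a" "var42 X C D E G \<cdot> pair X (pair X (pair X a b) c) d = b"
    "var43 X C D E G \<cdot> pair X (pair X (pair X a b) c) d = c" "var44 X C D E G \<cdot> pair X (pair X (pair X a b) c) d = d"
    unfolding var41_def var42_def var43_def var44_def
    using cmp_assoc[OF pp q var31H[OF o(1-3)]] cmp_assoc[OF pp q var32H[OF o(1-3)]]
      cmp_assoc[OF pp q var33H[OF o(1-3)]] e by simp_all
qed

lemma var4_comp:
  assumes "y \<in> Hom X Z (prd X (prd X (prd X C D) E) G)" "C \<in> Ob X" "D \<in> Ob X" "E \<in> Ob X" "G \<in> Ob X"
  obtains a b c d where "a \<in> Hom X Z C" "b \<in> Hom X Z D" "c \<in> Hom X Z E" "d \<in> Hom X Z G"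
    "y = pair X (pair X (pair X a b) c) d"
  using pair_surj[OF assms(1) prd_Ob[OF prd_Ob[OF assms(2,3)] assms(4)] assms(5)]
    var3_comp[OF _ assms(2-4)] that by metis

subsection \<open>Translation of the defining conditions\<close>

text \<open>Existence over the triple product unfolds to an element of it on a cover. Its outer
  components are the restrictions of the given pair, by \<open>e1\<close>, and its middle component
  is the witness that \<open>\<odot>\<close> asks for.\<close>

lemma relcomp_facts:
  assumes "\<phi> \<in> fib (prd X C D)" "\<psi> \<in> fib (prd X D E)" "C \<in> Ob X" "D \<in> Ob X" "E \<in> Ob X"
  shows relcomp_fib: "relcomp F C D E \<phi> \<psi> \<in> fib (prd X C E)"
    and ext_relcomp: "ext C E (relcomp F C D E \<phi> \<psi>) = ext C D \<phi> \<odot> ext D E \<psi>"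
proof -
  let ?K = "prd X (prd X C D) E"
  let ?c = "var31 X C D E" and ?d = "var32 X C D E" and ?e = "var33 X C D E"
  note c = var31H[OF assms(3-5)] and d = var32H[OF assms(3-5)] and e = var33H[OF assms(3-5)]
  let ?M = "inst2 F \<phi> ?c ?d \<sqinter> inst2 F \<psi> ?d ?e"
  note f1 = inst2_fib[OF c d assms(1)] and f2 = inst2_fib[OF d e assms(2)]
  have M: "?M \<in> fib ?K" using Meet_fib[OF f1 f2] .
  have eq: "relcomp F C D E \<phi> \<psi> = Exists F (pair X ?c ?e) ?M" unfolding relcomp_def Let_def ..
  show g: "relcomp F C D E \<phi> \<psi> \<in> fib (prd X C E)" unfolding eq using Exists_fib[OF pairH[OF c e] M] .
  have cl: "Cl (ext C E (relcomp F C D E \<phi> \<psi>))" using ext_Cl[OF g] .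
  have sem: "\<theta> \<preceq> rx (pair X (pair X x y) z) ?M \<longleftrightarrow> (\<theta>, x, y) \<in> ext C D \<phi> \<and> (\<theta>, y, z) \<in> ext D E \<psi>"
    if "x \<in> Hom X Z C" "y \<in> Hom X Z D" "z \<in> Hom X Z E" "\<theta> \<in> fib Z" for x y z \<theta> Z
  proof -
    note P = pairH[OF pairH[OF that(1,2)] that(3)]
    show ?thesis using ent_rx_Meet[OF f1 f2 P] inst2_iff[OF c d assms(1) P that(4)]
        inst2_iff[OF d e assms(2) P that(4)] var3_pair[OF that(1-3)] by simp
  qed
  show "ext C E (relcomp F C D E \<phi> \<psi>) = ext C D \<phi> \<odot> ext D E \<psi>"
  proof
    show "ext C D \<phi> \<odot> ext D E \<psi> \<subseteq> ext C E (relcomp F C D E \<phi> \<psi>)"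
    proof (rule comp_least[OF cl])
      fix \<theta> x y z assume xy: "(\<theta>, x, y) \<in> ext C D \<phi>" and yz: "(\<theta>, y, z) \<in> ext D E \<psi>"
      note h = extD(1-3)[OF xy] extD(3)[OF yz]
      let ?p = "pair X (pair X x y) z"
      have p: "?p \<in> Hom X (base \<theta>) ?K" using pairH[OF pairH[OF h(2,3)] h(4)] .
      have "\<theta> \<preceq> rx ?p ?M" using sem[OF h(2,3,4,1)] xy yz by simp
      then have "\<theta> \<preceq> rx (pair X ?c ?e \<cdot> ?p) (Exists F (pair X ?c ?e) ?M)"
        using Exists_intro[OF _ p pairH[OF c e] M] by blast
      then show "(\<theta>, x, z) \<in> ext C E (relcomp F C D E \<phi> \<psi>)"
        using ext_iff[OF h(1,2,4)] pair_comp[OF c e p] var3_pair[OF h(2-4)] eq by simp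
    qed
    show "ext C E (relcomp F C D E \<phi> \<psi>) \<subseteq> ext C D \<phi> \<odot> ext D E \<psi>"
    proof clarify
      fix \<theta> x z assume xz: "(\<theta>, x, z) \<in> ext C E (relcomp F C D E \<phi> \<psi>)"
      note h = extD[OF xz]
      obtain W w y \<chi> where w: "w \<in> Hom X W (base \<theta>)" and y: "y \<in> Hom X W ?K"
        and e1: "pair X ?c ?e \<cdot> y = pair X x z \<cdot> w" and ch: "\<chi> \<preceq> rx w \<theta>" "\<chi> \<preceq> rx y ?M" "\<theta> \<preceq> Exists F w \<chi>"
        using Exists_elim[OF h(4)[unfolded eq] pairH[OF h(2,3)] pairH[OF c e] M] .
      obtain a b k where a: "a \<in> Hom X W C" and b: "b \<in> Hom X W D" and k: "k \<in> Hom X W E"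
        and yy: "y = pair X (pair X a b) k" using var3_comp[OF y assms(3-5)] .
      have chf: "\<chi> \<in> fib W" using ent_fib[OF ch(2)] rx_fib[OF y M] by simp
      have "pair X a k = pair X (x \<cdot> w) (z \<cdot> w)"
        using e1 pair_comp[OF c e y] pair_comp[OF h(2,3) w] var3_pair[OF a b k] yy by simp
      then have "a = x \<cdot> w" "k = z \<cdot> w"
        using pr1_pair[OF a k] pr2_pair[OF a k] pr1_pair[OF cmpH[OF h(2) w] cmpH[OF h(3) w]]
          pr2_pair[OF cmpH[OF h(2) w] cmpH[OF h(3) w]] by metis+
      then have "(\<chi>, x \<cdot> w, b) \<in> ext C D \<phi>" "(\<chi>, b, z \<cdot> w) \<in> ext D E \<psi>"
        using sem[OF a b k chf] ch(2) yy by simp_all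
      then show "(\<theta>, x, z) \<in> ext C D \<phi> \<odot> ext D E \<psi>"
        using spnI[OF h(1-3)] w ch unfolding comp_def by blast
    qed
  qed
qed

text \<open>\<open>\<exists>d. \<phi>(a, d)\<close> is the diagonal part of \<open>\<phi>\<close>
  followed by its converse. This replaces a unary statement by a binary one and lets totality become
  \<open>r \<subseteq> f \<odot> cv f\<close>.\<close>

lemma ent_rx_Exists_pr1:
  assumes "\<phi> \<in> fib (prd X C D)" "C \<in> Ob X" "D \<in> Ob X" "a \<in> Hom X Z C" "\<theta> \<in> fib Z"
  shows "\<theta> \<preceq> rx a (Exists F (pr1 X C D) \<phi>) \<longleftrightarrow> (\<theta>, a, a) \<in> ext C D \<phi> \<odot> cv (ext C D \<phi>)"
proof
  note p = pr1H[OF assms(2,3)]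
  have bt: "base \<theta> = Z" using fibD assms(5) by blast
  assume "\<theta> \<preceq> rx a (Exists F (pr1 X C D) \<phi>)"
  from Exists_elim[OF this assms(4) p assms(1)] obtain W w y \<chi> where
    w: "w \<in> Hom X W Z" and y: "y \<in> Hom X W (prd X C D)" and e: "pr1 X C D \<cdot> y = a \<cdot> w"
    and ch: "\<chi> \<preceq> rx w \<theta>" "\<chi> \<preceq> rx y \<phi>" "\<theta> \<preceq> Exists F w \<chi>" .
  obtain x b where x: "x \<in> Hom X W C" and b: "b \<in> Hom X W D" and yy: "y = pair X x b"
    using pair_surj[OF y assms(2,3)] .
  have "x = a \<cdot> w" using e yy pr1_pair[OF x b] by simp
  then have "(\<chi>, a \<cdot> w, b) \<in> ext C D \<phi>" using extI[OF _ x b assms(1)] ch(2) yy by simp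
  then show "(\<theta>, a, a) \<in> ext C D \<phi> \<odot> cv (ext C D \<phi>)"
    using spnI[OF assms(5,4,4)] w ch bt unfolding comp_def by auto
next
  note p = pr1H[OF assms(2,3)]
  note g = rx_fib[OF assms(4) Exists_fib[OF p assms(1)]]
  have bt: "base \<theta> = Z" using fibD assms(5) by blast
  assume "(\<theta>, a, a) \<in> ext C D \<phi> \<odot> cv (ext C D \<phi>)"
  then obtain W w \<chi> b where w: "w \<in> Hom X W Z" and c: "\<chi> \<in> fib W" "\<chi> \<preceq> rx w \<theta>" "\<theta> \<preceq> Exists F w \<chi>"
    and e: "(\<chi>, a \<cdot> w, b) \<in> ext C D \<phi>" by (rule comp_elim) (use bt in blast)
  note h = extD(2-4)[OF e]
  have bc: "base \<chi> = W" using fibD c(1) by blast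
  have "\<chi> \<preceq> rx (pr1 X C D \<cdot> pair X (a \<cdot> w) b) (Exists F (pr1 X C D) \<phi>)"
    using Exists_intro[OF h(3) pairH[OF h(1,2)] p assms(1)] .
  then have "\<chi> \<preceq> rx w (rx a (Exists F (pr1 X C D) \<phi>))"
    using pr1_pair[OF h(1,2)] ent_rx_rx[OF assms(4) Exists_fib[OF p assms(1)] w c(1)] by simp
  then show "\<theta> \<preceq> rx a (Exists F (pr1 X C D) \<phi>)" using cover_local[OF c(3) _ w g] by blast
qed

section \<open>Partial equivalence relations and functional relations, as relations\<close>

definition PER :: "('p \<times> 'm \<times> 'm) set \<Rightarrow> bool" where
  "PER r \<longleftrightarrow> Cl r \<and> cv r \<subseteq> r \<and> r \<odot> r \<subseteq> r"

text \<open>Idempotence: every relation lies below \<open>r \<odot> cv r \<odot> r\<close>, which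
  symmetry and transitivity collapse to \<open>r \<odot> r\<close>.\<close>

lemma PER_simps: assumes "PER r" shows "Cl r" "cv r = r" "r \<odot> r = r"
proof -
  show c: "Cl r" and e: "cv r = r" using assms cv_mono[of "cv r" r] unfolding PER_def by auto
  have "r \<subseteq> r \<odot> r \<odot> r" using comp_cv_le[OF c] e by simp
  also have "\<dots> \<subseteq> r \<odot> r" using comp_mono assms unfolding PER_def by blast
  finally show "r \<odot> r = r" using assms unfolding PER_def by blast
qed

lemma PER_refl: assumes "PER r" "(\<theta>, a, b) \<in> r" shows "(\<theta>, a, a) \<in> r" "(\<theta>, b, b) \<in> r"
  using comp_intro[of \<theta> a b r a r] comp_intro[of \<theta> b a r b r] PER_simps[OF assms(1)] assms(2) cv_iff[of \<theta> b a r]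
  by simp_all

lemma per_iff:
  "per F (C, \<rho>) \<longleftrightarrow> C \<in> Ob X \<and> \<rho> \<in> fib (prd X C C) \<and> PER (ext C C \<rho>)"
proof (cases "C \<in> Ob X \<and> \<rho> \<in> fib (prd X C C)")
  case False then show ?thesis unfolding per_def by auto
next
  case True
  then have C: "C \<in> Ob X" and r: "\<rho> \<in> fib (prd X C C)" by auto
  let ?x = "var31 X C C C" and ?y = "var32 X C C C" and ?z = "var33 X C C C"
  note v = var31H[OF C C C] var32H[OF C C C] var33H[OF C C C]
  note f1 = inst2_fib[OF v(1,2) r] and f2 = inst2_fib[OF v(2,3) r] and f3 = inst2_fib[OF v(1,3) r]
  note sf = inst2_fib[OF pr2H[OF C C] pr1H[OF C C] r]
  have sym: "\<rho> \<preceq> inst2 F \<rho> (pr2 X C C) (pr1 X C C) \<longleftrightarrow> cv (ext C C \<rho>) \<subseteq> ext C C \<rho>"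
    using ent_ext[OF r sf C C] ext_cv[OF r C C] cv_mono cv_cv by metis
  have sem: "(\<theta> \<preceq> rx (pair X (pair X a b) c) (inst2 F \<rho> ?x ?y \<sqinter> inst2 F \<rho> ?y ?z) \<longleftrightarrow>
        (\<theta>, a, b) \<in> ext C C \<rho> \<and> (\<theta>, b, c) \<in> ext C C \<rho>) \<and>
      (\<theta> \<preceq> rx (pair X (pair X a b) c) (inst2 F \<rho> ?x ?z) \<longleftrightarrow> (\<theta>, a, c) \<in> ext C C \<rho>)"
    if "a \<in> Hom X Z C" "b \<in> Hom X Z C" "c \<in> Hom X Z C" "\<theta> \<in> fib Z" for a b c \<theta> Z
  proof -
    note P = pairH[OF pairH[OF that(1,2)] that(3)]
    show ?thesis using ent_rx_Meet[OF f1 f2 P] inst2_iff[OF v(1,2) r P that(4)]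
        inst2_iff[OF v(2,3) r P that(4)] inst2_iff[OF v(1,3) r P that(4)] var3_pair[OF that(1-3)] by simp
  qed
  have trans: "inst2 F \<rho> ?x ?y \<sqinter> inst2 F \<rho> ?y ?z \<preceq> inst2 F \<rho> ?x ?z \<longleftrightarrow> ext C C \<rho> \<odot> ext C C \<rho> \<subseteq> ext C C \<rho>"
    (is "?L \<preceq> ?R \<longleftrightarrow> _")
  proof
    assume l: "?L \<preceq> ?R"
    show "ext C C \<rho> \<odot> ext C C \<rho> \<subseteq> ext C C \<rho>"
    proof (rule comp_least[OF ext_Cl[OF r]])
      fix \<theta> a b c assume ab: "(\<theta>, a, b) \<in> ext C C \<rho>" and bc: "(\<theta>, b, c) \<in> ext C C \<rho>"
      note h = extD(2,3)[OF ab] extD(3,1)[OF bc]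
      have "\<theta> \<preceq> rx (pair X (pair X a b) c) ?R"
        using ent_trans[OF _ rx_mono[OF l f3 pairH[OF pairH[OF h(1,2)] h(3)]]] sem[OF h] ab bc by blast
      then show "(\<theta>, a, c) \<in> ext C C \<rho>" using sem[OF h] by blast
    qed
  next
    assume s: "ext C C \<rho> \<odot> ext C C \<rho> \<subseteq> ext C C \<rho>"
    show "?L \<preceq> ?R"
      unfolding ent_forcing[OF Meet_fib[OF f1 f2] f3]
    proof (intro allI impI)
      fix Z y \<theta> assume y: "y \<in> Hom X Z (prd X (prd X C C) C)" and t: "\<theta> \<in> fib Z" and "\<theta> \<preceq> rx y ?L"
      moreover obtain a b c where "a \<in> Hom X Z C" "b \<in> Hom X Z C" "c \<in> Hom X Z C" "y = pair X (pair X a b) c"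
        using var3_comp[OF y C C C] .
      ultimately show "\<theta> \<preceq> rx y ?R" using sem s comp_intro[OF _ _ ext_Cl[OF r] ext_Cl[OF r]] by blast
    qed
  qed
  show ?thesis unfolding per_def PER_def Let_def using sym trans C r ext_Cl[OF r] by simp
qed

definition Fun :: "('p \<times> 'm \<times> 'm) set \<Rightarrow> ('p \<times> 'm \<times> 'm) set \<Rightarrow> ('p \<times> 'm \<times> 'm) set \<Rightarrow> bool" where
  "Fun r f s \<longleftrightarrow> r \<odot> f = f \<and> f \<odot> s = f \<and> cv f \<odot> f \<subseteq> s \<and> r \<subseteq> f \<odot> cv f"

lemma strictness_iff:
  assumes "\<phi> \<in> fib (prd X C D)" "\<rho> \<in> fib (prd X C C)" "\<sigma> \<in> fib (prd X D D)" "C \<in> Ob X" "D \<in> Ob X"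
  shows "\<phi> \<preceq> inst2 F \<rho> (pr1 X C D) (pr1 X C D) \<sqinter> inst2 F \<sigma> (pr2 X C D) (pr2 X C D) \<longleftrightarrow>
    (\<forall>\<theta> a b. (\<theta>, a, b) \<in> ext C D \<phi> \<longrightarrow> (\<theta>, a, a) \<in> ext C C \<rho> \<and> (\<theta>, b, b) \<in> ext D D \<sigma>)"
    (is "\<phi> \<preceq> ?L \<sqinter> ?R \<longleftrightarrow> _")
proof -
  note p = pr1H[OF assms(4,5)] and q = pr2H[OF assms(4,5)]
  note l = inst2_fib[OF p p assms(2)] and r = inst2_fib[OF q q assms(3)]
  have sem: "(\<theta>, a, b) \<in> ext C D (?L \<sqinter> ?R) \<longleftrightarrow> (\<theta>, a, a) \<in> ext C C \<rho> \<and> (\<theta>, b, b) \<in> ext D D \<sigma>"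
    if "\<theta> \<in> fib Z" "a \<in> Hom X Z C" "b \<in> Hom X Z D" for \<theta> a b Z
    using ext_Meet[OF l r] ext_inst2[OF p p assms(2) that] ext_inst2[OF q q assms(3) that]
      pr1_pair[OF that(2,3)] pr2_pair[OF that(2,3)] by simp
  show ?thesis
  proof
    assume "\<phi> \<preceq> ?L \<sqinter> ?R"
    then have s: "ext C D \<phi> \<subseteq> ext C D (?L \<sqinter> ?R)" using ent_ext[OF assms(1) Meet_fib[OF l r] assms(4,5)] by simp
    show "\<forall>\<theta> a b. (\<theta>, a, b) \<in> ext C D \<phi> \<longrightarrow> (\<theta>, a, a) \<in> ext C C \<rho> \<and> (\<theta>, b, b) \<in> ext D D \<sigma>"
    proof (intro allI impI)
      fix \<theta> a b assume e: "(\<theta>, a, b) \<in> ext C D \<phi>"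
      show "(\<theta>, a, a) \<in> ext C C \<rho> \<and> (\<theta>, b, b) \<in> ext D D \<sigma>" using sem[OF extD(1-3)[OF e]] e s by blast
    qed
  next
    assume a: "\<forall>\<theta> a b. (\<theta>, a, b) \<in> ext C D \<phi> \<longrightarrow> (\<theta>, a, a) \<in> ext C C \<rho> \<and> (\<theta>, b, b) \<in> ext D D \<sigma>"
    have "ext C D \<phi> \<subseteq> ext C D (?L \<sqinter> ?R)"
    proof clarify
      fix \<theta> a b assume e: "(\<theta>, a, b) \<in> ext C D \<phi>"
      show "(\<theta>, a, b) \<in> ext C D (?L \<sqinter> ?R)" using sem[OF extD(1-3)[OF e]] e a by blast
    qed
    then show "\<phi> \<preceq> ?L \<sqinter> ?R" using ent_ext[OF assms(1) Meet_fib[OF l r] assms(4,5)] by simp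
  qed
qed

lemma congruence_iff:
  assumes "\<phi> \<in> fib (prd X C D)" "\<rho> \<in> fib (prd X C C)" "\<sigma> \<in> fib (prd X D D)" "C \<in> Ob X" "D \<in> Ob X"
  shows "(let c = var41 X C D C D; d = var42 X C D C D; c' = var43 X C D C D; d' = var44 X C D C D in
      inst2 F \<phi> c d \<sqinter> inst2 F \<rho> c c' \<sqinter> inst2 F \<sigma> d d' \<preceq> inst2 F \<phi> c' d') \<longleftrightarrow>
    (\<forall>\<theta> a b a' b'. (\<theta>, a, b) \<in> ext C D \<phi> \<longrightarrow> (\<theta>, a, a') \<in> ext C C \<rho> \<longrightarrow> (\<theta>, b, b') \<in> ext D D \<sigma> \<longrightarrow>
      (\<theta>, a', b') \<in> ext C D \<phi>)"
proof -
  let ?c = "var41 X C D C D" and ?d = "var42 X C D C D" and ?c' = "var43 X C D C D" and ?d' = "var44 X C D C D"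
  note v = var41H[OF assms(4,5,4,5)] var42H[OF assms(4,5,4,5)] var43H[OF assms(4,5,4,5)] var44H[OF assms(4,5,4,5)]
  note f = inst2_fib[OF v(1,2) assms(1)] inst2_fib[OF v(1,3) assms(2)] inst2_fib[OF v(2,4) assms(3)]
    inst2_fib[OF v(3,4) assms(1)]
  let ?L = "inst2 F \<phi> ?c ?d \<sqinter> inst2 F \<rho> ?c ?c' \<sqinter> inst2 F \<sigma> ?d ?d'" and ?R = "inst2 F \<phi> ?c' ?d'"
  have sem: "(\<theta> \<preceq> rx (pair X (pair X (pair X a b) a') b') ?L \<longleftrightarrow>
      (\<theta>, a, b) \<in> ext C D \<phi> \<and> (\<theta>, a, a') \<in> ext C C \<rho> \<and> (\<theta>, b, b') \<in> ext D D \<sigma>) \<and>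
      (\<theta> \<preceq> rx (pair X (pair X (pair X a b) a') b') ?R \<longleftrightarrow> (\<theta>, a', b') \<in> ext C D \<phi>)"
    if "a \<in> Hom X Z C" "b \<in> Hom X Z D" "a' \<in> Hom X Z C" "b' \<in> Hom X Z D" "\<theta> \<in> fib Z" for a b a' b' \<theta> Z
  proof -
    note P = pairH[OF pairH[OF pairH[OF that(1,2)] that(3)] that(4)]
    show ?thesis
      using ent_rx_Meet[OF Meet_fib[OF f(1,2)] f(3) P] ent_rx_Meet[OF f(1,2) P]
        inst2_iff[OF v(1,2) assms(1) P that(5)] inst2_iff[OF v(1,3) assms(2) P that(5)]
        inst2_iff[OF v(2,4) assms(3) P that(5)] inst2_iff[OF v(3,4) assms(1) P that(5)]
        var4_pair[OF that(1-4)] by simp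
  qed
  show ?thesis unfolding Let_def
  proof
    assume l: "?L \<preceq> ?R"
    show "\<forall>\<theta> a b a' b'. (\<theta>, a, b) \<in> ext C D \<phi> \<longrightarrow> (\<theta>, a, a') \<in> ext C C \<rho> \<longrightarrow> (\<theta>, b, b') \<in> ext D D \<sigma> \<longrightarrow>
      (\<theta>, a', b') \<in> ext C D \<phi>"
    proof (intro allI impI)
      fix \<theta> a b a' b'
      assume e: "(\<theta>, a, b) \<in> ext C D \<phi>" "(\<theta>, a, a') \<in> ext C C \<rho>" "(\<theta>, b, b') \<in> ext D D \<sigma>"
      note h = extD(2,3)[OF e(1)] extD(3)[OF e(2)] extD(3,1)[OF e(3)]
      have "\<theta> \<preceq> rx (pair X (pair X (pair X a b) a') b') ?R"
        using ent_trans[OF _ rx_mono[OF l f(4) pairH[OF pairH[OF pairH[OF h(1,2)] h(3)] h(4)]]] sem[OF h] e by blast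
      then show "(\<theta>, a', b') \<in> ext C D \<phi>" using sem[OF h] by blast
    qed
  next
    assume s: "\<forall>\<theta> a b a' b'. (\<theta>, a, b) \<in> ext C D \<phi> \<longrightarrow> (\<theta>, a, a') \<in> ext C C \<rho> \<longrightarrow> (\<theta>, b, b') \<in> ext D D \<sigma> \<longrightarrow>
      (\<theta>, a', b') \<in> ext C D \<phi>"
    show "?L \<preceq> ?R"
      unfolding ent_forcing[OF Meet_fib[OF Meet_fib[OF f(1,2)] f(3)] f(4)]
    proof (intro allI impI)
      fix Z y \<theta> assume y: "y \<in> Hom X Z (prd X (prd X (prd X C D) C) D)" and t: "\<theta> \<in> fib Z" and l: "\<theta> \<preceq> rx y ?L"
      obtain a b a' b' where h: "a \<in> Hom X Z C" "b \<in> Hom X Z D" "a' \<in> Hom X Z C" "b' \<in> Hom X Z D"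
        "y = pair X (pair X (pair X a b) a') b'" using var4_comp[OF y assms(4,5,4,5)] .
      show "\<theta> \<preceq> rx y ?R" using sem[OF h(1-4) t] s l h(5) by blast
    qed
  qed
qed

lemma single_valued_iff:
  assumes "\<phi> \<in> fib (prd X C D)" "\<sigma> \<in> fib (prd X D D)" "C \<in> Ob X" "D \<in> Ob X"
  shows "(let c = var31 X C D D; d = var32 X C D D; d' = var33 X C D D in
      inst2 F \<phi> c d \<sqinter> inst2 F \<phi> c d' \<preceq> inst2 F \<sigma> d d') \<longleftrightarrow> cv (ext C D \<phi>) \<odot> ext C D \<phi> \<subseteq> ext D D \<sigma>"
proof -
  let ?c = "var31 X C D D" and ?d = "var32 X C D D" and ?d' = "var33 X C D D"
  note v = var31H[OF assms(3,4,4)] var32H[OF assms(3,4,4)] var33H[OF assms(3,4,4)]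
  note f = inst2_fib[OF v(1,2) assms(1)] inst2_fib[OF v(1,3) assms(1)] inst2_fib[OF v(2,3) assms(2)]
  let ?L = "inst2 F \<phi> ?c ?d \<sqinter> inst2 F \<phi> ?c ?d'" and ?R = "inst2 F \<sigma> ?d ?d'"
  have sem: "(\<theta> \<preceq> rx (pair X (pair X a b) b') ?L \<longleftrightarrow> (\<theta>, a, b) \<in> ext C D \<phi> \<and> (\<theta>, a, b') \<in> ext C D \<phi>) \<and>
      (\<theta> \<preceq> rx (pair X (pair X a b) b') ?R \<longleftrightarrow> (\<theta>, b, b') \<in> ext D D \<sigma>)"
    if "a \<in> Hom X Z C" "b \<in> Hom X Z D" "b' \<in> Hom X Z D" "\<theta> \<in> fib Z" for a b b' \<theta> Z
  proof -
    note P = pairH[OF pairH[OF that(1,2)] that(3)]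
    show ?thesis
      using ent_rx_Meet[OF f(1,2) P] inst2_iff[OF v(1,2) assms(1) P that(4)]
        inst2_iff[OF v(1,3) assms(1) P that(4)] inst2_iff[OF v(2,3) assms(2) P that(4)]
        var3_pair[OF that(1-3)] by simp
  qed
  show ?thesis unfolding Let_def
  proof
    assume l: "?L \<preceq> ?R"
    show "cv (ext C D \<phi>) \<odot> ext C D \<phi> \<subseteq> ext D D \<sigma>"
    proof (rule comp_least[OF ext_Cl[OF assms(2)]])
      fix \<theta> b a b' assume e: "(\<theta>, b, a) \<in> cv (ext C D \<phi>)" "(\<theta>, a, b') \<in> ext C D \<phi>"
      then have e': "(\<theta>, a, b) \<in> ext C D \<phi>" by simp
      note h = extD(2,3)[OF e'] extD(3,1)[OF e(2)]
      have "\<theta> \<preceq> rx (pair X (pair X a b) b') ?R"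
        using ent_trans[OF _ rx_mono[OF l f(3) pairH[OF pairH[OF h(1,2)] h(3)]]] sem[OF h] e e' by blast
      then show "(\<theta>, b, b') \<in> ext D D \<sigma>" using sem[OF h] by blast
    qed
  next
    assume s: "cv (ext C D \<phi>) \<odot> ext C D \<phi> \<subseteq> ext D D \<sigma>"
    show "?L \<preceq> ?R"
      unfolding ent_forcing[OF Meet_fib[OF f(1,2)] f(3)]
    proof (intro allI impI)
      fix Z y \<theta> assume y: "y \<in> Hom X Z (prd X (prd X C D) D)" and t: "\<theta> \<in> fib Z" and l: "\<theta> \<preceq> rx y ?L"
      obtain a b b' where h: "a \<in> Hom X Z C" "b \<in> Hom X Z D" "b' \<in> Hom X Z D"
        "y = pair X (pair X a b) b'" using var3_comp[OF y assms(3,4,4)] .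
      have "(\<theta>, a, b) \<in> ext C D \<phi>" "(\<theta>, a, b') \<in> ext C D \<phi>" using sem[OF h(1-3) t] l h(4) by auto
      then have "(\<theta>, b, b') \<in> ext D D \<sigma>"
        using s comp_intro[OF _ _ cv_Cl[OF ext_Cl] ext_Cl, OF _ _ assms(1,1)] cv_iff by blast
      then show "\<theta> \<preceq> rx y ?R" using sem[OF h(1-3) t] h(4) by blast
    qed
  qed
qed

lemma totality_iff:
  assumes "\<phi> \<in> fib (prd X C D)" "\<rho> \<in> fib (prd X C C)" "C \<in> Ob X" "D \<in> Ob X"
  shows "(let c = Ident X C in inst2 F \<rho> c c \<preceq> Exists F (pr1 X C D) \<phi>) \<longleftrightarrow>
    (\<forall>\<theta> a. (\<theta>, a, a) \<in> ext C C \<rho> \<longrightarrow> (\<theta>, a, a) \<in> ext C D \<phi> \<odot> cv (ext C D \<phi>))"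
proof -
  let ?L = "inst2 F \<rho> (Ident X C) (Ident X C)" and ?R = "Exists F (pr1 X C D) \<phi>"
  note i = idH[OF assms(3)]
  note l = inst2_fib[OF i i assms(2)] and r = Exists_fib[OF pr1H[OF assms(3,4)] assms(1)]
  have sem: "\<theta> \<preceq> rx a ?L \<longleftrightarrow> (\<theta>, a, a) \<in> ext C C \<rho>" if "a \<in> Hom X Z C" "\<theta> \<in> fib Z" for a \<theta> Z
    using inst2_iff[OF i i assms(2) that] cmp_idl[OF that(1)] by simp
  show ?thesis unfolding Let_def ent_forcing[OF l r]
  proof (intro iffI allI impI)
    fix \<theta> a assume a: "\<forall>Z y \<theta>. y \<in> Hom X Z C \<longrightarrow> \<theta> \<in> fib Z \<longrightarrow> \<theta> \<preceq> rx y ?L \<longrightarrow> \<theta> \<preceq> rx y ?R"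
      and e: "(\<theta>, a, a) \<in> ext C C \<rho>"
    show "(\<theta>, a, a) \<in> ext C D \<phi> \<odot> cv (ext C D \<phi>)"
      using a sem[OF extD(2,1)[OF e]] ent_rx_Exists_pr1[OF assms(1,3,4) extD(2,1)[OF e]] extD(2,1)[OF e] e by blast
  next
    fix Z y \<theta> assume "\<forall>\<theta> a. (\<theta>, a, a) \<in> ext C C \<rho> \<longrightarrow> (\<theta>, a, a) \<in> ext C D \<phi> \<odot> cv (ext C D \<phi>)"
      "y \<in> Hom X Z C" "\<theta> \<in> fib Z" "\<theta> \<preceq> rx y ?L"
    then show "\<theta> \<preceq> rx y ?R" using sem ent_rx_Exists_pr1[OF assms(1,3,4)] by blast
  qed
qed

text \<open>Strictness and congruence are absorbed into the two equations of \<open>Fun\<close>. In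
  the converse direction strictness in \<open>D\<close> comes from single-valuedness and strictness
  in \<open>C\<close> from \<open>r \<odot> f = f\<close>. Totality, given on the diagonal only,
  spreads to all of \<open>r\<close> because
  \<open>(f \<odot> cv f) \<odot> r = f \<odot> cv (r \<odot> f)\<close>.\<close>

lemma functional_relation_iff:
  assumes A: "per F (C, \<rho>)" and B: "per F (D, \<sigma>)"
  shows "functional_relation F (C, \<rho>) (D, \<sigma>) \<phi> \<longleftrightarrow>
    \<phi> \<in> fib (prd X C D) \<and> Fun (ext C C \<rho>) (ext C D \<phi>) (ext D D \<sigma>)"
proof (cases "\<phi> \<in> fib (prd X C D)")
  case False then show ?thesis by (simp add: functional_relation_def)
next
  case True
  let ?r = "ext C C \<rho>" and ?s = "ext D D \<sigma>" and ?f = "ext C D \<phi>"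
  have o: "C \<in> Ob X" "D \<in> Ob X" and fr: "\<rho> \<in> fib (prd X C C)" "\<sigma> \<in> fib (prd X D D)"
    and pr: "PER ?r" "PER ?s" using A B by (auto simp: per_iff)
  note r = PER_simps[OF pr(1)] and s = PER_simps[OF pr(2)]
  note f = ext_Cl[OF True] note f' = cv_Cl[OF f]
  have def: "functional_relation F (C, \<rho>) (D, \<sigma>) \<phi> \<longleftrightarrow>
    (\<forall>\<theta> a b. (\<theta>, a, b) \<in> ?f \<longrightarrow> (\<theta>, a, a) \<in> ?r \<and> (\<theta>, b, b) \<in> ?s) \<and>
    (\<forall>\<theta> a b a' b'. (\<theta>, a, b) \<in> ?f \<longrightarrow> (\<theta>, a, a') \<in> ?r \<longrightarrow> (\<theta>, b, b') \<in> ?s \<longrightarrow> (\<theta>, a', b') \<in> ?f) \<and>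
    cv ?f \<odot> ?f \<subseteq> ?s \<and> (\<forall>\<theta> a. (\<theta>, a, a) \<in> ?r \<longrightarrow> (\<theta>, a, a) \<in> ?f \<odot> cv ?f)"
    unfolding functional_relation_def
    using strictness_iff[OF True fr o] congruence_iff[OF True fr o] single_valued_iff[OF True fr(2) o]
      totality_iff[OF True fr(1) o] True by (simp add: Let_def)
  show ?thesis
  proof
    assume fn: "functional_relation F (C, \<rho>) (D, \<sigma>) \<phi>"
    have st: "(\<theta>, a, a) \<in> ?r" "(\<theta>, b, b) \<in> ?s" if "(\<theta>, a, b) \<in> ?f" for \<theta> a b
      using fn that unfolding def by blast+
    have cg: "(\<theta>, a', b') \<in> ?f" if "(\<theta>, a, b) \<in> ?f" "(\<theta>, a, a') \<in> ?r" "(\<theta>, b, b') \<in> ?s" for \<theta> a b a' b'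
      using fn that unfolding def by blast
    have tot: "(\<theta>, a, a) \<in> ?f \<odot> cv ?f" if "(\<theta>, a, a) \<in> ?r" for \<theta> a
      using fn that unfolding def by blast
    have "?r \<odot> ?f \<subseteq> ?f"
    proof (rule comp_least[OF f])
      fix \<theta> a' a b assume "(\<theta>, a', a) \<in> ?r" "(\<theta>, a, b) \<in> ?f"
      then show "(\<theta>, a', b) \<in> ?f" using cg st r(2) cv_iff by metis
    qed
    moreover have "?f \<subseteq> ?r \<odot> ?f" by (clarify, rule comp_intro[OF st(1) _ r(1) f])
    moreover have "?f \<odot> ?s \<subseteq> ?f" by (rule comp_least[OF f]) (use cg st in blast)
    moreover have "?f \<subseteq> ?f \<odot> ?s" by (clarify, rule comp_intro[OF _ st(2) f s(1)])
    moreover have "?r \<subseteq> ?f \<odot> cv ?f"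
    proof clarify
      fix \<theta> a a' assume aa: "(\<theta>, a, a') \<in> ?r"
      have "(\<theta>, a, a') \<in> (?f \<odot> cv ?f) \<odot> ?r"
        using comp_intro[OF tot[OF PER_refl(1)[OF pr(1) aa]] aa comp_Cl[OF f f'] r(1)] .
      also have "(?f \<odot> cv ?f) \<odot> ?r = ?f \<odot> cv (?r \<odot> ?f)" using comp_assoc[OF f f' r(1)] r(2) by (simp add: cv_comp)
      also have "\<dots> \<subseteq> ?f \<odot> cv ?f" using comp_mono cv_mono \<open>?r \<odot> ?f \<subseteq> ?f\<close> by blast
      finally show "(\<theta>, a, a') \<in> ?f \<odot> cv ?f" .
    qed
    ultimately show "\<phi> \<in> fib (prd X C D) \<and> Fun ?r ?f ?s" using fn True unfolding def Fun_def by blast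
  next
    assume "\<phi> \<in> fib (prd X C D) \<and> Fun ?r ?f ?s"
    then have l: "?r \<odot> ?f = ?f" and ri: "?f \<odot> ?s = ?f" and sv: "cv ?f \<odot> ?f \<subseteq> ?s" and t: "?r \<subseteq> ?f \<odot> cv ?f"
      unfolding Fun_def by auto
    have rr: "?r \<odot> ?f \<odot> cv ?f = ?f \<odot> cv ?f" using comp_assoc[OF r(1) f f'] l by simp
    have st: "(\<theta>, a, a) \<in> ?r \<and> (\<theta>, b, b) \<in> ?s" if ab: "(\<theta>, a, b) \<in> ?f" for \<theta> a b
    proof
      have "(\<theta>, b, b) \<in> cv ?f \<odot> ?f" using comp_intro[OF _ ab f' f] ab by simp
      then show "(\<theta>, b, b) \<in> ?s" using sv by blast
      from ab l have "(\<theta>, a, b) \<in> ?r \<odot> ?f" by simp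
      then obtain W w \<chi> c where "spn \<theta> a b" "w \<in> Hom X W (base \<theta>)" "\<chi> \<preceq> rx w \<theta>" "\<theta> \<preceq> Exists F w \<chi>"
        "(\<chi>, a \<cdot> w, c) \<in> ?r" by (rule comp_elim)
      moreover have "spn \<theta> a a" using \<open>spn \<theta> a b\<close> by (simp add: spn_def)
      ultimately show "(\<theta>, a, a) \<in> ?r" using Cl_local[OF r(1)] PER_refl[OF pr(1)] by blast
    qed
    have cg: "(\<theta>, a', b') \<in> ?f" if "(\<theta>, a, b) \<in> ?f" "(\<theta>, a, a') \<in> ?r" "(\<theta>, b, b') \<in> ?s" for \<theta> a b a' b'
    proof -
      have "(\<theta>, a', a) \<in> ?r" using that(2) r(2) cv_iff by metis
      then have "(\<theta>, a', b) \<in> ?f" using comp_intro[OF _ that(1) r(1) f] l by blast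
      then show ?thesis using comp_intro[OF _ that(3) f s(1)] ri by blast
    qed
    show "functional_relation F (C, \<rho>) (D, \<sigma>) \<phi>" unfolding def using st cg sv t by blast
  qed
qed

section \<open>Restriction of a relation to a predicate\<close>

definition rst :: "('p \<times> 'm \<times> 'm) set \<Rightarrow> 'p \<Rightarrow> ('p \<times> 'm \<times> 'm) set" where
  "rst P \<phi> = {(\<theta>, a, b). (\<theta>, a, b) \<in> P \<and> \<theta> \<preceq> rx a \<phi>}"

lemma rst_iff: "(\<theta>, a, b) \<in> rst P \<phi> \<longleftrightarrow> (\<theta>, a, b) \<in> P \<and> \<theta> \<preceq> rx a \<phi>" by (simp add: rst_def)

lemma ext_rx_pr1:
  assumes "\<phi> \<in> fib C" "D \<in> Ob X" "\<theta> \<in> fib Z" "a \<in> Hom X Z C" "b \<in> Hom X Z D"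
  shows "(\<theta>, a, b) \<in> ext C D (rx (pr1 X C D) \<phi>) \<longleftrightarrow> \<theta> \<preceq> rx a \<phi>"
    "(\<theta>, b, a) \<in> ext D C (rx (pr2 X D C) \<phi>) \<longleftrightarrow> \<theta> \<preceq> rx a \<phi>"
  using ext_iff[OF assms(3-5)] ext_iff[OF assms(3,5,4)]
    ent_rx_rx[OF pr1H[OF fib_Ob[OF assms(1)] assms(2)] assms(1) pairH[OF assms(4,5)] assms(3)]
    ent_rx_rx[OF pr2H[OF assms(2) fib_Ob[OF assms(1)]] assms(1) pairH[OF assms(5,4)] assms(3)]
    pr1_pair[OF assms(4,5)] pr2_pair[OF assms(5,4)] by simp_all

lemma ext_rst:
  assumes "\<phi> \<in> fib C" "\<psi> \<in> fib (prd X C D)" "D \<in> Ob X"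
  shows "ext C D (\<psi> \<sqinter> rx (pr1 X C D) \<phi>) = rst (ext C D \<psi>) \<phi>"
    "ext C D (rx (pr1 X C D) \<phi> \<sqinter> \<psi>) = rst (ext C D \<psi>) \<phi>"
proof -
  note f = rx_fib[OF pr1H[OF fib_Ob[OF assms(1)] assms(3)] assms(1)]
  have "ext C D \<psi> \<inter> ext C D (rx (pr1 X C D) \<phi>) = rst (ext C D \<psi>) \<phi>"
  proof -
    have "(\<theta>, a, b) \<in> ext C D (rx (pr1 X C D) \<phi>) \<longleftrightarrow> \<theta> \<preceq> rx a \<phi>" if "(\<theta>, a, b) \<in> ext C D \<psi>" for \<theta> a b
      using ext_rx_pr1(1)[OF assms(1,3) extD(1-3)[OF that]] .
    then show ?thesis by (auto simp: rst_iff)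
  qed
  then show "ext C D (\<psi> \<sqinter> rx (pr1 X C D) \<phi>) = rst (ext C D \<psi>) \<phi>"
    "ext C D (rx (pr1 X C D) \<phi> \<sqinter> \<psi>) = rst (ext C D \<psi>) \<phi>"
    using ext_Meet[OF assms(2) f] ext_Meet[OF f assms(2)] by auto
qed

lemma strict_iff:
  assumes "C \<in> Ob X" "\<rho> \<in> fib (prd X C C)"
  shows "strict F (C, \<rho>) \<phi> \<longleftrightarrow> \<phi> \<in> fib C \<and>
    (\<forall>\<theta> Z a. \<theta> \<in> fib Z \<longrightarrow> a \<in> Hom X Z C \<longrightarrow> \<theta> \<preceq> rx a \<phi> \<longrightarrow> (\<theta>, a, a) \<in> ext C C \<rho>) \<and>
    (\<forall>\<theta> a b. (\<theta>, a, b) \<in> ext C C \<rho> \<longrightarrow> \<theta> \<preceq> rx a \<phi> \<longrightarrow> \<theta> \<preceq> rx b \<phi>)"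
proof (cases "\<phi> \<in> fib C")
  case False then show ?thesis by (simp add: strict_def)
next
  case True
  note i = idH[OF assms(1)] note p = pr1H[OF assms(1,1)] and q = pr2H[OF assms(1,1)]
  note f1 = inst2_fib[OF i i assms(2)] and fp = rx_fib[OF p True] and fq = rx_fib[OF q True]
  have 1: "\<phi> \<preceq> inst2 F \<rho> (Ident X C) (Ident X C) \<longleftrightarrow>
      (\<forall>\<theta> Z a. \<theta> \<in> fib Z \<longrightarrow> a \<in> Hom X Z C \<longrightarrow> \<theta> \<preceq> rx a \<phi> \<longrightarrow> (\<theta>, a, a) \<in> ext C C \<rho>)"
    unfolding ent_forcing[OF True f1] using inst2_iff[OF i i assms(2)] cmp_idl by fastforce
  have "rx (pr1 X C C) \<phi> \<sqinter> \<rho> \<preceq> rx (pr2 X C C) \<phi> \<longleftrightarrow> rst (ext C C \<rho>) \<phi> \<subseteq> ext C C (rx (pr2 X C C) \<phi>)"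
    using ent_ext[OF Meet_fib[OF fp assms(2)] fq assms(1,1)] ext_rst(2)[OF True assms(2,1)] by simp
  also have "\<dots> \<longleftrightarrow> (\<forall>\<theta> a b. (\<theta>, a, b) \<in> ext C C \<rho> \<longrightarrow> \<theta> \<preceq> rx a \<phi> \<longrightarrow> \<theta> \<preceq> rx b \<phi>)"
  proof -
    have "(\<theta>, a, b) \<in> ext C C (rx (pr2 X C C) \<phi>) \<longleftrightarrow> \<theta> \<preceq> rx b \<phi>" if "(\<theta>, a, b) \<in> ext C C \<rho>" for \<theta> a b
      using ext_rx_pr1(2)[OF True assms(1) extD(1,3,2)[OF that]] .
    then show ?thesis unfolding subset_iff by (auto simp: rst_iff)
  qed
  finally show ?thesis using 1 True unfolding strict_def Let_def by simp
qed

lemma rst_Cl: assumes "Cl P" "\<phi> \<in> fib C" "\<And>\<theta> a b. (\<theta>, a, b) \<in> P \<Longrightarrow> a \<in> Hom X (base \<theta>) C" shows "Cl (rst P \<phi>)"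
  unfolding Cl_def rst_iff
proof (intro conjI allI impI)
  fix \<theta> a b assume "(\<theta>, a, b) \<in> P \<and> \<theta> \<preceq> rx a \<phi>"
  then show "spn \<theta> a b" using Cl_spn[OF assms(1)] by blast
next
  fix \<theta> a b \<chi> w W
  assume e: "(\<theta>, a, b) \<in> P \<and> \<theta> \<preceq> rx a \<phi>" and w: "w \<in> Hom X W (base \<theta>)" "\<chi> \<preceq> rx w \<theta>"
  then show "(\<chi>, a \<cdot> w, b \<cdot> w) \<in> P" using Cl_restrict[OF assms(1)] by blast
  show "\<chi> \<preceq> rx (a \<cdot> w) \<phi>" using rx_cut[OF w(2) _ w(1) assms(3) assms(2)] e by blast
next
  fix \<theta> a b \<chi> w W
  assume s: "spn \<theta> a b" and w: "w \<in> Hom X W (base \<theta>)" "\<chi> \<preceq> rx w \<theta>" "\<theta> \<preceq> Exists F w \<chi>"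
    and e: "(\<chi>, a \<cdot> w, b \<cdot> w) \<in> P \<and> \<chi> \<preceq> rx (a \<cdot> w) \<phi>"
  show ab: "(\<theta>, a, b) \<in> P" using Cl_local[OF assms(1) s w] e by blast
  have a: "a \<in> Hom X (base \<theta>) C" using assms(3)[OF ab] .
  have ch: "\<chi> \<in> fib W" using ent_fib[OF w(2)] rx_fib[OF w(1) spnD(3)[OF s]] by simp
  have "\<chi> \<preceq> rx w (rx a \<phi>)" using e ent_rx_rx[OF a assms(2) w(1) ch] by simp
  then show "\<theta> \<preceq> rx a \<phi>" using cover_local[OF w(3) _ w(1) rx_fib[OF a assms(2)]] by blast
qed

lemma rst_PER:
  assumes "per F (C, \<rho>)" "strict F (C, \<rho>) \<phi>"
  shows "PER (rst (ext C C \<rho>) \<phi>)" "rst (ext C C \<rho>) \<phi> \<odot> ext C C \<rho> = rst (ext C C \<rho>) \<phi>"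
    "rst (ext C C \<rho>) \<phi> \<subseteq> ext C C \<rho>"
proof -
  let ?r = "ext C C \<rho>" let ?s = "rst ?r \<phi>"
  have o: "C \<in> Ob X" and f: "\<rho> \<in> fib (prd X C C)" and pr: "PER ?r" using assms(1) by (auto simp: per_iff)
  note r = PER_simps[OF pr]
  have ph: "\<phi> \<in> fib C" and st: "\<And>\<theta> a b. (\<theta>, a, b) \<in> ?r \<Longrightarrow> \<theta> \<preceq> rx a \<phi> \<Longrightarrow> \<theta> \<preceq> rx b \<phi>"
    using assms(2) unfolding strict_iff[OF o f] by auto
  have cl: "Cl ?s" using rst_Cl[OF r(1) ph extD(2)] .
  have symr: "(\<theta>, b, a) \<in> ?r" if "(\<theta>, a, b) \<in> ?r" for \<theta> a b using that r(2) cv_iff by metis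
  have sr: "?s \<odot> ?r \<subseteq> ?s"
  proof (rule comp_least[OF cl])
    fix \<theta> a b c assume "(\<theta>, a, b) \<in> ?s" "(\<theta>, b, c) \<in> ?r"
    then show "(\<theta>, a, c) \<in> ?s" using comp_intro[of \<theta> a b ?r c ?r] r by (simp add: rst_iff)
  qed
  show sub: "?s \<subseteq> ?r" by (auto simp: rst_iff)
  have "cv ?s \<subseteq> ?s" using st symr by (auto simp: cv_def rst_iff)
  moreover have "?s \<odot> ?s \<subseteq> ?s" using sr comp_mono[of ?s ?s ?s ?r] sub by blast
  ultimately show P: "PER ?s" using cl unfolding PER_def by blast
  have "?s = ?s \<odot> ?s" using PER_simps(3)[OF P] by simp
  also have "\<dots> \<subseteq> ?s \<odot> ?r" using comp_mono sub by blast
  finally show "?s \<odot> ?r = ?s" using sr by blast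
qed

section \<open>Identities and graphs\<close>

definition Idr :: "'o \<Rightarrow> ('p \<times> 'm \<times> 'm) set" where "Idr C = ext C C (equality F C)"

definition gr :: "'m \<Rightarrow> ('p \<times> 'm \<times> 'm) set" where
  "gr u = (let I = Dom X u; J = Cod X u in
     ext I J (inst2 F (equality F J) (u \<cdot> pr1 X I J) (pr2 X I J)))"

lemma equality_fib: "C \<in> Ob X \<Longrightarrow> equality F C \<in> fib (prd X C C)"
  unfolding equality_def using Exists_fib[OF pairH[OF idH idH] Top_fib] by blast

lemma Idr_Cl: "C \<in> Ob X \<Longrightarrow> Cl (Idr C)"
  unfolding Idr_def using ext_Cl equality_fib by blast

lemma diag_comp: "x \<in> Hom X Z C \<Longrightarrow> pair X (Ident X C) (Ident X C) \<cdot> x = pair X x x"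
  using pair_comp[OF idH idH] cmp_idl HomOb(2) by metis

lemma Idr_refl: assumes "x \<in> Hom X Z C" "\<theta> \<in> fib Z" shows "(\<theta>, x, x) \<in> Idr C"
proof -
  note C = HomOb(2)[OF assms(1)]
  have "\<theta> \<preceq> rx (pair X x x) (equality F C)" unfolding equality_def
    using Exists_intro[OF ent_rx_Top[OF assms] assms(1) pairH[OF idH[OF C] idH[OF C]] Top_fib[OF C]]
      diag_comp[OF assms(1)] by simp
  then show ?thesis unfolding Idr_def using ext_iff[OF assms(2,1,1)] by simp
qed

text \<open>Equality is existence along the diagonal, and an element of the diagonal has equal
  components: forced equality is actual equality on a cover.\<close>

lemma Idr_elim:
  assumes "(\<theta>, x, y) \<in> Idr C" "C \<in> Ob X"
  obtains W w \<chi> where "w \<in> Hom X W (base \<theta>)" "\<chi> \<in> fib W" "\<chi> \<preceq> rx w \<theta>" "\<theta> \<preceq> Exists F w \<chi>" "x \<cdot> w = y \<cdot> w"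
proof -
  note h = extD[OF assms(1)[unfolded Idr_def]]
  obtain W w v \<chi> where w: "w \<in> Hom X W (base \<theta>)" and v: "v \<in> Hom X W C"
    and e: "pair X (Ident X C) (Ident X C) \<cdot> v = pair X x y \<cdot> w" and ch: "\<chi> \<preceq> rx w \<theta>" "\<theta> \<preceq> Exists F w \<chi>"
    using Exists_elim[OF h(4)[unfolded equality_def] pairH[OF h(2,3)] pairH[OF idH idH] Top_fib] assms(2) by metis
  have "pair X v v = pair X (x \<cdot> w) (y \<cdot> w)" using e diag_comp[OF v] pair_comp[OF h(2,3) w] by simp
  then have "x \<cdot> w = y \<cdot> w"
    using pr1_pair[OF v v] pr2_pair[OF v v] pr1_pair[OF cmpH[OF h(2) w] cmpH[OF h(3) w]]
      pr2_pair[OF cmpH[OF h(2) w] cmpH[OF h(3) w]] by metis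
  then show ?thesis using that[OF w _ ch] ent_fib[OF ch(1)] rx_fib[OF w h(1)] by blast
qed

text \<open>Leibniz's rule. On a cover \<open>x\<close> and \<open>y\<close> restrict to the same
  arrow, and membership in \<open>P\<close> is local. The second argument of a relation is reached
  by applying this to the converse.\<close>

lemma Idr_subst:
  assumes "(\<theta>, x, y) \<in> Idr C" "C \<in> Ob X" "(\<theta>, y, z) \<in> P" "Cl P"
  shows "(\<theta>, x, z) \<in> P"
proof -
  obtain W w \<chi> where w: "w \<in> Hom X W (base \<theta>)" and c: "\<chi> \<preceq> rx w \<theta>" "\<theta> \<preceq> Exists F w \<chi>" and e: "x \<cdot> w = y \<cdot> w"
    using Idr_elim[OF assms(1,2)] by metis
  have "(\<chi>, x \<cdot> w, z \<cdot> w) \<in> P" using Cl_restrict[OF assms(4,3) w c(1)] e by simp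
  moreover have "spn \<theta> x z" using Cl_spn[OF assms(4,3)] Cl_spn[OF Idr_Cl[OF assms(2)] assms(1)] by (simp add: spn_def)
  ultimately show ?thesis using Cl_local[OF assms(4)] w c by blast
qed

lemma Idr_PER: assumes "C \<in> Ob X" shows "PER (Idr C)"
  unfolding PER_def
proof (intro conjI)
  show cl: "Cl (Idr C)" using Idr_Cl[OF assms] .
  show "Idr C \<odot> Idr C \<subseteq> Idr C" by (rule comp_least[OF cl]) (rule Idr_subst[OF _ assms _ cl])
  show "cv (Idr C) \<subseteq> Idr C"
  proof (clarsimp)
    fix \<theta> x y assume xy: "(\<theta>, y, x) \<in> Idr C"
    note h = extD[OF xy[unfolded Idr_def]]
    have "(\<theta>, y, y) \<in> cv (Idr C)" using Idr_refl[OF h(2,1)] by simp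
    then have "(\<theta>, x, y) \<in> Idr C \<longleftrightarrow> (\<theta>, y, x) \<in> cv (Idr C)" by simp
    moreover have "(\<theta>, x, x) \<in> cv (Idr C)" using Idr_refl[OF h(3,1)] by simp
    ultimately show "(\<theta>, x, y) \<in> Idr C" using Idr_subst[OF xy assms _ cv_Cl[OF cl]] by blast
  qed
qed

lemma per_equality: "C \<in> Ob X \<Longrightarrow> per F (C, equality F C)"
  using per_iff Idr_PER equality_fib unfolding Idr_def by blast

section \<open>The universe of relations and its closure properties\<close>

definition Rel :: "'o \<Rightarrow> 'o \<Rightarrow> ('p \<times> 'm \<times> 'm) set set" where
  "Rel C D = {ext C D \<phi> | \<phi>. C \<in> Ob X \<and> D \<in> Ob X \<and> \<phi> \<in> fib (prd X C D)}"

text \<open>The empty set is added so that \<open>Rl\<close> is closed under composites of non-composable relations.\<close>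

definition Rl :: "('p \<times> 'm \<times> 'm) set set" where "Rl = {P. P = {} \<or> (\<exists>C D. P \<in> Rel C D)}"

lemma RelI: "C \<in> Ob X \<Longrightarrow> D \<in> Ob X \<Longrightarrow> \<phi> \<in> fib (prd X C D) \<Longrightarrow> ext C D \<phi> \<in> Rel C D"
  by (auto simp: Rel_def)

lemma Rel_typed: "P \<in> Rel C D \<Longrightarrow> (\<theta>, a, b) \<in> P \<Longrightarrow> \<theta> \<in> fib (base \<theta>) \<and> a \<in> Hom X (base \<theta>) C \<and> b \<in> Hom X (base \<theta>) D"
  unfolding Rel_def using extD by blast

lemma Rel_Ob: "P \<in> Rel C D \<Longrightarrow> C \<in> Ob X" "P \<in> Rel C D \<Longrightarrow> D \<in> Ob X"
  by (auto simp: Rel_def)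

lemma Rel_Rl: "P \<in> Rel C D \<Longrightarrow> P \<in> Rl" by (auto simp: Rl_def)

lemma Cl_empty: "Cl {}" by (simp add: Cl_def)

lemma Rl_Cl: "P \<in> Rl \<Longrightarrow> Cl P" using ext_Cl Cl_empty by (auto simp: Rl_def Rel_def)

lemma Rel_Cl: "P \<in> Rel C D \<Longrightarrow> Cl P" using Rl_Cl Rel_Rl by blast

lemma RelE:
  assumes "P \<in> Rel C D"
  obtains \<phi> where "C \<in> Ob X" "D \<in> Ob X" "\<phi> \<in> fib (prd X C D)" "P = ext C D \<phi>"
  using assms by (auto simp: Rel_def)

lemma Rel_comp: assumes "P \<in> Rel C D" "Q \<in> Rel D E" shows "P \<odot> Q \<in> Rel C E"
proof -
  obtain \<phi> where f: "C \<in> Ob X" "D \<in> Ob X" "\<phi> \<in> fib (prd X C D)" "P = ext C D \<phi>" using RelE[OF assms(1)] .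
  obtain \<psi> where g: "D \<in> Ob X" "E \<in> Ob X" "\<psi> \<in> fib (prd X D E)" "Q = ext D E \<psi>" using RelE[OF assms(2)] .
  show ?thesis using RelI[OF f(1) g(2) relcomp_fib[OF f(3) g(3) f(1) g(1,2)]]
      ext_relcomp[OF f(3) g(3) f(1) g(1,2)] f(4) g(4) by simp
qed

lemma Rel_cv: assumes "P \<in> Rel C D" shows "cv P \<in> Rel D C"
proof -
  obtain \<phi> where f: "C \<in> Ob X" "D \<in> Ob X" "\<phi> \<in> fib (prd X C D)" "P = ext C D \<phi>" using RelE[OF assms] .
  show ?thesis using RelI[OF f(2,1) inst2_fib[OF pr2H[OF f(2,1)] pr1H[OF f(2,1)] f(3)]] ext_cv[OF f(3,1,2)] f(4)
    by simp
qed

lemma Rel_Int: assumes "P \<in> Rel C D" "Q \<in> Rel C D" shows "P \<inter> Q \<in> Rel C D"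
proof -
  obtain \<phi> where f: "C \<in> Ob X" "D \<in> Ob X" "\<phi> \<in> fib (prd X C D)" "P = ext C D \<phi>" using RelE[OF assms(1)] .
  obtain \<psi> where g: "\<psi> \<in> fib (prd X C D)" "Q = ext C D \<psi>" using RelE[OF assms(2)] .
  show ?thesis using RelI[OF f(1,2) Meet_fib[OF f(3) g(1)]] ext_Meet[OF f(3) g(1)] f(4) g(2) by simp
qed

lemma Rel_Idr: "C \<in> Ob X \<Longrightarrow> Idr C \<in> Rel C C"
  unfolding Idr_def using RelI equality_fib by blast

lemma gr_fib: "u \<in> Hom X I J \<Longrightarrow> inst2 F (equality F J) (u \<cdot> pr1 X I J) (pr2 X I J) \<in> fib (prd X I J)"
  using inst2_fib[OF cmpH[OF _ pr1H[OF HomOb]] pr2H[OF HomOb] equality_fib[OF HomOb(2)]] .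

lemma gr_ext: "u \<in> Hom X I J \<Longrightarrow> gr u = ext I J (inst2 F (equality F J) (u \<cdot> pr1 X I J) (pr2 X I J))"
  by (simp add: gr_def Let_def Hom_def)

lemma Rel_gr: "u \<in> Hom X I J \<Longrightarrow> gr u \<in> Rel I J"
  using RelI[OF HomOb gr_fib] gr_ext by metis

text \<open>A nonempty composite has a common middle element, whose codomain is unique, so the two
  types match and the typed statement applies.\<close>

lemma Rl_comp: assumes "P \<in> Rl" "Q \<in> Rl" shows "P \<odot> Q \<in> Rl"
proof (cases "P \<odot> Q = {}")
  case True then show ?thesis by (simp add: Rl_def)
next
  case False
  then obtain \<theta> a b c where "(\<theta>, a, b) \<in> P" "(\<theta>, b, c) \<in> Q" unfolding comp_def by blast
  moreover from this obtain C D D' E where "P \<in> Rel C D" "Q \<in> Rel D' E" using assms by (auto simp: Rl_def)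
  moreover from calculation have "D = D'" using Rel_typed HomD(3) by metis
  ultimately show ?thesis using Rel_comp Rel_Rl by blast
qed

lemma cv_empty [simp]: "cv {} = {}" by (simp add: cv_def)

lemma Rl_cv: "P \<in> Rl \<Longrightarrow> cv P \<in> Rl"
  unfolding Rl_def mem_Collect_eq using Rel_cv cv_empty by metis

lemma Rl_Int: assumes "P \<in> Rl" "Q \<in> Rl" shows "P \<inter> Q \<in> Rl"
proof (cases "P \<inter> Q = {}")
  case True then show ?thesis by (simp add: Rl_def)
next
  case False
  then obtain \<theta> a b where "(\<theta>, a, b) \<in> P" "(\<theta>, a, b) \<in> Q" by auto
  moreover from this obtain C D C' D' where "P \<in> Rel C D" "Q \<in> Rel C' D'" using assms by (auto simp: Rl_def)
  moreover from calculation have "C = C' \<and> D = D'" using Rel_typed HomD(3) by metis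
  ultimately show ?thesis using Rel_Int Rel_Rl by blast
qed

lemma Rl_Idr: "C \<in> Ob X \<Longrightarrow> Idr C \<in> Rl" using Rel_Idr Rel_Rl by blast

lemma Rl_assoc: "P \<in> Rl \<Longrightarrow> Q \<in> Rl \<Longrightarrow> R \<in> Rl \<Longrightarrow> (P \<odot> Q) \<odot> R = P \<odot> Q \<odot> R"
  using comp_assoc Rl_Cl by blast

lemma Idr_left: assumes "P \<in> Rel C D" shows "Idr C \<odot> P = P"
proof
  note C = Rel_Ob(1)[OF assms]
  show "Idr C \<odot> P \<subseteq> P" by (rule comp_least[OF Rel_Cl[OF assms]]) (rule Idr_subst[OF _ C _ Rel_Cl[OF assms]])
  show "P \<subseteq> Idr C \<odot> P"
  proof clarify
    fix \<theta> a b assume e: "(\<theta>, a, b) \<in> P"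
    show "(\<theta>, a, b) \<in> Idr C \<odot> P"
      using comp_intro[OF Idr_refl e Idr_Cl[OF C] Rel_Cl[OF assms]] Rel_typed[OF assms e] by blast
  qed
qed

lemma cv_Idr: "C \<in> Ob X \<Longrightarrow> cv (Idr C) = Idr C" using PER_simps(2)[OF Idr_PER] .

lemma Idr_right: assumes "P \<in> Rel C D" shows "P \<odot> Idr D = P"
proof -
  have "cv (P \<odot> Idr D) = Idr D \<odot> cv P" using cv_Idr[OF Rel_Ob(2)[OF assms]] by (simp add: cv_comp)
  also have "\<dots> = cv P" using Idr_left[OF Rel_cv[OF assms]] .
  finally show ?thesis by (metis cv_cv)
qed

section \<open>Graphs of arrows: composition, pullbacks, regular epis\<close>

lemma gr_iff:
  assumes "u \<in> Hom X I J" "a \<in> Hom X Z I" "b \<in> Hom X Z J" "\<theta> \<in> fib Z"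
  shows "(\<theta>, a, b) \<in> gr u \<longleftrightarrow> (\<theta>, u \<cdot> a, b) \<in> Idr J"
proof -
  note o = HomOb[OF assms(1)]
  note p = pr1H[OF o] and q = pr2H[OF o]
  show ?thesis
    using ext_inst2[OF cmpH[OF assms(1) p] q equality_fib[OF o(2)] assms(4,2,3)] gr_ext[OF assms(1)]
      pr1_pair[OF assms(2,3)] pr2_pair[OF assms(2,3)] cmp_assoc[OF pairH[OF assms(2,3)] p assms(1)]
    unfolding Idr_def by simp
qed

lemma gr_intro: "u \<in> Hom X I J \<Longrightarrow> a \<in> Hom X Z I \<Longrightarrow> \<theta> \<in> fib Z \<Longrightarrow> (\<theta>, a, u \<cdot> a) \<in> gr u"
  using gr_iff[OF _ _ cmpH] Idr_refl[OF cmpH] by blast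

lemma gr_total: assumes "u \<in> Hom X I J" shows "Idr I \<subseteq> gr u \<odot> cv (gr u)"
proof -
  note g = Rel_gr[OF assms] note I = HomOb(1)[OF assms]
  have "(\<theta>, a, b) \<in> gr u \<odot> cv (gr u)" if e: "(\<theta>, a, b) \<in> Idr I" for \<theta> a b
  proof -
    note h = extD(1-3)[OF e[unfolded Idr_def]]
    have "(\<theta>, b, b) \<in> gr u \<odot> cv (gr u)"
      using comp_intro[OF gr_intro[OF assms h(3,1)] _ Rel_Cl[OF g] cv_Cl[OF Rel_Cl[OF g]]]
        gr_intro[OF assms h(3,1)] by simp
    then show ?thesis using Idr_subst[OF e I _ comp_Cl[OF Rel_Cl[OF g] cv_Cl[OF Rel_Cl[OF g]]]] by blast
  qed
  then show ?thesis by auto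
qed

lemma gr_single_valued: assumes "u \<in> Hom X I J" shows "cv (gr u) \<odot> gr u \<subseteq> Idr J"
proof (rule comp_least[OF Idr_Cl[OF HomOb(2)[OF assms]]])
  note J = HomOb(2)[OF assms]
  fix \<theta> b a b' assume e: "(\<theta>, b, a) \<in> cv (gr u)" "(\<theta>, a, b') \<in> gr u"
  then have e': "(\<theta>, a, b) \<in> gr u" by simp
  have h: "\<theta> \<in> fib (base \<theta>)" "a \<in> Hom X (base \<theta>) I" "b \<in> Hom X (base \<theta>) J" "b' \<in> Hom X (base \<theta>) J"
    using Rel_typed[OF Rel_gr[OF assms]] e e' by blast+
  have "(\<theta>, u \<cdot> a, b) \<in> Idr J" "(\<theta>, u \<cdot> a, b') \<in> Idr J"
    using gr_iff[OF assms h(2,3,1)] gr_iff[OF assms h(2,4,1)] e e' by blast+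
  then show "(\<theta>, b, b') \<in> Idr J" using Idr_subst[OF _ J _ Idr_Cl[OF J]] cv_Idr[OF J] cv_iff by metis
qed

lemma gr_Ident: "C \<in> Ob X \<Longrightarrow> gr (Ident X C) = Idr C"
proof -
  assume C: "C \<in> Ob X"
  have "(\<theta>, a, b) \<in> gr (Ident X C) \<longleftrightarrow> (\<theta>, a, b) \<in> Idr C"
    if "\<theta> \<in> fib (base \<theta>) \<and> a \<in> Hom X (base \<theta>) C \<and> b \<in> Hom X (base \<theta>) C" for \<theta> a b
    using gr_iff[OF idH[OF C], of a "base \<theta>" b \<theta>] cmp_idl[of a "base \<theta>" C] that by simp
  then have "(\<theta>, a, b) \<in> gr (Ident X C) \<longleftrightarrow> (\<theta>, a, b) \<in> Idr C" for \<theta> a b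
    using Rel_typed[OF Rel_gr[OF idH[OF C]], of \<theta> a b] Rel_typed[OF Rel_Idr[OF C], of \<theta> a b] by blast
  then show ?thesis by auto
qed

lemma gr_comp: assumes "u \<in> Hom X I J" "v \<in> Hom X J K" shows "gr (v \<cdot> u) = gr u \<odot> gr v"
proof
  note c = cmpH[OF assms(2,1)] note K = HomOb(2)[OF assms(2)] and J = HomOb(1)[OF assms(2)]
  note ru = Rel_gr[OF assms(1)] and rv = Rel_gr[OF assms(2)] and rc = Rel_gr[OF c]
  show "gr (v \<cdot> u) \<subseteq> gr u \<odot> gr v"
  proof clarify
    fix \<theta> a b assume e: "(\<theta>, a, b) \<in> gr (v \<cdot> u)"
    have h: "\<theta> \<in> fib (base \<theta>)" "a \<in> Hom X (base \<theta>) I" "b \<in> Hom X (base \<theta>) K" using Rel_typed[OF rc e] by auto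
    have "(\<theta>, v \<cdot> (u \<cdot> a), b) \<in> Idr K" using gr_iff[OF c h(2,3,1)] e cmp_assoc[OF h(2) assms] by simp
    then have "(\<theta>, u \<cdot> a, b) \<in> gr v" using gr_iff[OF assms(2) cmpH[OF assms(1) h(2)] h(3,1)] by blast
    then show "(\<theta>, a, b) \<in> gr u \<odot> gr v"
      using comp_intro[OF gr_intro[OF assms(1) h(2,1)] _ Rel_Cl[OF ru] Rel_Cl[OF rv]] by blast
  qed
  show "gr u \<odot> gr v \<subseteq> gr (v \<cdot> u)"
  proof (rule comp_least[OF Rel_Cl[OF rc]])
    fix \<theta> a b c assume e: "(\<theta>, a, b) \<in> gr u" "(\<theta>, b, c) \<in> gr v"
    have h: "\<theta> \<in> fib (base \<theta>)" "a \<in> Hom X (base \<theta>) I" "b \<in> Hom X (base \<theta>) J" "c \<in> Hom X (base \<theta>) K"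
      using Rel_typed[OF ru e(1)] Rel_typed[OF rv e(2)] by auto
    have "(\<theta>, u \<cdot> a, b) \<in> Idr J" using gr_iff[OF assms(1) h(2,3,1)] e(1) by blast
    then have "(\<theta>, u \<cdot> a, c) \<in> gr v" using Idr_subst[OF _ J e(2) Rel_Cl[OF rv]] by blast
    then have "(\<theta>, v \<cdot> (u \<cdot> a), c) \<in> Idr K" using gr_iff[OF assms(2) cmpH[OF assms(1) h(2)] h(4,1)] by blast
    then show "(\<theta>, a, c) \<in> gr (v \<cdot> u)" using gr_iff[OF c h(2,4,1)] cmp_assoc[OF h(2) assms] by simp
  qed
qed

text \<open>Forced equality of \<open>f \<cdot> a\<close> and \<open>g \<cdot> b\<close> is actual
  equality on a cover, and there the pair factors through the pullback. Applied to a kernel pair,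
  this bounds the kernel of a quotient.\<close>

lemma gr_pullback:
  assumes "is_pullback X f g p q" "f \<in> Hom X A C" "g \<in> Hom X B C"
  shows "gr f \<odot> cv (gr g) \<subseteq> cv (gr p) \<odot> gr q"
proof -
  have g': "Dom X g = B" using HomD[OF assms(3)] by simp
  note P = pullback_Hom[OF assms(1,2), unfolded g']
  note rf = Rel_gr[OF assms(2)] and rg = Rel_gr[OF assms(3)] and rp = Rel_gr[OF P(2)] and rq = Rel_gr[OF P(3)]
  note C = HomOb(2)[OF assms(2)]
  note cl = comp_Cl[OF cv_Cl[OF Rel_Cl[OF rp]] Rel_Cl[OF rq]]
  show ?thesis
  proof (rule comp_least[OF cl])
    fix \<theta> a c b assume e: "(\<theta>, a, c) \<in> gr f" "(\<theta>, c, b) \<in> cv (gr g)"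
    then have e': "(\<theta>, b, c) \<in> gr g" by simp
    have h: "\<theta> \<in> fib (base \<theta>)" "a \<in> Hom X (base \<theta>) A" "b \<in> Hom X (base \<theta>) B" "c \<in> Hom X (base \<theta>) C"
      using Rel_typed[OF rf e(1)] Rel_typed[OF rg e'] by auto
    have "(\<theta>, f \<cdot> a, c) \<in> Idr C" "(\<theta>, c, g \<cdot> b) \<in> Idr C"
      using gr_iff[OF assms(2) h(2,4,1)] gr_iff[OF assms(3) h(3,4,1)] e e' cv_Idr[OF C] cv_iff by metis+
    then have "(\<theta>, f \<cdot> a, g \<cdot> b) \<in> Idr C" using Idr_subst[OF _ C _ Idr_Cl[OF C]] by blast
    then obtain W w \<chi> where w: "w \<in> Hom X W (base \<theta>)" and ch: "\<chi> \<in> fib W" "\<chi> \<preceq> rx w \<theta>" "\<theta> \<preceq> Exists F w \<chi>"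
      and eq: "f \<cdot> a \<cdot> w = g \<cdot> b \<cdot> w" using Idr_elim[OF _ C] by metis
    have "f \<cdot> (a \<cdot> w) = g \<cdot> (b \<cdot> w)" using eq cmp_assoc[OF w h(2) assms(2)] cmp_assoc[OF w h(3) assms(3)] by simp
    then obtain k where k: "k \<in> Hom X W (Dom X p)" "p \<cdot> k = a \<cdot> w" "q \<cdot> k = b \<cdot> w"
      using pullback_univ[OF assms(1) catX, of "a \<cdot> w" W "b \<cdot> w"] cmpH[OF h(2) w] cmpH[OF h(3) w]
        HomD[OF assms(2)] HomD[OF assms(3)] by auto
    have "(\<chi>, a \<cdot> w, k) \<in> cv (gr p)" "(\<chi>, k, b \<cdot> w) \<in> gr q"
      using gr_intro[OF P(2) k(1) ch(1)] gr_intro[OF P(3) k(1) ch(1)] k by auto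
    then have "(\<chi>, a \<cdot> w, b \<cdot> w) \<in> cv (gr p) \<odot> gr q"
      using comp_intro[OF _ _ cv_Cl[OF Rel_Cl[OF rp]] Rel_Cl[OF rq]] by blast
    then show "(\<theta>, a, b) \<in> cv (gr p) \<odot> gr q" using Cl_local[OF cl spnI[OF h(1-3)] w ch(2,3)] by blast
  qed
qed

text \<open>The entry point of the pre-stack condition: reindexed along \<open>e\<close>, the
  inequality is the unit of the adjunction between \<open>Exists F e\<close> and
  \<open>reindex F e\<close>.\<close>

lemma regular_epi_cover:
  assumes "regular_epi X e" "e \<in> Hom X W Z" "\<theta> \<in> fib Z"
  shows "\<theta> \<preceq> Exists F e (rx e \<theta>)"
  using pre_stack[OF assms Exists_fib[OF assms(2) rx_fib[OF assms(2,3)]] Exists_unit[OF assms(2) rx_fib[OF assms(2,3)]]] .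

text \<open>An element of \<open>J\<close> lifts to \<open>I\<close> along the pullback of
  \<open>e\<close>, which is again a regular epi and hence a cover.\<close>

lemma gr_regular_epi:
  assumes "regular_epi X e" "e \<in> Hom X I J"
  shows "Idr J \<subseteq> cv (gr e) \<odot> gr e"
proof -
  note re = Rel_gr[OF assms(2)] note J = HomOb(2)[OF assms(2)]
  note cl = comp_Cl[OF cv_Cl[OF Rel_Cl[OF re]] Rel_Cl[OF re]]
  have "(\<theta>, x, y) \<in> cv (gr e) \<odot> gr e" if xy: "(\<theta>, x, y) \<in> Idr J" for \<theta> x y
  proof -
    note h = extD(1-3)[OF xy[unfolded Idr_def]]
    obtain W v w where v: "v \<in> Hom X W I" and w: "w \<in> Hom X W (base \<theta>)" and eq: "e \<cdot> v = y \<cdot> w"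
      and pb: "is_pullback X e y v w" using pullback_ex[OF assms(2) h(3)] by metis
    have rw: "regular_epi X w" using regular_epi_stable[OF assms(1) pb] .
    note ch = rx_fib[OF w h(1)]
    have "(rx w \<theta>, v, y \<cdot> w) \<in> gr e" using gr_intro[OF assms(2) v ch] eq by simp
    then have "(rx w \<theta>, y \<cdot> w, y \<cdot> w) \<in> cv (gr e) \<odot> gr e"
      using comp_intro[OF _ _ cv_Cl[OF Rel_Cl[OF re]] Rel_Cl[OF re]] cv_iff by blast
    then have "(\<theta>, y, y) \<in> cv (gr e) \<odot> gr e"
      using Cl_local[OF cl spnI[OF h(1,3,3)] w ent_refl[OF ch] regular_epi_cover[OF rw w h(1)]] by blast
    then show ?thesis using Idr_subst[OF xy J _ cl] by blast
  qed
  then show ?thesis by auto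
qed

end

section \<open>Subobjects\<close>

lemma sub_fib_simps [simp]:
  "Ob (Tot (sub_fib C)) = {m. mono_arr C m}" "Base (sub_fib C) = C" "Fob (Proj (sub_fib C)) m = Cod C m"
  by (simp_all add: sub_fib_def)

lemma fibre_sub_fib: "m \<in> fibre (sub_fib C) I \<longleftrightarrow> mono_arr C m \<and> Cod C m = I"
  by (simp add: fibre_def)

lemma sub_over_iff:
  "(\<exists>f\<in>Hom (Tot (sub_fib C)) m n. Far (Proj (sub_fib C)) f = u) \<longleftrightarrow>
    mono_arr C m \<and> mono_arr C n \<and> u \<in> Hom C (Cod C m) (Cod C n) \<and>
    (\<exists>h\<in>Hom C (Dom C m) (Dom C n). n \<cdot>\<^bsub>C\<^esub> h = u \<cdot>\<^bsub>C\<^esub> m)"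
  by (auto simp: sub_fib_def Hom_def)

lemma sub_ent_iff:
  assumes "category C" "m \<in> Hom C U I" "n \<in> Hom C V I"
  shows "m \<turnstile>\<^bsub>sub_fib C\<^esub> n \<longleftrightarrow> mono_arr C m \<and> mono_arr C n \<and> (\<exists>h\<in>Hom C U V. n \<cdot>\<^bsub>C\<^esub> h = m)"
  unfolding entails_def sub_over_iff sub_fib_simps
  using HomD[OF assms(2)] HomD[OF assms(3)] Ident_Hom[OF assms(1) Hom_Ob(2)[OF assms(1,2)]]
    comp_Ident_left[OF assms(1,2)] by auto

lemma is_top_sub_iff:
  assumes "category C" "I \<in> Ob C"
  shows "is_top (sub_fib C) I t \<longleftrightarrow> mono_arr C t \<and> Cod C t = I \<and> (\<exists>h\<in>Hom C I (Dom C t). t \<cdot>\<^bsub>C\<^esub> h = Ident C I)"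
proof -
  have ar: "mono_arr C m \<Longrightarrow> Cod C m = I \<Longrightarrow> m \<in> Hom C (Dom C m) I" for m
    by (auto simp: mono_arr_def Hom_def)
  note i = Ident_Hom[OF assms] and mi = mono_Ident[OF assms]
  show ?thesis
  proof
    assume t: "is_top (sub_fib C) I t"
    then have t': "mono_arr C t" "Cod C t = I" by (auto simp: is_top_def fibre_sub_fib)
    have "Ident C I \<in> fibre (sub_fib C) I" using i mi by (simp add: fibre_sub_fib Hom_def)
    then have "Ident C I \<turnstile>\<^bsub>sub_fib C\<^esub> t" using t by (simp add: is_top_def)
    then show "mono_arr C t \<and> Cod C t = I \<and> (\<exists>h\<in>Hom C I (Dom C t). t \<cdot>\<^bsub>C\<^esub> h = Ident C I)"
      using sub_ent_iff[OF assms(1) i ar[OF t']] t' by blast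
  next
    assume "mono_arr C t \<and> Cod C t = I \<and> (\<exists>h\<in>Hom C I (Dom C t). t \<cdot>\<^bsub>C\<^esub> h = Ident C I)"
    then obtain h where t: "mono_arr C t" "Cod C t = I" and h: "h \<in> Hom C I (Dom C t)" "t \<cdot>\<^bsub>C\<^esub> h = Ident C I"
      by blast
    have "m \<turnstile>\<^bsub>sub_fib C\<^esub> t" if m: "mono_arr C m" "Cod C m = I" for m
    proof -
      have "h \<cdot>\<^bsub>C\<^esub> m \<in> Hom C (Dom C m) (Dom C t)" using comp_Hom[OF assms(1) h(1) ar[OF m]] .
      moreover have "t \<cdot>\<^bsub>C\<^esub> (h \<cdot>\<^bsub>C\<^esub> m) = m"
        using comp_assoc_Hom[OF assms(1) ar[OF m] h(1) ar[OF t]] h(2) comp_Ident_left[OF assms(1) ar[OF m]] by simp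
      ultimately show ?thesis using sub_ent_iff[OF assms(1) ar[OF m] ar[OF t]] m t by blast
    qed
    then show "is_top (sub_fib C) I t" using t by (simp add: is_top_def fibre_sub_fib)
  qed
qed

lemma is_top_sub_Top:
  assumes "category C" "I \<in> Ob C"
  shows "is_top (sub_fib C) I (Top (sub_fib C) I)"
proof -
  have "is_top (sub_fib C) I (Ident C I)"
    unfolding is_top_sub_iff[OF assms] using mono_Ident[OF assms] Ident_Hom[OF assms]
      comp_Ident_left[OF assms(1) Ident_Hom[OF assms]] by (auto simp: Hom_def)
  then show ?thesis unfolding Top_def by (rule someI)
qed

text \<open>\<open>Top\<close> is an arbitrary top subobject, so comparison with it is restated as
  the existence of a section. This serves the base, for dense predicates, and
  \<open>per_cat F\<close>, for dense monos.\<close>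

lemma eqv_Top_sub:
  assumes "category C" "m \<in> Hom C U I" "mono_arr C m"
  shows "m \<cong>\<^bsub>sub_fib C\<^esub> Top (sub_fib C) I \<longleftrightarrow> (\<exists>h\<in>Hom C I U. m \<cdot>\<^bsub>C\<^esub> h = Ident C I)"
proof -
  note I = Hom_Ob(2)[OF assms(1,2)]
  let ?t = "Top (sub_fib C) I"
  have t: "is_top (sub_fib C) I ?t" using is_top_sub_Top[OF assms(1) I] .
  then have tm: "mono_arr C ?t" "Cod C ?t = I" by (auto simp: is_top_def fibre_sub_fib)
  then have tH: "?t \<in> Hom C (Dom C ?t) I" by (auto simp: mono_arr_def Hom_def)
  have mt: "m \<turnstile>\<^bsub>sub_fib C\<^esub> ?t" using t assms(2,3) by (simp add: is_top_def fibre_sub_fib Hom_def)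
  show ?thesis
  proof
    assume "m \<cong>\<^bsub>sub_fib C\<^esub> ?t"
    then obtain k where k: "k \<in> Hom C (Dom C ?t) U" "m \<cdot>\<^bsub>C\<^esub> k = ?t"
      using sub_ent_iff[OF assms(1) tH assms(2)] unfolding eqv_def by blast
    obtain h where h: "h \<in> Hom C I (Dom C ?t)" "?t \<cdot>\<^bsub>C\<^esub> h = Ident C I"
      using t unfolding is_top_sub_iff[OF assms(1) I] by blast
    show "\<exists>h\<in>Hom C I U. m \<cdot>\<^bsub>C\<^esub> h = Ident C I"
      using comp_Hom[OF assms(1) k(1) h(1)] comp_assoc_Hom[OF assms(1) h(1) k(1) assms(2)] k(2) h(2) by metis
  next
    assume "\<exists>h\<in>Hom C I U. m \<cdot>\<^bsub>C\<^esub> h = Ident C I"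
    then obtain h where h: "h \<in> Hom C I U" "m \<cdot>\<^bsub>C\<^esub> h = Ident C I" by blast
    have "h \<cdot>\<^bsub>C\<^esub> ?t \<in> Hom C (Dom C ?t) U" "m \<cdot>\<^bsub>C\<^esub> (h \<cdot>\<^bsub>C\<^esub> ?t) = ?t"
      using comp_Hom[OF assms(1) h(1) tH] comp_assoc_Hom[OF assms(1) tH h(1) assms(2)] h(2)
        comp_Ident_left[OF assms(1) tH] by auto
    then have "?t \<turnstile>\<^bsub>sub_fib C\<^esub> m" using sub_ent_iff[OF assms(1) tH assms(2)] tm(1) assms(3) by blast
    then show "m \<cong>\<^bsub>sub_fib C\<^esub> ?t" using mt by (simp add: eqv_def)
  qed
qed

section \<open>The dense closure of a predicate\<close>

locale tcframe = fframe F for F :: "('p, 'e, 'o, 'm) fibn" +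
  fixes \<pi> :: "'p \<Rightarrow> 'm"
  assumes exactX: "exact_category (Base F)"
    and conn: "connected_components F \<pi>"
begin

abbreviation sub where "sub \<equiv> sub_fib X"
abbreviation box where "box \<phi> \<equiv> delta F (\<pi> \<phi>)"

lemma monoH: "mono_arr X m \<Longrightarrow> m \<in> Hom X (Dom X m) (Cod X m)" by (simp add: mono_arr_def Hom_def)

lemma delta_eq: "m \<in> Hom X U I \<Longrightarrow> delta F m = Exists F m (Top F U)" by (simp add: delta_def Hom_def)

lemma delta_fib: "m \<in> Hom X U I \<Longrightarrow> delta F m \<in> fib I"
  using delta_eq Exists_fib Top_fib HomOb(1) by metis

lemma delta_intro: assumes "m \<in> Hom X U I" "y \<in> Hom X Z U" "\<theta> \<in> fib Z" shows "\<theta> \<preceq> rx (m \<cdot> y) (delta F m)"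
  using Exists_intro[OF ent_rx_Top[OF assms(2,3)] assms(2,1) Top_fib[OF HomOb(1)[OF assms(1)]]] delta_eq[OF assms(1)]
  by simp

lemma delta_elim:
  assumes "\<theta> \<preceq> rx x (delta F m)" "x \<in> Hom X Z I" "m \<in> Hom X U I"
  obtains W w y \<chi> where "w \<in> Hom X W Z" "\<chi> \<in> fib W" "\<chi> \<preceq> rx w \<theta>" "\<theta> \<preceq> Exists F w \<chi>" "y \<in> Hom X W U" "m \<cdot> y = x \<cdot> w"
proof -
  obtain W w y \<chi> where a: "w \<in> Hom X W Z" "y \<in> Hom X W U" "m \<cdot> y = x \<cdot> w" "\<chi> \<preceq> rx w \<theta>" "\<theta> \<preceq> Exists F w \<chi>"
    using Exists_elim[OF assms(1)[unfolded delta_eq[OF assms(3)]] assms(2,3) Top_fib[OF HomOb(1)[OF assms(3)]]]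
    by metis
  have th: "\<theta> \<in> fib Z" using ent_fib[OF assms(1)] rx_fib[OF assms(2) delta_fib[OF assms(3)]] by simp
  show ?thesis using that[OF a(1) _ a(4,5,2,3)] ent_fib[OF a(4)] rx_fib[OF a(1) th] by simp
qed

lemma delta_least:
  assumes "m \<in> Hom X U I" "\<chi> \<in> fib I" "\<And>\<theta>. \<theta> \<in> fib U \<Longrightarrow> \<theta> \<preceq> rx m \<chi>"
  shows "delta F m \<preceq> \<chi>"
  using Exists_ent[OF assms(1) Top_fib[OF HomOb(1)[OF assms(1)]] assms(2)] assms(3) Top_fib[OF HomOb(1)[OF assms(1)]]
    delta_eq[OF assms(1)] by simp

lemma delta_mono:
  assumes "m \<in> Hom X U I" "n \<in> Hom X V I" "h \<in> Hom X U V" "n \<cdot> h = m"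
  shows "delta F m \<preceq> delta F n"
  by (rule delta_least[OF assms(1) delta_fib[OF assms(2)]]) (use delta_intro[OF assms(2,3)] assms(4) in simp)

lemma delta_pullback:
  assumes "is_pullback X m u p q" "m \<in> Hom X U I" "u \<in> Hom X J I"
  shows "rx u (delta F m) \<preceq> delta F q" "delta F q \<preceq> rx u (delta F m)"
proof -
  have J: "Dom X u = J" using HomD[OF assms(3)] by simp
  note P = pullback_Hom[OF assms(1,2), unfolded J]
  note q = P(3) and p = P(2) and um = P(4)
  note dm = delta_fib[OF assms(2)]
  note U = Top_fib[OF HomOb(1)[OF assms(2)]] and Q = Top_fib[OF HomOb(1)[OF q]]
  have "Exists F q (rx p (Top F U)) \<preceq> delta F q"
    unfolding delta_eq[OF q] using Exists_mono[OF q Q ent_Top[OF rx_fib[OF p U]]] .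
  then show "rx u (delta F m) \<preceq> delta F q"
    using Beck_Chevalley[OF assms(1,2) U] delta_eq[OF assms(2)] ent_trans by metis
  show "delta F q \<preceq> rx u (delta F m)"
  proof (rule delta_least[OF q rx_fib[OF assms(3) dm]])
    fix \<theta> assume t: "\<theta> \<in> fib (Dom X p)"
    show "\<theta> \<preceq> rx q (rx u (delta F m))"
      using ent_rx_rx[OF assms(3) dm q t] delta_intro[OF assms(2) p t] um by simp
  qed
qed

section \<open>The left adjoint of \<open>delta\<close> and the induced closure of
  predicates\<close>

lemma pi_mono_arr: assumes "\<phi> \<in> fib I" shows "mono_arr X (\<pi> \<phi>)" "\<pi> \<phi> \<in> Hom X (Dom X (\<pi> \<phi>)) I"
proof -
  have "\<pi> \<phi> \<in> fibre sub I" using conn assms fib_Ob[OF assms]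
    unfolding connected_components_def fibered_monotone_def by blast
  then show "mono_arr X (\<pi> \<phi>)" "\<pi> \<phi> \<in> Hom X (Dom X (\<pi> \<phi>)) I" using monoH by (auto simp: fibre_sub_fib)
qed

lemma box_fib: "\<phi> \<in> fib I \<Longrightarrow> box \<phi> \<in> fib I"
  using delta_fib pi_mono_arr(2) by blast

lemma pi_adj:
  assumes "\<phi> \<in> fib I" "mono_arr X m" "m \<in> Hom X U I"
  shows "\<phi> \<preceq> delta F m \<longleftrightarrow> (\<exists>h\<in>Hom X (Dom X (\<pi> \<phi>)) U. m \<cdot> h = \<pi> \<phi>)"
proof -
  have "m \<in> fibre sub I" using assms(2) HomD[OF assms(3)] by (simp add: fibre_sub_fib)
  then have "(\<pi> \<phi> \<turnstile>\<^bsub>sub\<^esub> m) \<longleftrightarrow> \<phi> \<preceq> delta F m"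
    using conn assms(1) fib_Ob[OF assms(1)] unfolding connected_components_def by blast
  then show ?thesis using sub_ent_iff[OF catX pi_mono_arr(2)[OF assms(1)] assms(3)] assms(2) pi_mono_arr(1)[OF assms(1)]
    by blast
qed

lemma box_unit: "\<phi> \<in> fib I \<Longrightarrow> \<phi> \<preceq> box \<phi>"
  using pi_adj[OF _ pi_mono_arr] idH[OF HomOb(1)[OF pi_mono_arr(2)]] cmp_idr[OF pi_mono_arr(2)] by blast

lemma box_least: "\<phi> \<in> fib I \<Longrightarrow> mono_arr X m \<Longrightarrow> m \<in> Hom X U I \<Longrightarrow> \<phi> \<preceq> delta F m \<Longrightarrow> box \<phi> \<preceq> delta F m"
  using pi_adj delta_mono[OF pi_mono_arr(2)] by blast

lemma box_mono: "\<phi> \<preceq> \<psi> \<Longrightarrow> \<psi> \<in> fib I \<Longrightarrow> box \<phi> \<preceq> box \<psi>"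
  using box_least[OF _ pi_mono_arr, of \<phi> I \<psi>] ent_fib[of \<phi> \<psi> I] box_unit[of \<psi> I] ent_trans by blast

lemma box_idem: "\<phi> \<in> fib I \<Longrightarrow> box (box \<phi>) \<preceq> box \<phi>"
  using box_least[OF box_fib pi_mono_arr] ent_refl box_fib by blast

lemma pi_Top: assumes "I \<in> Ob X" shows "\<exists>h\<in>Hom X I (Dom X (\<pi> (Top F I))). \<pi> (Top F I) \<cdot> h = Ident X I"
proof -
  have "is_top sub I (\<pi> (Top F I))"
    using conn is_top_Top[OF assms] assms unfolding connected_components_def preserves_finite_meets_def by blast
  then show ?thesis using is_top_sub_iff[OF catX assms] by blast
qed

text \<open>As \<open>\<pi>\<close> preserves the top predicate, \<open>\<delta>\<close> reflects truth.\<close>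

lemma delta_factor:
  assumes "mono_arr X m" "m \<in> Hom X U I" "x \<in> Hom X Z I" "Top F Z \<preceq> rx x (delta F m)"
  obtains h where "h \<in> Hom X Z U" "m \<cdot> h = x"
proof -
  note Z = HomOb(1)[OF assms(3)]
  obtain V p q where p: "p \<in> Hom X V U" and q: "q \<in> Hom X V Z" and c: "m \<cdot> p = x \<cdot> q" and pb: "is_pullback X m x p q"
    using pullback_ex[OF assms(2,3)] by metis
  have qm: "mono_arr X q" using pullback_mono[OF pb catX assms(1)] .
  have "Top F Z \<preceq> delta F q" using delta_pullback(1)[OF pb assms(2,3)] assms(4) ent_trans by blast
  then obtain k where k: "k \<in> Hom X (Dom X (\<pi> (Top F Z))) V" "q \<cdot> k = \<pi> (Top F Z)"
    using pi_adj[OF Top_fib[OF Z] qm q] by blast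
  obtain h where h: "h \<in> Hom X Z (Dom X (\<pi> (Top F Z)))" "\<pi> (Top F Z) \<cdot> h = Ident X Z" using pi_Top[OF Z] by blast
  note kh = cmpH[OF k(1) h(1)]
  have "q \<cdot> (k \<cdot> h) = Ident X Z" using cmp_assoc[OF h(1) k(1) q] k(2) h(2) by simp
  then have "m \<cdot> (p \<cdot> (k \<cdot> h)) = x"
    using cmp_assoc[OF kh p assms(2)] cmp_assoc[OF kh q assms(3)] c cmp_idr[OF assms(3)] by simp
  then show ?thesis using that[OF cmpH[OF p kh]] by blast
qed

text \<open>Beck-Chevalley makes \<open>delta\<close> stable, so the claim is about the pullback
  \<open>q\<close> of \<open>\<pi> \<phi>\<close>. The second inequality follows from the
  adjunction, as \<open>q\<close> is monic. For the first, \<open>\<pi>\<close> is stable relative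
  to the reindexing chosen in the subobject fibration; the pullback square is shown to be a
  cartesian lift, so that the chosen lift exists and \<open>q\<close> factors through it.\<close>

lemma box_rx:
  assumes "u \<in> Hom X J I" "\<phi> \<in> fib I"
  shows "rx u (box \<phi>) \<preceq> box (rx u \<phi>)" "box (rx u \<phi>) \<preceq> rx u (box \<phi>)"
proof -
  note m = pi_mono_arr[OF assms(2)] and r = rx_fib[OF assms]
  note n = pi_mono_arr[OF r]
  obtain V p q where p: "p \<in> Hom X V (Dom X (\<pi> \<phi>))" and q: "q \<in> Hom X V J" and c: "\<pi> \<phi> \<cdot> p = u \<cdot> q"
    and pb: "is_pullback X (\<pi> \<phi>) u p q" using pullback_ex[OF m(2) assms(1)] by metis
  have qm: "mono_arr X q" using pullback_mono[OF pb catX m(1)] .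
  note d = delta_pullback[OF pb m(2) assms(1)]
  have "rx u \<phi> \<preceq> delta F q"
    using rx_mono[OF box_unit[OF assms(2)] box_fib[OF assms(2)] assms(1)] d(1) ent_trans by blast
  then have "box (rx u \<phi>) \<preceq> delta F q" using box_least[OF r qm q] by blast
  then show "box (rx u \<phi>) \<preceq> rx u (box \<phi>)" using d(2) ent_trans by blast
  let ?s = "reindex sub u (\<pi> \<phi>)"
  define l where "l = (q, u, \<pi> \<phi>)"
  have "cartesian_lift sub u (\<pi> \<phi>) l"
    unfolding cartesian_lift_def cartesian_arr_def
  proof (intro conjI ballI impI)
    show l: "l \<in> Arr (Tot sub)" and "Cod (Tot sub) l = \<pi> \<phi>" and "Far (Proj sub) l = u"
      using qm m p c assms(1) HomD[OF q] HomD[OF p] HomD[OF m(2)] by (auto simp: l_def sub_fib_def Hom_def)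
    fix g w assume g: "g \<in> Arr (Tot sub)" and cod: "Cod (Tot sub) g = Cod (Tot sub) l"
      and w: "w \<in> Hom (Base sub) (Fob (Proj sub) (Dom (Tot sub) g)) (Fob (Proj sub) (Dom (Tot sub) l))"
      and e: "Far (Proj sub) l \<cdot>\<^bsub>Base sub\<^esub> w = Far (Proj sub) g"
    obtain n v k where gg: "g = (n, v, k)" by (cases g) auto
    have k: "k = \<pi> \<phi>" using cod gg by (simp add: l_def sub_fib_def)
    have nm: "mono_arr X n" and v: "v = u \<cdot> w" and w': "w \<in> Hom X (Cod X n) J"
      using g w e gg HomD[OF q] by (auto simp: l_def sub_fib_def Hom_def)
    obtain t where t: "t \<in> Hom X (Dom X n) (Dom X (\<pi> \<phi>))" "\<pi> \<phi> \<cdot> t = v \<cdot> n"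
      using g gg k by (auto simp: sub_fib_def)
    note wn = cmpH[OF w' monoH[OF nm]]
    have "\<pi> \<phi> \<cdot> t = u \<cdot> (w \<cdot> n)" using t(2) v cmp_assoc[OF monoH[OF nm] w' assms(1)] by simp
    then obtain h where h: "h \<in> Hom X (Dom X n) V" "q \<cdot> h = w \<cdot> n"
      using pullback_univ[OF pb catX t(1), of "w \<cdot> n"] wn HomD[OF assms(1)] HomD[OF p] by auto
    show "\<exists>!h. h \<in> Hom (Tot sub) (Dom (Tot sub) g) (Dom (Tot sub) l) \<and> Far (Proj sub) h = w \<and> l \<cdot>\<^bsub>Tot sub\<^esub> h = g"
    proof (rule ex1I[of _ "(n, w, q)"])
      show "(n, w, q) \<in> Hom (Tot sub) (Dom (Tot sub) g) (Dom (Tot sub) l) \<and> Far (Proj sub) (n, w, q) = w \<and>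
          l \<cdot>\<^bsub>Tot sub\<^esub> (n, w, q) = g"
        using gg k v nm qm w' h HomD[OF q] by (auto simp: l_def sub_fib_def Hom_def)
    next
      fix h' assume "h' \<in> Hom (Tot sub) (Dom (Tot sub) g) (Dom (Tot sub) l) \<and> Far (Proj sub) h' = w \<and> l \<cdot>\<^bsub>Tot sub\<^esub> h' = g"
      then show "h' = (n, w, q)" using gg by (cases h') (auto simp: l_def sub_fib_def Hom_def)
    qed
  qed
  then have cl: "cartesian_lift sub u (\<pi> \<phi>) (SOME f. cartesian_lift sub u (\<pi> \<phi>) f)" by (rule someI)
  let ?f = "SOME f. cartesian_lift sub u (\<pi> \<phi>) f"
  have fA: "?f \<in> Arr (Tot sub)" "Cod (Tot sub) ?f = \<pi> \<phi>" "Far (Proj sub) ?f = u" "Dom (Tot sub) ?f = ?s"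
    using cl by (auto simp: cartesian_lift_def cartesian_arr_def reindex_def)
  then have sm: "mono_arr X ?s" "Cod X ?s = J" using assms(1) by (auto simp: sub_fib_def Hom_def)
  have sH: "?s \<in> Hom X (Dom X ?s) J" using monoH sm by metis
  have lA: "l \<in> Arr (Tot sub)" "Cod (Tot sub) l = \<pi> \<phi>" "Far (Proj sub) l = u" "Dom (Tot sub) l = q"
    using qm m p c assms(1) HomD[OF q] HomD[OF p] HomD[OF m(2)] by (auto simp: l_def sub_fib_def Hom_def)
  have "\<forall>g\<in>Arr (Tot sub). Cod (Tot sub) g = Cod (Tot sub) ?f \<longrightarrow>
      (\<forall>w\<in>Hom (Base sub) (Fob (Proj sub) (Dom (Tot sub) g)) (Fob (Proj sub) (Dom (Tot sub) ?f)).
        Far (Proj sub) ?f \<cdot>\<^bsub>Base sub\<^esub> w = Far (Proj sub) g \<longrightarrow>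
        (\<exists>!h. h \<in> Hom (Tot sub) (Dom (Tot sub) g) (Dom (Tot sub) ?f) \<and> Far (Proj sub) h = w \<and> ?f \<cdot>\<^bsub>Tot sub\<^esub> h = g))"
    using cl unfolding cartesian_lift_def cartesian_arr_def by blast
  moreover have "Ident X J \<in> Hom (Base sub) (Fob (Proj sub) (Dom (Tot sub) l)) (Fob (Proj sub) (Dom (Tot sub) ?f))"
    using idH[OF HomOb(1)[OF assms(1)]] lA fA sm HomD[OF q] by simp
  moreover have "Cod (Tot sub) l = Cod (Tot sub) ?f" using lA fA by simp
  moreover have "Far (Proj sub) ?f \<cdot>\<^bsub>Base sub\<^esub> Ident X J = Far (Proj sub) l" using lA fA cmp_idr[OF assms(1)] by simp
  ultimately have "\<exists>h. h \<in> Hom (Tot sub) (Dom (Tot sub) l) (Dom (Tot sub) ?f) \<and> Far (Proj sub) h = Ident X J"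
    using lA(1) by blast
  then have "\<exists>h. h \<in> Hom (Tot sub) q ?s \<and> Far (Proj sub) h = Ident X J" using lA(4) fA(4) by simp
  then have "q \<turnstile>\<^bsub>sub\<^esub> ?s" using qm sm HomD[OF q] unfolding entails_def by auto
  moreover have "\<pi> (rx u \<phi>) \<cong>\<^bsub>sub\<^esub> ?s"
    using conn assms HomD[OF assms(1)] unfolding connected_components_def fibered_monotone_def by blast
  ultimately obtain a b where a: "a \<in> Hom X V (Dom X ?s)" "?s \<cdot> a = q"
    and b: "b \<in> Hom X (Dom X ?s) (Dom X (\<pi> (rx u \<phi>)))" "\<pi> (rx u \<phi>) \<cdot> b = ?s"
    using sub_ent_iff[OF catX q sH] sub_ent_iff[OF catX sH n(2)] unfolding eqv_def by blast
  have "delta F q \<preceq> box (rx u \<phi>)"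
    using delta_mono[OF q n(2) cmpH[OF b(1) a(1)]] cmp_assoc[OF a(1) b(1) n(2)] a b by simp
  then show "rx u (box \<phi>) \<preceq> box (rx u \<phi>)" using d(1) ent_trans by blast
qed

text \<open>Preservation of meets by \<open>\<pi>\<close> places the intersection of
  \<open>\<pi> \<phi>\<close> and \<open>\<pi> \<psi>\<close> below
  \<open>\<pi> (\<phi> \<sqinter> \<psi>)\<close>. A stage in both closures factors, on a cover
  refined twice, through both monos and hence through their intersection.\<close>

lemma box_Meet:
  assumes "\<phi> \<in> fib I" "\<psi> \<in> fib I" "\<theta> \<preceq> box \<phi>" "\<theta> \<preceq> box \<psi>"
  shows "\<theta> \<preceq> box (\<phi> \<sqinter> \<psi>)"
proof -
  note m = pi_mono_arr[OF assms(1)] and n = pi_mono_arr[OF assms(2)] and k = pi_mono_arr[OF Meet_fib[OF assms(1,2)]]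
  note B = box_fib[OF Meet_fib[OF assms(1,2)]]
  note I = idH[OF fib_Ob[OF assms(1)]]
  have th: "\<theta> \<in> fib I" using ent_fib[OF assms(3)] box_fib[OF assms(1)] by simp
  obtain V p q where p: "p \<in> Hom X V (Dom X (\<pi> \<phi>))" and q: "q \<in> Hom X V (Dom X (\<pi> \<psi>))" and c: "\<pi> \<phi> \<cdot> p = \<pi> \<psi> \<cdot> q"
    and pb: "is_pullback X (\<pi> \<phi>) (\<pi> \<psi>) p q" using pullback_ex[OF m(2) n(2)] by metis
  have qm: "mono_arr X q" using pullback_mono[OF pb catX m(1)] .
  let ?l = "\<pi> \<psi> \<cdot> q"
  have l: "mono_arr X ?l" "?l \<in> Hom X V I" using mono_comp[OF catX n qm q] cmpH[OF n(2) q] by auto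
  have "?l \<turnstile>\<^bsub>sub\<^esub> \<pi> \<phi>" "?l \<turnstile>\<^bsub>sub\<^esub> \<pi> \<psi>"
    using sub_ent_iff[OF catX l(2) m(2)] sub_ent_iff[OF catX l(2) n(2)] l m n p q c by metis+
  moreover have "is_meet sub (\<pi> \<phi>) (\<pi> \<psi>) (\<pi> (\<phi> \<sqinter> \<psi>))"
    using conn is_meet_Meet[OF assms(1,2)] assms(1,2) fib_Ob[OF assms(1)]
    unfolding connected_components_def preserves_finite_meets_def by blast
  ultimately have "?l \<turnstile>\<^bsub>sub\<^esub> \<pi> (\<phi> \<sqinter> \<psi>)" unfolding is_meet_def by blast
  then obtain g where g: "g \<in> Hom X V (Dom X (\<pi> (\<phi> \<sqinter> \<psi>)))" "\<pi> (\<phi> \<sqinter> \<psi>) \<cdot> g = ?l"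
    using sub_ent_iff[OF catX l(2) k(2)] by blast
  have "\<theta> \<preceq> rx (Ident X I) (box \<phi>)" using ent_rx_Ident[OF box_fib[OF assms(1)] th] assms(3) by simp
  then obtain W w y \<chi> where w: "w \<in> Hom X W I" and ch: "\<chi> \<in> fib W" "\<chi> \<preceq> rx w \<theta>" "\<theta> \<preceq> Exists F w \<chi>"
    and y: "y \<in> Hom X W (Dom X (\<pi> \<phi>))" "\<pi> \<phi> \<cdot> y = w" using delta_elim[OF _ I m(2)] cmp_idl by metis
  have "\<chi> \<preceq> rx w (box \<psi>)" using rx_mono[OF assms(4) box_fib[OF assms(2)] w] ch(2) ent_trans by blast
  then obtain W' w' z \<chi>' where w': "w' \<in> Hom X W' W" and ch': "\<chi>' \<in> fib W'" "\<chi> \<preceq> Exists F w' \<chi>'"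
    and z: "z \<in> Hom X W' (Dom X (\<pi> \<psi>))" "\<pi> \<psi> \<cdot> z = w \<cdot> w'" using delta_elim[OF _ w n(2)] by metis
  have "\<pi> \<phi> \<cdot> (y \<cdot> w') = \<pi> \<psi> \<cdot> z" using cmp_assoc[OF w' y(1) m(2)] y(2) z(2) by simp
  then obtain h where h: "h \<in> Hom X W' V" "q \<cdot> h = z"
    using pullback_univ[OF pb catX cmpH[OF y(1) w'] z(1)] HomD[OF p] by auto
  note gh = cmpH[OF g(1) h(1)]
  have "\<pi> (\<phi> \<sqinter> \<psi>) \<cdot> (g \<cdot> h) = w \<cdot> w'" using cmp_assoc[OF h(1) g(1) k(2)] cmp_assoc[OF h(1) q n(2)] g(2) h(2) z(2) by simp
  then have "\<chi>' \<preceq> rx (w \<cdot> w') (box (\<phi> \<sqinter> \<psi>))" using delta_intro[OF k(2) gh ch'(1)] by simp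
  then have "\<chi>' \<preceq> rx w' (rx w (box (\<phi> \<sqinter> \<psi>)))" using ent_rx_rx[OF w B w' ch'(1)] by simp
  then have "\<chi> \<preceq> rx w (box (\<phi> \<sqinter> \<psi>))" using cover_local[OF ch'(2) _ w' rx_fib[OF w B]] by blast
  then show ?thesis using cover_local[OF ch(3) _ w B] by blast
qed

text \<open>The image \<open>n\<close> of \<open>u \<cdot> \<pi> \<phi>\<close> separates the two
  sides. \<open>Exists F u \<phi>\<close> lies below \<open>delta F n\<close>, and so does its
  closure because \<open>n\<close> is monic; and \<open>delta F n\<close> lies below the right side
  since on the regular epi \<open>e\<close>, a cover, \<open>n\<close> factors through
  \<open>u \<cdot> \<pi> \<phi>\<close>.\<close>

lemma box_Exists:
  assumes "u \<in> Hom X J I" "\<phi> \<in> fib J"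
  shows "box (Exists F u \<phi>) \<preceq> Exists F u (box \<phi>)"
proof -
  note m = pi_mono_arr[OF assms(2)]
  note um = cmpH[OF assms(1) m(2)]
  note bf = box_fib[OF assms(2)] and ef = Exists_fib[OF assms] and ebf = Exists_fib[OF assms(1) box_fib[OF assms(2)]]
  obtain K e n where e: "e \<in> Hom X (Dom X (\<pi> \<phi>)) K" and n: "n \<in> Hom X K I" and ne: "n \<cdot> e = u \<cdot> \<pi> \<phi>"
    and re: "regular_epi X e" and mn: "mono_arr X n" using image_factorization[OF um] .
  note dn = delta_fib[OF n]
  have "box \<phi> \<preceq> rx u (delta F n)"
  proof (rule delta_least[OF m(2) rx_fib[OF assms(1) dn]])
    fix \<theta> assume t: "\<theta> \<in> fib (Dom X (\<pi> \<phi>))"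
    show "\<theta> \<preceq> rx (\<pi> \<phi>) (rx u (delta F n))"
      using ent_rx_rx[OF assms(1) dn m(2) t] delta_intro[OF n e t] ne by simp
  qed
  then have "\<phi> \<preceq> rx u (delta F n)" using box_unit[OF assms(2)] ent_trans by blast
  then have "Exists F u \<phi> \<preceq> delta F n" using Exists_ent[OF assms dn] by blast
  then have "box (Exists F u \<phi>) \<preceq> delta F n" using box_least[OF ef mn n] by blast
  also have "delta F n \<preceq> Exists F u (box \<phi>)"
  proof (rule delta_least[OF n ebf])
    fix \<theta> assume t: "\<theta> \<in> fib K"
    note et = rx_fib[OF e t]
    have "rx e \<theta> \<preceq> rx (\<pi> \<phi>) (box \<phi>)" using delta_intro[OF m(2) idH[OF HomOb(1)[OF m(2)]] et] cmp_idr[OF m(2)] by simp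
    then have "rx e \<theta> \<preceq> rx (n \<cdot> e) (Exists F u (box \<phi>))"
      using Exists_intro[OF _ m(2) assms(1) bf] ne by simp
    then have "rx e \<theta> \<preceq> rx e (rx n (Exists F u (box \<phi>)))" using ent_rx_rx[OF n ebf e et] by simp
    then show "\<theta> \<preceq> rx n (Exists F u (box \<phi>))"
      using cover_local[OF regular_epi_cover[OF re e t] _ e rx_fib[OF n ebf]] by blast
  qed
  finally show ?thesis .
qed

section \<open>The closure operator on relations\<close>

definition bx :: "('p \<times> 'm \<times> 'm) set \<Rightarrow> ('p \<times> 'm \<times> 'm) set" where
  "bx P = {(\<theta>, a, b). \<exists>\<chi> a' b' x. (\<chi>, a', b') \<in> P \<and> \<theta> \<in> Ob T \<and> x \<in> Hom X (base \<theta>) (base \<chi>) \<and>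
     \<theta> \<preceq> rx x (box \<chi>) \<and> a = a' \<cdot> x \<and> b = b' \<cdot> x}"

lemma bx_mono: "P \<subseteq> Q \<Longrightarrow> bx P \<subseteq> bx Q" unfolding bx_def by blast
lemma bx_cv: "bx (cv P) = cv (bx P)" unfolding bx_def cv_def by auto

text \<open>A bare set of forced pairs has no type and no predicate to which \<open>box\<close>
  could be applied, so \<open>bx\<close> acts on stages: a pair forced at \<open>\<chi>\<close> is
  granted at every stage mapping to \<open>box \<chi>\<close>. Stability of \<open>box\<close>
  bounds the result, and the generic pair of projections, forced by \<open>\<phi>\<close> itself,
  generates all of it.\<close>

lemma bx_ext:
  assumes "\<phi> \<in> fib (prd X C D)" "C \<in> Ob X" "D \<in> Ob X"
  shows "bx (ext C D \<phi>) = ext C D (box \<phi>)"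
proof
  show "bx (ext C D \<phi>) \<subseteq> ext C D (box \<phi>)"
  proof clarify
    fix \<theta> a b assume "(\<theta>, a, b) \<in> bx (ext C D \<phi>)"
    then obtain \<chi> a' b' x where e: "(\<chi>, a', b') \<in> ext C D \<phi>" and t: "\<theta> \<in> Ob T"
      and x: "x \<in> Hom X (base \<theta>) (base \<chi>)" and l: "\<theta> \<preceq> rx x (box \<chi>)" and ab: "a = a' \<cdot> x" "b = b' \<cdot> x"
      unfolding bx_def by blast
    note h = extD[OF e] note p = pairH[OF h(2,3)]
    have "box \<chi> \<preceq> rx (pair X a' b') (box \<phi>)"
      using box_mono[OF h(4) rx_fib[OF p assms(1)]] box_rx(2)[OF p assms(1)] ent_trans by blast
    then have "\<theta> \<preceq> rx (pair X a' b' \<cdot> x) (box \<phi>)" using rx_cut[OF l _ x p box_fib[OF assms(1)]] by blast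
    then show "(\<theta>, a, b) \<in> ext C D (box \<phi>)"
      using ab pair_comp[OF h(2,3) x] extI[OF _ cmpH[OF h(2) x] cmpH[OF h(3) x] box_fib[OF assms(1)]] by simp
  qed
  show "ext C D (box \<phi>) \<subseteq> bx (ext C D \<phi>)"
  proof clarify
    fix \<theta> a b assume e: "(\<theta>, a, b) \<in> ext C D (box \<phi>)"
    note h = extD[OF e] note p = pairH[OF h(2,3)]
    note q = pr1H[OF assms(2,3)] pr2H[OF assms(2,3)]
    have "\<phi> \<preceq> rx (pair X (pr1 X C D) (pr2 X C D)) \<phi>"
      using pair_pr[OF assms(2,3)] ent_rx_Ident[OF assms(1,1)] ent_refl[OF assms(1)] by simp
    then have "(\<phi>, pr1 X C D, pr2 X C D) \<in> ext C D \<phi>" using ext_iff[OF assms(1) q] by blast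
    moreover have "base \<phi> = prd X C D" using fibD(2)[OF assms(1)] .
    moreover have "pr1 X C D \<cdot> pair X a b = a" "pr2 X C D \<cdot> pair X a b = b"
      using pr1_pair[OF h(2,3)] pr2_pair[OF h(2,3)] .
    ultimately show "(\<theta>, a, b) \<in> bx (ext C D \<phi>)"
      using h(4) p fibD(1)[OF h(1)] unfolding bx_def mem_Collect_eq case_prod_conv by metis
  qed
qed

lemma Rel_bx: assumes "P \<in> Rel C D" shows "bx P \<in> Rel C D"
  using assms by (rule RelE) (use bx_ext RelI box_fib in metis)

lemma bx_empty [simp]: "bx {} = {}" by (simp add: bx_def)

lemma Rl_bx: "P \<in> Rl \<Longrightarrow> bx P \<in> Rl"
  unfolding Rl_def mem_Collect_eq using Rel_bx bx_empty by metis

lemma Rl_cases: assumes "P \<in> Rl" obtains "P = {}" | C D \<phi> where "C \<in> Ob X" "D \<in> Ob X" "\<phi> \<in> fib (prd X C D)" "P = ext C D \<phi>"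
  using assms by (auto simp: Rl_def Rel_def)

lemma bx_unit: assumes "P \<in> Rl" shows "P \<subseteq> bx P"
  using assms
proof (rule Rl_cases)
  fix C D \<phi> assume a: "C \<in> Ob X" "D \<in> Ob X" "\<phi> \<in> fib (prd X C D)" "P = ext C D \<phi>"
  show ?thesis using bx_ext[OF a(3,1,2)] ent_ext[OF a(3) box_fib[OF a(3)] a(1,2)] box_unit[OF a(3)] a(4) by simp
qed simp

lemma bx_idem: assumes "P \<in> Rl" shows "bx (bx P) = bx P"
proof
  show "bx (bx P) \<subseteq> bx P"
    using assms
  proof (rule Rl_cases)
    fix C D \<phi> assume a: "C \<in> Ob X" "D \<in> Ob X" "\<phi> \<in> fib (prd X C D)" "P = ext C D \<phi>"
    note b = box_fib[OF a(3)]
    show ?thesis using bx_ext[OF a(3,1,2)] bx_ext[OF b a(1,2)] ent_ext[OF box_fib[OF b] b a(1,2)] box_idem[OF a(3)] a(4)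
      by simp
  qed simp
  show "bx P \<subseteq> bx (bx P)" using bx_unit[OF Rl_bx[OF assms]] .
qed

text \<open>With \<open>b\<close> as the common middle element, the meet of the two instances is a
  stage at which both \<open>P\<close> and \<open>Q\<close> hold; \<open>box_Meet\<close> puts
  \<open>\<theta>\<close> below its closure.\<close>

lemma bx_comp_le: assumes "P \<in> Rl" "Q \<in> Rl" shows "bx P \<odot> bx Q \<subseteq> bx (P \<odot> Q)"
proof (rule comp_least[OF Rl_Cl[OF Rl_bx[OF Rl_comp[OF assms]]]])
  fix \<theta> a b c assume ab: "(\<theta>, a, b) \<in> bx P" and bc: "(\<theta>, b, c) \<in> bx Q"
  then have "P \<noteq> {}" "Q \<noteq> {}" by auto
  then obtain C D D' E \<phi> \<psi> where p: "C \<in> Ob X" "D \<in> Ob X" "\<phi> \<in> fib (prd X C D)" "P = ext C D \<phi>"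
    and q: "D' \<in> Ob X" "E \<in> Ob X" "\<psi> \<in> fib (prd X D' E)" "Q = ext D' E \<psi>" using assms by (metis Rl_cases)
  note h = extD[OF ab[unfolded p(4) bx_ext[OF p(3,1,2)]]] and k = extD[OF bc[unfolded q(4) bx_ext[OF q(3,1,2)]]]
  have D: "D' = D" using h(3) k(2) by (simp add: Hom_def)
  note x = pairH[OF h(2,3)] and y = pairH[OF k(2,3)]
  let ?x = "rx (pair X a b) \<phi>" and ?y = "rx (pair X b c) \<psi>"
  note fx = rx_fib[OF x p(3)] and fy = rx_fib[OF y q(3)]
  note m = Meet_fib[OF fx fy]
  have "\<theta> \<preceq> box (?x \<sqinter> ?y)"
    using box_Meet[OF fx fy] box_rx(1)[OF x p(3)] box_rx(1)[OF y q(3)] h(4) k(4) ent_trans by blast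
  then have l: "\<theta> \<preceq> rx (Ident X (base \<theta>)) (box (?x \<sqinter> ?y))" using ent_rx_Ident[OF box_fib[OF m] h(1)] by simp
  have mm: "?x \<sqinter> ?y \<preceq> ?x" "?x \<sqinter> ?y \<preceq> ?y" using ent_Meet[OF fx fy] ent_refl[OF m] by auto
  have "(?x \<sqinter> ?y, a, b) \<in> P" "(?x \<sqinter> ?y, b, c) \<in> Q"
    using ext_iff[OF m h(2,3)] ext_iff[OF m k(2,3)] mm p(4) q(4) by auto
  then have "(?x \<sqinter> ?y, a, c) \<in> P \<odot> Q" using comp_intro Rl_Cl assms by blast
  moreover have "base (?x \<sqinter> ?y) = base \<theta>" using fibD(2)[OF m] .
  moreover have "a = a \<cdot> Ident X (base \<theta>)" "c = c \<cdot> Ident X (base \<theta>)" using cmp_idr h(2) k(3) by metis+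
  ultimately show "(\<theta>, a, c) \<in> bx (P \<odot> Q)"
    using l fibD(1)[OF h(1)] idH[OF fib_Ob[OF h(1)]] unfolding bx_def mem_Collect_eq case_prod_conv by metis
qed

text \<open>The inclusion from left to right is the exchange of \<open>box\<close> with the
  quantifier over the middle variable, \<open>box_Exists\<close>; the other is preservation of
  meets. If the composite is empty, \<open>bx_comp_le\<close> empties the right side as
  well.\<close>

lemma bx_comp: assumes "P \<in> Rl" "Q \<in> Rl" shows "bx (P \<odot> Q) = bx P \<odot> bx Q"
proof (cases "P \<odot> Q = {}")
  case True
  then have "bx P \<odot> bx Q = {}" using bx_comp_le[OF assms] by simp
  then show ?thesis using True by simp
next
  case False
  then obtain \<theta> a b c where e: "(\<theta>, a, b) \<in> P" "(\<theta>, b, c) \<in> Q" unfolding comp_def by blast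
  then have "P \<noteq> {}" "Q \<noteq> {}" by auto
  then obtain C D D' E \<phi> \<psi> where p: "C \<in> Ob X" "D \<in> Ob X" "\<phi> \<in> fib (prd X C D)" "P = ext C D \<phi>"
    and q': "D' \<in> Ob X" "E \<in> Ob X" "\<psi> \<in> fib (prd X D' E)" "Q = ext D' E \<psi>" using assms by (metis Rl_cases)
  have "D' = D" using extD(3)[OF e(1)[unfolded p(4)]] extD(2)[OF e(2)[unfolded q'(4)]] by (simp add: Hom_def)
  then have q: "E \<in> Ob X" "\<psi> \<in> fib (prd X D E)" "Q = ext D E \<psi>" using q' by auto
  note o = p(1,2) q(1)
  note c = var31H[OF o] and d = var32H[OF o] and e = var33H[OF o]
  let ?f = "inst2 F \<phi> (var31 X C D E) (var32 X C D E)" and ?g = "inst2 F \<psi> (var32 X C D E) (var33 X C D E)"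
  let ?f' = "inst2 F (box \<phi>) (var31 X C D E) (var32 X C D E)" and ?g' = "inst2 F (box \<psi>) (var32 X C D E) (var33 X C D E)"
  note bp = box_fib[OF p(3)] and bq = box_fib[OF q(2)]
  note f = inst2_fib[OF c d p(3)] inst2_fib[OF d e q(2)] inst2_fib[OF c d bp] inst2_fib[OF d e bq]
  note m = Meet_fib[OF f(1,2)] and m' = Meet_fib[OF f(3,4)]
  note ce = pairH[OF c e]
  have "?f \<sqinter> ?g \<preceq> ?f" "?f \<sqinter> ?g \<preceq> ?g" using ent_Meet[OF f(1,2)] ent_refl[OF m] by auto
  then have "box (?f \<sqinter> ?g) \<preceq> box ?f" "box (?f \<sqinter> ?g) \<preceq> box ?g" using box_mono f by blast+
  moreover have "box ?f \<preceq> ?f'" "box ?g \<preceq> ?g'"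
    using box_rx(2)[OF pairH[OF c d] p(3)] box_rx(2)[OF pairH[OF d e] q(2)] unfolding inst2_def by auto
  ultimately have "box (?f \<sqinter> ?g) \<preceq> ?f' \<sqinter> ?g'" using ent_Meet[OF f(3,4)] ent_trans by blast
  then have "Exists F (pair X (var31 X C D E) (var33 X C D E)) (box (?f \<sqinter> ?g)) \<preceq> relcomp F C D E (box \<phi>) (box \<psi>)"
    using Exists_mono[OF ce m'] unfolding relcomp_def Let_def by blast
  then have l: "box (relcomp F C D E \<phi> \<psi>) \<preceq> relcomp F C D E (box \<phi>) (box \<psi>)"
    using box_Exists[OF ce m] ent_trans unfolding relcomp_def[of F C D E \<phi>] Let_def by blast
  note r = relcomp_fib[OF p(3) q(2) o] and r' = relcomp_fib[OF bp bq o]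
  have "bx (P \<odot> Q) = ext C E (box (relcomp F C D E \<phi> \<psi>))"
    using ext_relcomp[OF p(3) q(2) o] bx_ext[OF r o(1,3)] p(4) q(3) by simp
  also have "\<dots> \<subseteq> ext C E (relcomp F C D E (box \<phi>) (box \<psi>))" using l ent_ext[OF box_fib[OF r] r' o(1,3)] by simp
  also have "\<dots> = bx P \<odot> bx Q" using ext_relcomp[OF bp bq o] bx_ext[OF p(3) o(1,2)] bx_ext[OF q(2) o(2,3)] p(4) q(3) by simp
  finally show ?thesis using bx_comp_le[OF assms] by blast
qed

section \<open>Closed relations: equality, graphs and tabulations\<close>

lemma diag_mono: "C \<in> Ob X \<Longrightarrow> mono_arr X (pair X (Ident X C) (Ident X C))"
proof (rule mono_arrI[OF pairH[OF idH idH]])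
  fix z f g assume C: "C \<in> Ob X" and f: "f \<in> Hom X z C" and g: "g \<in> Hom X z C"
    and e: "pair X (Ident X C) (Ident X C) \<cdot> f = pair X (Ident X C) (Ident X C) \<cdot> g"
  then have "pair X f f = pair X g g" using diag_comp[OF f] diag_comp[OF g] by simp
  then show "f = g" using pr1_pair[OF f f] pr1_pair[OF g g] by metis
qed

lemma equality_delta: "C \<in> Ob X \<Longrightarrow> equality F C = delta F (pair X (Ident X C) (Ident X C))"
  using delta_eq[OF pairH[OF idH idH]] by (simp add: equality_def)

lemma box_equality: assumes "C \<in> Ob X" shows "box (equality F C) \<preceq> equality F C"
proof -
  note d = pairH[OF idH[OF assms] idH[OF assms]]
  show ?thesis using box_least[OF equality_fib[OF assms] diag_mono[OF assms] d] equality_delta[OF assms]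
      ent_refl[OF equality_fib[OF assms]] by simp
qed

text \<open>Equality is \<open>delta\<close> of the diagonal, a subobject, hence closed; a graph is
  a reindexing of equality.\<close>

lemma bx_gr: assumes "u \<in> Hom X I J" shows "bx (gr u) = gr u"
proof
  note o = HomOb[OF assms]
  note u = cmpH[OF assms pr1H[OF o]] and q = pr2H[OF o]
  note e = equality_fib[OF o(2)] note be = box_fib[OF e]
  have "box (inst2 F (equality F J) (u \<cdot> pr1 X I J) (pr2 X I J)) \<preceq> inst2 F (equality F J) (u \<cdot> pr1 X I J) (pr2 X I J)"
    unfolding inst2_def
    using box_rx(2)[OF pairH[OF u q] e] rx_mono[OF box_equality[OF o(2)] e pairH[OF u q]] ent_trans by blast
  then show "bx (gr u) \<subseteq> gr u"
    unfolding gr_ext[OF assms] bx_ext[OF gr_fib[OF assms] o]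
    using ent_ext[OF box_fib[OF gr_fib[OF assms]] gr_fib[OF assms] o] by blast
  show "gr u \<subseteq> bx (gr u)" using bx_unit[OF Rel_Rl[OF Rel_gr[OF assms]]] .
qed

lemma bx_Idr: "C \<in> Ob X \<Longrightarrow> bx (Idr C) = Idr C"
  using bx_gr[OF idH] gr_Ident by metis

text \<open>Evaluated at the identity with stage \<open>Top F I\<close>, the inclusion forces
  \<open>u\<close> and \<open>v\<close> to be equal; since \<open>delta\<close> reflects truth, the
  pair factors through the diagonal.\<close>

lemma gr_faithful:
  assumes "u \<in> Hom X I J" "v \<in> Hom X I J" "gr u \<subseteq> gr v"
  shows "u = v"
proof -
  note o = HomOb[OF assms(1)]
  note T = Top_fib[OF o(1)] note i = idH[OF o(1)]
  have "(Top F I, Ident X I, u) \<in> gr v" using gr_intro[OF assms(1) i T] cmp_idr[OF assms(1)] assms(3) by auto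
  then have "(Top F I, v, u) \<in> Idr J" using gr_iff[OF assms(2) i assms(1) T] cmp_idr[OF assms(2)] by simp
  then have "Top F I \<preceq> rx (pair X v u) (delta F (pair X (Ident X J) (Ident X J)))"
    using extD(4) equality_delta[OF o(2)] unfolding Idr_def by fastforce
  then obtain h where h: "h \<in> Hom X I J" "pair X (Ident X J) (Ident X J) \<cdot> h = pair X v u"
    using delta_factor[OF diag_mono[OF o(2)] pairH[OF idH[OF o(2)] idH[OF o(2)]] pairH[OF assms(2,1)]] by blast
  then have "pair X h h = pair X v u" using diag_comp by simp
  then show ?thesis using pr1_pair[OF h(1,1)] pr2_pair[OF h(1,1)] pr1_pair[OF assms(2,1)] pr2_pair[OF assms(2,1)] by metis
qed

text \<open>A closed relation is \<open>\<delta>(m)\<close> for a subobject \<open>m\<close> of the product, and the two legs of \<open>m\<close> tabulate it.\<close>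

lemma tabulation:
  assumes "E \<in> Rel C D" "bx E = E"
  obtains R r s where "r \<in> Hom X R C" "s \<in> Hom X R D" "E = cv (gr r) \<odot> gr s"
    "\<And>Z f g. f \<in> Hom X Z R \<Longrightarrow> g \<in> Hom X Z R \<Longrightarrow> r \<cdot> f = r \<cdot> g \<Longrightarrow> s \<cdot> f = s \<cdot> g \<Longrightarrow> f = g"
    "\<And>Z x y. x \<in> Hom X Z C \<Longrightarrow> y \<in> Hom X Z D \<Longrightarrow> cv (gr x) \<odot> gr y \<subseteq> E \<Longrightarrow>
       \<exists>h\<in>Hom X Z R. r \<cdot> h = x \<and> s \<cdot> h = y"
proof -
  obtain \<phi> where o: "C \<in> Ob X" "D \<in> Ob X" and f: "\<phi> \<in> fib (prd X C D)" and E: "E = ext C D \<phi>" using RelE[OF assms(1)] .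
  have Eb: "E = ext C D (box \<phi>)" using assms(2) bx_ext[OF f o] E by simp
  let ?m = "\<pi> \<phi>" let ?R = "Dom X ?m"
  note m = pi_mono_arr[OF f]
  note p = pr1H[OF o] and q = pr2H[OF o]
  let ?r = "pr1 X C D \<cdot> ?m" and ?s = "pr2 X C D \<cdot> ?m"
  have r: "?r \<in> Hom X ?R C" and s: "?s \<in> Hom X ?R D" using cmpH[OF p m(2)] cmpH[OF q m(2)] .
  have m_pair: "?m \<cdot> h = pair X (?r \<cdot> h) (?s \<cdot> h)" if h: "h \<in> Hom X Z ?R" for h Z
    using pair_eta[OF cmpH[OF m(2) h] o] cmp_assoc[OF h m(2) p] cmp_assoc[OF h m(2) q] by simp
  note Er = Rel_Cl[OF assms(1)]
  note cr = Rel_cv[OF Rel_gr[OF r]] and gs = Rel_gr[OF s]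
  have inE: "(\<theta>, ?r \<cdot> h, ?s \<cdot> h) \<in> E" if "h \<in> Hom X Z ?R" "\<theta> \<in> fib Z" for \<theta> h Z
    using extI[OF _ cmpH[OF r that(1)] cmpH[OF s that(1)] box_fib[OF f]] delta_intro[OF m(2) that] m_pair[OF that(1)] Eb
    by simp
  show ?thesis
  proof (rule that[OF r s])
    show "E = cv (gr ?r) \<odot> gr ?s"
    proof
      show "cv (gr ?r) \<odot> gr ?s \<subseteq> E"
      proof (rule comp_least[OF Er])
        fix \<theta> a k b assume e: "(\<theta>, a, k) \<in> cv (gr ?r)" "(\<theta>, k, b) \<in> gr ?s"
        have h: "\<theta> \<in> fib (base \<theta>)" "a \<in> Hom X (base \<theta>) C" "k \<in> Hom X (base \<theta>) ?R" "b \<in> Hom X (base \<theta>) D"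
          using Rel_typed[OF cr e(1)] Rel_typed[OF gs e(2)] by auto
        have ia: "(\<theta>, a, ?r \<cdot> k) \<in> Idr C" using gr_iff[OF r h(3,2,1)] e(1) cv_Idr[OF o(1)] cv_iff by metis
        have ib: "(\<theta>, b, ?s \<cdot> k) \<in> Idr D" using gr_iff[OF s h(3,4,1)] e(2) cv_Idr[OF o(2)] cv_iff by metis
        have "(\<theta>, a, ?s \<cdot> k) \<in> E" using Idr_subst[OF ia o(1) inE[OF h(3,1)] Er] .
        then have "(\<theta>, ?s \<cdot> k, a) \<in> cv E" by simp
        from Idr_subst[OF ib o(2) this cv_Cl[OF Er]] show "(\<theta>, a, b) \<in> E" by simp
      qed
      show "E \<subseteq> cv (gr ?r) \<odot> gr ?s"
      proof clarify
        fix \<theta> a b assume "(\<theta>, a, b) \<in> E"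
        note h = extD[OF this[unfolded Eb]]
        obtain W w y \<chi> where w: "w \<in> Hom X W (base \<theta>)" and ch: "\<chi> \<in> fib W" "\<chi> \<preceq> rx w \<theta>" "\<theta> \<preceq> Exists F w \<chi>"
          and y: "y \<in> Hom X W ?R" "?m \<cdot> y = pair X a b \<cdot> w" using delta_elim[OF h(4) pairH[OF h(2,3)] m(2)] .
        have e: "pair X (?r \<cdot> y) (?s \<cdot> y) = pair X (a \<cdot> w) (b \<cdot> w)" using m_pair[OF y(1)] y(2) pair_comp[OF h(2,3) w] by simp
        have "?r \<cdot> y = a \<cdot> w" "?s \<cdot> y = b \<cdot> w"
          using e pr1_pair[OF cmpH[OF r y(1)] cmpH[OF s y(1)]] pr2_pair[OF cmpH[OF r y(1)] cmpH[OF s y(1)]]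
            pr1_pair[OF cmpH[OF h(2) w] cmpH[OF h(3) w]] pr2_pair[OF cmpH[OF h(2) w] cmpH[OF h(3) w]] by metis+
        then have "(\<chi>, a \<cdot> w, y) \<in> cv (gr ?r)" "(\<chi>, y, b \<cdot> w) \<in> gr ?s"
          using gr_intro[OF r y(1) ch(1)] gr_intro[OF s y(1) ch(1)] by auto
        then have "(\<chi>, a \<cdot> w, b \<cdot> w) \<in> cv (gr ?r) \<odot> gr ?s" using comp_intro[OF _ _ Rel_Cl[OF cr] Rel_Cl[OF gs]] by blast
        then show "(\<theta>, a, b) \<in> cv (gr ?r) \<odot> gr ?s"
          using Cl_local[OF comp_Cl[OF Rel_Cl[OF cr] Rel_Cl[OF gs]] spnI[OF h(1-3)] w ch(2,3)] by blast
      qed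
    qed
    show "h = k" if "h \<in> Hom X Z ?R" "k \<in> Hom X Z ?R" "?r \<cdot> h = ?r \<cdot> k" "?s \<cdot> h = ?s \<cdot> k" for h k Z
      using mono_arrD[OF m that(1,2) _ catX] m_pair[OF that(1)] m_pair[OF that(2)] that(3,4) by simp
    show "\<exists>h\<in>Hom X Z ?R. ?r \<cdot> h = x \<and> ?s \<cdot> h = y"
      if x: "x \<in> Hom X Z C" and y: "y \<in> Hom X Z D" and l: "cv (gr x) \<odot> gr y \<subseteq> E" for x y Z
    proof -
      note Z = HomOb(1)[OF x] note T = Top_fib[OF Z] note i = idH[OF Z]
      \<comment> \<open>With the identity as middle element the span itself is forced at stage
        \<open>Top F Z\<close>, the stage at which \<open>delta_factor\<close> applies.\<close>
      have "(Top F Z, x, Ident X Z) \<in> cv (gr x)" "(Top F Z, Ident X Z, y) \<in> gr y"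
        using gr_intro[OF x i T] gr_intro[OF y i T] cmp_idr[OF x] cmp_idr[OF y] by auto
      then have "(Top F Z, x, y) \<in> E"
        using l comp_intro[OF _ _ cv_Cl[OF Rel_Cl[OF Rel_gr[OF x]]] Rel_Cl[OF Rel_gr[OF y]]] by blast
      then have "Top F Z \<preceq> rx (pair X x y) (box \<phi>)" using extD(4) Eb by blast
      then obtain h where h: "h \<in> Hom X Z ?R" "?m \<cdot> h = pair X x y" using delta_factor[OF m pairH[OF x y]] by blast
      have "pair X (?r \<cdot> h) (?s \<cdot> h) = pair X x y" using m_pair[OF h(1)] h(2) by simp
      then have "?r \<cdot> h = x" "?s \<cdot> h = y"
        using pr1_pair[OF cmpH[OF r h(1)] cmpH[OF s h(1)]] pr2_pair[OF cmpH[OF r h(1)] cmpH[OF s h(1)]]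
          pr1_pair[OF x y] pr2_pair[OF x y] by metis+
      then show ?thesis using h(1) by blast
    qed
  qed
qed

end

context fframe
begin

section \<open>The category of partial equivalence relations\<close>

lemma Fun_comp:
  assumes "Fun r f s" "Fun s g t" "r \<in> Rl" "s \<in> Rl" "t \<in> Rl" "f \<in> Rl" "g \<in> Rl"
  shows "Fun r (f \<odot> g) t"
proof -
  have f: "r \<odot> f = f" "f \<odot> s = f" "cv f \<odot> f \<subseteq> s" "r \<subseteq> f \<odot> cv f"
    and g: "s \<odot> g = g" "g \<odot> t = g" "cv g \<odot> g \<subseteq> t" "s \<subseteq> g \<odot> cv g"
    using assms(1,2) by (auto simp: Fun_def)
  note R = assms(3-7) Rl_cv[OF assms(6)] Rl_cv[OF assms(7)]
  have "cv (f \<odot> g) \<odot> (f \<odot> g) = cv g \<odot> (cv f \<odot> f) \<odot> g" using R by (simp add: cv_comp Rl_assoc Rl_comp)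
  also have "\<dots> \<subseteq> cv g \<odot> s \<odot> g" by (intro comp_mono order_refl f)
  finally have 1: "cv (f \<odot> g) \<odot> (f \<odot> g) \<subseteq> t" using g by simp
  have "r \<subseteq> (f \<odot> s) \<odot> cv f" using f by simp
  also have "\<dots> \<subseteq> (f \<odot> (g \<odot> cv g)) \<odot> cv f" by (intro comp_mono order_refl g)
  also have "\<dots> = (f \<odot> g) \<odot> cv (f \<odot> g)" using R by (simp add: cv_comp Rl_assoc Rl_comp)
  finally show ?thesis using 1 f(1) g(2) R Rl_assoc[of r f g] Rl_assoc[of f g t] unfolding Fun_def by simp
qed

lemma Fun_PER: "PER r \<Longrightarrow> Fun r r r" using PER_simps by (simp add: Fun_def)

text \<open>Functional relations are discretely ordered: \<open>g \<subseteq> f \<odot> cv f \<odot>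
  g \<subseteq> f \<odot> cv g \<odot> g \<subseteq> f\<close>. An equation between arrows therefore
  costs one inclusion.\<close>

lemma Fun_eqI:
  assumes "Fun r f s" "Fun r g s" "f \<subseteq> g" "f \<in> Rl" "g \<in> Rl"
  shows "f = g"
proof
  have "g = r \<odot> g" using assms(2) by (simp add: Fun_def)
  also have "\<dots> \<subseteq> (f \<odot> cv f) \<odot> g" using assms(1) by (intro comp_mono order_refl) (simp add: Fun_def)
  also have "\<dots> = f \<odot> cv f \<odot> g" using assms by (simp add: Rl_assoc Rl_cv)
  also have "\<dots> \<subseteq> f \<odot> cv g \<odot> g" using assms(3) cv_mono by (intro comp_mono order_refl)
  also have "\<dots> \<subseteq> f \<odot> s" using assms(2) by (intro comp_mono order_refl) (simp add: Fun_def)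
  finally show "g \<subseteq> f" using assms(1) by (simp add: Fun_def)
qed fact

section \<open>Objects and arrows of \<open>per_cat F\<close> as relations\<close>

definition ob :: "'o \<times> 'p \<Rightarrow> ('p \<times> 'm \<times> 'm) set" where "ob A = ext (fst A) (fst A) (snd A)"

text \<open>The equivalence class is recovered as the set of all predicates with extension
  \<open>f\<close>. For \<open>f\<close> in \<open>Rel\<close> of the right type it is inhabited,
  which is what makes \<open>mk\<close> injective.\<close>

definition mk :: "'o \<times> 'p \<Rightarrow> ('p \<times> 'm \<times> 'm) set \<Rightarrow> 'o \<times> 'p \<Rightarrow> ('o, 'p) per_arr" where
  "mk A f B = (A, {\<phi> \<in> fib (prd X (fst A) (fst B)). ext (fst A) (fst B) \<phi> = f}, B)"

definition HomR :: "'o \<times> 'p \<Rightarrow> 'o \<times> 'p \<Rightarrow> ('p \<times> 'm \<times> 'm) set set" where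
  "HomR A B = {f \<in> Rel (fst A) (fst B). Fun (ob A) f (ob B)}"

abbreviation XX where "XX \<equiv> per_cat F"

lemma per_ob:
  assumes "per F A"
  shows "fst A \<in> Ob X" "snd A \<in> fib (prd X (fst A) (fst A))" "PER (ob A)" "ob A \<in> Rel (fst A) (fst A)"
    "ob A \<in> Rl" "cv (ob A) = ob A" "ob A \<odot> ob A = ob A"
proof -
  show 1: "fst A \<in> Ob X" "snd A \<in> fib (prd X (fst A) (fst A))" "PER (ob A)"
    using assms per_iff[of "fst A" "snd A"] by (auto simp: ob_def)
  show 2: "ob A \<in> Rel (fst A) (fst A)" unfolding ob_def using RelI 1 by blast
  show "ob A \<in> Rl" using Rel_Rl[OF 2] .
  show "cv (ob A) = ob A" "ob A \<odot> ob A = ob A" using PER_simps[OF 1(3)] by auto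
qed

lemma HomRD:
  assumes "f \<in> HomR A B"
  shows "f \<in> Rel (fst A) (fst B)" "f \<in> Rl" "ob A \<odot> f = f" "f \<odot> ob B = f" "cv f \<odot> f \<subseteq> ob B"
    "ob A \<subseteq> f \<odot> cv f" "Fun (ob A) f (ob B)"
  using assms Rel_Rl unfolding HomR_def Fun_def by auto

lemma HomRI: "f \<in> Rel (fst A) (fst B) \<Longrightarrow> ob A \<odot> f = f \<Longrightarrow> f \<odot> ob B = f \<Longrightarrow> cv f \<odot> f \<subseteq> ob B \<Longrightarrow>
    ob A \<subseteq> f \<odot> cv f \<Longrightarrow> f \<in> HomR A B"
  by (simp add: HomR_def Fun_def)

lemma mk_eqv_class:
  assumes "fst A \<in> Ob X" "fst B \<in> Ob X" "\<phi> \<in> fib (prd X (fst A) (fst B))"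
  shows "(A, eqv_class F \<phi>, B) = mk A (ext (fst A) (fst B) \<phi>) B"
  unfolding mk_def eqv_class_def using eqv_ext[OF assms(3,1,2)] by auto

lemma mk_inj:
  assumes "f \<in> Rel (fst A) (fst B)" "mk A f B = mk A' g B'"
  shows "A = A'" "B = B'" "f = g"
proof -
  show a: "A = A'" "B = B'" using assms(2) by (auto simp: mk_def)
  obtain \<phi> where "\<phi> \<in> fib (prd X (fst A) (fst B))" "f = ext (fst A) (fst B) \<phi>" using RelE[OF assms(1)] .
  then have "\<phi> \<in> {\<phi> \<in> fib (prd X (fst A) (fst B)). ext (fst A) (fst B) \<phi> = g}"
    using assms(2) a by (auto simp: mk_def)
  then show "f = g" using \<open>f = _\<close> by simp
qed

lemma Hom_XX: "x \<in> Hom XX A B \<longleftrightarrow> per F A \<and> per F B \<and> (\<exists>f\<in>HomR A B. x = mk A f B)"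
proof
  assume "x \<in> Hom XX A B"
  then obtain \<phi> where p: "per F A" "per F B" and f: "functional_relation F A B \<phi>" and x: "x = (A, eqv_class F \<phi>, B)"
    by (auto simp: Hom_def per_cat_def)
  note a = per_ob(1)[OF p(1)] and b = per_ob(1)[OF p(2)]
  have ph: "\<phi> \<in> fib (prd X (fst A) (fst B))" "Fun (ob A) (ext (fst A) (fst B) \<phi>) (ob B)"
    using f functional_relation_iff[of "fst A" "snd A" "fst B" "snd B" \<phi>] p by (auto simp: ob_def)
  then have "ext (fst A) (fst B) \<phi> \<in> HomR A B" using RelI[OF a b ph(1)] by (simp add: HomR_def)
  then show "per F A \<and> per F B \<and> (\<exists>f\<in>HomR A B. x = mk A f B)" using p x mk_eqv_class[OF a b ph(1)] by blast
next
  assume "per F A \<and> per F B \<and> (\<exists>f\<in>HomR A B. x = mk A f B)"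
  then obtain f where p: "per F A" "per F B" and f: "f \<in> HomR A B" and x: "x = mk A f B" by blast
  note a = per_ob(1)[OF p(1)] and b = per_ob(1)[OF p(2)]
  obtain \<phi> where ph: "\<phi> \<in> fib (prd X (fst A) (fst B))" "f = ext (fst A) (fst B) \<phi>" using RelE[OF HomRD(1)[OF f]] .
  have "functional_relation F A B \<phi>"
    using functional_relation_iff[of "fst A" "snd A" "fst B" "snd B" \<phi>] p ph HomRD(7)[OF f] by (auto simp: ob_def)
  moreover have "x = (A, eqv_class F \<phi>, B)" using x mk_eqv_class[OF a b ph(1)] ph(2) by simp
  ultimately show "x \<in> Hom XX A B" using p by (auto simp: Hom_def per_cat_def)
qed

lemma XX_simps [simp]: "Ob XX = {A. per F A}" by (simp add: per_cat_def)

lemma Dom_mk [simp]: "Dom XX (mk A f B) = A" and Cod_mk [simp]: "Cod XX (mk A f B) = B"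
  by (simp_all add: per_cat_def mk_def)

lemma Ident_mk: assumes "per F A" shows "Ident XX A = mk A (ob A) A"
  using mk_eqv_class[OF per_ob(1,1,2)[OF assms]] assms by (cases A) (simp add: per_cat_def ob_def)

lemma comp_mk:
  assumes "f \<in> Rel (fst A) (fst B)" "g \<in> Rel (fst B) (fst E)"
  shows "mk B g E \<cdot>\<^bsub>XX\<^esub> mk A f B = mk A (f \<odot> g) E"
proof -
  obtain \<phi> where ph: "fst A \<in> Ob X" "fst B \<in> Ob X" "\<phi> \<in> fib (prd X (fst A) (fst B))" "f = ext (fst A) (fst B) \<phi>"
    using RelE[OF assms(1)] .
  obtain \<psi> where ps: "fst E \<in> Ob X" "\<psi> \<in> fib (prd X (fst B) (fst E))" "g = ext (fst B) (fst E) \<psi>"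
    using RelE[OF assms(2)] .
  note o = ph(1,2) ps(1)
  have key: "\<chi> \<cong>\<^bsub>F\<^esub> relcomp F (fst A) (fst B) (fst E) \<phi>' \<psi>' \<longleftrightarrow>
      \<chi> \<in> fib (prd X (fst A) (fst E)) \<and> ext (fst A) (fst E) \<chi> = f \<odot> g"
    if "\<phi>' \<in> fib (prd X (fst A) (fst B))" "ext (fst A) (fst B) \<phi>' = f"
      "\<psi>' \<in> fib (prd X (fst B) (fst E))" "ext (fst B) (fst E) \<psi>' = g" for \<chi> \<phi>' \<psi>'
    using eqv_ext[OF relcomp_fib[OF that(1,3) o] o(1,3)] ext_relcomp[OF that(1,3) o] that by simp
  let ?P = "{\<phi> \<in> fib (prd X (fst A) (fst B)). ext (fst A) (fst B) \<phi> = f}"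
  let ?Q = "{\<psi> \<in> fib (prd X (fst B) (fst E)). ext (fst B) (fst E) \<psi> = g}"
  have "\<phi> \<in> ?P" "\<psi> \<in> ?Q" using ph ps by auto
  then have "{\<chi>. \<exists>\<phi>'\<in>?P. \<exists>\<psi>'\<in>?Q. \<chi> \<cong>\<^bsub>F\<^esub> relcomp F (fst A) (fst B) (fst E) \<phi>' \<psi>'} =
      {\<chi> \<in> fib (prd X (fst A) (fst E)). ext (fst A) (fst E) \<chi> = f \<odot> g}"
    using key by blast
  then show ?thesis unfolding per_cat_def mk_def by simp
qed

lemma HomR_comp:
  assumes "f \<in> HomR A B" "g \<in> HomR B E" "per F A" "per F B" "per F E"
  shows "f \<odot> g \<in> HomR A E"
  using Rel_comp[OF HomRD(1)[OF assms(1)] HomRD(1)[OF assms(2)]]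
    Fun_comp[OF HomRD(7)[OF assms(1)] HomRD(7)[OF assms(2)]] HomRD(2) assms per_ob(5) by (simp add: HomR_def)

lemma HomR_id: "per F A \<Longrightarrow> ob A \<in> HomR A A"
  using Fun_PER per_ob by (simp add: HomR_def)

lemma mk_Hom: "per F A \<Longrightarrow> per F B \<Longrightarrow> f \<in> HomR A B \<Longrightarrow> mk A f B \<in> Hom XX A B"
  using Hom_XX by blast

lemma Hom_XX_E:
  assumes "x \<in> Hom XX A B"
  obtains f where "per F A" "per F B" "f \<in> HomR A B" "x = mk A f B"
  using assms Hom_XX by blast

lemma catXX: "category XX"
  unfolding category_def
proof (intro conjI ballI impI)
  fix x assume "x \<in> Arr XX"
  from Arr_Hom[OF this] obtain f where f: "per F (Dom XX x)" "per F (Cod XX x)" "f \<in> HomR (Dom XX x) (Cod XX x)"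
    "x = mk (Dom XX x) f (Cod XX x)" by (rule Hom_XX_E)
  show "Dom XX x \<in> Ob XX" "Cod XX x \<in> Ob XX" using f by simp_all
  show "x \<cdot>\<^bsub>XX\<^esub> Ident XX (Dom XX x) = x" "Ident XX (Cod XX x) \<cdot>\<^bsub>XX\<^esub> x = x"
    using comp_mk[OF per_ob(4)[OF f(1)] HomRD(1)[OF f(3)]] comp_mk[OF HomRD(1)[OF f(3)] per_ob(4)[OF f(2)]]
      Ident_mk[OF f(1)] Ident_mk[OF f(2)] HomRD(3,4)[OF f(3)] f(4) by metis+
next
  fix A assume "A \<in> Ob XX"
  then show "Ident XX A \<in> Hom XX A A" using Ident_mk mk_Hom HomR_id by simp
next
  fix x y assume "x \<in> Arr XX" "y \<in> Arr XX" and e: "Cod XX x = Dom XX y"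
  from Arr_Hom[OF this(1)] obtain f where f: "per F (Dom XX x)" "per F (Cod XX x)" "f \<in> HomR (Dom XX x) (Cod XX x)"
    "x = mk (Dom XX x) f (Cod XX x)" by (rule Hom_XX_E)
  from Arr_Hom[OF \<open>y \<in> Arr XX\<close>] obtain g where g: "per F (Cod XX y)" "g \<in> HomR (Dom XX y) (Cod XX y)"
    "y = mk (Dom XX y) g (Cod XX y)" by (rule Hom_XX_E)
  have g': "g \<in> HomR (Cod XX x) (Cod XX y)" using g(2) e by simp
  have "y \<cdot>\<^bsub>XX\<^esub> x = mk (Dom XX x) (f \<odot> g) (Cod XX y)"
    using comp_mk[OF HomRD(1)[OF f(3)] HomRD(1)[OF g']] f(4) g(3) e by metis
  then show "y \<cdot>\<^bsub>XX\<^esub> x \<in> Hom XX (Dom XX x) (Cod XX y)"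
    using mk_Hom[OF f(1) g(1) HomR_comp[OF f(3) g' f(1,2) g(1)]] by simp
  fix z assume "z \<in> Arr XX" and e2: "Cod XX y = Dom XX z"
  from Arr_Hom[OF this(1)] obtain h where h: "h \<in> HomR (Dom XX z) (Cod XX z)"
    "z = mk (Dom XX z) h (Cod XX z)" by (rule Hom_XX_E)
  have h': "h \<in> HomR (Cod XX y) (Cod XX z)" using h(1) e2 by simp
  note rf = HomRD(1)[OF f(3)] and rg = HomRD(1)[OF g'] and rh = HomRD(1)[OF h']
  obtain A B C D where abcd: "A = Dom XX x" "B = Cod XX x" "C = Cod XX y" "D = Cod XX z" by blast
  have x: "x = mk A f B" and y: "y = mk B g C" and z: "z = mk C h D" using f(4) g(3) h(2) e e2 abcd by simp_all
  note rf = rf[folded abcd] and rg = rg[folded abcd] and rh = rh[folded abcd]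
  show "z \<cdot>\<^bsub>XX\<^esub> (y \<cdot>\<^bsub>XX\<^esub> x) = (z \<cdot>\<^bsub>XX\<^esub> y) \<cdot>\<^bsub>XX\<^esub> x"
    unfolding x y z comp_mk[OF rf rg] comp_mk[OF rg rh] comp_mk[OF Rel_comp[OF rf rg] rh] comp_mk[OF rf Rel_comp[OF rg rh]]
    using Rl_assoc[OF Rel_Rl[OF rf] Rel_Rl[OF rg] Rel_Rl[OF rh]] by simp
qed

section \<open>Constant objects\<close>

abbreviation dl where "dl I \<equiv> (I, equality F I)"

lemma Delta_simps: "Fob (Delta F) I = dl I" by (simp add: Delta_def)

lemma ob_dl: "ob (dl I) = Idr I" by (simp add: ob_def Idr_def)

lemma HomR_dl: "f \<in> HomR A (dl I) \<longleftrightarrow> f \<in> Rel (fst A) I \<and> ob A \<odot> f = f \<and> cv f \<odot> f \<subseteq> Idr I \<and> ob A \<subseteq> f \<odot> cv f"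
  unfolding HomR_def Fun_def ob_dl using Idr_right by auto

lemma gr_HomR: assumes "u \<in> Hom X I J" shows "gr u \<in> HomR (dl I) (dl J)"
  unfolding HomR_dl ob_dl
  using Rel_gr[OF assms] Idr_left gr_total[OF assms] gr_single_valued[OF assms] by auto

lemma Delta_mk: assumes "u \<in> Hom X I J" shows "Far (Delta F) u = mk (dl I) (gr u) (dl J)"
proof -
  have o: "fst (dl I) \<in> Ob X" "fst (dl J) \<in> Ob X" using HomOb[OF assms] by simp_all
  show ?thesis using mk_eqv_class[OF o, of "inst2 F (equality F J) (u \<cdot> pr1 X I J) (pr2 X I J)"] gr_fib[OF assms]
      gr_ext[OF assms] HomD[OF assms] by (simp add: Delta_def Let_def)
qed

lemma Delta_functor: "is_functor X XX (Delta F)"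
  unfolding is_functor_def Delta_simps
proof (intro conjI ballI impI catX catXX)
  show "dl a \<in> Ob XX" if "a \<in> Ob X" for a using per_equality that by simp
  show "Far (Delta F) f \<in> Hom XX (dl (Dom X f)) (dl (Cod X f))" if "f \<in> Arr X" for f
    using Delta_mk[OF Arr_Hom[OF that]] mk_Hom gr_HomR[OF Arr_Hom[OF that]] per_equality HomOb[OF Arr_Hom[OF that]]
    by simp
  show "Far (Delta F) (Ident X a) = Ident XX (dl a)" if "a \<in> Ob X" for a
    using Delta_mk[OF idH[OF that]] Ident_mk[OF per_equality[OF that]] gr_Ident[OF that] ob_dl by simp
  show "Far (Delta F) (g \<cdot> f) = Far (Delta F) g \<cdot>\<^bsub>XX\<^esub> Far (Delta F) f"
    if "f \<in> Arr X" "g \<in> Arr X" "Cod X f = Dom X g" for f g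
  proof -
    have f: "f \<in> Hom X (Dom X f) (Dom X g)" and g: "g \<in> Hom X (Dom X g) (Cod X g)" using that by (auto simp: Hom_def)
    have "gr f \<in> Rel (fst (dl (Dom X f))) (fst (dl (Dom X g)))" "gr g \<in> Rel (fst (dl (Dom X g))) (fst (dl (Cod X g)))"
      using Rel_gr f g by simp_all
    from comp_mk[OF this] show ?thesis using Delta_mk[OF f] Delta_mk[OF g] Delta_mk[OF cmpH[OF g f]] gr_comp[OF f g] by simp
  qed
qed

end

section \<open>Function comprehension\<close>

context tcframe
begin

text \<open>Unique choice. Tabulate \<open>G\<close> by \<open>r\<close>, \<open>s\<close>.
  Single-valuedness makes \<open>r\<close> monic, totality makes the generic element of
  \<open>C\<close> factor through \<open>r\<close> locally, and since \<open>delta\<close> reflects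
  truth \<open>r\<close> acquires a section \<open>h\<close>. The arrow is
  \<open>s \<cdot> h\<close>; its graph lies in \<open>G\<close>, and comparable functional
  relations agree.\<close>

lemma function_comprehension:
  assumes "G \<in> Rel C D" "bx G = G" "cv G \<odot> G \<subseteq> Idr D" "Idr C \<subseteq> G \<odot> cv G"
  obtains g where "g \<in> Hom X C D" "gr g = G"
proof -
  obtain R r s where r: "r \<in> Hom X R C" and s: "s \<in> Hom X R D" and G: "G = cv (gr r) \<odot> gr s"
    and jm: "\<And>Z f g. f \<in> Hom X Z R \<Longrightarrow> g \<in> Hom X Z R \<Longrightarrow> r \<cdot> f = r \<cdot> g \<Longrightarrow> s \<cdot> f = s \<cdot> g \<Longrightarrow> f = g"
    using tabulation[OF assms(1,2)] by metis
  note C = HomOb(2)[OF r]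
  note gr = Rel_gr[OF r] and gs = Rel_gr[OF s]
  note Rr = Rel_Rl[OF gr] and Rs = Rel_Rl[OF gs] and RG = Rel_Rl[OF assms(1)]
  note rl = Rr Rs RG Rl_comp Rl_cv
  have sG: "gr s \<subseteq> gr r \<odot> G"
  proof -
    have "gr s = Idr R \<odot> gr s" using Idr_left[OF gs] by simp
    also have "\<dots> \<subseteq> (gr r \<odot> cv (gr r)) \<odot> gr s" by (intro comp_mono order_refl gr_total[OF r])
    also have "\<dots> = gr r \<odot> G" unfolding G using rl by (simp add: Rl_assoc)
    finally show ?thesis .
  qed
  have rm: "mono_arr X r"
  proof (rule mono_arrI[OF r])
    fix Z f g assume f: "f \<in> Hom X Z R" and g: "g \<in> Hom X Z R" and e: "r \<cdot> f = r \<cdot> g"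
    note sf = cmpH[OF s f] and sg = cmpH[OF s g] and rf = cmpH[OF r f]
    let ?H = "gr (r \<cdot> f) \<odot> G"
    note R' = Rel_Rl[OF Rel_gr[OF f]] Rel_Rl[OF Rel_gr[OF g]] Rel_Rl[OF Rel_gr[OF rf]] Rel_Rl[OF Rel_gr[OF sf]] Rel_Rl[OF Rel_gr[OF sg]]
    \<comment> \<open>The graphs of \<open>s \<cdot> f\<close> and \<open>s \<cdot> g\<close> both
      lie in the single-valued relation \<open>?H\<close>, so the two arrows coincide and joint
      monicity applies.\<close>
    have le: "gr (s \<cdot> k) \<subseteq> gr (r \<cdot> k) \<odot> G" if k: "k \<in> Hom X Z R" for k
    proof -
      have "gr (s \<cdot> k) \<subseteq> gr k \<odot> gr r \<odot> G" unfolding gr_comp[OF k s] by (intro comp_mono order_refl sG)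
      then show ?thesis unfolding gr_comp[OF k r] using Rl_assoc[OF Rel_Rl[OF Rel_gr[OF k]] Rr RG] by simp
    qed
    have "cv ?H \<odot> ?H = cv G \<odot> (cv (gr (r \<cdot> f)) \<odot> gr (r \<cdot> f)) \<odot> G" using rl R' by (simp add: cv_comp Rl_assoc)
    also have "\<dots> \<subseteq> cv G \<odot> Idr C \<odot> G" by (intro comp_mono order_refl gr_single_valued[OF rf])
    also have "\<dots> = cv G \<odot> G" using Idr_left[OF assms(1)] by simp
    finally have H: "cv ?H \<odot> ?H \<subseteq> Idr D" using assms(3) by blast
    have "gr (s \<cdot> f) = Idr Z \<odot> gr (s \<cdot> f)" using Idr_left[OF Rel_gr[OF sf]] by simp
    also have "\<dots> \<subseteq> (gr (s \<cdot> g) \<odot> cv (gr (s \<cdot> g))) \<odot> gr (s \<cdot> f)" by (intro comp_mono order_refl gr_total[OF sg])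
    also have "\<dots> = gr (s \<cdot> g) \<odot> cv (gr (s \<cdot> g)) \<odot> gr (s \<cdot> f)" using rl R' by (simp add: Rl_assoc)
    also have "\<dots> \<subseteq> gr (s \<cdot> g) \<odot> cv ?H \<odot> ?H"
      using le[OF f] le[OF g] e by (intro comp_mono order_refl cv_mono) simp_all
    also have "\<dots> \<subseteq> gr (s \<cdot> g) \<odot> Idr D" by (intro comp_mono order_refl H)
    also have "\<dots> = gr (s \<cdot> g)" using Idr_right[OF Rel_gr[OF sg]] .
    finally have "s \<cdot> f = s \<cdot> g" using gr_faithful[OF sf sg] by blast
    then show "f = g" using jm[OF f g e] by blast
  qed
  note T = Top_fib[OF C] and i = idH[OF C]
  note dr = delta_fib[OF r]
  \<comment> \<open>Totality at the generic element of \<open>C\<close> gives a cover on which the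
    identity lifts along \<open>r\<close> up to forced equality. A second cover makes the equality
    actual, whence \<open>Top F C \<preceq> delta F r\<close>.\<close>
  have "(Top F C, Ident X C, Ident X C) \<in> G \<odot> cv G" using assms(4) Idr_refl[OF i T] by blast
  then have "(Top F C, Ident X C, Ident X C) \<in> cv (gr r) \<odot> (gr s \<odot> cv G)" unfolding G using rl by (simp add: Rl_assoc)
  then obtain W w \<chi> b where w': "w \<in> Hom X W (base (Top F C))" and ch: "\<chi> \<in> fib W" "Top F C \<preceq> Exists F w \<chi>"
    and b: "(\<chi>, Ident X C \<cdot> w, b) \<in> cv (gr r)" by (rule comp_elim)
  have w: "w \<in> Hom X W C" using w' fibD(2)[OF T] by simp
  have bw: "(\<chi>, b, w) \<in> gr r" using b cmp_idl[OF w] by simp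
  have bH: "b \<in> Hom X W R" using Rel_typed[OF gr bw] fibD(2)[OF ch(1)] by simp
  have "(\<chi>, r \<cdot> b, w) \<in> Idr C" using gr_iff[OF r bH w ch(1)] bw by blast
  then obtain W' w' \<chi>' where w': "w' \<in> Hom X W' W" and ch': "\<chi>' \<in> fib W'" "\<chi> \<preceq> Exists F w' \<chi>'"
    and e: "r \<cdot> b \<cdot> w' = w \<cdot> w'" using Idr_elim[OF _ C] fibD(2)[OF ch(1)] by metis
  have "\<chi>' \<preceq> rx (w \<cdot> w') (delta F r)"
    using delta_intro[OF r cmpH[OF bH w'] ch'(1)] cmp_assoc[OF w' bH r] e by simp
  then have "\<chi>' \<preceq> rx w' (rx w (delta F r))" using ent_rx_rx[OF w dr w' ch'(1)] by simp
  then have "\<chi> \<preceq> rx w (delta F r)" using cover_local[OF ch'(2) _ w' rx_fib[OF w dr]] by blast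
  then have "Top F C \<preceq> delta F r" using cover_local[OF ch(2) _ w dr] by blast
  then have "Top F C \<preceq> rx (Ident X C) (delta F r)" using ent_rx_Ident[OF dr T] by simp
  then obtain h where h: "h \<in> Hom X C R" "r \<cdot> h = Ident X C" using delta_factor[OF rm r i] by blast
  note sh = cmpH[OF s h(1)]
  note Rh = Rel_Rl[OF Rel_gr[OF h(1)]] and Rsh = Rel_Rl[OF Rel_gr[OF sh]]
  have "gr h = gr h \<odot> Idr R" using Idr_right[OF Rel_gr[OF h(1)]] by simp
  also have "\<dots> \<subseteq> gr h \<odot> gr r \<odot> cv (gr r)" by (intro comp_mono order_refl gr_total[OF r])
  also have "\<dots> = gr (r \<cdot> h) \<odot> cv (gr r)" using gr_comp[OF h(1) r] Rl_assoc[OF Rh Rr Rl_cv[OF Rr]] by simp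
  also have "\<dots> = cv (gr r)" using h(2) gr_Ident[OF C] Idr_left[OF Rel_cv[OF gr]] by simp
  finally have "gr (s \<cdot> h) \<subseteq> G" unfolding gr_comp[OF h(1) s] G by (intro comp_mono order_refl)
  moreover have "Fun (Idr C) (gr (s \<cdot> h)) (Idr D)" "Fun (Idr C) G (Idr D)"
    unfolding Fun_def
    using Idr_left[OF Rel_gr[OF sh]] Idr_right[OF Rel_gr[OF sh]] gr_total[OF sh] gr_single_valued[OF sh]
      Idr_left[OF assms(1)] Idr_right[OF assms(1)] assms(3,4) by auto
  ultimately have "gr (s \<cdot> h) = G" using Fun_eqI Rsh RG by blast
  then show ?thesis using that[OF sh] by blast
qed

end

section \<open>The reflector\<close>

text \<open>Universal arrows are chosen object by object; uniqueness of factorizations yields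
  functoriality of the choice and naturality of the unit.\<close>

lemma left_adjoint_of_universal_arrows:
  assumes R: "is_functor D C R"
    and ex: "\<And>a. a \<in> Ob C \<Longrightarrow> \<exists>d u. d \<in> Ob D \<and> u \<in> Hom C a (Fob R d) \<and>
      (\<forall>d'\<in>Ob D. \<forall>f\<in>Hom C a (Fob R d'). \<exists>!g. g \<in> Hom D d d' \<and> Far R g \<cdot>\<^bsub>C\<^esub> u = f)"
  shows "\<exists>L \<eta>. left_adjoint C D L R \<eta>"
proof -
  have D: "category D" and C: "category C" using R by (auto simp: is_functor_def)
  have RH: "Far R g \<in> Hom C (Fob R d) (Fob R d')" if "g \<in> Hom D d d'" for g d d'
    using R that unfolding is_functor_def Hom_def by auto
  have Rc: "Far R (h \<cdot>\<^bsub>D\<^esub> g) = Far R h \<cdot>\<^bsub>C\<^esub> Far R g" if "g \<in> Hom D a b" "h \<in> Hom D b c" for g h a b c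
    using R that unfolding is_functor_def Hom_def by auto
  have Ri: "Far R (Ident D d) = Ident C (Fob R d)" if "d \<in> Ob D" for d using R that by (simp add: is_functor_def)
  have "\<forall>a\<in>Ob C. \<exists>du. fst du \<in> Ob D \<and> snd du \<in> Hom C a (Fob R (fst du)) \<and>
      (\<forall>d'\<in>Ob D. \<forall>f\<in>Hom C a (Fob R d'). \<exists>!g. g \<in> Hom D (fst du) d' \<and> Far R g \<cdot>\<^bsub>C\<^esub> snd du = f)"
  proof
    fix a assume "a \<in> Ob C"
    from ex[OF this] obtain d u where "d \<in> Ob D \<and> u \<in> Hom C a (Fob R d) \<and>
      (\<forall>d'\<in>Ob D. \<forall>f\<in>Hom C a (Fob R d'). \<exists>!g. g \<in> Hom D d d' \<and> Far R g \<cdot>\<^bsub>C\<^esub> u = f)" by blast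
    then show "\<exists>du. fst du \<in> Ob D \<and> snd du \<in> Hom C a (Fob R (fst du)) \<and>
      (\<forall>d'\<in>Ob D. \<forall>f\<in>Hom C a (Fob R d'). \<exists>!g. g \<in> Hom D (fst du) d' \<and> Far R g \<cdot>\<^bsub>C\<^esub> snd du = f)"
      by (intro exI[of _ "(d, u)"]) simp
  qed
  from bchoice[OF this] obtain k where k: "\<And>a. a \<in> Ob C \<Longrightarrow> fst (k a) \<in> Ob D"
    "\<And>a. a \<in> Ob C \<Longrightarrow> snd (k a) \<in> Hom C a (Fob R (fst (k a)))"
    "\<And>a d' f. a \<in> Ob C \<Longrightarrow> d' \<in> Ob D \<Longrightarrow> f \<in> Hom C a (Fob R d') \<Longrightarrow>
      \<exists>!g. g \<in> Hom D (fst (k a)) d' \<and> Far R g \<cdot>\<^bsub>C\<^esub> snd (k a) = f" by blast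
  let ?o = "\<lambda>a. fst (k a)" and ?u = "\<lambda>a. snd (k a)"
  define l where "l f = (THE g. g \<in> Hom D (?o (Dom C f)) (?o (Cod C f)) \<and>
    Far R g \<cdot>\<^bsub>C\<^esub> ?u (Dom C f) = ?u (Cod C f) \<cdot>\<^bsub>C\<^esub> f)" for f
  have l: "l f \<in> Hom D (?o a) (?o b)" "Far R (l f) \<cdot>\<^bsub>C\<^esub> ?u a = ?u b \<cdot>\<^bsub>C\<^esub> f" if f: "f \<in> Hom C a b" for f a b
  proof -
    note o = Hom_Ob[OF C f]
    have "\<exists>!g. g \<in> Hom D (?o a) (?o b) \<and> Far R g \<cdot>\<^bsub>C\<^esub> ?u a = ?u b \<cdot>\<^bsub>C\<^esub> f"
      using k(3)[OF o(1) k(1)[OF o(2)] comp_Hom[OF C k(2)[OF o(2)] f]] .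
    from theI'[OF this] show "l f \<in> Hom D (?o a) (?o b)" "Far R (l f) \<cdot>\<^bsub>C\<^esub> ?u a = ?u b \<cdot>\<^bsub>C\<^esub> f"
      unfolding l_def HomD(2,3)[OF f] by blast+
  qed
  have uniq: "g = h" if "a \<in> Ob C" "d' \<in> Ob D" "g \<in> Hom D (?o a) d'" "h \<in> Hom D (?o a) d'"
    "Far R g \<cdot>\<^bsub>C\<^esub> ?u a = Far R h \<cdot>\<^bsub>C\<^esub> ?u a" for a d' g h
  proof -
    have "\<exists>!x. x \<in> Hom D (?o a) d' \<and> Far R x \<cdot>\<^bsub>C\<^esub> ?u a = Far R h \<cdot>\<^bsub>C\<^esub> ?u a"
      using k(3)[OF that(1,2) comp_Hom[OF C RH[OF that(4)] k(2)[OF that(1)]]] .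
    then obtain x where "\<And>y. y \<in> Hom D (?o a) d' \<Longrightarrow> Far R y \<cdot>\<^bsub>C\<^esub> ?u a = Far R h \<cdot>\<^bsub>C\<^esub> ?u a \<Longrightarrow> y = x" by auto
    from this[OF that(3,5)] this[OF that(4) refl] show ?thesis by simp
  qed
  define L where "L = \<lparr>Fob = ?o, Far = l\<rparr>"
  have LF: "is_functor C D L"
    unfolding is_functor_def L_def ftor.simps
  proof (intro conjI ballI impI C D)
    fix a assume a: "a \<in> Ob C"
    show oa: "?o a \<in> Ob D" using k(1)[OF a] .
    note i = Ident_Hom[OF C a]
    show "l (Ident C a) = Ident D (?o a)"
      by (rule uniq[OF a oa l(1)[OF i] Ident_Hom[OF D oa]])
        (simp add: l(2)[OF i] Ri[OF oa] comp_Ident_left[OF C k(2)[OF a]] comp_Ident_right[OF C k(2)[OF a]])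
  next
    fix f assume f: "f \<in> Arr C"
    show "l f \<in> Hom D (?o (Dom C f)) (?o (Cod C f))" using l(1)[OF Arr_Hom[OF f]] .
    fix g assume g: "g \<in> Arr C" and e: "Cod C f = Dom C g"
    have f': "f \<in> Hom C (Dom C f) (Dom C g)" and g': "g \<in> Hom C (Dom C g) (Cod C g)" using f g e by (auto simp: Hom_def)
    note gf = comp_Hom[OF C g' f'] and lgf = comp_Hom[OF D l(1)[OF g'] l(1)[OF f']]
    note a = Hom_Ob(1)[OF C f'] and b = Hom_Ob(1)[OF C g'] and c = Hom_Ob(2)[OF C g']
    show "l (g \<cdot>\<^bsub>C\<^esub> f) = l g \<cdot>\<^bsub>D\<^esub> l f"
    proof (rule uniq[OF a k(1)[OF c] l(1)[OF gf] lgf])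
      have "Far R (l g \<cdot>\<^bsub>D\<^esub> l f) \<cdot>\<^bsub>C\<^esub> ?u (Dom C f) = Far R (l g) \<cdot>\<^bsub>C\<^esub> (?u (Dom C g) \<cdot>\<^bsub>C\<^esub> f)"
        using Rc[OF l(1)[OF f'] l(1)[OF g']] comp_assoc_Hom[OF C k(2)[OF a] RH[OF l(1)[OF f']] RH[OF l(1)[OF g']]] l(2)[OF f']
        by simp
      also have "\<dots> = ?u (Cod C g) \<cdot>\<^bsub>C\<^esub> (g \<cdot>\<^bsub>C\<^esub> f)"
        using comp_assoc_Hom[OF C f' k(2)[OF b] RH[OF l(1)[OF g']]] comp_assoc_Hom[OF C f' g' k(2)[OF c]] l(2)[OF g'] by simp
      finally show "Far R (l (g \<cdot>\<^bsub>C\<^esub> f)) \<cdot>\<^bsub>C\<^esub> ?u (Dom C f) = Far R (l g \<cdot>\<^bsub>D\<^esub> l f) \<cdot>\<^bsub>C\<^esub> ?u (Dom C f)"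
        using l(2)[OF gf] by simp
    qed
  qed
  have "is_functor C C id_ftor" using C unfolding is_functor_def id_ftor_def category_def Hom_def by auto
  moreover have "is_functor C C (comp_ftor R L)"
    unfolding is_functor_def comp_ftor_def ftor.simps
  proof (intro conjI ballI impI C)
    show "Fob R (Fob L a) \<in> Ob C" if "a \<in> Ob C" for a using R LF that unfolding is_functor_def by blast
    show "Far R (Far L f) \<in> Hom C (Fob R (Fob L (Dom C f))) (Fob R (Fob L (Cod C f)))" if "f \<in> Arr C" for f
      using RH LF that unfolding is_functor_def by blast
    show "Far R (Far L (Ident C a)) = Ident C (Fob R (Fob L a))" if "a \<in> Ob C" for a
      using Ri LF that unfolding is_functor_def by simp
    show "Far R (Far L (g \<cdot>\<^bsub>C\<^esub> f)) = Far R (Far L g) \<cdot>\<^bsub>C\<^esub> Far R (Far L f)"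
      if "f \<in> Arr C" "g \<in> Arr C" "Cod C f = Dom C g" for f g
    proof -
      have f: "Far L f \<in> Hom D (Fob L (Dom C f)) (Fob L (Dom C g))" and g: "Far L g \<in> Hom D (Fob L (Dom C g)) (Fob L (Cod C g))"
        using LF that unfolding is_functor_def by auto
      show ?thesis using Rc[OF f g] LF that unfolding is_functor_def by simp
    qed
  qed
  ultimately have "nat_trans C C id_ftor (comp_ftor R L) ?u"
    using k(2) l(2)[OF Arr_Hom] unfolding nat_trans_def by (simp add: id_ftor_def comp_ftor_def L_def)
  then have "left_adjoint C D L R ?u"
    using LF R k(3) unfolding left_adjoint_def by (simp add: L_def)
  then show ?thesis by blast
qed

section \<open>Reflections into constant objects: existence and universality\<close>

context tcframe
begin

lemmas rl = Rl_comp Rl_cv Rl_Int Rl_bx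

lemma comp_intro_Rl: "(\<theta>, a, b) \<in> P \<Longrightarrow> (\<theta>, b, c) \<in> Q \<Longrightarrow> P \<in> Rl \<Longrightarrow> Q \<in> Rl \<Longrightarrow> (\<theta>, a, c) \<in> P \<odot> Q"
  using comp_intro Rl_Cl by simp

text \<open>After closure \<open>e\<close> is invertible: its kernel becomes
  \<open>bx (ob A)\<close> and its image everything. As it mentions no other arrows, the condition
  can be carried through relational calculations.\<close>

definition reflection :: "'o \<times> 'p \<Rightarrow> 'o \<Rightarrow> ('p \<times> 'm \<times> 'm) set \<Rightarrow> bool" where
  "reflection A Q e \<longleftrightarrow> Q \<in> Ob X \<and> e \<in> HomR A (dl Q) \<and> e \<odot> cv e \<subseteq> bx (ob A) \<and> Idr Q \<subseteq> bx (cv e \<odot> e)"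

text \<open>The relation lives on part of the carrier, so the quotient is formed on the subobject
  \<open>i\<close> of it given by \<open>\<pi>\<close> of the domain predicate \<open>?d\<close>.
  There the closure \<open>E\<close> is reflexive, and being closed it is tabulated by an
  equivalence relation \<open>s\<close>, \<open>t\<close> in the base, effective by exactness. The
  arrow \<open>e\<close> moves to \<open>U\<close> along \<open>i\<close> and then passes to the
  quotient.\<close>

lemma reflection_ex:
  assumes A: "per F A"
  shows "\<exists>Q e. reflection A Q e"
proof -
  let ?C = "fst A" and ?r = "ob A"
  note r = per_ob[OF A]
  note C = r(1)
  have rr: "?r \<odot> P = ?r \<odot> ?r \<odot> P" if "P \<in> Rl" for P using Rl_assoc[OF r(5,5) that] r(7) by simp
  let ?d = "inst2 F (snd A) (Ident X ?C) (Ident X ?C)"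
  note ic = idH[OF C]
  note d = inst2_fib[OF ic ic r(2)]
  have d_iff: "\<theta> \<preceq> rx a ?d \<longleftrightarrow> (\<theta>, a, a) \<in> ?r" if "a \<in> Hom X Z ?C" "\<theta> \<in> fib Z" for \<theta> a Z
    using inst2_iff[OF ic ic r(2) that] cmp_idl[OF that(1)] by (simp add: ob_def)
  define i where "i = \<pi> ?d"
  define U where "U = Dom X i"
  have m: "mono_arr X i" "i \<in> Hom X U (fst A)" using pi_mono_arr[OF d] by (simp_all add: i_def U_def)
  note Uo = HomOb(1)[OF m(2)]
  define I where "I = gr i"
  define E where "E = I \<odot> bx ?r \<odot> cv I"
  have I: "I \<in> Rel U ?C" and bI: "bx I = I" and svI: "cv I \<odot> I \<subseteq> Idr ?C"
    unfolding I_def using Rel_gr[OF m(2)] bx_gr[OF m(2)] gr_single_valued[OF m(2)] .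
  note RI = Rel_Rl[OF I]
  have E: "E \<in> Rel U U" unfolding E_def using Rel_comp[OF I Rel_comp[OF Rel_bx[OF r(4)] Rel_cv[OF I]]] .
  have bE: "bx E = E" unfolding E_def using RI r(5) rl by (simp add: bx_comp bx_idem bx_cv bI)
  \<comment> \<open>An element of \<open>U\<close> satisfies the closure of the domain predicate,
    and by stability of \<open>box\<close> it is then related to itself by the closure of the
    relation.\<close>
  have Erefl: "Idr U \<subseteq> E"
  proof clarify
    fix \<theta> u v assume uv: "(\<theta>, u, v) \<in> Idr U"
    note h = extD(1-3)[OF uv[unfolded Idr_def]]
    note iv = cmpH[OF m(2) h(3)]
    have "\<theta> \<preceq> rx (i \<cdot> v) (box ?d)" using delta_intro[OF m(2) h(3,1)] i_def by simp
    moreover have "box ?d \<preceq> inst2 F (box (snd A)) (Ident X ?C) (Ident X ?C)"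
      unfolding inst2_def using box_rx(2)[OF pairH[OF ic ic] r(2)] .
    ultimately have "\<theta> \<preceq> rx (i \<cdot> v) (inst2 F (box (snd A)) (Ident X ?C) (Ident X ?C))"
      using rx_mono[OF _ inst2_fib[OF ic ic box_fib[OF r(2)]] iv] ent_trans by blast
    then have "(\<theta>, i \<cdot> v, i \<cdot> v) \<in> bx ?r"
      using inst2_iff[OF ic ic box_fib[OF r(2)] iv h(1)] cmp_idl[OF iv] bx_ext[OF r(2) C C] by (simp add: ob_def)
    moreover have "(\<theta>, v, i \<cdot> v) \<in> I" using gr_intro[OF m(2) h(3,1)] by (simp add: I_def)
    ultimately have "(\<theta>, v, v) \<in> E" unfolding E_def using RI r(5) rl by (meson comp_intro Rl_Cl cv_iff)
    then show "(\<theta>, u, v) \<in> E" using Idr_subst[OF uv Uo _ Rel_Cl[OF E]] by blast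
  qed
  have Esym: "cv E = E" unfolding E_def using RI r(5) rl by (simp add: cv_comp bx_cv[symmetric] r(6) Rl_assoc)
  have Etrans: "E \<odot> E \<subseteq> E"
  proof -
    have "E \<odot> E = I \<odot> bx ?r \<odot> (cv I \<odot> I) \<odot> bx ?r \<odot> cv I" unfolding E_def using RI r(5) rl by (simp add: Rl_assoc)
    also have "\<dots> \<subseteq> I \<odot> bx ?r \<odot> Idr ?C \<odot> bx ?r \<odot> cv I" by (intro comp_mono order_refl svI)
    also have "\<dots> = I \<odot> (bx ?r \<odot> bx ?r) \<odot> cv I"
      using Idr_left[OF Rel_comp[OF Rel_bx[OF r(4)] Rel_cv[OF I]]] RI r(5) rl by (simp add: Rl_assoc)
    also have "\<dots> = E" unfolding E_def using bx_comp[OF r(5,5)] r(7) by simp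
    finally show ?thesis .
  qed
  obtain R s t where s: "s \<in> Hom X R U" and t: "t \<in> Hom X R U" and Et: "E = cv (gr s) \<odot> gr t"
    and jm: "\<And>Z f g. f \<in> Hom X Z R \<Longrightarrow> g \<in> Hom X Z R \<Longrightarrow> s \<cdot> f = s \<cdot> g \<Longrightarrow> t \<cdot> f = t \<cdot> g \<Longrightarrow> f = g"
    and fac: "\<And>Z x y. x \<in> Hom X Z U \<Longrightarrow> y \<in> Hom X Z U \<Longrightarrow> cv (gr x) \<odot> gr y \<subseteq> E \<Longrightarrow>
       \<exists>h\<in>Hom X Z R. s \<cdot> h = x \<and> t \<cdot> h = y"
    by (rule tabulation[OF E bE], rule that)
  note gs = Rel_gr[OF s] and gt = Rel_gr[OF t]
  note Rst = Rel_Rl[OF gs] Rel_Rl[OF gt]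
  have "equivalence_relation X s t"
    unfolding equivalence_relation_def HomD[OF s] HomD[OF t]
  proof (intro conjI allI impI ballI refl)
    show "s \<in> Arr X" "t \<in> Arr X" using HomD(1)[OF s] HomD(1)[OF t] .
    show "f = g" if "f \<in> Hom X z R" "g \<in> Hom X z R" "s \<cdot> f = s \<cdot> g" "t \<cdot> f = t \<cdot> g" for z f g
      using jm that by blast
    have "cv (gr (Ident X U)) \<odot> gr (Ident X U) = Idr U"
      using gr_Ident[OF Uo] cv_Idr[OF Uo] Idr_left[OF Rel_Idr[OF Uo]] by simp
    then show "\<exists>d\<in>Hom X U R. s \<cdot> d = Ident X U \<and> t \<cdot> d = Ident X U"
      using fac[OF idH[OF Uo] idH[OF Uo]] Erefl by simp
    have "cv (gr t) \<odot> gr s = cv E" unfolding Et by (simp add: cv_comp)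
    then show "\<exists>w\<in>Hom X R R. s \<cdot> w = t \<and> t \<cdot> w = s" using fac[OF t s] Esym by simp
    fix p q assume pb: "is_pullback X t s p q"
    note P = pullback_Hom[OF pb t]
    have R: "Dom X s = R" using HomD[OF s] by simp
    have p: "p \<in> Hom X (Dom X p) R" and q: "q \<in> Hom X (Dom X p) R" and c: "t \<cdot> p = s \<cdot> q" using P R by auto
    note gp = Rel_gr[OF p] and gq = Rel_gr[OF q] note Rpq = Rel_Rl[OF gp] Rel_Rl[OF gq]
    have "cv (gr p) \<odot> gr q = cv (gr p) \<odot> gr q \<odot> Idr R" using Idr_right[OF gq] by simp
    also have "\<dots> \<subseteq> cv (gr p) \<odot> gr q \<odot> gr s \<odot> cv (gr s)" by (intro comp_mono order_refl gr_total[OF s])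
    also have "\<dots> = (cv (gr p) \<odot> gr p) \<odot> gr t \<odot> cv (gr s)"
      using gr_comp[OF p t] gr_comp[OF q s] c Rpq Rst rl Rl_assoc[of "gr q" "gr s" "cv (gr s)"]
        Rl_assoc[of "gr p" "gr t" "cv (gr s)"] Rl_assoc[of "cv (gr p)" "gr p" "gr t \<odot> cv (gr s)"] by simp
    also have "\<dots> \<subseteq> Idr R \<odot> gr t \<odot> cv (gr s)" by (intro comp_mono order_refl gr_single_valued[OF p])
    also have "\<dots> = gr t \<odot> cv (gr s)" using Idr_left[OF Rel_comp[OF gt Rel_cv[OF gs]]] .
    finally have pq: "cv (gr p) \<odot> gr q \<subseteq> gr t \<odot> cv (gr s)" .
    have "cv (gr (s \<cdot> p)) \<odot> gr (t \<cdot> q) = cv (gr s) \<odot> (cv (gr p) \<odot> gr q) \<odot> gr t"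
      using gr_comp[OF p s] gr_comp[OF q t] Rpq Rst rl by (simp add: cv_comp Rl_assoc)
    also have "\<dots> \<subseteq> cv (gr s) \<odot> (gr t \<odot> cv (gr s)) \<odot> gr t" by (intro comp_mono order_refl pq)
    also have "\<dots> = E \<odot> E" unfolding Et using Rst rl by (simp add: Rl_assoc)
    finally have "cv (gr (s \<cdot> p)) \<odot> gr (t \<cdot> q) \<subseteq> E" using Etrans by blast
    then show "\<exists>ta\<in>Hom X (Dom X p) R. s \<cdot> ta = s \<cdot> p \<and> t \<cdot> ta = t \<cdot> q"
      using fac[OF cmpH[OF s p] cmpH[OF t q]] by blast
  qed
  \<comment> \<open>Exactness gives some \<open>f\<close> with kernel pair \<open>s\<close>,
    \<open>t\<close>, which need not be the quotient. The coequalizer \<open>e0\<close> is a regular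
    epi, and as \<open>f\<close> factors through it as \<open>k \<cdot> e0\<close>, the kernel of
    \<open>e0\<close> is contained in that of \<open>f\<close>, hence in \<open>E\<close>.\<close>
  then obtain f where pb: "is_pullback X f f s t" using exactX unfolding exact_category_def by blast
  then obtain e0 where co: "is_coequalizer X s t e0" using regX unfolding regular_category_def by blast
  have f: "f \<in> Hom X U (Cod X f)" using pb HomD[OF s] by (auto simp: is_pullback_def Hom_def)
  have re: "regular_epi X e0" using co unfolding regular_epi_def by blast
  let ?Q = "Cod X e0"
  have e0: "e0 \<in> Hom X U ?Q" using co HomD[OF s] by (auto simp: is_coequalizer_def Hom_def)
  note Q = HomOb(2)[OF e0]
  have es: "e0 \<cdot> s = e0 \<cdot> t" using co unfolding is_coequalizer_def by blast
  have "f \<cdot> s = f \<cdot> t" using pb unfolding is_pullback_def by blast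
  moreover have "\<forall>z\<in>Ob X. \<forall>h\<in>Hom X (Dom X e0) z. h \<cdot> s = h \<cdot> t \<longrightarrow> (\<exists>!k. k \<in> Hom X (Cod X e0) z \<and> k \<cdot> e0 = h)"
    using co unfolding is_coequalizer_def by blast
  ultimately obtain k where k: "k \<in> Hom X ?Q (Cod X f)" "k \<cdot> e0 = f"
    using f HomOb(2)[OF f] HomD(2)[OF e0] by metis
  let ?g = "gr e0"
  note g = Rel_gr[OF e0] note Rg = Rel_Rl[OF g] and Rk = Rel_Rl[OF Rel_gr[OF k(1)]]
  have ker: "?g \<odot> cv ?g \<subseteq> E"
  proof -
    have "?g \<odot> cv ?g = ?g \<odot> Idr ?Q \<odot> cv ?g" using Idr_left[OF Rel_cv[OF g]] by simp
    also have "\<dots> \<subseteq> ?g \<odot> (gr k \<odot> cv (gr k)) \<odot> cv ?g" by (intro comp_mono order_refl gr_total[OF k(1)])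
    also have "\<dots> = gr f \<odot> cv (gr f)" using gr_comp[OF e0 k(1)] k(2) Rg Rk rl by (simp add: cv_comp Rl_assoc)
    also have "\<dots> \<subseteq> E" unfolding Et using gr_pullback[OF pb f f] .
    finally show ?thesis .
  qed
  \<comment> \<open>An element \<open>c\<close> of the domain need not lift to \<open>U\<close> at
    its own stage; \<open>cv I\<close> expresses \<open>i \<cdot> u = c\<close> as a relation and
    leaves the choice of \<open>u\<close> local.\<close>
  let ?e = "?r \<odot> cv I \<odot> ?g"
  have e: "?e \<in> Rel ?C ?Q" using Rel_comp[OF r(4) Rel_comp[OF Rel_cv[OF I] g]] .
  have ee: "cv ?e \<odot> ?e = cv ?g \<odot> (I \<odot> ?r \<odot> cv I) \<odot> ?g"
    using RI r(5) Rg rl rr[of "cv I \<odot> ?g"] by (simp add: cv_comp Rl_assoc r(6))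
  have sv: "cv ?e \<odot> ?e \<subseteq> Idr ?Q"
  proof -
    have "cv ?e \<odot> ?e \<subseteq> cv ?g \<odot> E \<odot> ?g" unfolding ee E_def by (intro comp_mono order_refl bx_unit[OF r(5)])
    also have "\<dots> = cv (gr (e0 \<cdot> s)) \<odot> gr (e0 \<cdot> t)"
      unfolding Et using gr_comp[OF s e0] gr_comp[OF t e0] Rst Rg rl by (simp add: cv_comp Rl_assoc)
    also have "\<dots> \<subseteq> Idr ?Q" using gr_single_valued[OF cmpH[OF e0 t]] es by simp
    finally show ?thesis .
  qed
  \<comment> \<open>The domain predicate lies below its closure \<open>delta F i\<close>, so on a
    cover each element of the domain comes from \<open>U\<close>.\<close>
  have loc: "?r \<subseteq> ?r \<odot> cv I \<odot> I \<odot> ?r"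
  proof clarify
    fix \<theta> a b assume ab: "(\<theta>, a, b) \<in> ?r"
    have h: "\<theta> \<in> fib (base \<theta>)" "a \<in> Hom X (base \<theta>) ?C" "b \<in> Hom X (base \<theta>) ?C" using Rel_typed[OF r(4) ab] by auto
    have "\<theta> \<preceq> rx a ?d" using d_iff[OF h(2,1)] PER_refl(1)[OF r(3) ab] by blast
    then have ad: "\<theta> \<preceq> rx a (delta F i)"
      unfolding i_def using rx_mono[OF box_unit[OF d] box_fib[OF d] h(2)] ent_trans by blast
    obtain W w y \<chi> where w: "w \<in> Hom X W (base \<theta>)" and ch: "\<chi> \<in> fib W" "\<chi> \<preceq> rx w \<theta>" "\<theta> \<preceq> Exists F w \<chi>"
      and y: "y \<in> Hom X W U" "i \<cdot> y = a \<cdot> w" using delta_elim[OF ad h(2) m(2)] .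
    have yI: "(\<chi>, y, a \<cdot> w) \<in> I" using gr_intro[OF m(2) y(1) ch(1)] y(2) by (simp add: I_def)
    have rw: "(\<chi>, a \<cdot> w, b \<cdot> w) \<in> ?r" using Cl_restrict[OF Rl_Cl[OF r(5)] ab w ch(2)] .
    have R3: "I \<odot> ?r \<in> Rl" "cv I \<odot> I \<odot> ?r \<in> Rl" "?r \<odot> cv I \<odot> I \<odot> ?r \<in> Rl" using RI r(5) rl by simp_all
    have "(\<chi>, y, b \<cdot> w) \<in> I \<odot> ?r" using comp_intro_Rl[OF yI rw RI r(5)] .
    then have "(\<chi>, a \<cdot> w, b \<cdot> w) \<in> cv I \<odot> I \<odot> ?r" using comp_intro_Rl[OF _ _ Rl_cv[OF RI] R3(1)] yI by simp
    then have "(\<chi>, a \<cdot> w, b \<cdot> w) \<in> ?r \<odot> cv I \<odot> I \<odot> ?r"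
      using comp_intro_Rl[OF PER_refl(1)[OF r(3) rw] _ r(5) R3(2)] by simp
    then show "(\<theta>, a, b) \<in> ?r \<odot> cv I \<odot> I \<odot> ?r"
      using Cl_local[OF Rl_Cl[OF R3(3)] spnI[OF h] w ch(2,3)] by simp
  qed
  have ec: "?e \<odot> cv ?e = ?r \<odot> cv I \<odot> (?g \<odot> cv ?g) \<odot> I \<odot> ?r"
    using RI r(5) Rg rl by (simp add: cv_comp Rl_assoc r(6))
  have tot: "?r \<subseteq> ?e \<odot> cv ?e"
  proof -
    have "?r \<odot> cv I \<odot> I \<odot> ?r = ?r \<odot> cv I \<odot> Idr U \<odot> I \<odot> ?r" using Idr_left[OF Rel_comp[OF I r(4)]] by simp
    also have "\<dots> \<subseteq> ?e \<odot> cv ?e" unfolding ec by (intro comp_mono order_refl gr_total[OF e0])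
    finally show ?thesis using loc by blast
  qed
  have kere: "?e \<odot> cv ?e \<subseteq> bx ?r"
  proof -
    have "?e \<odot> cv ?e \<subseteq> ?r \<odot> cv I \<odot> E \<odot> I \<odot> ?r" unfolding ec by (intro comp_mono order_refl ker)
    also have "\<dots> = ?r \<odot> (cv I \<odot> I) \<odot> bx ?r \<odot> (cv I \<odot> I) \<odot> ?r" unfolding E_def using RI r(5) rl by (simp add: Rl_assoc)
    also have "\<dots> \<subseteq> ?r \<odot> Idr ?C \<odot> bx ?r \<odot> Idr ?C \<odot> ?r" by (intro comp_mono order_refl svI)
    also have "\<dots> = ?r \<odot> bx ?r \<odot> ?r"
      using Idr_left[OF r(4)] Idr_left[OF Rel_comp[OF Rel_bx[OF r(4)] r(4)]] by simp
    also have "\<dots> \<subseteq> bx ?r \<odot> bx ?r \<odot> bx ?r" by (intro comp_mono order_refl bx_unit[OF r(5)])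
    also have "\<dots> = bx ?r" using r(5,7) rl by (simp add: bx_comp[symmetric])
    finally show ?thesis .
  qed
  \<comment> \<open>Closure is essential here: \<open>e0\<close> covers the quotient by
    \<open>U\<close>, but elements of \<open>U\<close> satisfy the domain predicate only up to
    \<open>box\<close>.\<close>
  have surj: "Idr ?Q \<subseteq> bx (cv ?e \<odot> ?e)"
  proof -
    have "Idr ?Q \<subseteq> cv ?g \<odot> ?g" using gr_regular_epi[OF re e0] .
    also have "\<dots> = cv ?g \<odot> Idr U \<odot> ?g" using Idr_left[OF g] by simp
    also have "\<dots> \<subseteq> cv ?g \<odot> E \<odot> ?g" by (intro comp_mono order_refl Erefl)
    also have "\<dots> = bx (cv ?e \<odot> ?e)"
      unfolding ee E_def using RI r(5) Rg rl by (simp add: bx_comp bx_cv bI bx_gr[OF e0])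
    finally show ?thesis .
  qed
  have "?e \<in> HomR A (dl ?Q)"
    unfolding HomR_dl using e rr[of "cv I \<odot> ?g"] RI Rg rl sv tot by simp
  then show ?thesis using Q kere surj unfolding reflection_def by blast
qed

text \<open>The factorization has graph \<open>bx (cv e \<odot> f)\<close>. The kernel bound makes
  this relation single-valued, surjectivity makes it total, and it is closed, so unique choice
  applies. For uniqueness, \<open>bx (cv e \<odot> e)\<close> is the identity, so
  \<open>gr g\<close> equals \<open>bx (cv e \<odot> e \<odot> gr g)\<close>, which is determined by
  \<open>f\<close>.\<close>

lemma reflection_universal:
  assumes e: "reflection A Q e" and A: "per F A" and f: "f \<in> HomR A (dl I)" and I: "I \<in> Ob X"
  shows "\<exists>!g. g \<in> Hom X Q I \<and> e \<odot> gr g = f"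
proof -
  let ?r = "ob A"
  note r = per_ob[OF A]
  have Q: "Q \<in> Ob X" and eH: "e \<in> HomR A (dl Q)" and ker: "e \<odot> cv e \<subseteq> bx ?r" and sur: "Idr Q \<subseteq> bx (cv e \<odot> e)"
    using e by (auto simp: reflection_def)
  have e: "e \<in> Rel (fst A) Q" "?r \<odot> e = e" "cv e \<odot> e \<subseteq> Idr Q" "?r \<subseteq> e \<odot> cv e" using eH by (auto simp: HomR_dl)
  have f': "f \<in> Rel (fst A) I" "?r \<odot> f = f" "cv f \<odot> f \<subseteq> Idr I" "?r \<subseteq> f \<odot> cv f" using f by (auto simp: HomR_dl)
  note Re = Rel_Rl[OF e(1)] and Rf = Rel_Rl[OF f'(1)]
  let ?G = "bx (cv e \<odot> f)"
  have G: "?G \<in> Rel Q I" using Rel_bx[OF Rel_comp[OF Rel_cv[OF e(1)] f'(1)]] .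
  have "cv ?G \<odot> ?G = bx (cv f \<odot> (e \<odot> cv e) \<odot> f)" using Re Rf rl by (simp add: bx_cv[symmetric] bx_comp cv_comp Rl_assoc)
  also have "\<dots> \<subseteq> bx (cv f \<odot> bx ?r \<odot> f)" by (intro bx_mono comp_mono order_refl ker)
  also have "\<dots> = bx (cv f \<odot> ?r \<odot> f)" using Re Rf r(5) rl by (simp add: bx_comp bx_idem)
  also have "\<dots> \<subseteq> bx (Idr I)" using f'(2,3) bx_mono by simp
  finally have sv: "cv ?G \<odot> ?G \<subseteq> Idr I" using bx_Idr[OF I] by simp
  have "Idr Q \<subseteq> bx (cv e \<odot> ?r \<odot> e)" using sur e(2) by simp
  also have "\<dots> \<subseteq> bx (cv e \<odot> (f \<odot> cv f) \<odot> e)" by (intro bx_mono comp_mono order_refl f'(4))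
  also have "\<dots> = ?G \<odot> cv ?G" using Re Rf rl by (simp add: bx_cv[symmetric] bx_comp cv_comp Rl_assoc)
  finally have tot: "Idr Q \<subseteq> ?G \<odot> cv ?G" .
  have "bx ?G = ?G" using Re Rf rl by (simp add: bx_idem)
  then obtain g where g: "g \<in> Hom X Q I" "gr g = ?G" using function_comprehension[OF G _ sv tot] by blast
  have "f \<subseteq> (e \<odot> cv e) \<odot> f" using comp_mono[OF e(4) order_refl, of f] f'(2) by simp
  also have "\<dots> = e \<odot> cv e \<odot> f" using Re Rf rl by (simp add: Rl_assoc)
  also have "\<dots> \<subseteq> e \<odot> gr g" unfolding g(2) using Re Rf rl by (intro comp_mono order_refl bx_unit) simp
  finally have le: "f \<subseteq> e \<odot> gr g" .
  have "e \<odot> gr g \<in> HomR A (dl I)" using HomR_comp[OF eH gr_HomR[OF g(1)] A per_equality[OF Q] per_equality[OF I]] .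
  then have "e \<odot> gr g = f" using Fun_eqI[OF HomRD(7)[OF f] HomRD(7) le Rf HomRD(2)] by blast
  moreover have "g1 = g2" if "g1 \<in> Hom X Q I" "e \<odot> gr g1 = f" "g2 \<in> Hom X Q I" "e \<odot> gr g2 = f" for g1 g2
  proof -
    have eq: "bx (cv e \<odot> e) \<odot> gr g' = bx (cv e \<odot> f)" if "g' \<in> Hom X Q I" "e \<odot> gr g' = f" for g'
    proof -
      note R' = Rel_Rl[OF Rel_gr[OF that(1)]]
      have "bx (cv e \<odot> e) \<odot> gr g' = bx (cv e \<odot> e \<odot> gr g')"
        using Re R' rl by (simp add: bx_comp bx_gr[OF that(1)] Rl_assoc)
      then show ?thesis using that(2) by simp
    qed
    have "gr g1 = Idr Q \<odot> gr g1" using Idr_left[OF Rel_gr[OF that(1)]] by simp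
    also have "\<dots> \<subseteq> bx (cv e \<odot> e) \<odot> gr g1" by (intro comp_mono order_refl sur)
    also have "\<dots> = bx (cv e \<odot> e) \<odot> gr g2" using eq that by simp
    also have "\<dots> \<subseteq> bx (Idr Q) \<odot> gr g2" by (intro comp_mono order_refl bx_mono e)
    also have "\<dots> = gr g2" using bx_Idr[OF Q] Idr_left[OF Rel_gr[OF that(3)]] by simp
    finally show ?thesis using gr_faithful that by blast
  qed
  ultimately show ?thesis using g(1) by blast
qed

end

text \<open>\<open>closure_op\<close> takes an arbitrary pullback leg; monicity and the class up to
  isomorphism are carried over from a leg that is computed explicitly.\<close>

lemma pullback_unique_mono:
  assumes C: "category C" and pb: "is_pullback C f g k q" and pb': "is_pullback C f g k' q'" and k: "mono_arr C k"
  shows "mono_arr C k'" "k' \<cong>\<^bsub>sub_fib C\<^esub> k"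
proof -
  have f: "f \<in> Hom C (Dom C f) (Cod C f)" using pb by (simp add: is_pullback_def Hom_def)
  note P = pullback_Hom[OF pb f] and P' = pullback_Hom[OF pb' f]
  obtain h where h: "h \<in> Hom C (Dom C k') (Dom C k)" "k \<cdot>\<^bsub>C\<^esub> h = k'" "q \<cdot>\<^bsub>C\<^esub> h = q'"
    using pullback_univ[OF pb C P'(2,3,4)] by blast
  obtain h' where h': "h' \<in> Hom C (Dom C k) (Dom C k')" "k' \<cdot>\<^bsub>C\<^esub> h' = k"
    using pullback_univ[OF pb' C P(2,3,4)] by blast
  show m: "mono_arr C k'"
  proof (rule mono_arrI[OF P'(2)])
    fix z a b assume a: "a \<in> Hom C z (Dom C k')" and b: "b \<in> Hom C z (Dom C k')" and e: "k' \<cdot>\<^bsub>C\<^esub> a = k' \<cdot>\<^bsub>C\<^esub> b"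
    have "k \<cdot>\<^bsub>C\<^esub> (h \<cdot>\<^bsub>C\<^esub> a) = k \<cdot>\<^bsub>C\<^esub> (h \<cdot>\<^bsub>C\<^esub> b)"
      using comp_assoc_Hom[OF C a h(1) P(2)] comp_assoc_Hom[OF C b h(1) P(2)] h(2) e by simp
    then have "h \<cdot>\<^bsub>C\<^esub> a = h \<cdot>\<^bsub>C\<^esub> b" using mono_arrD[OF k P(2) comp_Hom[OF C h(1) a] comp_Hom[OF C h(1) b] _ C] by blast
    then have "q' \<cdot>\<^bsub>C\<^esub> a = q' \<cdot>\<^bsub>C\<^esub> b"
      using comp_assoc_Hom[OF C a h(1) P(3)] comp_assoc_Hom[OF C b h(1) P(3)] h(3) by simp
    then show "a = b" using pullback_joint_mono[OF pb' C a b e] by blast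
  qed
  show "k' \<cong>\<^bsub>sub_fib C\<^esub> k"
    unfolding eqv_def using sub_ent_iff[OF C P'(2) P(2)] sub_ent_iff[OF C P(2) P'(2)] m k h h' by blast
qed

context tcframe
begin

lemma ob_ex: assumes "P \<in> Rel C C" "PER P" obtains A where "per F A" "fst A = C" "ob A = P"
proof -
  obtain \<rho> where "C \<in> Ob X" "\<rho> \<in> fib (prd X C C)" "P = ext C C \<rho>" using RelE[OF assms(1)] .
  then show ?thesis using that[of "(C, \<rho>)"] per_iff[of C \<rho>] assms(2) by (simp add: ob_def)
qed

lemma mk_comp_HomR:
  "f \<in> HomR A B \<Longrightarrow> g \<in> HomR B E \<Longrightarrow> mk B g E \<cdot>\<^bsub>XX\<^esub> mk A f B = mk A (f \<odot> g) E"
  using comp_mk HomRD(1) by blast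

lemma mk_dl_comp: "f \<in> HomR A (dl I) \<Longrightarrow> g \<in> Hom X I J \<Longrightarrow> Far (Delta F) g \<cdot>\<^bsub>XX\<^esub> mk A f (dl I) = mk A (f \<odot> gr g) (dl J)"
  using mk_comp_HomR gr_HomR Delta_mk by simp

section \<open>The chosen reflector\<close>

text \<open>\<open>reflector\<close> is a choice by description, so its properties hinge on the
  existence of some left adjoint; the reflections provide a universal arrow from every
  object.\<close>

lemma reflector_adjoint: "left_adjoint XX X (Pi_ftor F) (Delta F) (eta F)"
proof -
  have "\<exists>L \<eta>. left_adjoint XX X L (Delta F) \<eta>"
  proof (rule left_adjoint_of_universal_arrows[OF Delta_functor])
    fix A assume "A \<in> Ob XX"
    then have A: "per F A" by simp
    obtain Q e where e: "reflection A Q e" using reflection_ex[OF A] by blast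
    then have Q: "Q \<in> Ob X" and eH: "e \<in> HomR A (dl Q)" by (auto simp: reflection_def)
    have un: "\<exists>!g. g \<in> Hom X Q I \<and> Far (Delta F) g \<cdot>\<^bsub>XX\<^esub> mk A e (dl Q) = f"
      if I: "I \<in> Ob X" and f: "f \<in> Hom XX A (dl I)" for I f
    proof -
      obtain f' where f': "f' \<in> HomR A (dl I)" "f = mk A f' (dl I)" using f by (rule Hom_XX_E)
      have "Far (Delta F) g \<cdot>\<^bsub>XX\<^esub> mk A e (dl Q) = f \<longleftrightarrow> e \<odot> gr g = f'" if "g \<in> Hom X Q I" for g
        using mk_dl_comp[OF eH that] f'(2) mk_inj(3)[of f' A "dl I" A "e \<odot> gr g" "dl I"] HomRD(1)[OF f'(1)] by auto
      then show ?thesis using reflection_universal[OF e A f'(1) I] by blast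
    qed
    show "\<exists>d u. d \<in> Ob X \<and> u \<in> Hom XX A (Fob (Delta F) d) \<and>
      (\<forall>d'\<in>Ob X. \<forall>f\<in>Hom XX A (Fob (Delta F) d'). \<exists>!g. g \<in> Hom X d d' \<and> Far (Delta F) g \<cdot>\<^bsub>XX\<^esub> u = f)"
      unfolding Delta_simps
      by (intro exI[of _ Q] exI[of _ "mk A e (dl Q)"] conjI ballI Q mk_Hom[OF A per_equality[OF Q] eH] un)
  qed
  then have "\<exists>z. (\<lambda>(L, \<eta>). left_adjoint XX X L (Delta F) \<eta>) z" by auto
  then have "(\<lambda>(L, \<eta>). left_adjoint XX X L (Delta F) \<eta>) (reflector F)" unfolding reflector_def by (rule someI_ex)
  then show ?thesis by (simp add: Pi_ftor_def eta_def case_prod_beta)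
qed

abbreviation PP where "PP A \<equiv> Fob (Pi_ftor F) A"

lemma PP_Ob: assumes "per F A" shows "PP A \<in> Ob X"
proof -
  have "A \<in> Ob XX" using assms by simp
  then show ?thesis using reflector_adjoint unfolding left_adjoint_def is_functor_def by blast
qed

text \<open>The chosen unit need not be the quotient constructed above. Both are universal, so
  comparison arrows \<open>g\<close>, \<open>g'\<close> relate them, and along these the two
  inequalities are carried over to the actual \<open>eta\<close>.\<close>

lemma eta_reflection:
  assumes A: "per F A"
  obtains e where "eta F A = mk A e (dl (PP A))" "reflection A (PP A) e"
proof -
  let ?P = "PP A"
  note P = PP_Ob[OF A]
  have AO: "A \<in> Ob XX" using A by simp
  have univ: "\<exists>!g. g \<in> Hom X ?P I \<and> Far (Delta F) g \<cdot>\<^bsub>XX\<^esub> eta F A = f" if "I \<in> Ob X" "f \<in> Hom XX A (dl I)" for I f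
    using reflector_adjoint that AO unfolding left_adjoint_def Delta_simps by blast
  have "eta F A \<in> Hom XX A (dl ?P)"
    using reflector_adjoint AO unfolding left_adjoint_def nat_trans_def id_ftor_def comp_ftor_def ftor.simps Delta_simps
    by blast
  then obtain e where e: "e \<in> HomR A (dl ?P)" "eta F A = mk A e (dl ?P)" by (rule Hom_XX_E)
  obtain Q e0 where r: "reflection A Q e0" using reflection_ex[OF A] by blast
  then have Q: "Q \<in> Ob X" and e0: "e0 \<in> HomR A (dl Q)" and ker: "e0 \<odot> cv e0 \<subseteq> bx (ob A)"
    and sur: "Idr Q \<subseteq> bx (cv e0 \<odot> e0)" by (auto simp: reflection_def)
  obtain g' where g': "g' \<in> Hom X ?P Q" "Far (Delta F) g' \<cdot>\<^bsub>XX\<^esub> eta F A = mk A e0 (dl Q)"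
    using univ[OF Q mk_Hom[OF A per_equality[OF Q] e0]] by blast
  have eg': "e \<odot> gr g' = e0"
    using g'(2) mk_dl_comp[OF e(1) g'(1)] e(2) mk_inj(3)[OF HomRD(1)[OF e0]] by metis
  obtain g where g: "g \<in> Hom X Q ?P" "e0 \<odot> gr g = e" using reflection_universal[OF r A e(1) P] by blast
  note Re = HomRD(2)[OF e(1)] HomRD(2)[OF e0] Rel_Rl[OF Rel_gr[OF g(1)]] Rel_Rl[OF Rel_gr[OF g'(1)]]
  note gg = cmpH[OF g(1) g'(1)]
  have "e \<odot> gr (g \<cdot> g') = e" using gr_comp[OF g'(1) g(1)] Rl_assoc[OF Re(1,4,3)] eg' g(2) by simp
  then have "Far (Delta F) (g \<cdot> g') \<cdot>\<^bsub>XX\<^esub> eta F A = eta F A" using mk_dl_comp[OF e(1) gg] e(2) by simp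
  moreover have "Far (Delta F) (Ident X ?P) \<cdot>\<^bsub>XX\<^esub> eta F A = eta F A"
    using mk_dl_comp[OF e(1) idH[OF P]] e(2) gr_Ident[OF P] Idr_right[OF HomRD(1)[OF e(1)]] by simp
  ultimately have id: "g \<cdot> g' = Ident X ?P"
    using univ[OF P mk_Hom[OF A per_equality[OF P] e(1)]] gg idH[OF P] e(2) by metis
  have "e \<odot> cv e = e \<odot> Idr ?P \<odot> cv e" using Idr_left[OF Rel_cv[OF HomRD(1)[OF e(1)]]] by simp
  also have "\<dots> \<subseteq> e \<odot> (gr g' \<odot> cv (gr g')) \<odot> cv e" by (intro comp_mono order_refl gr_total[OF g'(1)])
  also have "\<dots> = e0 \<odot> cv e0" unfolding eg'[symmetric] using Re rl by (simp add: cv_comp Rl_assoc)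
  finally have ker': "e \<odot> cv e \<subseteq> bx (ob A)" using ker by blast
  have "Idr ?P = cv (gr (g \<cdot> g')) \<odot> gr (g \<cdot> g')" using id gr_Ident[OF P] cv_Idr[OF P] Idr_left[OF Rel_Idr[OF P]] by simp
  also have "\<dots> = cv (gr g) \<odot> (cv (gr g') \<odot> gr g') \<odot> gr g" using gr_comp[OF g'(1) g(1)] Re rl by (simp add: cv_comp Rl_assoc)
  also have "\<dots> \<subseteq> cv (gr g) \<odot> Idr Q \<odot> gr g" by (intro comp_mono order_refl gr_single_valued[OF g'(1)])
  also have "\<dots> \<subseteq> cv (gr g) \<odot> bx (cv e0 \<odot> e0) \<odot> gr g" by (intro comp_mono order_refl sur)
  also have "\<dots> = bx (cv e \<odot> e)" unfolding g(2)[symmetric] using Re rl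
    by (simp add: cv_comp bx_comp bx_cv bx_gr[OF g(1)] Rl_assoc)
  finally have "reflection A ?P e" using P e(1) ker' by (simp add: reflection_def)
  then show ?thesis using that e(2) by blast
qed

lemma L_monad_arrow:
  assumes m: "mk U M A \<in> Hom XX U A" and M: "M \<in> HomR U A"
    and eU: "eta F U = mk U eU (dl (PP U))" "reflection U (PP U) eU"
    and eA: "eta F A = mk A eA (dl (PP A))" "reflection A (PP A) eA"
  obtains w where "w \<in> Hom X (PP U) (PP A)" "Far (L_monad F) (mk U M A) = mk (dl (PP U)) (gr w) (dl (PP A))"
    "M \<odot> eA = eU \<odot> gr w"
proof -
  let ?w = "Far (Pi_ftor F) (mk U M A)"
  have w: "?w \<in> Hom X (PP U) (PP A)"
    using reflector_adjoint m HomD[OF m] unfolding left_adjoint_def is_functor_def by metis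
  have L: "Far (L_monad F) (mk U M A) = Far (Delta F) ?w" by (simp add: L_monad_def comp_ftor_def)
  have "\<forall>f\<in>Arr XX. eta F (Cod XX f) \<cdot>\<^bsub>XX\<^esub> f = Far (L_monad F) f \<cdot>\<^bsub>XX\<^esub> eta F (Dom XX f)"
    using reflector_adjoint unfolding left_adjoint_def nat_trans_def L_monad_def id_ftor_def ftor.simps by blast
  from bspec[OF this HomD(1)[OF m]] have "eta F A \<cdot>\<^bsub>XX\<^esub> mk U M A = Far (Delta F) ?w \<cdot>\<^bsub>XX\<^esub> eta F U"
    using L by simp
  moreover have "eU \<in> HomR U (dl (PP U))" "eA \<in> HomR A (dl (PP A))" using eU eA by (auto simp: reflection_def)
  ultimately have "mk U (M \<odot> eA) (dl (PP A)) = mk U (eU \<odot> gr ?w) (dl (PP A))"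
    using mk_comp_HomR[OF M] mk_dl_comp[OF _ w] eU(1) eA(1) by simp
  moreover have "M \<odot> eA \<in> Rel (fst U) (fst (dl (PP A)))"
    using Rel_comp[OF HomRD(1)[OF M] HomRD(1)[OF \<open>eA \<in> _\<close>]] .
  ultimately have "M \<odot> eA = eU \<odot> gr ?w" using mk_inj(3) by blast
  then show ?thesis using that[OF w] L Delta_mk[OF w] by simp
qed

section \<open>Closure of subobjects\<close>

text \<open>Cancellation by the converse: \<open>p \<subseteq> p \<odot> M \<odot> cv M = q \<odot>
  M \<odot> cv M \<subseteq> q\<close> whenever \<open>p \<odot> M = q \<odot> M\<close>.\<close>

lemma mono_mkI:
  assumes "per F U" "per F A" "M \<in> HomR U A" "M \<odot> cv M \<subseteq> ob U"
  shows "mono_arr XX (mk U M A)"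
proof (rule mono_arrI[OF mk_Hom[OF assms(1-3)]])
  fix Z f g assume f: "f \<in> Hom XX Z U" and g: "g \<in> Hom XX Z U" and e: "mk U M A \<cdot>\<^bsub>XX\<^esub> f = mk U M A \<cdot>\<^bsub>XX\<^esub> g"
  obtain p where Z: "per F Z" and p: "p \<in> HomR Z U" "f = mk Z p U" using f by (rule Hom_XX_E)
  obtain q where q: "q \<in> HomR Z U" "g = mk Z q U" using g by (rule Hom_XX_E)
  have "mk Z (p \<odot> M) A = mk Z (q \<odot> M) A" using e p(2) q(2) mk_comp_HomR[OF p(1) assms(3)] mk_comp_HomR[OF q(1) assms(3)] by simp
  then have eq: "p \<odot> M = q \<odot> M" using mk_inj(3)[OF Rel_comp[OF HomRD(1)[OF p(1)] HomRD(1)[OF assms(3)]]] by blast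
  note R = HomRD(2)[OF p(1)] HomRD(2)[OF q(1)] HomRD(2)[OF assms(3)]
  have "p = p \<odot> ob U" using HomRD(4)[OF p(1)] by simp
  also have "\<dots> \<subseteq> p \<odot> M \<odot> cv M" by (intro comp_mono order_refl HomRD(6)[OF assms(3)])
  also have "\<dots> = q \<odot> M \<odot> cv M" using eq Rl_assoc[OF R(1,3) Rl_cv[OF R(3)]] Rl_assoc[OF R(2,3) Rl_cv[OF R(3)]] by simp
  also have "\<dots> \<subseteq> q \<odot> ob U" by (intro comp_mono order_refl assms)
  also have "\<dots> = q" using HomRD(4)[OF q(1)] .
  finally have "p = q" using Fun_eqI[OF HomRD(7)[OF p(1)] HomRD(7)[OF q(1)] _ R(1,2)] by blast
  then show "f = g" using p q by simp
qed

text \<open>\<open>cv M \<odot> M\<close> is the image of \<open>M\<close>, seen as a partial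
  equivalence relation inside \<open>r\<close>.\<close>

definition clo :: "('p \<times> 'm \<times> 'm) set \<Rightarrow> ('p \<times> 'm \<times> 'm) set \<Rightarrow> ('p \<times> 'm \<times> 'm) set" where
  "clo r M = r \<inter> bx (cv M \<odot> M)"

lemma clo_props:
  assumes "per F U" "per F A" "M \<in> HomR U A" "M \<odot> cv M \<subseteq> ob U"
  shows "clo (ob A) M \<in> Rel (fst A) (fst A)" "PER (clo (ob A) M)" "clo (ob A) M \<odot> ob A = clo (ob A) M"
    "clo (ob A) M \<subseteq> ob A" "clo (ob A) M \<subseteq> bx (cv M \<odot> M)"
proof -
  let ?r = "ob A" let ?t = "clo ?r M"
  note r = per_ob[OF assms(2)]
  note M = HomRD[OF assms(3)]
  show t: "?t \<in> Rel (fst A) (fst A)"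
    unfolding clo_def using Rel_Int[OF r(4) Rel_bx[OF Rel_comp[OF Rel_cv[OF M(1)] M(1)]]] .
  show s: "?t \<subseteq> ?r" and s2: "?t \<subseteq> bx (cv M \<odot> M)" by (auto simp: clo_def)
  have "?t \<odot> ?r \<subseteq> ?r \<odot> ?r" by (intro comp_mono order_refl s)
  then have tr1: "?t \<odot> ?r \<subseteq> ?r" using r(7) by simp
  have "?t \<odot> ?r \<subseteq> bx (cv M \<odot> M) \<odot> bx ?r" by (intro comp_mono s2 bx_unit r(5))
  also have "\<dots> = bx (cv M \<odot> M \<odot> ?r)" using M(2) r(5) rl by (simp add: bx_comp Rl_assoc)
  finally have tr: "?t \<odot> ?r \<subseteq> ?t" using tr1 M(4) by (simp add: clo_def)
  have "cv ?t \<subseteq> ?t" using r(6) by (simp add: clo_def bx_cv[symmetric] cv_comp)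
  moreover have "?t \<odot> ?t \<subseteq> ?t" using tr comp_mono[OF order_refl s, of ?t] by blast
  ultimately show P: "PER ?t" using Rel_Cl[OF t] by (simp add: PER_def)
  have "?t = ?t \<odot> ?t" using PER_simps(3)[OF P] by simp
  also have "\<dots> \<subseteq> ?t \<odot> ?r" by (intro comp_mono order_refl s)
  finally show "?t \<odot> ?r = ?t" using tr by blast
qed

text \<open>The second leg of the pullback sends \<open>c\<close> to the class of any \<open>u\<close> with \<open>\<delta>\<pi>M(u, c)\<close>.\<close>

lemma closure_pullback:
  assumes U: "per F U" and A: "per F A" and M: "M \<in> HomR U A" and inj: "M \<odot> cv M \<subseteq> ob U"
    and B: "per F B" "fst B = fst A" "ob B = clo (ob A) M"
  shows "mk B (ob B) A \<in> Hom XX B A" "mono_arr XX (mk B (ob B) A)"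
    "\<exists>q. is_pullback XX (eta F A) (Far (L_monad F) (mk U M A)) (mk B (ob B) A) q"
proof -
  let ?r = "ob A" and ?t = "ob B" and ?c = "ob U"
  note r = per_ob[OF A] and c = per_ob[OF U] and t = per_ob[OF B(1)]
  note cl = clo_props[OF U A M inj, folded B(3)]
  note m = HomRD[OF M]
  have tH: "?t \<in> HomR B A"
    by (rule HomRI) (use t cl B(2) in \<open>simp_all\<close>)
  show k: "mk B ?t A \<in> Hom XX B A" using mk_Hom[OF B(1) A tH] .
  show km: "mono_arr XX (mk B ?t A)" using mono_mkI[OF B(1) A tH] t(6,7) by simp
  obtain eU where eU: "eta F U = mk U eU (dl (PP U))" "reflection U (PP U) eU" using eta_reflection[OF U] .
  obtain eA where eA: "eta F A = mk A eA (dl (PP A))" "reflection A (PP A) eA" using eta_reflection[OF A] .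
  let ?J = "PP U" and ?I = "PP A"
  obtain w where w: "w \<in> Hom X ?J ?I" "Far (L_monad F) (mk U M A) = mk (dl ?J) (gr w) (dl ?I)" "M \<odot> eA = eU \<odot> gr w"
    using L_monad_arrow[OF mk_Hom[OF U A M] M eU eA] .
  note J = PP_Ob[OF U] and I = PP_Ob[OF A]
  have eUH: "eU \<in> HomR U (dl ?J)" and kerU: "eU \<odot> cv eU \<subseteq> bx ?c" and surU: "Idr ?J \<subseteq> bx (cv eU \<odot> eU)"
    using eU(2) by (auto simp: reflection_def)
  have eAH: "eA \<in> HomR A (dl ?I)" and kerA: "eA \<odot> cv eA \<subseteq> bx ?r" using eA(2) by (auto simp: reflection_def)
  note u = HomRD[OF eUH, unfolded ob_dl fst_conv] and a = HomRD[OF eAH, unfolded ob_dl fst_conv]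
  note W = Rel_gr[OF w(1)]
  note R = r(5) c(5) t(5) m(2) u(2) a(2) Rel_Rl[OF W] rl
  let ?N = "bx (cv M \<odot> eU)"
  have N: "?N \<in> Rel (fst A) ?J" using Rel_bx[OF Rel_comp[OF Rel_cv[OF m(1)] u(1)]] .
  note R = R Rel_Rl[OF N]
  let ?q = "?t \<odot> ?N"
  have qH: "?q \<in> HomR B (dl ?J)"
    unfolding HomR_dl
  proof (intro conjI)
    show "?q \<in> Rel (fst B) ?J" using Rel_comp[OF t(4)] N B(2) by simp
    show "?t \<odot> ?q = ?q" using Rl_assoc[OF t(5,5) Rel_Rl[OF N]] t(7) by simp
    have "cv ?q \<odot> ?q = cv ?N \<odot> (?t \<odot> ?t) \<odot> ?N" using R by (simp add: cv_comp t(6) Rl_assoc)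
    also have "\<dots> \<subseteq> cv ?N \<odot> bx ?r \<odot> ?N" using t(7) cl(4) bx_unit[OF r(5)] by (intro comp_mono order_refl) simp
    also have "\<dots> = bx (cv eU \<odot> (M \<odot> ?r) \<odot> cv M \<odot> eU)" using R by (simp add: bx_cv[symmetric] bx_comp cv_comp Rl_assoc)
    also have "\<dots> = bx (cv eU \<odot> (M \<odot> cv M) \<odot> eU)" using R m(4) by (simp add: Rl_assoc)
    also have "\<dots> \<subseteq> bx (cv eU \<odot> ?c \<odot> eU)" by (intro bx_mono comp_mono order_refl inj)
    also have "\<dots> \<subseteq> bx (Idr ?J)" using u(3,5) bx_mono by simp
    finally show "cv ?q \<odot> ?q \<subseteq> Idr ?J" using bx_Idr[OF J] by simp
    have "?t \<subseteq> bx (cv M \<odot> ?c \<odot> M)" using cl(5) m(3) by simp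
    also have "\<dots> \<subseteq> bx (cv M \<odot> (eU \<odot> cv eU) \<odot> M)" by (intro bx_mono comp_mono order_refl u(6))
    also have "\<dots> = ?N \<odot> cv ?N" using R by (simp add: bx_cv[symmetric] bx_comp cv_comp Rl_assoc)
    finally have "?t \<odot> ?t \<odot> ?t \<subseteq> ?t \<odot> (?N \<odot> cv ?N) \<odot> ?t" by (intro comp_mono order_refl)
    then show "?t \<subseteq> ?q \<odot> cv ?q" using t(7) R by (simp add: cv_comp t(6) Rl_assoc)
  qed
  have "is_pullback XX (eta F A) (Far (L_monad F) (mk U M A)) (mk B ?t A) (mk B ?q (dl ?J))"
    unfolding is_pullback_def eA(1) w(2) Dom_mk Cod_mk
  proof (intro conjI ballI impI refl)
    show "mk A eA (dl ?I) \<in> Arr XX" using HomD(1)[OF mk_Hom[OF A per_equality[OF I] eAH]] .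
    show "mk (dl ?J) (gr w) (dl ?I) \<in> Arr XX"
      using HomD(1)[OF mk_Hom[OF per_equality[OF J] per_equality[OF I] gr_HomR[OF w(1)]]] .
    show "mk B ?t A \<in> Arr XX" using HomD(1)[OF k] .
    show "mk B ?q (dl ?J) \<in> Arr XX" using HomD(1)[OF mk_Hom[OF B(1) per_equality[OF J] qH]] .
    \<comment> \<open>One inclusion suffices for the square to commute, since both composites are
      functional.\<close>
    have le: "?t \<odot> eA \<subseteq> ?q \<odot> gr w"
    proof -
      have "?t \<odot> eA = ?t \<odot> ?t \<odot> eA" using Rl_assoc[OF t(5,5) a(2)] t(7) by simp
      also have "\<dots> \<subseteq> ?t \<odot> bx (cv M \<odot> M) \<odot> bx eA" by (intro comp_mono order_refl cl(5) bx_unit a(2))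
      also have "\<dots> = ?t \<odot> bx (cv M \<odot> M \<odot> eA)" using R by (simp add: bx_comp Rl_assoc)
      also have "\<dots> = ?q \<odot> gr w" unfolding w(3) using R by (simp add: bx_comp bx_gr[OF w(1)] Rl_assoc)
      finally show ?thesis .
    qed
    have "?t \<odot> eA \<in> HomR B (dl ?I)" "?q \<odot> gr w \<in> HomR B (dl ?I)"
      using HomR_comp[OF tH eAH B(1) A per_equality[OF I]]
        HomR_comp[OF qH gr_HomR[OF w(1)] B(1) per_equality[OF J] per_equality[OF I]] .
    then have "?t \<odot> eA = ?q \<odot> gr w" using Fun_eqI[OF HomRD(7) HomRD(7) le HomRD(2) HomRD(2)] by blast
    then show "mk A eA (dl ?I) \<cdot>\<^bsub>XX\<^esub> mk B ?t A = mk (dl ?J) (gr w) (dl ?I) \<cdot>\<^bsub>XX\<^esub> mk B ?q (dl ?J)"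
      using mk_comp_HomR[OF tH eAH] mk_comp_HomR[OF qH gr_HomR[OF w(1)]] by simp
    fix Z x y assume "Z \<in> Ob XX" and x: "x \<in> Hom XX Z A" and y: "y \<in> Hom XX Z (dl ?J)"
      and e: "mk A eA (dl ?I) \<cdot>\<^bsub>XX\<^esub> x = mk (dl ?J) (gr w) (dl ?I) \<cdot>\<^bsub>XX\<^esub> y"
    obtain f where Z: "per F Z" and f: "f \<in> HomR Z A" "x = mk Z f A" using x by (rule Hom_XX_E)
    obtain g where g: "g \<in> HomR Z (dl ?J)" "y = mk Z g (dl ?J)" using y by (rule Hom_XX_E)
    note ff = HomRD[OF f(1)] and gg = HomRD[OF g(1), unfolded ob_dl fst_conv]
    note R = R ff(2) gg(2)
    have "mk Z (f \<odot> eA) (dl ?I) = mk Z (g \<odot> gr w) (dl ?I)"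
      using e f(2) g(2) mk_comp_HomR[OF f(1) eAH] mk_comp_HomR[OF g(1) gr_HomR[OF w(1)]] by simp
    then have sq: "f \<odot> eA = g \<odot> gr w" using mk_inj(3)[OF Rel_comp[OF ff(1) HomRD(1)[OF eAH]]] by blast
    \<comment> \<open>The estimate behind the universal property: what \<open>f\<close> and
      \<open>g\<close> share comes from \<open>U\<close> up to closure. Naturality and totality of
      \<open>gr w\<close> express \<open>eU\<close> through \<open>M\<close>, the commuting square
      exchanges \<open>g \<odot> gr w\<close> for \<open>f \<odot> eA\<close>, and the kernel bound
      of \<open>eA\<close> removes \<open>eA\<close>.\<close>
    let ?gf = "cv g \<odot> f"
    have "eU = eU \<odot> Idr ?J" using Idr_right[OF u(1)] by simp
    also have "\<dots> \<subseteq> eU \<odot> gr w \<odot> cv (gr w)" by (intro comp_mono order_refl gr_total[OF w(1)])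
    also have "\<dots> = (M \<odot> eA) \<odot> cv (gr w)" unfolding w(3) using R by (simp add: Rl_assoc)
    finally have 1: "bx eU \<subseteq> bx ((M \<odot> eA) \<odot> cv (gr w))" by (rule bx_mono)
    have "bx eU \<odot> ?gf \<subseteq> bx ((M \<odot> eA) \<odot> cv (gr w)) \<odot> ?gf" by (intro comp_mono order_refl 1)
    also have "\<dots> = bx (M \<odot> eA) \<odot> cv (g \<odot> gr w) \<odot> f" using R by (simp add: bx_comp bx_cv bx_gr[OF w(1)] cv_comp Rl_assoc)
    also have "\<dots> = bx (M \<odot> eA) \<odot> cv eA \<odot> (cv f \<odot> f)" unfolding sq[symmetric] using R by (simp add: cv_comp Rl_assoc)
    also have "\<dots> \<subseteq> bx (M \<odot> eA) \<odot> bx (cv eA) \<odot> bx ?r"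
      using ff(5) bx_unit[OF r(5)] R by (intro comp_mono order_refl bx_unit) auto
    also have "\<dots> = bx (M \<odot> (eA \<odot> cv eA) \<odot> ?r)" using R by (simp add: bx_comp Rl_assoc)
    also have "\<dots> \<subseteq> bx (M \<odot> bx ?r \<odot> ?r)" by (intro bx_mono comp_mono order_refl kerA)
    also have "\<dots> = bx ((M \<odot> ?r) \<odot> ?r)" using R by (simp add: bx_comp bx_idem Rl_assoc)
    also have "\<dots> = bx M" using m(4) by simp
    finally have 2: "bx eU \<odot> ?gf \<subseteq> bx M" .
    have "?gf = Idr ?J \<odot> ?gf" using Idr_left[OF Rel_comp[OF Rel_cv[OF gg(1)] ff(1)]] by simp
    also have "\<dots> \<subseteq> bx (cv eU \<odot> eU) \<odot> ?gf" by (intro comp_mono order_refl surU)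
    also have "\<dots> = bx (cv eU) \<odot> bx eU \<odot> ?gf" using R by (simp add: bx_comp Rl_assoc)
    also have "\<dots> \<subseteq> bx (cv eU) \<odot> bx M" by (intro comp_mono order_refl 2)
    also have "\<dots> = bx (cv eU \<odot> M)" using R by (simp add: bx_comp)
    finally have 3: "?gf \<subseteq> bx (cv eU \<odot> M)" .
    \<comment> \<open>Totality of \<open>g\<close> brings the estimate to bear on \<open>f\<close>:
      its image lies in the closure, so \<open>f\<close> itself, retyped with target
      \<open>B\<close>, is the mediating relation.\<close>
    have "f \<subseteq> (g \<odot> cv g) \<odot> f" using comp_mono[OF gg(6) order_refl, of f] ff(3) by simp
    then have "cv f \<odot> f \<subseteq> cv f \<odot> (g \<odot> cv g) \<odot> f" by (intro comp_mono order_refl)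
    also have "\<dots> = cv ?gf \<odot> ?gf" using R by (simp add: cv_comp Rl_assoc)
    also have "\<dots> \<subseteq> cv (bx (cv eU \<odot> M)) \<odot> bx (cv eU \<odot> M)" by (intro comp_mono cv_mono 3)
    also have "\<dots> = bx (cv M \<odot> (eU \<odot> cv eU) \<odot> M)" using R by (simp add: bx_cv[symmetric] bx_comp cv_comp Rl_assoc)
    also have "\<dots> \<subseteq> bx (cv M \<odot> bx ?c \<odot> M)" by (intro bx_mono comp_mono order_refl kerU)
    also have "\<dots> = bx (cv M \<odot> ?c \<odot> M)" using R by (simp add: bx_comp bx_idem)
    finally have 4: "cv f \<odot> f \<subseteq> ?t" using m(3) ff(5) B(3) by (simp add: clo_def)
    have "f \<subseteq> (f \<odot> cv f) \<odot> f" using comp_mono[OF ff(6) order_refl, of f] ff(3) by simp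
    also have "\<dots> = f \<odot> cv f \<odot> f" using R by (simp add: Rl_assoc)
    also have "\<dots> \<subseteq> f \<odot> ?t" by (intro comp_mono order_refl 4)
    finally have "f \<subseteq> f \<odot> ?t" .
    moreover have "f \<odot> ?t \<subseteq> f" using comp_mono[OF order_refl cl(4), of f] ff(4) by simp
    ultimately have 5: "f \<odot> ?t = f" by blast
    have fB: "f \<in> HomR Z B" by (rule HomRI) (use ff B(2) 4 5 in simp_all)
    have "g \<subseteq> (f \<odot> cv f) \<odot> g" using comp_mono[OF ff(6) order_refl, of g] gg(3) by simp
    also have "\<dots> = f \<odot> cv ?gf" using R by (simp add: cv_comp Rl_assoc)
    also have "\<dots> \<subseteq> f \<odot> cv (bx (cv eU \<odot> M))" by (intro comp_mono order_refl cv_mono 3)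
    also have "\<dots> = (f \<odot> ?t) \<odot> ?N" unfolding 5 using R by (simp add: bx_cv[symmetric] cv_comp)
    also have "\<dots> = f \<odot> ?q" using R by (simp add: Rl_assoc)
    finally have le: "g \<subseteq> f \<odot> ?q" .
    have fq: "f \<odot> ?q \<in> HomR Z (dl ?J)" using HomR_comp[OF fB qH Z B(1) per_equality[OF J]] .
    have 6: "f \<odot> ?q = g" using Fun_eqI[OF HomRD(7)[OF g(1)] HomRD(7)[OF fq] le gg(2) HomRD(2)[OF fq]] by simp
    show "\<exists>!h. h \<in> Hom XX Z B \<and> mk B ?t A \<cdot>\<^bsub>XX\<^esub> h = x \<and> mk B ?q (dl ?J) \<cdot>\<^bsub>XX\<^esub> h = y"
    proof (rule ex1I[of _ "mk Z f B"])
      show "mk Z f B \<in> Hom XX Z B \<and> mk B ?t A \<cdot>\<^bsub>XX\<^esub> mk Z f B = x \<and> mk B ?q (dl ?J) \<cdot>\<^bsub>XX\<^esub> mk Z f B = y"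
        using mk_Hom[OF Z B(1) fB] mk_comp_HomR[OF fB tH] mk_comp_HomR[OF fB qH] 5 6 f(2) g(2) by simp
      fix h assume "h \<in> Hom XX Z B \<and> mk B ?t A \<cdot>\<^bsub>XX\<^esub> h = x \<and> mk B ?q (dl ?J) \<cdot>\<^bsub>XX\<^esub> h = y"
      then show "h = mk Z f B"
        using mono_arrD[OF km k _ mk_Hom[OF Z B(1) fB] _ catXX, of h] mk_comp_HomR[OF fB tH] 5 f(2) by simp
    qed
  qed
  then show "\<exists>q. is_pullback XX (eta F A) (Far (L_monad F) (mk U M A)) (mk B ?t A) q" by blast
qed

lemma closure_op_eqv:
  assumes U: "per F U" and A: "per F A" and M: "M \<in> HomR U A" and inj: "M \<odot> cv M \<subseteq> ob U"
    and B: "per F B" "fst B = fst A" "ob B = clo (ob A) M"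
  shows "mono_arr XX (closure_op F (mk U M A))" "closure_op F (mk U M A) \<cong>\<^bsub>sub_fib XX\<^esub> mk B (ob B) A"
proof -
  note cp = closure_pullback[OF assms]
  from cp(3) obtain q where q: "is_pullback XX (eta F A) (Far (L_monad F) (mk U M A)) (mk B (ob B) A) q" by blast
  then have "\<exists>k q. is_pullback XX (eta F A) (Far (L_monad F) (mk U M A)) k q" by blast
  from someI_ex[OF this] obtain q' where q': "is_pullback XX (eta F A) (Far (L_monad F) (mk U M A)) (closure_op F (mk U M A)) q'"
    unfolding closure_op_def Cod_mk by blast
  show "mono_arr XX (closure_op F (mk U M A))" "closure_op F (mk U M A) \<cong>\<^bsub>sub_fib XX\<^esub> mk B (ob B) A"
    using pullback_unique_mono[OF catXX q q' cp(2)] .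
qed

end

section \<open>The preorder of subobjects\<close>

lemma sub_ent_cod:
  assumes "category C" "m \<turnstile>\<^bsub>sub_fib C\<^esub> n"
  shows "mono_arr C m" "mono_arr C n" "Cod C m = Cod C n"
proof -
  have e: "mono_arr C m" "mono_arr C n" "Ident C (Cod C m) \<in> Hom C (Cod C m) (Cod C n)"
    using assms(2) unfolding entails_def sub_over_iff sub_fib_simps by auto
  show "mono_arr C m" "mono_arr C n" using e by auto
  have "Cod C m \<in> Ob C" using e(1) assms(1) unfolding mono_arr_def category_def by blast
  then show "Cod C m = Cod C n" using Ident_Hom[OF assms(1)] e(3) by (auto simp: Hom_def)
qed

lemma sub_ent_trans:
  assumes "category C" "m \<turnstile>\<^bsub>sub_fib C\<^esub> n" "n \<turnstile>\<^bsub>sub_fib C\<^esub> k"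
  shows "m \<turnstile>\<^bsub>sub_fib C\<^esub> k"
proof -
  note mn = sub_ent_cod[OF assms(1,2)] and nk = sub_ent_cod[OF assms(1,3)]
  have m: "m \<in> Hom C (Dom C m) (Cod C m)" and n: "n \<in> Hom C (Dom C n) (Cod C m)" and k: "k \<in> Hom C (Dom C k) (Cod C m)"
    using mn nk by (auto simp: mono_arr_def Hom_def)
  obtain f where f: "f \<in> Hom C (Dom C m) (Dom C n)" "n \<cdot>\<^bsub>C\<^esub> f = m" using assms(2) sub_ent_iff[OF assms(1) m n] by blast
  obtain g where g: "g \<in> Hom C (Dom C n) (Dom C k)" "k \<cdot>\<^bsub>C\<^esub> g = n" using assms(3) sub_ent_iff[OF assms(1) n k] by blast
  have "k \<cdot>\<^bsub>C\<^esub> (g \<cdot>\<^bsub>C\<^esub> f) = m" using comp_assoc_Hom[OF assms(1) f(1) g(1) k] f(2) g(2) by simp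
  then show ?thesis using sub_ent_iff[OF assms(1) m k] comp_Hom[OF assms(1) g(1) f(1)] mn nk by blast
qed

section \<open>The closure of a strict predicate\<close>

context tcframe
begin

text \<open>Restriction is the meet with a reindexed predicate, and \<open>box\<close> commutes with
  both operations.\<close>

lemma bx_rst:
  assumes "P \<in> Rel C D" "\<phi> \<in> fib C"
  shows "bx (rst P \<phi>) = rst (bx P) (box \<phi>)"
proof -
  obtain \<psi> where o: "C \<in> Ob X" "D \<in> Ob X" and p: "\<psi> \<in> fib (prd X C D)" "P = ext C D \<psi>" using RelE[OF assms(1)] .
  note q = pr1H[OF o]
  let ?e = "rx (pr1 X C D) \<phi>" and ?b = "rx (pr1 X C D) (box \<phi>)"
  note e = rx_fib[OF q assms(2)] and bp = box_fib[OF p(1)] and bf = box_fib[OF assms(2)]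
  note b = rx_fib[OF q bf]
  note m = Meet_fib[OF p(1) e] and m' = Meet_fib[OF bp b]
  have "\<psi> \<sqinter> ?e \<preceq> \<psi>" "\<psi> \<sqinter> ?e \<preceq> ?e" using ent_Meet[OF p(1) e] ent_refl[OF m] by auto
  then have "box (\<psi> \<sqinter> ?e) \<preceq> box \<psi>" "box (\<psi> \<sqinter> ?e) \<preceq> ?b"
    using box_mono[OF _ p(1)] box_mono[OF _ e] box_rx(2)[OF q assms(2)] ent_trans by blast+
  then have 1: "box (\<psi> \<sqinter> ?e) \<preceq> box \<psi> \<sqinter> ?b" using ent_Meet[OF bp b] by blast
  have "box \<psi> \<sqinter> ?b \<preceq> box \<psi>" "box \<psi> \<sqinter> ?b \<preceq> ?b" using ent_Meet[OF bp b] ent_refl[OF m'] by auto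
  then have 2: "box \<psi> \<sqinter> ?b \<preceq> box (\<psi> \<sqinter> ?e)"
    using box_Meet[OF p(1) e] box_rx(1)[OF q assms(2)] ent_trans by blast
  have "ext C D (box (\<psi> \<sqinter> ?e)) = ext C D (box \<psi> \<sqinter> ?b)"
    using 1 2 ent_ext[OF box_fib[OF m] m' o] ent_ext[OF m' box_fib[OF m] o] by blast
  then show ?thesis
    using ext_rst(1)[OF assms(2) p(1) o(2)] ext_rst(1)[OF bf bp o(2)] bx_ext[OF m o] bx_ext[OF p(1) o] p(2) by simp
qed

lemma strict_mono_facts:
  assumes A: "per F (C, \<rho>)" and st: "strict F (C, \<rho>) \<phi>"
  shows "per F (restrict_per F (C, \<rho>) \<phi>)" "ob (restrict_per F (C, \<rho>) \<phi>) = rst (ob (C, \<rho>)) \<phi>"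
    "fst (restrict_per F (C, \<rho>) \<phi>) = C"
    "strict_mono_arr F (C, \<rho>) \<phi> = mk (restrict_per F (C, \<rho>) \<phi>) (rst (ob (C, \<rho>)) \<phi>) (C, \<rho>)"
    "rst (ob (C, \<rho>)) \<phi> \<in> HomR (restrict_per F (C, \<rho>) \<phi>) (C, \<rho>)"
proof -
  let ?B = "restrict_per F (C, \<rho>) \<phi>"
  have o: "C \<in> Ob X" and r: "\<rho> \<in> fib (prd X C C)" using A by (auto simp: per_iff)
  have ph: "\<phi> \<in> fib C" using st strict_iff[OF o r] by blast
  note rs = rst_PER[OF A st]
  have B: "?B = (C, \<rho> \<sqinter> rx (pr1 X C C) \<phi>)" by (simp add: restrict_per_def)
  have f: "\<rho> \<sqinter> rx (pr1 X C C) \<phi> \<in> fib (prd X C C)" using Meet_fib[OF r rx_fib[OF pr1H[OF o o] ph]] .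
  show ob: "ob ?B = rst (ob (C, \<rho>)) \<phi>" unfolding B ob_def fst_conv snd_conv using ext_rst(1)[OF ph r o] .
  show p: "per F ?B" unfolding B using per_iff ob[unfolded B] rs(1) o f by (simp add: ob_def)
  show fst: "fst ?B = C" by (simp add: B)
  show "strict_mono_arr F (C, \<rho>) \<phi> = mk ?B (rst (ob (C, \<rho>)) \<phi>) (C, \<rho>)"
    using mk_eqv_class[of ?B "(C, \<rho>)" "snd ?B"] o f ob unfolding strict_mono_arr_def by (simp add: B ob_def)
  note b = per_ob[OF p, unfolded ob fst]
  show "rst (ob (C, \<rho>)) \<phi> \<in> HomR ?B (C, \<rho>)"
    by (rule HomRI) (use b rs in \<open>simp_all add: ob fst, simp_all add: ob_def\<close>)
qed

text \<open>The inclusion of a strict predicate is its own image, since \<rho> restricted to \<phi>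
  is symmetric and idempotent. Its closure is therefore the meet of \<rho> with the closure of that
  restriction, which by \<open>bx_rst\<close> and \<rho> \<le> \<box>\<rho> is \<rho> restricted to
  \<open>box \<phi>\<close>. Restricting to \<open>\<psi>\<close> gives the same, because \<rho>(c,
  c) holds wherever \<rho>(c, c') does.\<close>

lemma closure_of_strict:
  assumes A: "per F (C, \<rho>)" and st: "strict F (C, \<rho>) \<phi>"
    and ps: "\<psi> = box \<phi> \<sqinter> inst2 F \<rho> (Ident X C) (Ident X C)"
  shows "strict F (C, \<rho>) \<psi>"
    "closure_op F (strict_mono_arr F (C, \<rho>) \<phi>) \<cong>\<^bsub>sub_fib XX\<^esub> strict_mono_arr F (C, \<rho>) \<psi>"
proof -
  let ?A = "(C, \<rho>)" let ?r = "ob ?A" let ?U = "restrict_per F ?A \<phi>" let ?M = "rst ?r \<phi>"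
  have o: "C \<in> Ob X" and r: "\<rho> \<in> fib (prd X C C)" using A by (auto simp: per_iff)
  have ph: "\<phi> \<in> fib C" using st strict_iff[OF o r] by blast
  note rs = rst_PER[OF A st] and rp = per_ob[OF A]
  note sm = strict_mono_facts[OF A st]
  note u = per_ob[OF sm(1), unfolded sm(2,3)]
  note i = idH[OF o] note bf = box_fib[OF ph] and d = inst2_fib[OF i i r]
  have psf: "\<psi> \<in> fib C" unfolding ps using Meet_fib[OF bf d] .
  have iff: "\<theta> \<preceq> rx a \<psi> \<longleftrightarrow> \<theta> \<preceq> rx a (box \<phi>) \<and> (\<theta>, a, a) \<in> ?r" if "\<theta> \<in> fib Z" "a \<in> Hom X Z C" for \<theta> a Z
    unfolding ps using ent_rx_Meet[OF bf d that(2)] inst2_iff[OF i i r that(2,1)] cmp_idl[OF that(2)] by (simp add: ob_def)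
  have "clo ?r ?M = ?r \<inter> bx ?M" using u(6,7) by (simp add: clo_def)
  also have "\<dots> = ?r \<inter> rst (bx ?r) (box \<phi>)" using bx_rst[of ?r C C \<phi>] rp(4) ph by simp
  also have "\<dots> = rst ?r (box \<phi>)" using bx_unit[OF rp(5)] by (auto simp: rst_def)
  also have "\<dots> = rst ?r \<psi>"
  proof -
    have "\<theta> \<preceq> rx a (box \<phi>) \<longleftrightarrow> \<theta> \<preceq> rx a \<psi>" if "(\<theta>, a, b) \<in> ?r" for \<theta> a b
      using iff[of \<theta> "base \<theta>" a] Rel_typed[OF rp(4) that] PER_refl(1)[OF rp(3) that] by simp
    then show ?thesis by (auto simp: rst_def)
  qed
  finally have clo: "clo ?r ?M = rst ?r \<psi>" .
  have inj: "?M \<odot> cv ?M \<subseteq> ob ?U" using u(6,7) sm(2) by simp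
  note cp = clo_props[OF sm(1) A sm(5) inj, unfolded clo]
  \<comment> \<open>Symmetry of the restricted relation is what yields the congruence of
    \<open>\<psi>\<close>.\<close>
  have sym: "(\<theta>, b, a) \<in> rst ?r \<psi>" if "(\<theta>, a, b) \<in> rst ?r \<psi>" for \<theta> a b
    using that PER_simps(2)[OF cp(2)] cv_iff[of \<theta> b a "rst ?r \<psi>"] by simp
  show st': "strict F ?A \<psi>"
    unfolding strict_iff[OF o r]
  proof (intro conjI allI impI psf)
    show "(\<theta>, a, a) \<in> ext C C \<rho>" if "\<theta> \<in> fib Z" "a \<in> Hom X Z C" "\<theta> \<preceq> rx a \<psi>" for \<theta> Z a
      using iff[OF that(1,2)] that(3) by (simp add: ob_def)
    show "\<theta> \<preceq> rx b \<psi>" if "(\<theta>, a, b) \<in> ext C C \<rho>" "\<theta> \<preceq> rx a \<psi>" for \<theta> a b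
      using sym[of \<theta> a b] that by (simp add: rst_iff ob_def)
  qed
  note sm' = strict_mono_facts[OF A st']
  show "closure_op F (strict_mono_arr F ?A \<phi>) \<cong>\<^bsub>sub_fib XX\<^esub> strict_mono_arr F ?A \<psi>"
    using closure_op_eqv(2)[OF sm(1) A sm(5) inj sm'(1)] sm(4) sm'(2,3,4) clo by simp
qed

section \<open>Coreflexive relations and assemblies\<close>

text \<open>The relation of the assembly \<open>(C, =_\<phi>)\<close>. Predicates on
  \<open>C\<close> become coreflexive relations, the subrelations of the identity.\<close>

definition cor :: "'o \<Rightarrow> 'p \<Rightarrow> ('p \<times> 'm \<times> 'm) set" where "cor C \<phi> = rst (Idr C) \<phi>"

lemma Idr_pred:
  assumes "(\<theta>, a, b) \<in> Idr C" "\<theta> \<preceq> rx a \<phi>" "\<phi> \<in> fib C"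
  shows "\<theta> \<preceq> rx b \<phi>"
proof -
  note C = fib_Ob[OF assms(3)]
  have h: "\<theta> \<in> fib (base \<theta>)" "a \<in> Hom X (base \<theta>) C" "b \<in> Hom X (base \<theta>) C" using Rel_typed[OF Rel_Idr[OF C] assms(1)] by auto
  obtain W w \<chi> where w: "w \<in> Hom X W (base \<theta>)" and ch: "\<chi> \<in> fib W" "\<chi> \<preceq> rx w \<theta>" "\<theta> \<preceq> Exists F w \<chi>" and e: "a \<cdot> w = b \<cdot> w"
    using Idr_elim[OF assms(1) C] .
  have "\<chi> \<preceq> rx (b \<cdot> w) \<phi>" using rx_cut[OF ch(2) assms(2) w h(2) assms(3)] e by simp
  then have "\<chi> \<preceq> rx w (rx b \<phi>)" using ent_rx_rx[OF h(3) assms(3) w ch(1)] by simp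
  then show ?thesis using cover_local[OF ch(3) _ w rx_fib[OF h(3) assms(3)]] by blast
qed

lemma strict_dl: "\<phi> \<in> fib C \<Longrightarrow> strict F (dl C) \<phi>"
  using strict_iff[OF fib_Ob equality_fib[OF fib_Ob]] Idr_refl Idr_pred unfolding Idr_def by blast

lemma cor_facts:
  assumes "\<phi> \<in> fib C"
  shows "cor C \<phi> \<in> Rel C C" "PER (cor C \<phi>)" "cor C \<phi> \<subseteq> Idr C" "bx (cor C \<phi>) = cor C (box \<phi>)"
proof -
  note C = fib_Ob[OF assms]
  note s = rst_PER[OF per_equality[OF C] strict_dl[OF assms]] strict_mono_facts[OF per_equality[OF C] strict_dl[OF assms]]
  show "PER (cor C \<phi>)" "cor C \<phi> \<subseteq> Idr C" using s(1,3) by (simp_all add: cor_def Idr_def)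
  show "cor C \<phi> \<in> Rel C C" using per_ob(4)[OF s(4)] s(5,6) ob_dl by (simp add: cor_def)
  show "bx (cor C \<phi>) = cor C (box \<phi>)" unfolding cor_def using bx_rst[OF Rel_Idr[OF C] assms] bx_Idr[OF C] by simp
qed

lemma cor_refl: "\<phi> \<in> fib C \<Longrightarrow> a \<in> Hom X Z C \<Longrightarrow> \<theta> \<in> fib Z \<Longrightarrow> (\<theta>, a, a) \<in> cor C \<phi> \<longleftrightarrow> \<theta> \<preceq> rx a \<phi>"
  unfolding cor_def rst_iff using Idr_refl by blast

lemma cor_subset:
  assumes "\<phi> \<in> fib C" "\<psi> \<in> fib C"
  shows "cor C \<phi> \<subseteq> cor C \<psi> \<longleftrightarrow> \<phi> \<preceq> \<psi>"
proof
  assume s: "cor C \<phi> \<subseteq> cor C \<psi>"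
  show "\<phi> \<preceq> \<psi>" unfolding ent_forcing[OF assms] using s cor_refl assms by blast
next
  assume l: "\<phi> \<preceq> \<psi>"
  have "\<theta> \<preceq> rx a \<psi>" if "(\<theta>, a, b) \<in> Idr C" "\<theta> \<preceq> rx a \<phi>" for \<theta> a b
    using Rel_typed[OF Rel_Idr[OF fib_Ob[OF assms(1)]] that(1)] rx_mono[OF l assms(2)] that(2) ent_trans by blast
  then show "cor C \<phi> \<subseteq> cor C \<psi>" unfolding cor_def rst_def by blast
qed

lemma assembly_facts:
  assumes "\<phi> \<in> fib C"
  shows "fst (assembly F \<phi>) = C" "ob (assembly F \<phi>) = cor C \<phi>" "per F (assembly F \<phi>)"
proof -
  note C = fib_Ob[OF assms] note e = equality_fib[OF C]
  have a: "assembly F \<phi> = (C, rx (pr1 X C C) \<phi> \<sqinter> equality F C)" using fibD(2)[OF assms] by (simp add: assembly_def Let_def)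
  show "fst (assembly F \<phi>) = C" by (simp add: a)
  show ob: "ob (assembly F \<phi>) = cor C \<phi>" unfolding a ob_def fst_conv snd_conv cor_def Idr_def using ext_rst(2)[OF assms e C] .
  show "per F (assembly F \<phi>)"
    unfolding a using per_iff C Meet_fib[OF rx_fib[OF pr1H[OF C C] assms] e] cor_facts(2)[OF assms] ob[unfolded a ob_def]
    by simp
qed

text \<open>The predicate is the diagonal instance of \<open>P\<close>; below the identity, a pair
  may be replaced by its diagonal.\<close>

lemma coreflexive:
  assumes "P \<in> Rel C C" "P \<subseteq> Idr C"
  obtains \<psi> where "\<psi> \<in> fib C" "P = cor C \<psi>"
proof -
  obtain \<phi> where C: "C \<in> Ob X" and p: "\<phi> \<in> fib (prd X C C)" "P = ext C C \<phi>" using RelE[OF assms(1)] .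
  note i = idH[OF C]
  let ?s = "inst2 F \<phi> (Ident X C) (Ident X C)"
  have f: "?s \<in> fib C" using inst2_fib[OF i i p(1)] .
  have iff: "\<theta> \<preceq> rx a ?s \<longleftrightarrow> (\<theta>, a, a) \<in> P" if "a \<in> Hom X Z C" "\<theta> \<in> fib Z" for \<theta> a Z
    using inst2_iff[OF i i p(1) that] cmp_idl[OF that(1)] p(2) by simp
  have "(\<theta>, a, b) \<in> P \<longleftrightarrow> (\<theta>, a, b) \<in> cor C ?s" for \<theta> a b
  proof (cases "(\<theta>, a, b) \<in> Idr C")
    case False then show ?thesis using assms(2) by (auto simp: cor_def rst_iff)
  next
    case True
    have h: "\<theta> \<in> fib (base \<theta>)" "a \<in> Hom X (base \<theta>) C" using Rel_typed[OF Rel_Idr[OF C] True] by auto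
    have "(\<theta>, b, a) \<in> Idr C" using True cv_Idr[OF C] cv_iff by metis
    then have "(\<theta>, a, b) \<in> P \<longleftrightarrow> (\<theta>, a, a) \<in> P"
      using comp_intro_Rl[OF _ True Rel_Rl[OF assms(1)] Rl_Idr[OF C]] comp_intro_Rl[OF _ _ Rel_Rl[OF assms(1)] Rl_Idr[OF C]]
        Idr_right[OF assms(1)] by blast
    then show ?thesis using iff[OF h(2,1)] True by (simp add: cor_def rst_iff)
  qed
  then have "P = cor C ?s" by auto
  then show ?thesis using that f by blast
qed

text \<open>If \<open>\<pi> \<phi>\<close> has a section, every element of \<open>C\<close> factors
  through it. Conversely the generic element at stage \<open>Top F C\<close> satisfies
  \<open>box \<phi>\<close>, and \<open>delta_factor\<close> produces the section.\<close>

lemma dense_iff: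
  assumes "\<phi> \<in> fib C"
  shows "\<pi> \<phi> \<cong>\<^bsub>sub\<^esub> Top sub C \<longleftrightarrow> Idr C \<subseteq> bx (cor C \<phi>)"
proof -
  note C = fib_Ob[OF assms] and m = pi_mono_arr[OF assms] and i = idH[OF fib_Ob[OF assms]]
  have "(\<exists>h\<in>Hom X C (Dom X (\<pi> \<phi>)). \<pi> \<phi> \<cdot> h = Ident X C) \<longleftrightarrow> Idr C \<subseteq> cor C (box \<phi>)"
  proof
    assume "\<exists>h\<in>Hom X C (Dom X (\<pi> \<phi>)). \<pi> \<phi> \<cdot> h = Ident X C"
    then obtain h where h: "h \<in> Hom X C (Dom X (\<pi> \<phi>))" "\<pi> \<phi> \<cdot> h = Ident X C" by blast
    have "\<theta> \<preceq> rx a (box \<phi>)" if "(\<theta>, a, b) \<in> Idr C" for \<theta> a b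
    proof -
      have a: "\<theta> \<in> fib (base \<theta>)" "a \<in> Hom X (base \<theta>) C" using Rel_typed[OF Rel_Idr[OF C] that] by auto
      show ?thesis using delta_intro[OF m(2) cmpH[OF h(1) a(2)] a(1)] cmp_assoc[OF a(2) h(1) m(2)] h(2) cmp_idl[OF a(2)] by simp
    qed
    then show "Idr C \<subseteq> cor C (box \<phi>)" by (auto simp: cor_def rst_def)
  next
    assume s: "Idr C \<subseteq> cor C (box \<phi>)"
    have "Top F C \<preceq> rx (Ident X C) (box \<phi>)"
      using cor_refl[OF box_fib[OF assms] i Top_fib[OF C]] s Idr_refl[OF i Top_fib[OF C]] by blast
    then show "\<exists>h\<in>Hom X C (Dom X (\<pi> \<phi>)). \<pi> \<phi> \<cdot> h = Ident X C" using delta_factor[OF m i] by blast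
  qed
  then show ?thesis using eqv_Top_sub[OF catX m(2,1)] cor_facts(4)[OF assms] by simp
qed

section \<open>Monomorphisms, density and separatedness\<close>

text \<open>For a relation \<open>P\<close> on a partial equivalence relation, the assembly on the pairs satisfying \<open>P\<close>
  has two projections, which are equalised by exactly those arrows for which \<open>P\<close> is contained in the kernel.\<close>

lemma cor_pr:
  assumes "\<kappa> \<in> fib (prd X C C)" "C \<in> Ob X"
  shows "cor (prd X C C) \<kappa> \<odot> gr (pr1 X C C) \<subseteq> cor (prd X C C) \<kappa> \<odot> gr (pr2 X C C) \<odot> cv (ext C C \<kappa>)" (is ?A)
    and "\<And>\<theta> x y. (\<theta>, x, y) \<in> ext C C \<kappa> \<Longrightarrow> (\<theta>, pair X x y, pair X x y) \<in> cor (prd X C C) \<kappa> \<and>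
      (\<theta>, pair X x y, x) \<in> gr (pr1 X C C) \<and> (\<theta>, pair X x y, y) \<in> gr (pr2 X C C)"
    and "\<And>\<theta> z z'. (\<theta>, z, z') \<in> cor (prd X C C) \<kappa> \<Longrightarrow> (\<theta>, pr1 X C C \<cdot> z, pr2 X C C \<cdot> z) \<in> ext C C \<kappa> \<and>
      (\<theta>, z, z) \<in> cor (prd X C C) \<kappa> \<and> z \<in> Hom X (base \<theta>) (prd X C C) \<and> \<theta> \<in> fib (base \<theta>)"
proof -
  let ?K = "prd X C C" let ?c = "cor ?K \<kappa>" let ?P = "ext C C \<kappa>"
  note K = prd_Ob[OF assms(2,2)] and p = pr1H[OF assms(2,2)] and q = pr2H[OF assms(2,2)]
  note c = cor_facts[OF assms(1)] and P = RelI[OF assms(2,2,1)]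
  note gp = Rel_gr[OF p] and gq = Rel_gr[OF q]
  show 3: "(\<theta>, pr1 X C C \<cdot> z, pr2 X C C \<cdot> z) \<in> ?P \<and> (\<theta>, z, z) \<in> ?c \<and> z \<in> Hom X (base \<theta>) ?K \<and> \<theta> \<in> fib (base \<theta>)"
    if "(\<theta>, z, z') \<in> ?c" for \<theta> z z'
  proof -
    have h: "\<theta> \<in> fib (base \<theta>)" "z \<in> Hom X (base \<theta>) ?K" using Rel_typed[OF c(1) that] by auto
    have l: "\<theta> \<preceq> rx z \<kappa>" using that by (simp add: cor_def rst_iff)
    then show ?thesis
      using ext_iff[OF h(1) cmpH[OF p h(2)] cmpH[OF q h(2)]] pair_eta[OF h(2) assms(2,2)] cor_refl[OF assms(1) h(2,1)] h by simp
  qed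
  show "(\<theta>, pair X x y, pair X x y) \<in> ?c \<and> (\<theta>, pair X x y, x) \<in> gr (pr1 X C C) \<and> (\<theta>, pair X x y, y) \<in> gr (pr2 X C C)"
    if "(\<theta>, x, y) \<in> ?P" for \<theta> x y
  proof -
    note h = extD[OF that] note xy = pairH[OF h(2,3)]
    show ?thesis using cor_refl[OF assms(1) xy h(1)] h(4) gr_intro[OF p xy h(1)] gr_intro[OF q xy h(1)]
        pr1_pair[OF h(2,3)] pr2_pair[OF h(2,3)] by simp
  qed
  note R = Rel_Rl[OF c(1)] Rel_Rl[OF gq] Rl_cv[OF Rel_Rl[OF P]]
  note cl = Rl_comp[OF R(2,3)]
  show ?A
  proof (rule comp_least[OF Rl_Cl[OF Rl_comp[OF R(1) cl]]])
    fix \<theta> z z' x assume a: "(\<theta>, z, z') \<in> ?c" and b: "(\<theta>, z', x) \<in> gr (pr1 X C C)"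
    note z = 3[OF a]
    have h: "x \<in> Hom X (base \<theta>) C" using Rel_typed[OF gp b] by auto
    have "(\<theta>, z, z') \<in> Idr ?K" using a c(3) by blast
    then have "(\<theta>, z, x) \<in> gr (pr1 X C C)" using Idr_subst[OF _ K b Rel_Cl[OF gp]] by blast
    then have "(\<theta>, pr1 X C C \<cdot> z, x) \<in> Idr C" using gr_iff[OF p _ h] z by blast
    then have "(\<theta>, x, pr1 X C C \<cdot> z) \<in> Idr C" using cv_Idr[OF assms(2)] cv_iff by metis
    then have "(\<theta>, x, pr2 X C C \<cdot> z) \<in> ?P" using Idr_subst[OF _ assms(2) _ Rel_Cl[OF P]] z by blast
    then have "(\<theta>, z, x) \<in> gr (pr2 X C C) \<odot> cv ?P" using comp_intro_Rl[OF _ _ R(2,3)] gr_intro[OF q] z cv_iff by blast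
    then show "(\<theta>, z, x) \<in> ?c \<odot> gr (pr2 X C C) \<odot> cv ?P" using comp_intro_Rl[OF _ _ R(1) cl] z by blast
  qed
qed

text \<open>A source of parallel arrows testing whether a relation on the carrier lies inside
  \<open>ob A\<close>. Absorption of \<open>ob A\<close> on both sides places the components of a
  pair in the domain of \<open>ob A\<close>, so that both projections are total. If they agree, a
  pair is sent to the classes of both its components, which then coincide. Monicity and
  separatedness are both tested this way.\<close>

lemma test_object:
  assumes A: "per F A" and k: "\<kappa> \<in> fib (prd X (fst A) (fst A))"
    and P: "ob A \<odot> ext (fst A) (fst A) \<kappa> = ext (fst A) (fst A) \<kappa>" "ext (fst A) (fst A) \<kappa> \<odot> ob A = ext (fst A) (fst A) \<kappa>"
  defines "c \<equiv> cor (prd X (fst A) (fst A)) \<kappa>"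
    and "g1 \<equiv> gr (pr1 X (fst A) (fst A))" and "g2 \<equiv> gr (pr2 X (fst A) (fst A))"
  shows "c \<odot> g1 \<odot> ob A \<in> HomR (assembly F \<kappa>) A" "c \<odot> g2 \<odot> ob A \<in> HomR (assembly F \<kappa>) A"
    "c \<odot> g1 \<odot> ob A = c \<odot> g2 \<odot> ob A \<Longrightarrow> ext (fst A) (fst A) \<kappa> \<subseteq> ob A"
proof -
  let ?C = "fst A" let ?K = "prd X ?C ?C" let ?P = "ext ?C ?C \<kappa>" let ?r = "ob A"
  note r = per_ob[OF A] note C = r(1)
  note p = pr1H[OF C C] and q = pr2H[OF C C]
  note cf = cor_facts[OF k, folded c_def] and a = assembly_facts[OF k] and cp = cor_pr[OF k C, folded c_def g1_def g2_def]
  note PR = RelI[OF C C k]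
  note cc = PER_simps[OF cf(2)]
  have refl: "(\<theta>, x, x) \<in> ?r" "(\<theta>, y, y) \<in> ?r" if xy: "(\<theta>, x, y) \<in> ?P" for \<theta> x y
  proof -
    have h: "\<theta> \<in> fib (base \<theta>)" "x \<in> Hom X (base \<theta>) ?C" "y \<in> Hom X (base \<theta>) ?C" using Rel_typed[OF PR xy] by auto
    have "(\<theta>, x, y) \<in> ?r \<odot> ?P" using xy P(1) by simp
    then obtain W w \<chi> z where w: "w \<in> Hom X W (base \<theta>)" "\<chi> \<preceq> rx w \<theta>" "\<theta> \<preceq> Exists F w \<chi>" "(\<chi>, x \<cdot> w, z) \<in> ?r"
      by (rule comp_elim)
    show "(\<theta>, x, x) \<in> ?r" using Cl_local[OF Rl_Cl[OF r(5)] spnI[OF h(1,2,2)] w(1-3) PER_refl(1)[OF r(3) w(4)]] .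
    have "(\<theta>, x, y) \<in> ?P \<odot> ?r" using xy P(2) by simp
    then obtain W w \<chi> z where w: "w \<in> Hom X W (base \<theta>)" "\<chi> \<preceq> rx w \<theta>" "\<theta> \<preceq> Exists F w \<chi>" "(\<chi>, z, y \<cdot> w) \<in> ?r"
      by (rule comp_elim)
    show "(\<theta>, y, y) \<in> ?r" using Cl_local[OF Rl_Cl[OF r(5)] spnI[OF h(1,3,3)] w(1-3) PER_refl(2)[OF r(3) w(4)]] .
  qed
  have hom: "c \<odot> gr g \<odot> ?r \<in> HomR (assembly F \<kappa>) A"
    if g: "g \<in> Hom X ?K ?C" and gr: "\<And>\<theta> z. (\<theta>, z, z) \<in> c \<Longrightarrow> (\<theta>, g \<cdot> z, g \<cdot> z) \<in> ?r" for g
  proof (rule HomRI, unfold a)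
    note G = Rel_gr[OF g]
    note R = Rel_Rl[OF cf(1)] Rel_Rl[OF G] r(5) rl
    show "c \<odot> gr g \<odot> ?r \<in> Rel ?K ?C" using Rel_comp[OF cf(1) Rel_comp[OF G r(4)]] .
    show "cor ?K \<kappa> \<odot> c \<odot> gr g \<odot> ?r = c \<odot> gr g \<odot> ?r"
      using Rl_assoc[OF R(1,1) Rl_comp[OF R(2,3)]] cc(3) by (simp add: c_def)
    show "(c \<odot> gr g \<odot> ?r) \<odot> ?r = c \<odot> gr g \<odot> ?r" using R r(7) by (simp add: Rl_assoc)
    have "cv (c \<odot> gr g \<odot> ?r) \<odot> c \<odot> gr g \<odot> ?r = ?r \<odot> cv (gr g) \<odot> (c \<odot> c) \<odot> gr g \<odot> ?r"
      using R by (simp add: cv_comp cc(2) r(6) Rl_assoc)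
    also have "\<dots> \<subseteq> ?r \<odot> cv (gr g) \<odot> Idr ?K \<odot> gr g \<odot> ?r" using cf(3) cc(3) by (intro comp_mono order_refl) simp
    also have "\<dots> = ?r \<odot> (cv (gr g) \<odot> gr g) \<odot> ?r" using Idr_left[OF Rel_comp[OF G r(4)]] R by (simp add: Rl_assoc)
    also have "\<dots> \<subseteq> ?r \<odot> Idr ?C \<odot> ?r" by (intro comp_mono order_refl gr_single_valued[OF g])
    also have "\<dots> = ?r" using Idr_left[OF r(4)] r(7) by simp
    finally show "cv (c \<odot> gr g \<odot> ?r) \<odot> c \<odot> gr g \<odot> ?r \<subseteq> ?r" .
    show "cor ?K \<kappa> \<subseteq> (c \<odot> gr g \<odot> ?r) \<odot> cv (c \<odot> gr g \<odot> ?r)"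
    proof clarify
      fix \<theta> z z' assume "(\<theta>, z, z') \<in> cor ?K \<kappa>"
      then have zz: "(\<theta>, z, z') \<in> c" by (simp add: c_def)
      note z = cp(3)[OF zz]
      have k1: "(\<theta>, z, g \<cdot> z) \<in> gr g \<odot> ?r" using comp_intro_Rl[OF gr_intro[OF g] gr R(2,3)] z by blast
      have k2: "(\<theta>, z, g \<cdot> z) \<in> c \<odot> gr g \<odot> ?r" using comp_intro_Rl[OF _ k1 R(1) Rl_comp[OF R(2,3)]] z by blast
      have "(\<theta>, z', z) \<in> c" using zz cc(2) cv_iff by metis
      then have "(\<theta>, z', g \<cdot> z) \<in> c \<odot> gr g \<odot> ?r" using comp_intro_Rl[OF _ k1 R(1) Rl_comp[OF R(2,3)]] by blast
      then show "(\<theta>, z, z') \<in> (c \<odot> gr g \<odot> ?r) \<odot> cv (c \<odot> gr g \<odot> ?r)"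
        using comp_intro_Rl[OF k2 _ Rl_comp[OF R(1) Rl_comp[OF R(2,3)]] Rl_cv[OF Rl_comp[OF R(1) Rl_comp[OF R(2,3)]]]] by simp
    qed
  qed
  show "c \<odot> g1 \<odot> ?r \<in> HomR (assembly F \<kappa>) A" unfolding g1_def using hom[OF p] refl(1) cp(3) by blast
  show "c \<odot> g2 \<odot> ?r \<in> HomR (assembly F \<kappa>) A" unfolding g2_def using hom[OF q] refl(2) cp(3) by blast
  assume e: "c \<odot> g1 \<odot> ?r = c \<odot> g2 \<odot> ?r"
  note G1 = Rel_gr[OF p, folded g1_def] and G2 = Rel_gr[OF q, folded g2_def]
  note R = Rel_Rl[OF cf(1)] Rel_Rl[OF G1] Rel_Rl[OF G2] r(5)
  show "?P \<subseteq> ?r"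
  proof clarify
    fix \<theta> x y assume xy: "(\<theta>, x, y) \<in> ?P"
    note z = cp(2)[OF xy]
    have "(\<theta>, pair X x y, x) \<in> c \<odot> g1 \<odot> ?r"
      using comp_intro_Rl[OF _ comp_intro_Rl[OF _ refl(1)[OF xy] R(2,4)] R(1) Rl_comp[OF R(2,4)]] z by blast
    then have "(\<theta>, pair X x y, x) \<in> c \<odot> g2 \<odot> ?r" using e by simp
    then have "(\<theta>, y, x) \<in> cv g2 \<odot> c \<odot> g2 \<odot> ?r"
      using comp_intro_Rl[OF _ _ Rl_cv[OF R(3)] Rl_comp[OF R(1) Rl_comp[OF R(3,4)]]] z cv_iff by blast
    also have "cv g2 \<odot> c \<odot> g2 \<odot> ?r \<subseteq> cv g2 \<odot> Idr ?K \<odot> g2 \<odot> ?r" by (intro comp_mono order_refl cf(3))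
    also have "\<dots> = (cv g2 \<odot> g2) \<odot> ?r"
      using Idr_left[OF Rel_comp[OF G2 r(4)]] Rl_assoc[OF Rl_cv[OF R(3)] R(3,4)] by simp
    also have "\<dots> \<subseteq> Idr ?C \<odot> ?r" unfolding g2_def by (intro comp_mono order_refl gr_single_valued[OF q])
    also have "\<dots> = ?r" using Idr_left[OF r(4)] .
    finally show "(\<theta>, x, y) \<in> ?r" using r(6) cv_iff by metis
  qed
qed

end

text \<open>The definition asks for an explicit quasi-inverse. Objects \<open>s d\<close> and
  isomorphisms \<open>e d\<close> are chosen, and arrows are conjugated by them and lifted through
  full faithfulness; the functor laws and the naturality of the unit are checked after applying
  \<open>T\<close>, where the isomorphisms cancel.\<close>

lemma equivalence_functorI:
  assumes T: "is_functor C D T"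
    and ff: "\<And>a b g. a \<in> Ob C \<Longrightarrow> b \<in> Ob C \<Longrightarrow> g \<in> Hom D (Fob T a) (Fob T b) \<Longrightarrow>
      \<exists>!f. f \<in> Hom C a b \<and> Far T f = g"
    and es: "\<And>d. d \<in> Ob D \<Longrightarrow> \<exists>a\<in>Ob C. \<exists>i\<in>Hom D (Fob T a) d. iso_arr D i"
  shows "equivalence_functor C D T"
proof -
  have C: "category C" and D: "category D" using T by (auto simp: is_functor_def)
  have TH: "Far T f \<in> Hom D (Fob T a) (Fob T b)" if "f \<in> Hom C a b" for f a b
    using T that unfolding is_functor_def Hom_def by auto
  have TO: "Fob T a \<in> Ob D" if "a \<in> Ob C" for a using T that unfolding is_functor_def by blast
  have Tc: "Far T (g \<cdot>\<^bsub>C\<^esub> f) = Far T g \<cdot>\<^bsub>D\<^esub> Far T f" if "f \<in> Hom C a b" "g \<in> Hom C b c" for f g a b c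
    using T that unfolding is_functor_def Hom_def by auto
  have Ti: "Far T (Ident C a) = Ident D (Fob T a)" if "a \<in> Ob C" for a using T that unfolding is_functor_def by blast
  define lift where "lift a b g = (THE f. f \<in> Hom C a b \<and> Far T f = g)" for a b g
  have lift: "lift a b g \<in> Hom C a b" "Far T (lift a b g) = g"
    if "a \<in> Ob C" "b \<in> Ob C" "g \<in> Hom D (Fob T a) (Fob T b)" for a b g
    using theI'[OF ff[OF that]] unfolding lift_def by auto
  have faith: "f = f'" if "f \<in> Hom C a b" "f' \<in> Hom C a b" "Far T f = Far T f'" for f f' a b
    using ff[OF Hom_Ob[OF C that(2)] TH[OF that(2)]] that by metis
  have "\<forall>d\<in>Ob D. \<exists>x. fst x \<in> Ob C \<and> fst (snd x) \<in> Hom D (Fob T (fst x)) d \<and> snd (snd x) \<in> Hom D d (Fob T (fst x)) \<and>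
      snd (snd x) \<cdot>\<^bsub>D\<^esub> fst (snd x) = Ident D (Fob T (fst x)) \<and> fst (snd x) \<cdot>\<^bsub>D\<^esub> snd (snd x) = Ident D d"
  proof
    fix d assume "d \<in> Ob D"
    from es[OF this] obtain a i where a: "a \<in> Ob C" and i: "i \<in> Hom D (Fob T a) d" "iso_arr D i" by blast
    then obtain j where j: "j \<in> Hom D d (Fob T a)" "j \<cdot>\<^bsub>D\<^esub> i = Ident D (Fob T a)" "i \<cdot>\<^bsub>D\<^esub> j = Ident D d"
      unfolding iso_arr_def HomD[OF i(1)] by blast
    show "\<exists>x. fst x \<in> Ob C \<and> fst (snd x) \<in> Hom D (Fob T (fst x)) d \<and> snd (snd x) \<in> Hom D d (Fob T (fst x)) \<and>
      snd (snd x) \<cdot>\<^bsub>D\<^esub> fst (snd x) = Ident D (Fob T (fst x)) \<and> fst (snd x) \<cdot>\<^bsub>D\<^esub> snd (snd x) = Ident D d"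
      by (rule exI[of _ "(a, i, j)"]) (simp add: a i j)
  qed
  from bchoice[OF this] obtain k where k: "\<forall>d\<in>Ob D. fst (k d) \<in> Ob C \<and> fst (snd (k d)) \<in> Hom D (Fob T (fst (k d))) d \<and>
      snd (snd (k d)) \<in> Hom D d (Fob T (fst (k d))) \<and>
      snd (snd (k d)) \<cdot>\<^bsub>D\<^esub> fst (snd (k d)) = Ident D (Fob T (fst (k d))) \<and>
      fst (snd (k d)) \<cdot>\<^bsub>D\<^esub> snd (snd (k d)) = Ident D d" by blast
  define s e e' where "s d = fst (k d)" and "e d = fst (snd (k d))" and "e' d = snd (snd (k d))" for d
  have s: "s d \<in> Ob C" and e: "e d \<in> Hom D (Fob T (s d)) d" and e': "e' d \<in> Hom D d (Fob T (s d))"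
    and ee: "e' d \<cdot>\<^bsub>D\<^esub> e d = Ident D (Fob T (s d))" "e d \<cdot>\<^bsub>D\<^esub> e' d = Ident D d" if "d \<in> Ob D" for d
    using k that unfolding s_def e_def e'_def by auto
  define Sa where "Sa f = lift (s (Dom D f)) (s (Cod D f)) (e' (Cod D f) \<cdot>\<^bsub>D\<^esub> (f \<cdot>\<^bsub>D\<^esub> e (Dom D f)))" for f
  have Sa: "Sa f \<in> Hom C (s a) (s b)" "Far T (Sa f) = e' b \<cdot>\<^bsub>D\<^esub> (f \<cdot>\<^bsub>D\<^esub> e a)" if f: "f \<in> Hom D a b" for f a b
  proof -
    note o = Hom_Ob[OF D f]
    have "e' b \<cdot>\<^bsub>D\<^esub> (f \<cdot>\<^bsub>D\<^esub> e a) \<in> Hom D (Fob T (s a)) (Fob T (s b))"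
      using comp_Hom[OF D e'[OF o(2)] comp_Hom[OF D f e[OF o(1)]]] .
    from lift[OF s[OF o(1)] s[OF o(2)] this] show "Sa f \<in> Hom C (s a) (s b)" "Far T (Sa f) = e' b \<cdot>\<^bsub>D\<^esub> (f \<cdot>\<^bsub>D\<^esub> e a)"
      unfolding Sa_def HomD[OF f] .
  qed
  have eSa: "e b \<cdot>\<^bsub>D\<^esub> Far T (Sa f) = f \<cdot>\<^bsub>D\<^esub> e a" if f: "f \<in> Hom D a b" for f a b
  proof -
    note o = Hom_Ob[OF D f] note fe = comp_Hom[OF D f e[OF o(1)]]
    show ?thesis
      unfolding Sa(2)[OF f] comp_assoc_Hom[OF D fe e'[OF o(2)] e[OF o(2)]] ee(2)[OF o(2)] comp_Ident_left[OF D fe] ..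
  qed
  have mono_e: "x = y" if "x \<in> Hom D a (Fob T (s b))" "y \<in> Hom D a (Fob T (s b))" "e b \<cdot>\<^bsub>D\<^esub> x = e b \<cdot>\<^bsub>D\<^esub> y" "b \<in> Ob D" for x y a b
  proof -
    have r: "e' b \<cdot>\<^bsub>D\<^esub> (e b \<cdot>\<^bsub>D\<^esub> z) = z" if "z \<in> Hom D a (Fob T (s b))" for z
      unfolding comp_assoc_Hom[OF D that e[OF \<open>b \<in> Ob D\<close>] e'[OF \<open>b \<in> Ob D\<close>]] ee(1)[OF \<open>b \<in> Ob D\<close>]
      by (rule comp_Ident_left[OF D that])
    show ?thesis using r[OF that(1)] r[OF that(2)] that(3) by metis
  qed
  define S where "S = \<lparr>Fob = s, Far = Sa\<rparr>"
  have S: "is_functor D C S"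
    unfolding is_functor_def S_def ftor.simps
  proof (intro conjI ballI impI D C)
    fix a assume a: "a \<in> Ob D"
    show sa: "s a \<in> Ob C" using s[OF a] .
    note i = Ident_Hom[OF D a]
    have "Far T (Sa (Ident D a)) = Far T (Ident C (s a))"
      using Sa(2)[OF i] comp_Ident_left[OF D e[OF a]] ee(1)[OF a] Ti[OF sa] by simp
    then show "Sa (Ident D a) = Ident C (s a)" using faith[OF Sa(1)[OF i] Ident_Hom[OF C sa]] by blast
  next
    fix f assume f: "f \<in> Arr D"
    show "Sa f \<in> Hom C (s (Dom D f)) (s (Cod D f))" using Sa(1)[OF Arr_Hom[OF f]] .
    fix g assume g: "g \<in> Arr D" and c: "Cod D f = Dom D g"
    have f': "f \<in> Hom D (Dom D f) (Dom D g)" and g': "g \<in> Hom D (Dom D g) (Cod D g)" using f g c by (auto simp: Hom_def)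
    note gf = comp_Hom[OF D g' f'] and sgf = comp_Hom[OF C Sa(1)[OF g'] Sa(1)[OF f']]
    note oa = Hom_Ob(1)[OF D f'] and ob = Hom_Ob(1)[OF D g'] and oc = Hom_Ob(2)[OF D g']
    have "e (Cod D g) \<cdot>\<^bsub>D\<^esub> Far T (Sa g \<cdot>\<^bsub>C\<^esub> Sa f) = g \<cdot>\<^bsub>D\<^esub> (e (Dom D g) \<cdot>\<^bsub>D\<^esub> Far T (Sa f))"
      using Tc[OF Sa(1)[OF f'] Sa(1)[OF g']] comp_assoc_Hom[OF D TH[OF Sa(1)[OF f']] TH[OF Sa(1)[OF g']] e[OF oc]]
        comp_assoc_Hom[OF D TH[OF Sa(1)[OF f']] e[OF ob] g'] eSa[OF g'] by simp
    also have "\<dots> = (g \<cdot>\<^bsub>D\<^esub> f) \<cdot>\<^bsub>D\<^esub> e (Dom D f)" using eSa[OF f'] comp_assoc_Hom[OF D e[OF oa] f' g'] by simp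
    also have "\<dots> = e (Cod D g) \<cdot>\<^bsub>D\<^esub> Far T (Sa (g \<cdot>\<^bsub>D\<^esub> f))" using eSa[OF gf] by simp
    finally have "Far T (Sa g \<cdot>\<^bsub>C\<^esub> Sa f) = Far T (Sa (g \<cdot>\<^bsub>D\<^esub> f))"
      using mono_e[OF TH[OF sgf] TH[OF Sa(1)[OF gf]] _ oc] by blast
    then show "Sa (g \<cdot>\<^bsub>D\<^esub> f) = Sa g \<cdot>\<^bsub>C\<^esub> Sa f" using faith[OF sgf Sa(1)[OF gf]] by simp
  qed
  have idf: "is_functor E E id_ftor" if "category E" for E :: "('x, 'y) cat"
    using that unfolding is_functor_def id_ftor_def category_def Hom_def by auto
  have cf: "is_functor A E (comp_ftor H G)" if G: "is_functor A B G" and H: "is_functor B E H"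
    for A :: "('x, 'y) cat" and B :: "('x2, 'y2) cat" and E :: "('x3, 'y3) cat" and G H
  proof -
    have GH: "Far G f \<in> Hom B (Fob G a) (Fob G b)" if "f \<in> Hom A a b" for f a b
      using G that unfolding is_functor_def Hom_def by auto
    have HH: "Far H f \<in> Hom E (Fob H a) (Fob H b)" if "f \<in> Hom B a b" for f a b
      using H that unfolding is_functor_def Hom_def by auto
    show ?thesis
      unfolding is_functor_def[of A E] comp_ftor_def ftor.simps
    proof (intro conjI ballI impI)
      show "category A" "category E" using G H by (simp_all add: is_functor_def)
      show "Fob H (Fob G a) \<in> Ob E" if "a \<in> Ob A" for a using G H that unfolding is_functor_def by blast
      show "Far H (Far G f) \<in> Hom E (Fob H (Fob G (Dom A f))) (Fob H (Fob G (Cod A f)))" if "f \<in> Arr A" for f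
        using HH[OF GH[OF Arr_Hom[OF that]]] .
      show "Far H (Far G (Ident A a)) = Ident E (Fob H (Fob G a))" if "a \<in> Ob A" for a
        using G H that unfolding is_functor_def by simp
      show "Far H (Far G (g \<cdot>\<^bsub>A\<^esub> f)) = Far H (Far G g) \<cdot>\<^bsub>E\<^esub> Far H (Far G f)"
        if "f \<in> Arr A" "g \<in> Arr A" "Cod A f = Dom A g" for f g
      proof -
        have "Far G f \<in> Arr B" "Far G g \<in> Arr B" "Cod B (Far G f) = Dom B (Far G g)"
          using HomD[OF GH[OF Arr_Hom[OF that(1)]]] HomD[OF GH[OF Arr_Hom[OF that(2)]]] that(3) by simp_all
        then show ?thesis using G H that unfolding is_functor_def by simp
      qed
    qed
  qed
  have n1: "nat_iso D D (comp_ftor T S) id_ftor e"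
    unfolding nat_iso_def nat_trans_def
  proof (intro conjI ballI cf[OF S T] idf[OF D])
    fix a assume a: "a \<in> Ob D"
    show "e a \<in> Hom D (Fob (comp_ftor T S) a) (Fob id_ftor a)" using e[OF a] by (simp add: comp_ftor_def id_ftor_def S_def)
    show "iso_arr D (e a)" unfolding iso_arr_def HomD[OF e[OF a]] using HomD(1)[OF e[OF a]] e'[OF a] ee[OF a] by blast
  next
    fix f assume "f \<in> Arr D"
    from eSa[OF Arr_Hom[OF this]] show "e (Cod D f) \<cdot>\<^bsub>D\<^esub> Far (comp_ftor T S) f = Far id_ftor f \<cdot>\<^bsub>D\<^esub> e (Dom D f)"
      by (simp add: comp_ftor_def id_ftor_def S_def)
  qed
  define t where "t a = lift a (s (Fob T a)) (e' (Fob T a))" for a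
  define t' where "t' a = lift (s (Fob T a)) a (e (Fob T a))" for a
  have t: "t a \<in> Hom C a (s (Fob T a))" "Far T (t a) = e' (Fob T a)" "t' a \<in> Hom C (s (Fob T a)) a" "Far T (t' a) = e (Fob T a)"
    if "a \<in> Ob C" for a
    using lift[OF that s[OF TO[OF that]] e'[OF TO[OF that]]] lift[OF s[OF TO[OF that]] that e[OF TO[OF that]]]
    by (auto simp: t_def t'_def)
  have n2: "nat_iso C C id_ftor (comp_ftor S T) t"
    unfolding nat_iso_def nat_trans_def
  proof (intro conjI ballI cf[OF T S] idf[OF C])
    fix a assume a: "a \<in> Ob C"
    note ta = t[OF a] and Ta = TO[OF a]
    show "t a \<in> Hom C (Fob id_ftor a) (Fob (comp_ftor S T) a)" using ta by (simp add: comp_ftor_def id_ftor_def S_def)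
    have "t' a \<cdot>\<^bsub>C\<^esub> t a = Ident C a"
      using faith[OF comp_Hom[OF C ta(3,1)] Ident_Hom[OF C a]] Tc[OF ta(1,3)] ta(2,4) ee(2)[OF Ta] Ti[OF a] by simp
    moreover have "t a \<cdot>\<^bsub>C\<^esub> t' a = Ident C (s (Fob T a))"
      using faith[OF comp_Hom[OF C ta(1,3)] Ident_Hom[OF C s[OF Ta]]] Tc[OF ta(3,1)] ta(2,4) ee(1)[OF Ta] Ti[OF s[OF Ta]] by simp
    ultimately show "iso_arr C (t a)" unfolding iso_arr_def HomD[OF ta(1)] using HomD(1)[OF ta(1)] ta(3) by blast
  next
    fix f assume "f \<in> Arr C"
    note f = Arr_Hom[OF this] let ?a = "Dom C f" and ?b = "Cod C f"
    note a = Hom_Ob(1)[OF C f] and b = Hom_Ob(2)[OF C f]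
    note Tf = TH[OF f] and ta = t[OF a] and tb = t[OF b]
    note l = comp_Hom[OF C tb(1) f] and r = comp_Hom[OF C Sa(1)[OF Tf] ta(1)]
    have "Far T (Sa (Far T f) \<cdot>\<^bsub>C\<^esub> t ?a) = (e' (Fob T ?b) \<cdot>\<^bsub>D\<^esub> (Far T f \<cdot>\<^bsub>D\<^esub> e (Fob T ?a))) \<cdot>\<^bsub>D\<^esub> e' (Fob T ?a)"
      using Tc[OF ta(1) Sa(1)[OF Tf]] ta(2) Sa(2)[OF Tf] by simp
    also have "\<dots> = e' (Fob T ?b) \<cdot>\<^bsub>D\<^esub> Far T f"
      using comp_assoc_Hom[OF D e'[OF TO[OF a]] comp_Hom[OF D Tf e[OF TO[OF a]]] e'[OF TO[OF b]]]
        comp_assoc_Hom[OF D e'[OF TO[OF a]] e[OF TO[OF a]] Tf] ee(2)[OF TO[OF a]] comp_Ident_right[OF D Tf] by simp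
    finally have "Far T (t ?b \<cdot>\<^bsub>C\<^esub> f) = Far T (Sa (Far T f) \<cdot>\<^bsub>C\<^esub> t ?a)" using Tc[OF f tb(1)] tb(2) by simp
    from faith[OF l r this] show "t ?b \<cdot>\<^bsub>C\<^esub> Far id_ftor f = Far (comp_ftor S T) f \<cdot>\<^bsub>C\<^esub> t ?a"
      by (simp add: comp_ftor_def id_ftor_def S_def)
  qed
  show ?thesis unfolding equivalence_functor_def using T S n1 n2 by blast
qed

lemma iso_arr_full_subcat:
  assumes "iso_arr C i" "Dom C i \<in> S" "Cod C i \<in> S"
  shows "iso_arr (full_subcat C S) i"
proof -
  from assms(1) obtain g where g: "i \<in> Arr C" "g \<in> Hom C (Cod C i) (Dom C i)"
    "g \<cdot>\<^bsub>C\<^esub> i = Ident C (Dom C i)" "i \<cdot>\<^bsub>C\<^esub> g = Ident C (Cod C i)"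
    unfolding iso_arr_def by blast
  have "g \<in> Hom (full_subcat C S) (Cod C i) (Dom C i)" 
    unfolding Hom_full_subcat[OF assms(3,2)] by (rule g(2))
  then show ?thesis using g assms(2,3) unfolding iso_arr_def full_subcat_simps by blast
qed

section \<open>Monos, density and separatedness as inequalities between relations\<close>

context tcframe
begin

text \<open>The test object is taken for the kernel \<open>M \<odot> cv M\<close>. Its two
  projections agree after \<open>M\<close>, because the components of a pair in the kernel have a
  common value, so monicity makes them equal.\<close>

lemma mono_mkD:
  assumes U: "per F U" and A: "per F A" and M: "M \<in> HomR U A" and m: "mono_arr XX (mk U M A)"
  shows "M \<odot> cv M \<subseteq> ob U"
proof -
  let ?r = "ob U" let ?P = "M \<odot> cv M"
  note r = per_ob[OF U] and MM = HomRD[OF M]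
  obtain \<kappa> where k: "\<kappa> \<in> fib (prd X (fst U) (fst U))" and P: "?P = ext (fst U) (fst U) \<kappa>"
    using RelE[OF Rel_comp[OF MM(1) Rel_cv[OF MM(1)]]] .
  have P1: "?r \<odot> ?P = ?P" using Rl_assoc[OF r(5) MM(2) Rl_cv[OF MM(2)]] MM(3) by simp
  have P2: "?P \<odot> ?r = ?P" using P1 r(6) cv_comp[of ?r ?P] by (simp add: cv_comp)
  let ?K = "assembly F \<kappa>" let ?c = "cor (prd X (fst U) (fst U)) \<kappa>"
  let ?g1 = "gr (pr1 X (fst U) (fst U))" and ?g2 = "gr (pr2 X (fst U) (fst U))"
  note t = test_object[OF U k P1[unfolded P] P2[unfolded P]]
  note K = assembly_facts[OF k] and cf = cor_facts[OF k]
  note g1 = Rel_gr[OF pr1H[OF r(1,1)]] and g2 = Rel_gr[OF pr2H[OF r(1,1)]]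
  note R = Rel_Rl[OF cf(1)] Rel_Rl[OF g1] Rel_Rl[OF g2] r(5) MM(2) rl
  have k1: "(?c \<odot> ?g1 \<odot> ?r) \<odot> M = ?c \<odot> ?g1 \<odot> M" and k2: "(?c \<odot> ?g2 \<odot> ?r) \<odot> M = ?c \<odot> ?g2 \<odot> M"
    using R MM(3) by (simp_all add: Rl_assoc)
  have "?c \<odot> ?g1 \<odot> M = (?c \<odot> ?g1) \<odot> M" using R by (simp add: Rl_assoc)
  also have "\<dots> \<subseteq> (?c \<odot> ?g2 \<odot> cv ?P) \<odot> M" using comp_mono[OF cor_pr(1)[OF k r(1)] order_refl] P by simp
  also have "\<dots> = ?c \<odot> ?g2 \<odot> M \<odot> (cv M \<odot> M)" using R by (simp add: Rl_assoc cv_comp)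
  also have "\<dots> \<subseteq> ?c \<odot> ?g2 \<odot> M \<odot> ob A" by (intro comp_mono order_refl MM(5))
  also have "\<dots> = ?c \<odot> ?g2 \<odot> M" using MM(4) by simp
  finally have le: "(?c \<odot> ?g1 \<odot> ?r) \<odot> M \<subseteq> (?c \<odot> ?g2 \<odot> ?r) \<odot> M" using k1 k2 by simp
  note h1 = HomR_comp[OF t(1) M K(3) U A] and h2 = HomR_comp[OF t(2) M K(3) U A]
  have "mk U M A \<cdot>\<^bsub>XX\<^esub> mk ?K (?c \<odot> ?g1 \<odot> ?r) U = mk U M A \<cdot>\<^bsub>XX\<^esub> mk ?K (?c \<odot> ?g2 \<odot> ?r) U"
    using mk_comp_HomR[OF t(1) M] mk_comp_HomR[OF t(2) M] Fun_eqI[OF HomRD(7)[OF h1] HomRD(7)[OF h2] le HomRD(2)[OF h1] HomRD(2)[OF h2]]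
    by simp
  then have "mk ?K (?c \<odot> ?g1 \<odot> ?r) U = mk ?K (?c \<odot> ?g2 \<odot> ?r) U"
    using mono_arrD[OF m mk_Hom[OF U A M] mk_Hom[OF K(3) U t(1)] mk_Hom[OF K(3) U t(2)] _ catXX] by blast
  then have "?c \<odot> ?g1 \<odot> ?r = ?c \<odot> ?g2 \<odot> ?r" using mk_inj(3)[OF HomRD(1)[OF t(1)]] by blast
  then show ?thesis using t(3) P by simp
qed

text \<open>By the computation of the closure, density means that the mono from
  \<open>clo (ob A) M\<close> has a section, that is \<open>ob A \<subseteq> clo (ob A) M\<close>.
  If the kernel inequality fails, the arrow is not monic and both sides are false.\<close>

lemma dense_mono_iff:
  assumes U: "per F U" and A: "per F A" and M: "M \<in> HomR U A"
  shows "dense_mono F (mk U M A) \<longleftrightarrow> M \<odot> cv M \<subseteq> ob U \<and> ob A \<subseteq> bx (cv M \<odot> M)"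
proof (cases "M \<odot> cv M \<subseteq> ob U")
  case False
  then show ?thesis using mono_mkD[OF assms] by (auto simp: dense_mono_def)
next
  case inj: True
  note mono = mono_mkI[OF assms inj]
  note cp = clo_props[OF assms inj]
  obtain B where B: "per F B" "fst B = fst A" "ob B = clo (ob A) M" using ob_ex[OF cp(1,2)] .
  note k = closure_pullback[OF U A M inj B] and co = closure_op_eqv[OF U A M inj B]
  let ?k = "mk B (ob B) A"
  have AO: "A \<in> Ob XX" using A by simp
  let ?T = "Top (sub_fib XX) A"
  have "closure_op F (mk U M A) \<cong>\<^bsub>sub_fib XX\<^esub> ?T \<longleftrightarrow> ?k \<cong>\<^bsub>sub_fib XX\<^esub> ?T"
    using co(2) sub_ent_trans[OF catXX] unfolding eqv_def by blast
  also have "\<dots> \<longleftrightarrow> (\<exists>h\<in>Hom XX A B. ?k \<cdot>\<^bsub>XX\<^esub> h = Ident XX A)" using eqv_Top_sub[OF catXX k(1,2)] .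
  also have "\<dots> \<longleftrightarrow> ob A \<subseteq> bx (cv M \<odot> M)"
  proof
    assume "\<exists>h\<in>Hom XX A B. ?k \<cdot>\<^bsub>XX\<^esub> h = Ident XX A"
    then obtain h where h: "h \<in> Hom XX A B" "?k \<cdot>\<^bsub>XX\<^esub> h = Ident XX A" by blast
    obtain H where H: "H \<in> HomR A B" "h = mk A H B" using h(1) by (rule Hom_XX_E)
    have "ob B \<in> Rel (fst B) (fst A)" using per_ob(4)[OF B(1)] B(2) by simp
    then have "mk A (H \<odot> ob B) A = mk A (ob A) A"
      using h(2) H(2) comp_mk[OF HomRD(1)[OF H(1)], of "ob B" A] Ident_mk[OF A] by simp
    moreover have "H \<odot> ob B \<in> Rel (fst A) (fst A)"
      using Rel_comp[OF HomRD(1)[OF H(1)] per_ob(4)[OF B(1)]] B(2) by simp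
    ultimately have "H = ob A" using mk_inj(3) HomRD(4)[OF H(1)] by metis
    then have "ob A \<subseteq> ob B" using HomRD(5)[OF H(1)] per_ob(6,7)[OF A] by simp
    then show "ob A \<subseteq> bx (cv M \<odot> M)" using cp(5) B(3) by blast
  next
    assume "ob A \<subseteq> bx (cv M \<odot> M)"
    then have e: "ob B = ob A" using B(3) by (auto simp: clo_def)
    have "ob A \<in> HomR A B" using HomR_id[OF A] B(2) e by (simp add: HomR_def)
    moreover have "mk B (ob B) A \<cdot>\<^bsub>XX\<^esub> mk A (ob A) B = Ident XX A"
      using comp_mk[of "ob A" A B "ob B" A] per_ob(4,7)[OF A] B(2) e Ident_mk[OF A] by simp
    ultimately show "\<exists>h\<in>Hom XX A B. ?k \<cdot>\<^bsub>XX\<^esub> h = Ident XX A" using mk_Hom[OF A B(1)] by blast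
  qed
  finally show ?thesis using mono inj by (simp add: dense_mono_def)
qed

lemma separatedI:
  assumes S: "per F S" and cr: "ob S \<subseteq> Idr (fst S)"
  shows "separated F S"
  unfolding separated_def
proof (intro conjI allI impI)
  show "S \<in> Ob XX" using S by simp
  fix U A m f h h'
  assume m: "m \<in> Hom XX U A" and d: "dense_mono F m" and h: "h \<in> Hom XX A S" and h': "h' \<in> Hom XX A S"
    and e: "h \<cdot>\<^bsub>XX\<^esub> m = f" "h' \<cdot>\<^bsub>XX\<^esub> m = f"
  obtain M where U: "per F U" and A: "per F A" and M: "M \<in> HomR U A" "m = mk U M A" using m by (rule Hom_XX_E)
  obtain H where H: "H \<in> HomR A S" "h = mk A H S" using h by (rule Hom_XX_E)
  obtain H' where H': "H' \<in> HomR A S" "h' = mk A H' S" using h' by (rule Hom_XX_E)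
  have den: "ob A \<subseteq> bx (cv M \<odot> M)" using d dense_mono_iff[OF U A M(1)] M(2) by simp
  note MM = HomRD[OF M(1)] and HH = HomRD[OF H(1)] and HH' = HomRD[OF H'(1)]
  note R = MM(2) HH(2) HH'(2) rl
  have "mk U (M \<odot> H) S = mk U (M \<odot> H') S"
    using e M(2) H(2) H'(2) mk_comp_HomR[OF M(1) H(1)] mk_comp_HomR[OF M(1) H'(1)] by simp
  then have eq: "M \<odot> H = M \<odot> H'" using mk_inj(3)[OF Rel_comp[OF MM(1) HH(1)]] by blast
  have "cv H \<odot> H' = cv H \<odot> ob A \<odot> H'" using HH'(3) by simp
  also have "\<dots> \<subseteq> bx (cv H) \<odot> bx (cv M \<odot> M) \<odot> bx H'" using R by (intro comp_mono den bx_unit) simp_all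
  also have "\<dots> = bx (cv (M \<odot> H) \<odot> (M \<odot> H'))" using R by (simp add: bx_comp cv_comp Rl_assoc)
  also have "\<dots> = bx ((cv H' \<odot> (cv M \<odot> M)) \<odot> H')" unfolding eq using R by (simp add: cv_comp Rl_assoc)
  also have "\<dots> \<subseteq> bx ((cv H' \<odot> ob A) \<odot> H')" by (intro bx_mono comp_mono order_refl MM(5))
  also have "\<dots> = bx (cv H' \<odot> H')" using HH'(3) R per_ob(5)[OF A] by (simp add: Rl_assoc)
  \<comment> \<open>\<open>ob S\<close> is enlarged to the identity of its carrier because the
    latter is fixed by \<open>bx\<close>, while \<open>ob S\<close> need not be.\<close>
  also have "\<dots> \<subseteq> bx (Idr (fst S))" using HH'(5) cr by (intro bx_mono) blast
  also have "\<dots> = Idr (fst S)" using bx_Idr[OF per_ob(1)[OF S]] .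
  finally have 1: "cv H \<odot> H' \<subseteq> Idr (fst S)" .
  have "H' \<subseteq> (H \<odot> cv H) \<odot> H'" using comp_mono[OF HH(6) order_refl, of H'] HH'(3) by simp
  also have "\<dots> = H \<odot> cv H \<odot> H'" using R by (simp add: Rl_assoc)
  also have "\<dots> \<subseteq> H \<odot> Idr (fst S)" by (intro comp_mono order_refl 1)
  also have "\<dots> = H" using Idr_right[OF HH(1)] .
  finally have "H' = H" using Fun_eqI[OF HH'(7) HH(7) _ R(3,2)] by blast
  then show "h = h'" using H(2) H'(2) by simp
qed

text \<open>Separatedness against the dense inclusion of \<open>\<rho>\<close> into \<open>\<rho>;\<delta>\<pi>\<rho>;\<rho>\<close>, seen as assemblies.\<close>

lemma separatedD:
  assumes S: "separated F S"
  shows "ob S \<odot> bx (ob S) \<odot> ob S \<subseteq> ob S"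
proof -
  have pS: "per F S" using S by (simp add: separated_def)
  \<comment> \<open>The closure is flanked by \<open>?r\<close> because \<open>bx ?r\<close> may
    relate elements outside the domain of \<open>?r\<close>; the flanked relation absorbs
    \<open>?r\<close>, as \<open>test_object\<close> requires.\<close>
  let ?r = "ob S" let ?C = "fst S" let ?P = "?r \<odot> bx ?r \<odot> ?r" let ?K = "prd X ?C ?C"
  note r = per_ob[OF pS]
  note R = r(5) Rl_bx[OF r(5)] rl
  obtain \<kappa> where k: "\<kappa> \<in> fib ?K" and P: "?P = ext ?C ?C \<kappa>"
    using RelE[OF Rel_comp[OF r(4) Rel_comp[OF Rel_bx[OF r(4)] r(4)]]] .
  have rk: "snd S \<in> fib ?K" "ext ?C ?C (snd S) = ?r" using r(2) by (simp_all add: ob_def)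
  have P1: "?r \<odot> ?P = ?P" using Rl_assoc[OF r(5,5)] R r(7) by (metis Rl_comp)
  have P2: "?P \<odot> ?r = ?P" using R r(7) by (simp add: Rl_assoc)
  have "?r = ?r \<odot> ?r \<odot> ?r" using r(7) by simp
  also have "\<dots> \<subseteq> ?P" by (intro comp_mono order_refl bx_unit r(5))
  finally have rP: "?r \<subseteq> ?P" .
  have "?P \<subseteq> bx ?r \<odot> bx ?r \<odot> bx ?r" by (intro comp_mono order_refl bx_unit r(5))
  also have "\<dots> = bx ?r" using r(5,7) rl by (simp add: bx_comp[symmetric])
  finally have Pb: "?P \<subseteq> bx ?r" .
  let ?c = "cor ?K \<kappa>" and ?d = "cor ?K (snd S)"
  let ?g1 = "gr (pr1 X ?C ?C)" and ?g2 = "gr (pr2 X ?C ?C)"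
  let ?A = "assembly F \<kappa>" and ?U = "assembly F (snd S)"
  note t = test_object[OF pS k P1[unfolded P] P2[unfolded P]]
  note A = assembly_facts[OF k] and U = assembly_facts[OF rk(1)]
  note cf = cor_facts[OF k] and df = cor_facts[OF rk(1)]
  note dd = PER_simps[OF df(2)]
  have "snd S \<preceq> \<kappa>" using ent_ext[OF rk(1) k r(1,1)] rP P rk(2) by simp
  then have dc: "?d \<subseteq> ?c" using cor_subset[OF rk(1) k] by simp
  \<comment> \<open>Density of the inclusion: \<open>\<kappa>\<close> lies between
    \<open>snd S\<close> and \<open>box (snd S)\<close>.\<close>
  have "bx ?r = ext ?C ?C (box (snd S))" using bx_ext[OF rk(1) r(1,1)] rk(2) by simp
  then have "\<kappa> \<preceq> box (snd S)" using ent_ext[OF k box_fib[OF rk(1)] r(1,1)] Pb P by simp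
  then have cb: "?c \<subseteq> bx ?d" using cor_subset[OF k box_fib[OF rk(1)]] df(4) by simp
  have "?d \<odot> ?c \<subseteq> ?d \<odot> Idr ?K" by (intro comp_mono order_refl cf(3))
  then have dc1: "?d \<odot> ?c \<subseteq> ?d" using Idr_right[OF df(1)] by simp
  have "?d \<odot> ?d \<subseteq> ?d \<odot> ?c" by (intro comp_mono order_refl dc)
  then have dc2: "?d \<odot> ?c = ?d" using dc1 dd(3) by blast
  have M: "?d \<in> HomR ?U ?A" by (rule HomRI) (use df(1) dd dc dc2 in \<open>simp_all add: A U\<close>)
  have den: "dense_mono F (mk ?U ?d ?A)"
    unfolding dense_mono_iff[OF U(3) A(3) M] using dd cb by (simp add: A U)
  note g1 = Rel_gr[OF pr1H[OF r(1,1)]] and g2 = Rel_gr[OF pr2H[OF r(1,1)]]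
  note R = R Rel_Rl[OF cf(1)] Rel_Rl[OF df(1)] Rel_Rl[OF g1] Rel_Rl[OF g2]
  have c1: "?d \<odot> ?c \<odot> ?g1 \<odot> ?r = ?d \<odot> ?g1 \<odot> ?r" and c2: "?d \<odot> ?c \<odot> ?g2 \<odot> ?r = ?d \<odot> ?g2 \<odot> ?r"
    using Rl_assoc[of ?d ?c "?g1 \<odot> ?r"] Rl_assoc[of ?d ?c "?g2 \<odot> ?r"] R dc2 by simp_all
  \<comment> \<open>On the smaller assembly the projections agree, since there the components are
    related by \<open>?r\<close> itself.\<close>
  have "?d \<odot> ?g1 \<odot> ?r = (?d \<odot> ?g1) \<odot> ?r" using R by (simp add: Rl_assoc)
  also have "\<dots> \<subseteq> (?d \<odot> ?g2 \<odot> cv ?r) \<odot> ?r"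
    using comp_mono[OF cor_pr(1)[OF rk(1) r(1)] order_refl] rk(2) by simp
  also have "\<dots> = ?d \<odot> ?g2 \<odot> ?r" using R r(6,7) by (simp add: Rl_assoc)
  finally have le: "?d \<odot> ?c \<odot> ?g1 \<odot> ?r \<subseteq> ?d \<odot> ?c \<odot> ?g2 \<odot> ?r" using c1 c2 by simp
  note h1 = HomR_comp[OF M t(1) U(3) A(3) pS] and h2 = HomR_comp[OF M t(2) U(3) A(3) pS]
  have "mk ?A (?c \<odot> ?g1 \<odot> ?r) S \<cdot>\<^bsub>XX\<^esub> mk ?U ?d ?A = mk ?A (?c \<odot> ?g2 \<odot> ?r) S \<cdot>\<^bsub>XX\<^esub> mk ?U ?d ?A"
    using mk_comp_HomR[OF M t(1)] mk_comp_HomR[OF M t(2)]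
      Fun_eqI[OF HomRD(7)[OF h1] HomRD(7)[OF h2] le HomRD(2)[OF h1] HomRD(2)[OF h2]] by simp
  moreover have "mk ?A (?c \<odot> ?g2 \<odot> ?r) S \<cdot>\<^bsub>XX\<^esub> mk ?U ?d ?A \<in> Hom XX ?U S"
    using comp_Hom[OF catXX mk_Hom[OF A(3) pS t(2)] mk_Hom[OF U(3) A(3) M]] .
  moreover have "\<And>U A m f h h'. m \<in> Hom XX U A \<Longrightarrow> dense_mono F m \<Longrightarrow> f \<in> Hom XX U S \<Longrightarrow>
      h \<in> Hom XX A S \<Longrightarrow> h' \<in> Hom XX A S \<Longrightarrow> h \<cdot>\<^bsub>XX\<^esub> m = f \<Longrightarrow> h' \<cdot>\<^bsub>XX\<^esub> m = f \<Longrightarrow> h = h'"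
    using S unfolding separated_def by blast
  ultimately have "mk ?A (?c \<odot> ?g1 \<odot> ?r) S = mk ?A (?c \<odot> ?g2 \<odot> ?r) S"
    using mk_Hom[OF U(3) A(3) M] den mk_Hom[OF A(3) pS t(1)] mk_Hom[OF A(3) pS t(2)] by metis
  then have "?c \<odot> ?g1 \<odot> ?r = ?c \<odot> ?g2 \<odot> ?r" using mk_inj(3)[OF HomRD(1)[OF t(1)]] by blast
  then show ?thesis using t(3) P by simp
qed

text \<open>Absorbing \<open>ob S\<close> on both sides improves the kernel bound of the unit from
  \<open>bx (ob S)\<close> to the relation in \<open>separatedD\<close>, so
  \<open>e \<odot> cv e\<close> is exactly \<open>ob S\<close>. Then \<open>e\<close> and
  \<open>cv e\<close> are mutually inverse between \<open>S\<close> and the assembly of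
  \<open>cv e \<odot> e\<close>, whose density is the surjectivity of \<open>e\<close>.\<close>

lemma separated_iso_assembly:
  assumes S: "separated F S"
  obtains Q \<psi> i where "\<psi> \<in> fib Q" "\<pi> \<psi> \<cong>\<^bsub>sub\<^esub> Top sub Q" "i \<in> Hom XX (assembly F \<psi>) S" "iso_arr XX i"
proof -
  have pS: "per F S" using S by (simp add: separated_def)
  note r = per_ob[OF pS]
  obtain Q e where rf: "reflection S Q e" using reflection_ex[OF pS] by blast
  then have Q: "Q \<in> Ob X" and eH: "e \<in> HomR S (dl Q)" and ker: "e \<odot> cv e \<subseteq> bx (ob S)" and sur: "Idr Q \<subseteq> bx (cv e \<odot> e)"
    by (auto simp: reflection_def)
  note e = HomRD[OF eH, unfolded ob_dl fst_conv]
  note R = r(5) e(2) rl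
  have "e \<odot> cv e = ob S \<odot> (e \<odot> cv e) \<odot> ob S"
    using Rl_assoc[of "ob S" e "cv e"] cv_comp[of "ob S" e] R e(3) r(6) by (simp add: Rl_assoc)
  also have "\<dots> \<subseteq> ob S \<odot> bx (ob S) \<odot> ob S" by (intro comp_mono order_refl ker)
  also have "\<dots> \<subseteq> ob S" using separatedD[OF S] .
  finally have ee: "e \<odot> cv e = ob S" using e(6) by blast
  obtain \<psi> where ps: "\<psi> \<in> fib Q" "cv e \<odot> e = cor Q \<psi>"
    using coreflexive[OF Rel_comp[OF Rel_cv[OF e(1)] e(1)] e(5)] .
  note D = assembly_facts[OF ps(1)]
  let ?D = "assembly F \<psi>"
  have re: "ob S \<odot> e = e" using e(3) .
  have eD: "e \<odot> cor Q \<psi> = e" unfolding ps(2)[symmetric] using Rl_assoc[OF e(2) Rl_cv[OF e(2)] e(2)] ee re by simp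
  have cre: "cv e \<odot> ob S = cv e" using re cv_comp[of "ob S" e] r(6) by simp
  have cDe: "cor Q \<psi> \<odot> cv e = cv e" using eD cv_comp[of e "cor Q \<psi>"] PER_simps(2)[OF cor_facts(2)[OF ps(1)]] by simp
  have h: "e \<in> HomR S ?D" by (rule HomRI) (use e re eD ps(2) ee in \<open>simp_all add: D\<close>)
  have h': "cv e \<in> HomR ?D S" by (rule HomRI) (use Rel_cv[OF e(1)] cre cDe ps(2) ee in \<open>simp_all add: D\<close>)
  let ?i = "mk ?D (cv e) S" and ?j = "mk S e ?D"
  have i: "?i \<in> Hom XX ?D S" and j: "?j \<in> Hom XX S ?D" using mk_Hom[OF D(3) pS h'] mk_Hom[OF pS D(3) h] .
  have "?j \<cdot>\<^bsub>XX\<^esub> ?i = Ident XX ?D" "?i \<cdot>\<^bsub>XX\<^esub> ?j = Ident XX S"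
    using mk_comp_HomR[OF h' h] mk_comp_HomR[OF h h'] ps(2) ee Ident_mk[OF D(3)] Ident_mk[OF pS] D(2) by simp_all
  then have "iso_arr XX ?i" unfolding iso_arr_def using HomD(1)[OF i] j by auto
  moreover have "\<pi> \<psi> \<cong>\<^bsub>sub\<^esub> Top sub Q" using dense_iff[OF ps(1)] sur ps(2) by simp
  ultimately show ?thesis using that[OF ps(1) _ i] by blast
qed

section \<open>The assembly functor\<close>

lemma over_rx_iff: "u \<in> Hom X C D \<Longrightarrow> \<phi> \<in> fib C \<Longrightarrow> \<psi> \<in> fib D \<Longrightarrow>
    (\<exists>f\<in>Hom T \<phi> \<psi>. Far (Proj F) f = u) \<longleftrightarrow> \<phi> \<preceq> rx u \<psi>"
  using over_iff unfolding over_def .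

text \<open>The definition of a preorder fibration compares vertical arrows. Two arrows above the
  same base arrow factor through one cartesian lift by vertical arrows, which are equal.\<close>

lemma Tot_faithful:
  assumes "f \<in> Hom T \<phi> \<psi>" "g \<in> Hom T \<phi> \<psi>" "Far (Proj F) f = Far (Proj F) g"
  shows "f = g"
proof -
  have fibs: "\<phi> \<in> fib (base \<phi>)" "\<psi> \<in> fib (base \<psi>)" using Hom_Ob[OF catT assms(1)] fib_base by auto
  let ?u = "Far (Proj F) f"
  have u: "?u \<in> Hom X (base \<phi>) (base \<psi>)" using Far_Hom[OF assms(1)] .
  obtain l where l: "cartesian_lift F ?u \<psi> l" "l \<in> Hom T (rx ?u \<psi>) \<psi>" using lift_ex[OF u fibs(2)] .
  have lu: "Far (Proj F) l = ?u" and lc: "cartesian_arr F l" using l(1) by (auto simp: cartesian_lift_def)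
  have bl: "base (rx ?u \<psi>) = base \<phi>" using fibD(2)[OF rx_fib[OF u fibs(2)]] .
  have id: "Ident X (base \<phi>) \<in> Hom X (base \<phi>) (base (rx ?u \<psi>))" using idH[OF fib_Ob[OF fibs(1)]] bl by simp
  have "\<forall>k\<in>Arr T. Cod T k = Cod T l \<longrightarrow> (\<forall>w\<in>Hom X (base (Dom T k)) (base (Dom T l)).
      Far (Proj F) l \<cdot> w = Far (Proj F) k \<longrightarrow>
      (\<exists>!h. h \<in> Hom T (Dom T k) (Dom T l) \<and> Far (Proj F) h = w \<and> l \<cdot>\<^bsub>T\<^esub> h = k))"
    using lc unfolding cartesian_arr_def by blast
  then have ex: "\<exists>!h. h \<in> Hom T \<phi> (rx ?u \<psi>) \<and> Far (Proj F) h = Ident X (base \<phi>) \<and> l \<cdot>\<^bsub>T\<^esub> h = k"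
    if "k \<in> Hom T \<phi> \<psi>" "Far (Proj F) k = ?u" for k
    using HomD[OF that(1)] HomD[OF l(2)] that(2) lu id cmp_idr[OF u] by metis
  obtain h where h: "h \<in> Hom T \<phi> (rx ?u \<psi>)" "Far (Proj F) h = Ident X (base \<phi>)" "l \<cdot>\<^bsub>T\<^esub> h = f"
    using ex[OF assms(1)] by blast
  obtain k where k: "k \<in> Hom T \<phi> (rx ?u \<psi>)" "Far (Proj F) k = Ident X (base \<phi>)" "l \<cdot>\<^bsub>T\<^esub> k = g"
    using ex[OF assms(2)] assms(3) by auto
  have "h = k" using preord Hom_Ob[OF catT h(1)] h k unfolding preorder_fibration_def by blast
  then show ?thesis using h k by simp
qed

lemma cor_gr:
  assumes "\<phi> \<in> fib C" "u \<in> Hom X C D"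
  shows "cor C \<phi> \<odot> gr u = rst (gr u) \<phi>"
proof
  note c = cor_facts[OF assms(1)] and g = Rel_gr[OF assms(2)] and C = fib_Ob[OF assms(1)]
  have cl: "Cl (rst (gr u) \<phi>)" using rst_Cl[OF Rel_Cl[OF g] assms(1)] Rel_typed[OF g] by blast
  show "cor C \<phi> \<odot> gr u \<subseteq> rst (gr u) \<phi>"
  proof (rule comp_least[OF cl])
    fix \<theta> a b d assume "(\<theta>, a, b) \<in> cor C \<phi>" "(\<theta>, b, d) \<in> gr u"
    then show "(\<theta>, a, d) \<in> rst (gr u) \<phi>" using Idr_subst[OF _ C _ Rel_Cl[OF g]] by (auto simp: cor_def rst_iff)
  qed
  show "rst (gr u) \<phi> \<subseteq> cor C \<phi> \<odot> gr u"
  proof clarify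
    fix \<theta> a b assume "(\<theta>, a, b) \<in> rst (gr u) \<phi>"
    then have ab: "(\<theta>, a, b) \<in> gr u" "\<theta> \<preceq> rx a \<phi>" by (auto simp: rst_iff)
    have "(\<theta>, a, a) \<in> cor C \<phi>" using cor_refl[OF assms(1)] ab(2) Rel_typed[OF g ab(1)] by blast
    then show "(\<theta>, a, b) \<in> cor C \<phi> \<odot> gr u" using comp_intro_Rl[OF _ ab(1) Rel_Rl[OF c(1)] Rel_Rl[OF g]] by blast
  qed
qed

text \<open>Absorbing \<open>cor D \<psi>\<close> on the right means that the values satisfy
  \<open>\<psi>\<close>. One direction makes the assembly functor well defined on arrows, the other
  yields the arrow of the total category needed for fullness.\<close>

lemma cor_gr_cor:
  assumes "\<phi> \<in> fib C" "\<psi> \<in> fib D" "u \<in> Hom X C D"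
  shows "\<phi> \<preceq> rx u \<psi> \<longleftrightarrow> (cor C \<phi> \<odot> gr u) \<odot> cor D \<psi> = cor C \<phi> \<odot> gr u"
proof
  note c = cor_facts[OF assms(1)] and d = cor_facts[OF assms(2)] and g = Rel_gr[OF assms(3)]
  note k = Rel_comp[OF c(1) g]
  note R = Rel_Rl[OF k] Rel_Rl[OF d(1)]
  note o = HomOb[OF assms(3)]
  {
    assume l: "\<phi> \<preceq> rx u \<psi>"
    have "cor C \<phi> \<odot> gr u \<subseteq> (cor C \<phi> \<odot> gr u) \<odot> cor D \<psi>"
    proof clarify
      fix \<theta> a b assume ab: "(\<theta>, a, b) \<in> cor C \<phi> \<odot> gr u"
      then have e: "(\<theta>, a, b) \<in> gr u" "\<theta> \<preceq> rx a \<phi>" unfolding cor_gr[OF assms(1,3)] rst_iff by auto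
      have h: "\<theta> \<in> fib (base \<theta>)" "a \<in> Hom X (base \<theta>) C" "b \<in> Hom X (base \<theta>) D" using Rel_typed[OF g e(1)] by auto
      have "(\<theta>, u \<cdot> a, b) \<in> Idr D" using gr_iff[OF assms(3) h(2,3,1)] e(1) by blast
      moreover have "\<theta> \<preceq> rx (u \<cdot> a) \<psi>" using rx_cut[OF e(2) l h(2) assms(3,2)] .
      ultimately have "\<theta> \<preceq> rx b \<psi>" using Idr_pred[OF _ _ assms(2)] by blast
      then have "(\<theta>, b, b) \<in> cor D \<psi>" using cor_refl[OF assms(2) h(3,1)] by blast
      then show "(\<theta>, a, b) \<in> (cor C \<phi> \<odot> gr u) \<odot> cor D \<psi>" using comp_intro_Rl[OF ab _ R] by blast
    qed
    moreover have "(cor C \<phi> \<odot> gr u) \<odot> cor D \<psi> \<subseteq> (cor C \<phi> \<odot> gr u) \<odot> Idr D" by (intro comp_mono order_refl d(3))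
    ultimately show "(cor C \<phi> \<odot> gr u) \<odot> cor D \<psi> = cor C \<phi> \<odot> gr u" using Idr_right[OF k] by blast
  }
  assume e: "(cor C \<phi> \<odot> gr u) \<odot> cor D \<psi> = cor C \<phi> \<odot> gr u"
  show "\<phi> \<preceq> rx u \<psi>"
    unfolding ent_forcing[OF assms(1) rx_fib[OF assms(3,2)]]
  proof (intro allI impI)
    fix Z a \<theta> assume a: "a \<in> Hom X Z C" and t: "\<theta> \<in> fib Z" and l: "\<theta> \<preceq> rx a \<phi>"
    note ua = cmpH[OF assms(3) a]
    have "(\<theta>, a, u \<cdot> a) \<in> cor C \<phi> \<odot> gr u" unfolding cor_gr[OF assms(1,3)] rst_iff using gr_intro[OF assms(3) a t] l by blast
    then have "(\<theta>, a, u \<cdot> a) \<in> (cor C \<phi> \<odot> gr u) \<odot> cor D \<psi>" using e by simp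
    then obtain W w \<chi> b where w: "w \<in> Hom X W (base \<theta>)" and ch: "\<chi> \<in> fib W" "\<chi> \<preceq> rx w \<theta>" "\<theta> \<preceq> Exists F w \<chi>"
      and b: "(\<chi>, b, u \<cdot> a \<cdot> w) \<in> cor D \<psi>" by (rule comp_elim)
    have w': "w \<in> Hom X W Z" using w fibD(2)[OF t] by simp
    have "\<chi> \<preceq> rx (u \<cdot> a \<cdot> w) \<psi>" using b Idr_pred[OF _ _ assms(2)] by (auto simp: cor_def rst_iff)
    then have "\<chi> \<preceq> rx w (rx (u \<cdot> a) \<psi>)" using ent_rx_rx[OF ua assms(2) w' ch(1)] by simp
    then have "\<theta> \<preceq> rx (u \<cdot> a) \<psi>" using cover_local[OF ch(3) _ w' rx_fib[OF ua assms(2)]] by blast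
    then show "\<theta> \<preceq> rx a (rx u \<psi>)" using ent_rx_rx[OF assms(3,2) a t] by simp
  qed
qed

lemma cor_gr_HomR:
  assumes "\<phi> \<in> fib C" "\<psi> \<in> fib D" "u \<in> Hom X C D" "\<phi> \<preceq> rx u \<psi>"
  shows "cor C \<phi> \<odot> gr u \<in> HomR (assembly F \<phi>) (assembly F \<psi>)"
proof -
  note c = cor_facts[OF assms(1)] and d = cor_facts[OF assms(2)] and g = Rel_gr[OF assms(3)]
  note cc = PER_simps[OF c(2)] and dd = PER_simps[OF d(2)]
  note a = assembly_facts[OF assms(1)] and b = assembly_facts[OF assms(2)]
  let ?k = "cor C \<phi> \<odot> gr u"
  note k = Rel_comp[OF c(1) g]
  note R = Rel_Rl[OF c(1)] Rel_Rl[OF d(1)] Rel_Rl[OF g] rl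
  have kd: "?k \<odot> cor D \<psi> = ?k" using cor_gr_cor[OF assms(1-3)] assms(4) by simp
  have "cv ?k \<odot> ?k = cv (gr u) \<odot> (cor C \<phi> \<odot> cor C \<phi>) \<odot> gr u" using R by (simp add: cv_comp cc(2) Rl_assoc)
  also have "\<dots> \<subseteq> cv (gr u) \<odot> Idr C \<odot> gr u" using c(3) cc(3) by (intro comp_mono order_refl) simp
  also have "\<dots> \<subseteq> Idr D" using gr_single_valued[OF assms(3)] Idr_left[OF g] by simp
  finally have 1: "cv ?k \<odot> ?k \<subseteq> Idr D" .
  have "cv ?k \<odot> ?k = cv (?k \<odot> cor D \<psi>) \<odot> (?k \<odot> cor D \<psi>)" using kd by simp
  also have "\<dots> = cor D \<psi> \<odot> (cv ?k \<odot> ?k) \<odot> cor D \<psi>" using R by (simp add: cv_comp cc(2) dd(2) Rl_assoc)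
  also have "\<dots> \<subseteq> cor D \<psi> \<odot> Idr D \<odot> cor D \<psi>" by (intro comp_mono order_refl 1)
  also have "\<dots> = cor D \<psi>" using Idr_left[OF d(1)] dd(3) by simp
  finally have sv: "cv ?k \<odot> ?k \<subseteq> cor D \<psi>" .
  have "cor C \<phi> = cor C \<phi> \<odot> Idr C \<odot> cor C \<phi>" using Idr_left[OF c(1)] cc(3) by simp
  also have "\<dots> \<subseteq> cor C \<phi> \<odot> (gr u \<odot> cv (gr u)) \<odot> cor C \<phi>" by (intro comp_mono order_refl gr_total[OF assms(3)])
  also have "\<dots> = ?k \<odot> cv ?k" using R by (simp add: cv_comp cc(2) Rl_assoc)
  finally have tot: "cor C \<phi> \<subseteq> ?k \<odot> cv ?k" .
  have ck: "cor C \<phi> \<odot> ?k = ?k" using Rl_assoc[OF R(1,1,3)] cc(3) by simp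
  show ?thesis by (rule HomRI) (use k ck kd sv tot in \<open>simp_all add: a b\<close>)
qed

lemma assembly_arr:
  assumes f: "f \<in> Hom T \<phi> \<psi>" and ph: "\<phi> \<in> fib C" and ps: "\<psi> \<in> fib D"
  shows "Far (Proj F) f \<in> Hom X C D"
    "Far (assembly_ftor F) f = mk (assembly F \<phi>) (cor C \<phi> \<odot> gr (Far (Proj F) f)) (assembly F \<psi>)"
    "cor C \<phi> \<odot> gr (Far (Proj F) f) \<in> HomR (assembly F \<phi>) (assembly F \<psi>)"
proof -
  let ?u = "Far (Proj F) f"
  show u: "?u \<in> Hom X C D" using Far_Hom[OF f] fibD(2)[OF ph] fibD(2)[OF ps] by simp
  note o = HomOb[OF u] and a = assembly_facts[OF ph] and b = assembly_facts[OF ps]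
  have "\<phi> \<preceq> rx ?u \<psi>" using over_rx_iff[OF u ph ps] f by blast
  then show "cor C \<phi> \<odot> gr ?u \<in> HomR (assembly F \<phi>) (assembly F \<psi>)" using cor_gr_HomR[OF ph ps u] by blast
  let ?q = "rx (pr1 X C D) \<phi> \<sqinter> inst2 F (equality F D) (?u \<cdot> pr1 X C D) (pr2 X C D)"
  have q: "?q \<in> fib (prd X C D)" using Meet_fib[OF rx_fib[OF pr1H[OF o] ph] gr_fib[OF u]] .
  have "ext C D ?q = cor C \<phi> \<odot> gr ?u"
    using ext_rst(2)[OF ph gr_fib[OF u] o(2)] cor_gr[OF ph u] gr_ext[OF u] by simp
  then show "Far (assembly_ftor F) f = mk (assembly F \<phi>) (cor C \<phi> \<odot> gr ?u) (assembly F \<psi>)"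
    using mk_eqv_class[of "assembly F \<phi>" "assembly F \<psi>" ?q] a(1) b(1) o q HomD[OF f] fibD(2)[OF ph] fibD(2)[OF ps]
    by (simp add: assembly_ftor_def Let_def)
qed

section \<open>Equivalence of dense predicates, separated objects and assemblies\<close>

abbreviation dense where "dense \<equiv> {\<phi>. \<pi> \<phi> \<cong>\<^bsub>sub\<^esub> Top sub (base \<phi>)}"
abbreviation sepd where "sepd \<equiv> {S. separated F S}"

lemma Hom_Sep: "separated F A \<Longrightarrow> separated F B \<Longrightarrow> Hom (Sep F) A B = Hom XX A B"
  by (simp add: Sep_def Hom_full_subcat)

lemma assembly_separated: "\<phi> \<in> fib C \<Longrightarrow> separated F (assembly F \<phi>)"
  using separatedI[of "assembly F \<phi>"] assembly_facts cor_facts(3) by simp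

lemma assembly_functor: "is_functor (dense_total F \<pi>) (Sep F) (assembly_ftor F)"
  unfolding is_functor_def
proof (intro conjI ballI impI)
  show "category (dense_total F \<pi>)" "category (Sep F)"
    unfolding dense_total_def Sep_def by (rule category_full_subcat, rule catT, rule category_full_subcat, rule catXX)
  have Fob: "Fob (assembly_ftor F) \<phi> = assembly F \<phi>" for \<phi> by (simp add: assembly_ftor_def)
  {
    fix \<phi> assume "\<phi> \<in> Ob (dense_total F \<pi>)"
    then have ph: "\<phi> \<in> fib (base \<phi>)" using fib_base by (simp add: dense_total_def)
    note C = fib_Ob[OF ph]
    show "Fob (assembly_ftor F) \<phi> \<in> Ob (Sep F)"
      using assembly_separated[OF ph] assembly_facts(3)[OF ph] Fob by (simp add: Sep_def)
    have i: "Ident T \<phi> \<in> Hom T \<phi> \<phi>" using Ident_Hom[OF catT fibD(1)[OF ph]] .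
    have "Far (Proj F) (Ident T \<phi>) = Ident X (base \<phi>)" using ProjF fibD(1)[OF ph] by (simp add: is_functor_def)
    then have "Far (assembly_ftor F) (Ident T \<phi>) = Ident XX (assembly F \<phi>)"
      using assembly_arr(2)[OF i ph ph] gr_Ident[OF C] Idr_right[OF cor_facts(1)[OF ph]] Ident_mk assembly_facts[OF ph]
      by simp
    then show "Far (assembly_ftor F) (Ident (dense_total F \<pi>) \<phi>) = Ident (Sep F) (Fob (assembly_ftor F) \<phi>)"
      using Fob by (simp add: dense_total_def Sep_def)
  }
  fix f assume fA: "f \<in> Arr (dense_total F \<pi>)"
  then have fT: "f \<in> Hom T (Dom T f) (Cod T f)" by (auto simp: dense_total_def Hom_def)
  have a: "Dom T f \<in> fib (base (Dom T f))" and b: "Cod T f \<in> fib (base (Cod T f))"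
    using Hom_Ob[OF catT fT] fib_base by auto
  note fa = assembly_arr[OF fT a b]
  have "Far (assembly_ftor F) f \<in> Hom XX (assembly F (Dom T f)) (assembly F (Cod T f))"
    unfolding fa(2) using mk_Hom[OF assembly_facts(3)[OF a] assembly_facts(3)[OF b] fa(3)] .
  then show "Far (assembly_ftor F) f \<in> Hom (Sep F) (Fob (assembly_ftor F) (Dom (dense_total F \<pi>) f))
      (Fob (assembly_ftor F) (Cod (dense_total F \<pi>) f))"
    using assembly_separated[OF a] assembly_separated[OF b] Fob by (simp add: Sep_def dense_total_def Hom_full_subcat)
  fix g assume "g \<in> Arr (dense_total F \<pi>)" and "Cod (dense_total F \<pi>) f = Dom (dense_total F \<pi>) g"
  then have gT: "g \<in> Hom T (Cod T f) (Cod T g)" by (auto simp: dense_total_def Hom_def)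
  have c: "Cod T g \<in> fib (base (Cod T g))" using Hom_Ob[OF catT gT] fib_base by auto
  note ga = assembly_arr[OF gT b c] and gfa = assembly_arr[OF comp_Hom[OF catT gT fT] a c]
  let ?c = "cor (base (Dom T f)) (Dom T f)" and ?d = "cor (base (Cod T f)) (Cod T f)"
  note R = Rel_Rl[OF cor_facts(1)[OF a]] Rel_Rl[OF Rel_gr[OF fa(1)]] Rel_Rl[OF cor_facts(1)[OF b]] Rel_Rl[OF Rel_gr[OF ga(1)]]
  have "(?c \<odot> gr (Far (Proj F) f)) \<odot> ?d \<odot> gr (Far (Proj F) g) =
      ((?c \<odot> gr (Far (Proj F) f)) \<odot> ?d) \<odot> gr (Far (Proj F) g)" using R rl by (simp add: Rl_assoc)
  also have "\<dots> = (?c \<odot> gr (Far (Proj F) f)) \<odot> gr (Far (Proj F) g)"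
    using HomRD(4)[OF fa(3)] assembly_facts(2)[OF b] by simp
  also have "\<dots> = ?c \<odot> gr (Far (Proj F) (g \<cdot>\<^bsub>T\<^esub> f))"
    using Far_comp[OF fT gT] gr_comp[OF fa(1) ga(1)] R by (simp add: Rl_assoc)
  finally have "Far (assembly_ftor F) (g \<cdot>\<^bsub>T\<^esub> f) = Far (assembly_ftor F) g \<cdot>\<^bsub>XX\<^esub> Far (assembly_ftor F) f"
    unfolding gfa(2) fa(2) ga(2) using mk_comp_HomR[OF fa(3) ga(3)] by simp
  then show "Far (assembly_ftor F) (g \<cdot>\<^bsub>dense_total F \<pi>\<^esub> f) = Far (assembly_ftor F) g \<cdot>\<^bsub>Sep F\<^esub> Far (assembly_ftor F) f"
    by (simp add: dense_total_def Sep_def)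
qed

text \<open>Density extends \<open>G\<close>, which is total only on \<open>\<phi>\<close>, to all
  of \<open>C\<close>: as \<open>Idr C \<subseteq> bx (cor C \<phi>)\<close>, the closure of
  \<open>G\<close> is total and function comprehension applies to it. The relation \<open>G\<close>
  is recovered by restricting the graph to \<open>\<phi>\<close>.\<close>

lemma dense_arrow_graph:
  assumes ph: "\<phi> \<in> fib C" "\<pi> \<phi> \<cong>\<^bsub>sub\<^esub> Top sub C" and ps: "\<psi> \<in> fib D"
    and G: "G \<in> HomR (assembly F \<phi>) (assembly F \<psi>)"
  obtains u where "u \<in> Hom X C D" "\<phi> \<preceq> rx u \<psi>" "G = cor C \<phi> \<odot> gr u" "gr u = bx G"
proof -
  note a = assembly_facts[OF ph(1)] and b = assembly_facts[OF ps]
  note g = HomRD[OF G, unfolded a b]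
  note c = cor_facts[OF ph(1)] and d = cor_facts[OF ps]
  note R = g(2) Rel_Rl[OF c(1)] rl
  note D = fib_Ob[OF ps]
  have den: "Idr C \<subseteq> bx (cor C \<phi>)" using dense_iff[OF ph(1)] ph(2) by simp
  have "cv (bx G) \<odot> bx G = bx (cv G \<odot> G)" using R by (simp add: bx_comp bx_cv)
  also have "\<dots> \<subseteq> bx (Idr D)" using g(5) d(3) bx_mono by blast
  finally have sv: "cv (bx G) \<odot> bx G \<subseteq> Idr D" using bx_Idr[OF D] by simp
  have "bx (cor C \<phi>) \<subseteq> bx (G \<odot> cv G)" using g(6) bx_mono by blast
  then have tot: "Idr C \<subseteq> bx G \<odot> cv (bx G)" using den R by (simp add: bx_comp bx_cv)
  obtain u where u: "u \<in> Hom X C D" "gr u = bx G"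
    using function_comprehension[OF Rel_bx[OF g(1)] bx_idem[OF g(2)] sv tot] by blast
  note Ru = Rel_Rl[OF Rel_gr[OF u(1)]]
  have Gu: "G \<subseteq> gr u" using bx_unit[OF g(2)] u(2) by simp
  have 1: "G \<subseteq> cor C \<phi> \<odot> gr u" using comp_mono[OF order_refl Gu, of "cor C \<phi>"] g(3) by simp
  have "cor C \<phi> \<odot> gr u \<subseteq> (G \<odot> cv G) \<odot> gr u" by (intro comp_mono[OF g(6)] order_refl)
  also have "\<dots> = G \<odot> cv G \<odot> gr u" using R Ru by (simp add: Rl_assoc)
  also have "\<dots> \<subseteq> G \<odot> cv (gr u) \<odot> gr u" by (intro comp_mono order_refl cv_mono Gu)
  also have "\<dots> \<subseteq> G \<odot> Idr D" by (intro comp_mono order_refl gr_single_valued[OF u(1)])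
  also have "\<dots> = G" using Idr_right[OF g(1)] .
  finally have e: "G = cor C \<phi> \<odot> gr u" using 1 by blast
  then have "\<phi> \<preceq> rx u \<psi>" using cor_gr_cor[OF ph(1) ps u(1)] g(4) by simp
  then show ?thesis using that u e by blast
qed

lemma assembly_equivalence: "equivalence_functor (dense_total F \<pi>) (Sep F) (assembly_ftor F)"
proof (rule equivalence_functorI[OF assembly_functor])
  have Fob: "Fob (assembly_ftor F) \<phi> = assembly F \<phi>" for \<phi> by (simp add: assembly_ftor_def)
  fix \<phi> \<psi> G assume "\<phi> \<in> Ob (dense_total F \<pi>)" "\<psi> \<in> Ob (dense_total F \<pi>)"
    and G: "G \<in> Hom (Sep F) (Fob (assembly_ftor F) \<phi>) (Fob (assembly_ftor F) \<psi>)"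
  then have ph: "\<phi> \<in> fib (base \<phi>)" "\<phi> \<in> dense" and ps: "\<psi> \<in> fib (base \<psi>)" "\<psi> \<in> dense"
    using fib_base by (auto simp: dense_total_def)
  have HT: "Hom (dense_total F \<pi>) \<phi> \<psi> = Hom T \<phi> \<psi>" unfolding dense_total_def using Hom_full_subcat[OF ph(2) ps(2)] .
  have "G \<in> Hom XX (assembly F \<phi>) (assembly F \<psi>)"
    using G assembly_separated[OF ph(1)] assembly_separated[OF ps(1)] Fob by (simp add: Sep_def Hom_full_subcat)
  then obtain g where g: "g \<in> HomR (assembly F \<phi>) (assembly F \<psi>)" "G = mk (assembly F \<phi>) g (assembly F \<psi>)"
    by (rule Hom_XX_E)
  have d: "\<pi> \<phi> \<cong>\<^bsub>sub\<^esub> Top sub (base \<phi>)" using ph(2) by simp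
  obtain u where u: "u \<in> Hom X (base \<phi>) (base \<psi>)" "\<phi> \<preceq> rx u \<psi>" "g = cor (base \<phi>) \<phi> \<odot> gr u" "gr u = bx g"
    using dense_arrow_graph[OF ph(1) d ps(1) g(1)] .
  obtain f where f: "f \<in> Hom T \<phi> \<psi>" "Far (Proj F) f = u" using over_rx_iff[OF u(1) ph(1) ps(1)] u(2) by blast
  show "\<exists>!f. f \<in> Hom (dense_total F \<pi>) \<phi> \<psi> \<and> Far (assembly_ftor F) f = G"
    unfolding HT
  proof (rule ex1I[of _ f])
    show "f \<in> Hom T \<phi> \<psi> \<and> Far (assembly_ftor F) f = G" using f assembly_arr(2)[OF f(1) ph(1) ps(1)] u(3) g(2) by simp
    fix f' assume f': "f' \<in> Hom T \<phi> \<psi> \<and> Far (assembly_ftor F) f' = G"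
    then have fT: "f' \<in> Hom T \<phi> \<psi>" by blast
    note fa = assembly_arr[OF fT ph(1) ps(1)]
    let ?v = "Far (Proj F) f'"
    have "mk (assembly F \<phi>) (cor (base \<phi>) \<phi> \<odot> gr ?v) (assembly F \<psi>) = mk (assembly F \<phi>) g (assembly F \<psi>)"
      using fa(2) f' g(2) by simp
    then have gv: "g = cor (base \<phi>) \<phi> \<odot> gr ?v" using mk_inj(3)[OF HomRD(1)[OF fa(3)]] by blast
    have "cor (base \<phi>) \<phi> \<odot> gr ?v \<subseteq> Idr (base \<phi>) \<odot> gr ?v" by (intro comp_mono order_refl cor_facts(3)[OF ph(1)])
    then have "g \<subseteq> gr ?v" using gv Idr_left[OF Rel_gr[OF fa(1)]] by simp
    \<comment> \<open>Closing \<open>g\<close> recovers the graph of \<open>u\<close>, and graphs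
      are closed, so \<open>u\<close> is determined by \<open>g\<close>.\<close>
    then have "gr u \<subseteq> gr ?v" unfolding u(4) using bx_mono bx_gr[OF fa(1)] by blast
    then have "u = ?v" using gr_faithful[OF u(1) fa(1)] by blast
    then show "f' = f" using Tot_faithful[OF fT f(1)] f(2) by simp
  qed
next
  fix S assume "S \<in> Ob (Sep F)"
  then have S: "separated F S" by (simp add: Sep_def)
  obtain Q \<psi> i where ps: "\<psi> \<in> fib Q" "\<pi> \<psi> \<cong>\<^bsub>sub\<^esub> Top sub Q" and i: "i \<in> Hom XX (assembly F \<psi>) S" "iso_arr XX i"
    using separated_iso_assembly[OF S] .
  note s = assembly_separated[OF ps(1)]
  have "\<psi> \<in> Ob (dense_total F \<pi>)" using ps fibD[OF ps(1)] by (simp add: dense_total_def)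
  moreover have "i \<in> Hom (Sep F) (assembly F \<psi>) S" using i(1) Hom_Sep[OF s S] by simp
  moreover have "iso_arr (Sep F) i" unfolding Sep_def
    by (rule iso_arr_full_subcat[OF i(2)]) (use HomD[OF i(1)] s S in simp_all)
  ultimately show "\<exists>a\<in>Ob (dense_total F \<pi>). \<exists>i\<in>Hom (Sep F) (Fob (assembly_ftor F) a) S. iso_arr (Sep F) i"
    by (auto simp: assembly_ftor_def)
qed

text \<open>Both categories are full in \<open>per_cat F\<close>, and every assembly, dense or not,
  is separated, so the inclusion is full and faithful. By \<open>separated_iso_assembly\<close> it
  reaches every separated object up to isomorphism.\<close>

lemma Asm_equivalence: "equivalence_functor (Asm F) (Sep F) id_ftor"
proof -
  let ?S = "{assembly F \<phi> | C \<phi>. C \<in> Ob X \<and> \<phi> \<in> fib C}"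
  have sep: "S \<in> sepd" if "S \<in> ?S" for S using that assembly_separated by auto
  have HH: "Hom (Asm F) A B = Hom (Sep F) A B" if "A \<in> ?S" "B \<in> ?S" for A B
    unfolding Asm_def Sep_def Hom_full_subcat[OF that] Hom_full_subcat[OF sep[OF that(1)] sep[OF that(2)]] ..
  have cats: "category (Asm F)" "category (Sep F)"
    unfolding Asm_def Sep_def by (rule category_full_subcat[OF catXX])+
  have fu: "is_functor (Asm F) (Sep F) id_ftor"
    unfolding is_functor_def id_ftor_def ftor.simps
  proof (intro conjI ballI impI cats)
    show "a \<in> Ob (Sep F)" if "a \<in> Ob (Asm F)" for a using that sep by (auto simp: Asm_def Sep_def)
    show "f \<in> Hom (Sep F) (Dom (Asm F) f) (Cod (Asm F) f)" if f: "f \<in> Arr (Asm F)" for f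
    proof -
      have "Dom XX f \<in> ?S" "Cod XX f \<in> ?S" using f by (auto simp: Asm_def)
      then show ?thesis using HH[of "Dom XX f" "Cod XX f"] Arr_Hom[OF f] by (simp add: Asm_def)
    qed
    show "Ident (Asm F) a = Ident (Sep F) a" for a by (simp add: Asm_def Sep_def)
    show "g \<cdot>\<^bsub>Asm F\<^esub> f = g \<cdot>\<^bsub>Sep F\<^esub> f" for f g by (simp add: Asm_def Sep_def)
  qed
  show ?thesis
  proof (rule equivalence_functorI[OF fu], unfold id_ftor_def ftor.simps)
    fix A B g assume "A \<in> Ob (Asm F)" "B \<in> Ob (Asm F)" and g: "g \<in> Hom (Sep F) A B"
    then have "A \<in> ?S" "B \<in> ?S" by (auto simp: Asm_def)
    from HH[OF this] g show "\<exists>!f. f \<in> Hom (Asm F) A B \<and> f = g" by auto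
  next
    fix S assume "S \<in> Ob (Sep F)"
    then have S: "separated F S" by (simp add: Sep_def)
    obtain Q \<psi> i where ps: "\<psi> \<in> fib Q" and i: "i \<in> Hom XX (assembly F \<psi>) S" "iso_arr XX i"
      using separated_iso_assembly[OF S] by metis
    note s = assembly_separated[OF ps]
    have "assembly F \<psi> \<in> ?S" using ps fib_Ob[OF ps] by blast
    then have "assembly F \<psi> \<in> Ob (Asm F)" using assembly_facts(3)[OF ps] unfolding Asm_def full_subcat_simps by simp
    moreover have "i \<in> Hom (Sep F) (assembly F \<psi>) S" using i(1) Hom_Sep[OF s S] by simp
    moreover have "iso_arr (Sep F) i" unfolding Sep_def
      by (rule iso_arr_full_subcat[OF i(2)]) (use HomD[OF i(1)] s S in simp_all)
    ultimately show "\<exists>a\<in>Ob (Asm F). \<exists>i\<in>Hom (Sep F) a S. iso_arr (Sep F) i" by blast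
  qed
qed

end

theorem lemma3p4p30:
  fixes F :: "('p, 'e, 'o, 'm) fibn" and \<pi> :: "'p \<Rightarrow> 'm"
  assumes "exact_category (Base F)"
    and "fibered_frame F"
    and "totally_connected F"
    and "connected_components F \<pi>"
  shows "(\<forall>C \<rho> \<phi>. (C, \<rho>) \<in> Ob (per_cat F) \<longrightarrow> strict F (C, \<rho>) \<phi> \<longrightarrow>
      (let \<psi> = delta F (\<pi> \<phi>) \<sqinter>\<^bsub>F\<^esub> inst2 F \<rho> (Ident (Base F) C) (Ident (Base F) C) in
         strict F (C, \<rho>) \<psi> \<and>
         (closure_op F (strict_mono_arr F (C, \<rho>) \<phi>)
            \<cong>\<^bsub>sub_fib (per_cat F)\<^esub> strict_mono_arr F (C, \<rho>) \<psi>))) \<and>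
    equivalence_functor (dense_total F \<pi>) (Sep F) (assembly_ftor F) \<and>
    equivalence_functor (Asm F) (Sep F) id_ftor"
proof -
  interpret tcframe F \<pi>
    using assms by unfold_locales (simp_all add: fibered_frame_def)
  show ?thesis
    unfolding Let_def using closure_of_strict[OF _ _ refl] assembly_equivalence Asm_equivalence by simp
qed

end
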